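(* Let $\{\sigma_s\}_{s\in\mathbb{Z}_+}$ be the random average process described in the context, with i.i.d. weight vectors satisfying the nondegeneracy assumptions (i) and (ii). Assume $\sigma_0(0)=0$ and that the initial increments $\eta_i(0)=\sigma_0(i)-\sigma_0(i-1)$, $i\in\mathbb{Z}$, are i.i.d., independent of the weight vectors, and satisfy $E[|\eta_i(0)|^{2+\alpha}]<\infty$ for some $\alpha>0$. Let $\mu_0=E(\eta_i(0))$ and $\sigma_0^2=\mathrm{Var}(\eta_i(0))$. For $(t,r)\in\mathbb{R}_+\times\mathbb{R}$ let $$\overline{Y}_n(t,r)=n^{-1/4}\bigl\{\sigma_{\lfloor nt\rfloor}\bigl(\lfloor r\sqrt n\rfloor+\lfloor ntb\rfloor\bigr)-\mu_0r\sqrt n\bigr\}.$$ Then as $n\to\infty$ the finite-dimensional distributions of $\{\overline{Y}_n(t,r):(t,r)\in\mathbb{R}_+\times\mathbb{R}\}$ converge weakly to the finite-dimensional distributions of the mean zero Gaussian process $\{Z(t,r):(t,r)\in\mathbb{R}_+\times\mathbb{R}\}$ with covariance $$\mathbf{E}Z(s,q)Z(t,r)=\mu_0^2\,\kappa\,\Gamma_1((s,q),(t,r))+\sigma_0^2\,\Gamma_2((s,q),(t,r)).$$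
   Context: Random average process: fix $R\in\mathbb{N}$. Let $\omega_{k,s}=(\omega_{k,s}(j):-R\le j\le R)$, $k\in\mathbb{Z}$, $s\in\mathbb{N}$, be i.i.d. random probability vectors (under a probability measure $\mathbb{P}$ with expectation $\mathbb{E}$). The height functions $\sigma_s:\mathbb{Z}\to\mathbb{R}$ evolve by $\sigma_s(k)=\sum_{|j|\le R}\omega_{k,s}(j)\,\sigma_{s-1}(k+j)$ for $s\ge1$, $k\in\mathbb{Z}$. (The height function $\sigma_0(\cdot)$ at time $0$ should not be confused with the constant $\sigma_0^2$.) Let $p(0,j)=\mathbb{E}[\omega_{0,0}(j)]$ (where $\omega_{0,0}$ denotes a generic weight vector), $V=\sum_x x\,p(0,x)$, $\sigma_1^2=\sum_x(x-V)^2p(0,x)$, $b=-V$. Nondegeneracy assumptions: (i) there is no integer $h>1$ such that for some $x\in\mathbb{Z}$, $\sum_{k\in\mathbb{Z}}p(0,x+kh)=1$; (ii) $\mathbb{P}\{\max_j\omega_{0,0}(j)<1\}>0$. Constant $\kappa$: let $\sigma_D^2=\mathbb{E}\bigl[\bigl(\sum_jj\,\omega_{0,0}(j)-V\bigr)^2\bigr]$. Let $\bar q(x,y)=\sum_{z}p(0,z)p(0,z+y-x)$ for $x,y\in\mathbb{Z}$, and $q(x,y)=\bar q(x,y)$ for $x\ne0$, $q(0,y)=\sum_z\mathbb{E}[\omega_{0,0}(z)\omega_{0,0}(z+y)]$. The potential kernel is $\bar a(x)=\lim_{n\to\infty}\bigl\{\sum_{k=0}^n\bar q^k(0,0)-\sum_{k=0}^n\bar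 q^k(x,0)\bigr\}$, where $\bar q^k$ is the $k$-step transition probability. Set $\beta=\sum_xq(0,x)\bar a(x)$ and $\kappa=\sigma_D^2/(\beta\sigma_1^2)$. With $\varphi_{\nu^2}$, $\Phi_{\nu^2}$ the density and distribution function of the centered Gaussian with variance $\nu^2$, let $\Psi_{\nu^2}(x)=\nu^2\varphi_{\nu^2}(x)-x(1-\Phi_{\nu^2}(x))$, $\Psi_0(x)=\max(-x,0)$ (the limit as $\nu\to0$), and $$\Gamma_1((s,q),(t,r))=\Psi_{\sigma_1^2(t+s)}(r-q)-\Psi_{\sigma_1^2|t-s|}(r-q),$$ $$\Gamma_2((s,q),(t,r))=\Psi_{\sigma_1^2s}(-q)+\Psi_{\sigma_1^2t}(r)-\Psi_{\sigma_1^2(t+s)}(r-q).$$ *)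

theory Defs
  imports "HOL-Probability.Probability"
begin

section \<open>Probabilistic notions\<close>

definition iid :: "'a measure \<Rightarrow> 'b measure \<Rightarrow> ('i \<Rightarrow> 'a \<Rightarrow> 'b) \<Rightarrow> 'i set \<Rightarrow> bool" where
  "iid M N X I \<longleftrightarrow> prob_space.indep_vars M (\<lambda>_. N) X I \<and>
     (\<forall>i\<in>I. \<forall>j\<in>I. distr M N (X i) = distr M N (X j))"

text \<open>The library's \<open>indep_var\<close> forces both random elements to have values in the same type;
  this is its heterogeneous version.\<close>

definition independent_elements ::
    "'a measure \<Rightarrow> 'b measure \<Rightarrow> ('a \<Rightarrow> 'b) \<Rightarrow> 'c measure \<Rightarrow> ('a \<Rightarrow> 'c) \<Rightarrow> bool" where
  "independent_elements M N X N' X' \<longleftrightarrow> X \<in> measurable M N \<and> X' \<in> measurable M N' \<and>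
     prob_space.indep_set M {X -` A \<inter> space M | A. A \<in> sets N}
                            {X' -` A \<inter> space M | A. A \<in> sets N'}"

text \<open>Centered Gaussian law with variance \<open>v \<ge> 0\<close>; the point mass at 0 if \<open>v = 0\<close>.\<close>

definition centered_gaussian :: "real \<Rightarrow> real measure" where
  "centered_gaussian v =
     (if v = 0 then return borel 0 else density lborel (normal_density 0 (sqrt v)))"

definition centered_gaussian_process ::
    "'a measure \<Rightarrow> 'i set \<Rightarrow> ('i \<Rightarrow> 'a \<Rightarrow> real) \<Rightarrow> bool" where
  "centered_gaussian_process N I Z \<longleftrightarrow> prob_space N \<and> (\<forall>i\<in>I. Z i \<in> borel_measurable N) \<and>
     (\<forall>J c. finite J \<and> J \<subseteq> I \<longrightarrow>
        (\<exists>v\<ge>0. distr N borel (\<lambda>x. \<Sum>i\<in>J. c i * Z i x) = centered_gaussian v))"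

definition weakly_converges :: "'b topology \<Rightarrow> (nat \<Rightarrow> 'b measure) \<Rightarrow> 'b measure \<Rightarrow> bool" where
  "weakly_converges T \<mu> \<nu> \<longleftrightarrow>
     (\<forall>f. continuous_map T euclideanreal f \<and> bounded (f ` topspace T) \<longrightarrow>
        (\<lambda>n. integral\<^sup>L (\<mu> n) f) \<longlonglongrightarrow> integral\<^sup>L \<nu> f)"

definition fd_law :: "'a measure \<Rightarrow> 'i set \<Rightarrow> ('i \<Rightarrow> 'a \<Rightarrow> real) \<Rightarrow> ('i \<Rightarrow> real) measure" where
  "fd_law M J X = distr M (PiM J (\<lambda>_. borel)) (\<lambda>x. \<lambda>j\<in>J. X j x)"

definition fdd_converge :: "'i set \<Rightarrow> 'a measure \<Rightarrow> (nat \<Rightarrow> 'i \<Rightarrow> 'a \<Rightarrow> real) \<Rightarrow>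
    'b measure \<Rightarrow> ('i \<Rightarrow> 'b \<Rightarrow> real) \<Rightarrow> bool" where
  "fdd_converge I M X N Z \<longleftrightarrow>
     (\<forall>J. finite J \<and> J \<subseteq> I \<longrightarrow>
        weakly_converges (product_topology (\<lambda>_. euclideanreal) J)
          (\<lambda>n. fd_law M J (X n)) (fd_law N J Z))"

section \<open>Weight vectors and the constants of the process\<close>

text \<open>Weight vectors \<open>(w j : -R \<le> j \<le> R)\<close> are extended by 0 to all integers, so that sums over
  the integers make sense; below all such sums have finitely many nonzero terms.\<close>

abbreviation vec_space :: "(int \<Rightarrow> real) measure" where
  "vec_space \<equiv> PiM UNIV (\<lambda>_. borel)"

definition prob_vector :: "nat \<Rightarrow> (int \<Rightarrow> real) \<Rightarrow> bool" where
  "prob_vector R w \<longleftrightarrow> (\<forall>j. 0 \<le> w j) \<and> (\<forall>j. \<bar>j\<bar> > int R \<longrightarrow> w j = 0) \<and>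
     (\<Sum>j=-int R..int R. w j) = 1"

text \<open>In this section \<open>w\<close> is a generic random weight vector on the probability space \<open>M\<close>;
  \<open>mean_weight M w j\<close> is \<open>p(0,j)\<close>.\<close>

definition mean_weight :: "'a measure \<Rightarrow> ('a \<Rightarrow> int \<Rightarrow> real) \<Rightarrow> int \<Rightarrow> real" where
  "mean_weight M w j = (\<integral>x. w x j \<partial>M)"

definition drift :: "'a measure \<Rightarrow> ('a \<Rightarrow> int \<Rightarrow> real) \<Rightarrow> real" where
  "drift M w = (\<Sum>\<^sub>\<infinity>x. real_of_int x * mean_weight M w x)"

definition sigma1_sq :: "'a measure \<Rightarrow> ('a \<Rightarrow> int \<Rightarrow> real) \<Rightarrow> real" where
  "sigma1_sq M w = (\<Sum>\<^sub>\<infinity>x. (real_of_int x - drift M w)\<^sup>2 * mean_weight M w x)"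

definition sigmaD_sq :: "'a measure \<Rightarrow> ('a \<Rightarrow> int \<Rightarrow> real) \<Rightarrow> real" where
  "sigmaD_sq M w = (\<integral>x. ((\<Sum>\<^sub>\<infinity>j. real_of_int j * w x j) - drift M w)\<^sup>2 \<partial>M)"

definition qbar :: "'a measure \<Rightarrow> ('a \<Rightarrow> int \<Rightarrow> real) \<Rightarrow> int \<Rightarrow> int \<Rightarrow> real" where
  "qbar M w x y = (\<Sum>\<^sub>\<infinity>z. mean_weight M w z * mean_weight M w (z + y - x))"

definition qker :: "'a measure \<Rightarrow> ('a \<Rightarrow> int \<Rightarrow> real) \<Rightarrow> int \<Rightarrow> int \<Rightarrow> real" where
  "qker M w x y =
     (if x = 0 then (\<Sum>\<^sub>\<infinity>z. (\<integral>\<xi>. w \<xi> z * w \<xi> (z + y) \<partial>M)) else qbar M w x y)"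

fun kernel_pow :: "(int \<Rightarrow> int \<Rightarrow> real) \<Rightarrow> nat \<Rightarrow> int \<Rightarrow> int \<Rightarrow> real" where
  "kernel_pow K 0 x y = (if x = y then 1 else 0)"
| "kernel_pow K (Suc k) x y = (\<Sum>\<^sub>\<infinity>z. K x z * kernel_pow K k z y)"

definition potential_kernel :: "'a measure \<Rightarrow> ('a \<Rightarrow> int \<Rightarrow> real) \<Rightarrow> int \<Rightarrow> real" where
  "potential_kernel M w x =
     lim (\<lambda>n. (\<Sum>k=0..n. kernel_pow (qbar M w) k 0 0) - (\<Sum>k=0..n. kernel_pow (qbar M w) k x 0))"

definition rap_beta :: "'a measure \<Rightarrow> ('a \<Rightarrow> int \<Rightarrow> real) \<Rightarrow> real" where
  "rap_beta M w = (\<Sum>\<^sub>\<infinity>x. qker M w 0 x * potential_kernel M w x)"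

definition rap_kappa :: "'a measure \<Rightarrow> ('a \<Rightarrow> int \<Rightarrow> real) \<Rightarrow> real" where
  "rap_kappa M w = sigmaD_sq M w / (rap_beta M w * sigma1_sq M w)"

section \<open>The limiting covariance\<close>

text \<open>The first argument of \<open>Psi\<close> is the variance \<open>\<nu>\<^sup>2\<close>.\<close>

definition Psi :: "real \<Rightarrow> real \<Rightarrow> real" where
  "Psi v x = (if v = 0 then max (- x) 0
     else v * normal_density 0 (sqrt v) x - x * (1 - cdf (centered_gaussian v) x))"

text \<open>The parameter \<open>a\<close> of \<open>Gamma1\<close> and \<open>Gamma2\<close> is the constant \<open>\<sigma>\<^sub>1\<^sup>2\<close>.\<close>

definition Gamma1 :: "real \<Rightarrow> real \<times> real \<Rightarrow> real \<times> real \<Rightarrow> real" where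
  "Gamma1 a = (\<lambda>(s, q) (t, r). Psi (a * (t + s)) (r - q) - Psi (a * \<bar>t - s\<bar>) (r - q))"

definition Gamma2 :: "real \<Rightarrow> real \<times> real \<Rightarrow> real \<times> real \<Rightarrow> real" where
  "Gamma2 a = (\<lambda>(s, q) (t, r). Psi (a * s) (- q) + Psi (a * t) r - Psi (a * (t + s)) (r - q))"

section \<open>The rescaled height process\<close>

definition Ybar :: "(nat \<Rightarrow> int \<Rightarrow> 'a \<Rightarrow> real) \<Rightarrow> real \<Rightarrow> real \<Rightarrow> nat \<Rightarrow> real \<times> real \<Rightarrow> 'a \<Rightarrow> real"
  where
  "Ybar \<sigma> \<mu>\<^sub>0 b n = (\<lambda>(t, r) x. real n powr (-1/4) *
     (\<sigma> (nat \<lfloor>real n * t\<rfloor>) (\<lfloor>r * sqrt (real n)\<rfloor> + \<lfloor>real n * t * b\<rfloor>) x - \<mu>\<^sub>0 * r * sqrt (real n)))"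

end

theory Submission
  imports Defs "HOL-Real_Asymp.Real_Asymp"
begin

text \<open>
  Iterating the evolution, \<open>\<sigma> T k\<close> is the quenched mean of \<open>\<sigma> 0\<close> at the endpoint of a random walk
  that runs backwards in time from \<open>(T, k)\<close> through the environment. Expanding this mean over the levels
  writes a linear combination of heights as a deterministic part plus a sum over space-time points of an
  innovation (the centred increment at level 0, \<open>\<mu>\<^sub>0\<close> times the centred quenched drift at later levels)
  times a coefficient that depends only on strictly later levels. Revealing the environment from late to
  early levels makes this a martingale array with uniformly small coefficients, so its characteristic
  function is Gaussian in the limit once the sum of conditional variances converges in \<open>L\<^sup>1\<close>.

  That sum counts the meetings of two walks in the same environment. The potential kernel \<open>abar\<close>, applied to
  the difference of the walks, gains \<open>beta\<close> at each meeting and is otherwise a martingale, so the number of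
  meetings is a difference of boundary terms up to a martingale of lower order (a discrete Tanaka formula).
  Since \<open>abar x\<close> differs from \<open>\<bar>x\<bar> / (2 \<sigma>\<^sub>1\<^sup>2)\<close> by a bounded amount, only mean absolute values of differences
  of walks remain; these converge by the quenched central limit theorem to \<open>2 \<Psi>(r) + r\<close>, which produces
  \<open>\<Gamma>\<^sub>1\<close> and \<open>\<Gamma>\<^sub>2\<close>.
\<close>

section \<open>The absolute value as a cosine integral\<close>

text \<open>Two obstacles shape the proof. First, the conditional variance of the martingale array
  is random and only its limit is constant. The characteristic function is therefore compared with
  the Gaussian one after multiplication by exp(V / 2), V being the variance accumulated so far; this
  needs V bounded, whence a predictable truncation. Second, the variance involves mean absolute
  values in a fixed environment, while the quenched walk is accessible through its characteristic
  function. The identity pi |z| = integral of (1 - cos(t z)) / t^2 over the real line bridges the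
  two, and it also extracts the linear growth of the potential kernel from its Fourier integral.
  Meeting counts enter twice: a crude bound of order sqrt T, from the mean of the Tanaka formula,
  makes the Tanaka martingale and the fluctuations of the quenched characteristic function
  negligible; only then can the exact limit be read off. The limit process has to be constructed as
  well; positive semidefiniteness of its covariance is inherited from the conditional
  variances.\<close>

lemma cos_taylor4: "\<bar>cos u - (1 - u\<^sup>2 / 2)\<bar> \<le> u ^ 4 / 24" for u :: real
proof -
  have "\<bar>Re (iexp u - (\<Sum>k\<le>3. (\<i> * complex_of_real u)^k / fact k))\<bar> \<le> \<bar>u\<bar>^(Suc 3) / fact (Suc 3)"
    using iexp_approx1[of u 3] abs_Re_le_cmod order_trans by blast
  moreover have "Re (\<Sum>k\<le>3. (\<i> * complex_of_real u)^k / fact k) = 1 - u\<^sup>2 / 2"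
    by (simp add: numeral_eq_Suc fact_numeral Re_divide power2_eq_square)
  moreover have "Re (iexp u) = cos u"
    by (simp add: Re_exp)
  ultimately show ?thesis
    by (simp add: fact_numeral)
qed

lemma one_minus_cos_le: "1 - cos u \<le> u\<^sup>2 / 2" for u :: real
proof -
  have "cos u = cos (2 * (u / 2))" by simp
  also have "\<dots> = 1 - 2 * (sin (u/2))\<^sup>2" by (rule cos_double_sin)
  finally have "1 - cos u = 2 * (sin (u/2))\<^sup>2" by simp
  also have "\<dots> \<le> 2 * (u/2)\<^sup>2"
    using abs_sin_x_le_abs_x[of "u/2"] unfolding abs_le_square_iff by (intro mult_left_mono) auto
  finally show ?thesis by (simp add: power2_eq_square)
qed

text \<open>Integration by parts: \<open>Si t - (1 - cos t) / t\<close> is an antiderivative on the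
  positive half line. It tends to 0 at the origin and, by the Dirichlet integral, to
  \<open>pi / 2\<close> at infinity. The integrand is nonnegative, so integrability comes with the
  value.\<close>

lemma has_integral_one_minus_cos_Ioi:
  "set_integrable lborel {0<..} (\<lambda>t::real. (1 - cos t) / t\<^sup>2)"
  "(LBINT t:{0<..}. (1 - cos t) / t\<^sup>2) = pi / 2"
proof -
  let ?F = "\<lambda>t::real. Si t - (1 - cos t) / t"
  have d: "(?F has_real_derivative (1 - cos t) / t\<^sup>2) (at t)" if "t > 0" for t
  proof -
    have "(?F has_real_derivative (sinc t - (sin t * t - (1 - cos t)) / (t * t))) (at t)"
      using that by (auto intro!: derivative_eq_intros DERIV_Si)
    moreover have "sinc t - (sin t * t - (1 - cos t)) / (t * t) = (1 - cos t) / t\<^sup>2"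
      using that by (simp add: field_simps power2_eq_square)
    ultimately show ?thesis by simp
  qed
  have l0: "(?F \<longlongrightarrow> 0) (at_right 0)"
  proof -
    have "(Si \<longlongrightarrow> Si 0) (at_right 0)"
      using isCont_Si[of 0] by (simp add: isCont_def filterlim_at_split)
    moreover have "Si 0 = 0"
      by (simp add: Si_def zero_ereal_def[symmetric])
    moreover have "((\<lambda>t::real. (1 - cos t) / t) \<longlongrightarrow> 0) (at_right 0)"
    proof (rule Lim_null_comparison)
      show "eventually (\<lambda>t::real. norm ((1 - cos t) / t) \<le> t) (at_right 0)"
      proof (intro eventually_at_right_less[THEN eventually_mono])
        fix t :: real assume "0 < t"
        have "1 - cos t \<le> t\<^sup>2" using one_minus_cos_le[of t] zero_le_power2[of t] by linarith
        then show "norm ((1 - cos t) / t) \<le> t"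
          using \<open>0 < t\<close> by (simp add: field_simps power2_eq_square)
      qed
    qed (rule tendsto_ident_at)
    ultimately show ?thesis using tendsto_diff[of Si 0 "at_right 0"] by fastforce
  qed
  have l1: "(?F \<longlongrightarrow> pi/2) at_top"
  proof -
    have "((\<lambda>t::real. (1 - cos t) / t) \<longlongrightarrow> 0) at_top"
    proof (rule Lim_null_comparison)
      show "eventually (\<lambda>t::real. norm ((1 - cos t) / t) \<le> 2 / t) at_top"
        using eventually_gt_at_top[of 0]
      proof eventually_elim
        fix t :: real assume "0 < t"
        have "\<bar>1 - cos t\<bar> \<le> 2" using cos_ge_minus_one[of t] cos_le_one[of t] by linarith
        then show "norm ((1 - cos t) / t) \<le> 2 / t"
          using \<open>0 < t\<close> divide_right_mono[of "\<bar>1 - cos t\<bar>" 2 t] by simp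
      qed
      show "((\<lambda>t::real. 2 / t) \<longlongrightarrow> 0) at_top" by real_asymp
    qed
    from tendsto_diff[OF Si_at_top this] show ?thesis by simp
  qed
  have I1: "set_integrable lborel (einterval 0 \<infinity>) (\<lambda>t::real. (1 - cos t) / t\<^sup>2)"
    by (rule interval_integral_FTC_nonneg(1)[where F = ?F and A = 0 and B = "pi/2"])
       (auto intro!: d l0 l1 continuous_intros simp: ereal_tendsto_simps zero_ereal_def)
  have I2: "(LBINT t=0..\<infinity>. (1 - cos t) / t\<^sup>2) = pi/2 - 0"
    by (rule interval_integral_FTC_nonneg(2)[where F = ?F and A = 0 and B = "pi/2"])
       (auto intro!: d l0 l1 continuous_intros simp: ereal_tendsto_simps zero_ereal_def)
  have e: "einterval 0 \<infinity> = {0<..}" by (auto simp: einterval_def)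
  show "set_integrable lborel {0<..} (\<lambda>t::real. (1 - cos t) / t\<^sup>2)"
    using I1 by (simp add: e)
  show "(LBINT t:{0<..}. (1 - cos t) / t\<^sup>2) = pi / 2"
    using I2 by (simp add: interval_lebesgue_integral_0_infty)
qed

lemma has_integral_one_minus_cos_UNIV:
  "has_bochner_integral lborel (\<lambda>t::real. (1 - cos t) / t\<^sup>2) pi"
proof -
  let ?f = "\<lambda>t::real. (1 - cos t) / t\<^sup>2"
  have 1: "has_bochner_integral lborel (\<lambda>t. indicator {0<..} t *\<^sub>R ?f t) (pi/2)"
    using has_integral_one_minus_cos_Ioi
    by (simp add: has_bochner_integral_iff set_integrable_def set_lebesgue_integral_def)
  have 2: "has_bochner_integral lborel (\<lambda>t. indicator {0<..} (-t) *\<^sub>R ?f (-t)) (pi/2)"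
    using lborel_has_bochner_integral_real_affine_iff[of "-1" "\<lambda>t. indicator {0<..} t *\<^sub>R ?f t" "pi/2" 0] 1
    by simp
  have "(\<lambda>t. indicator {0<..} t *\<^sub>R ?f t + indicator {0<..} (-t) *\<^sub>R ?f (-t)) = ?f"
    by (auto simp: indicator_def fun_eq_iff)
  with has_bochner_integral_add[OF 1 2] show ?thesis by simp
qed

text \<open>The substitution of \<open>z * t\<close> for \<open>t\<close> produces the factor |z|.
  Averaging over \<open>z\<close> turns the mean absolute value of any law into an integral of the
  real part of its characteristic function.\<close>

lemma abs_eq_integral_cos:
  "has_bochner_integral lborel (\<lambda>t::real. (1 - cos (t * z)) / t\<^sup>2) (pi * \<bar>z\<bar>)"
proof (cases "z = 0")
  case False
  have "has_bochner_integral lborel (\<lambda>t. (1 - cos (z * t)) / (z * t)\<^sup>2) (pi /\<^sub>R \<bar>z\<bar>)"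
    using lborel_has_bochner_integral_real_affine_iff[of z "\<lambda>t. (1 - cos t) / t\<^sup>2" pi 0]
      has_integral_one_minus_cos_UNIV False by simp
  then have "has_bochner_integral lborel (\<lambda>t. z\<^sup>2 * ((1 - cos (z * t)) / (z * t)\<^sup>2)) (z\<^sup>2 * (pi /\<^sub>R \<bar>z\<bar>))"
    by (intro has_bochner_integral_mult_right) simp
  moreover have "z\<^sup>2 * (pi /\<^sub>R \<bar>z\<bar>) = pi * \<bar>z\<bar>"
    using False by (simp add: field_simps power2_eq_square abs_mult_self_eq)
  moreover have "(\<lambda>t. z\<^sup>2 * ((1 - cos (z * t)) / (z * t)\<^sup>2)) = (\<lambda>t. (1 - cos (t * z)) / t\<^sup>2)"
    using False by (auto simp: fun_eq_iff power_mult_distrib mult.commute)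
  ultimately show ?thesis by (simp only:)
qed (simp add: has_bochner_integral_zero)

text \<open>This is the mean of |G + r| for a centred Gaussian G of variance \<open>v\<close> (see
  \<open>Lam_normal\<close>). It is written through the characteristic function of G so that
  \<open>v = 0\<close> is included and limits of walk averages arise in this very form.\<close>

definition Lam :: "real \<Rightarrow> real \<Rightarrow> real" where
  "Lam v r = (\<integral>t. (1 - cos (t * r) * exp (- (t\<^sup>2 * v / 2))) / t\<^sup>2 \<partial>lborel) / pi"

lemma Lam_minus: "Lam v (- r) = Lam v r"
  by (simp add: Lam_def)

lemma char_gaussian_cos:
  assumes "v > 0"
  shows "(\<integral>x. normal_density 0 (sqrt v) x * cos (t * (x + r)) \<partial>lborel) = cos (t * r) * exp (- (t\<^sup>2 * v / 2))"
    "integrable lborel (\<lambda>x. normal_density 0 (sqrt v) x * cos (t * (x + r)))"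
proof -
  let ?s = "sqrt v"
  have s: "?s > 0" using assms by simp
  interpret N: prob_space "density lborel (normal_density 0 ?s)"
    by (rule prob_space_normal_density[OF s])
  interpret S: real_distribution std_normal_distribution by (rule real_dist_normal_dist)
  have D: "distr std_normal_distribution borel (\<lambda>x. ?s * x) = density lborel (normal_density 0 ?s)"
  proof -
    have "distributed std_normal_distribution lborel (\<lambda>x. x) std_normal_density"
      by (auto simp: distributed_def measure_density_const distr_id2 intro: distr_id2)
    then have "distr std_normal_distribution lborel (\<lambda>x. ?s * x) = density lborel (normal_density 0 ?s)"
      using s S.normal_density_affine[of "\<lambda>x. x" 0 1 ?s 0] by (simp add: distributed_def)
    moreover have "distr std_normal_distribution lborel (\<lambda>x. ?s * x) = distr std_normal_distribution borel (\<lambda>x. ?s * x)"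
      by (rule distr_cong) auto
    ultimately show ?thesis by (simp only:)
  qed
  have "(CLINT x|density lborel (normal_density 0 ?s). iexp (t * (x + r)))
      = (CLINT x|std_normal_distribution. iexp (t * (?s * x + r)))"
    unfolding D[symmetric] by (subst integral_distr) auto
  also have "\<dots> = (CLINT x|std_normal_distribution. iexp (t * r) * iexp ((t * ?s) * x))"
    by (intro Bochner_Integration.integral_cong refl) (simp add: exp_add[symmetric] algebra_simps)
  also have "\<dots> = iexp (t * r) * char std_normal_distribution (t * ?s)"
    by (simp add: char_def)
  also have "\<dots> = iexp (t * r) * of_real (exp (- (t\<^sup>2 * v / 2)))"
    using assms by (simp add: char_std_normal_distribution power_mult_distrib exp_of_real[symmetric] flip: of_real_power)
  finally have E: "(CLINT x|density lborel (normal_density 0 ?s). iexp (t * (x + r)))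
     = iexp (t * r) * of_real (exp (- (t\<^sup>2 * v / 2)))" .
  have I: "integrable (density lborel (normal_density 0 ?s)) (\<lambda>x. iexp (t * (x + r)))"
    by (rule N.integrable_iexp) auto
  have "(\<integral>x. cos (t * (x + r)) \<partial>density lborel (normal_density 0 ?s)) = cos (t * r) * exp (- (t\<^sup>2 * v / 2))"
    using integral_Re[OF I] unfolding E by (simp add: Re_exp)
  then show "(\<integral>x. normal_density 0 (sqrt v) x * cos (t * (x + r)) \<partial>lborel) = cos (t * r) * exp (- (t\<^sup>2 * v / 2))"
    by (subst (asm) integral_density) auto
  have "integrable (density lborel (normal_density 0 ?s)) (\<lambda>x. cos (t * (x + r)))"
    using integrable_Re[OF I] by (simp add: Re_exp)
  then show "integrable lborel (\<lambda>x. normal_density 0 (sqrt v) x * cos (t * (x + r)))"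
    by (subst (asm) integrable_density) auto
qed

text \<open>Fubini for the cosine representation of |x + r|: the double integrand is nonnegative,
  and integrating over \<open>t\<close> first leaves \<open>pi\<close> times the first absolute
  moment of a Gaussian, which is finite.\<close>

lemma Lam_normal:
  assumes "v > 0"
  shows "Lam v r = (\<integral>x. normal_density 0 (sqrt v) x * \<bar>x + r\<bar> \<partial>lborel)"
    "integrable lborel (\<lambda>t. (1 - cos (t * r) * exp (- (t\<^sup>2 * v / 2))) / t\<^sup>2)"
proof -
  let ?d = "normal_density 0 (sqrt v)"
  let ?g = "\<lambda>x t. ?d x * ((1 - cos (t * (x + r))) / t\<^sup>2)"
  have s: "sqrt v > 0" using assms by simp
  have m1: "integrable lborel (\<lambda>x. ?d x * x)"
    using integrable_normal_moment[of "sqrt v" 0 1] s by simp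
  have i0: "integrable lborel ?d" using s by simp
  have "integrable lborel (\<lambda>x. \<bar>?d x * x + ?d x * r\<bar>)"
    using m1 i0 by (intro integrable_abs Bochner_Integration.integrable_add) auto
  then have m: "integrable lborel (\<lambda>x. ?d x * \<bar>x + r\<bar>)"
    by (simp add: distrib_left[symmetric] abs_mult)
  have inner: "has_bochner_integral lborel (\<lambda>t. ?g x t) (?d x * (pi * \<bar>x + r\<bar>))" for x
    by (intro has_bochner_integral_mult_right abs_eq_integral_cos)
  have nn: "?g x t \<ge> 0" for x t by simp
  have P: "integrable (lborel \<Otimes>\<^sub>M lborel) (\<lambda>(x, t). ?g x t)"
  proof (rule lborel_pair.Fubini_integrable)
    show "(\<lambda>(x, t). ?g x t) \<in> borel_measurable (lborel \<Otimes>\<^sub>M lborel)" by measurable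
    have "(\<lambda>x. LBINT t. norm (case (x, t) of (x, t) \<Rightarrow> ?g x t)) = (\<lambda>x. ?d x * \<bar>x + r\<bar> * pi)"
      using inner nn by (auto simp: has_bochner_integral_iff abs_of_nonneg fun_eq_iff)
    then show "integrable lborel (\<lambda>x. LBINT t. norm (case (x, t) of (x, t) \<Rightarrow> ?g x t))"
      using m by simp
    show "AE x in lborel. integrable lborel (\<lambda>t. case (x, t) of (x, t) \<Rightarrow> ?g x t)"
      using inner by (auto simp: has_bochner_integral_iff)
  qed
  have "(\<integral>x. (\<integral>t. ?g x t \<partial>lborel) \<partial>lborel) = (\<integral>t. (\<integral>x. ?g x t \<partial>lborel) \<partial>lborel)"
    using lborel_pair.Fubini_integral[OF P] by simp
  moreover have "(\<integral>x. (\<integral>t. ?g x t \<partial>lborel) \<partial>lborel) = pi * (\<integral>x. ?d x * \<bar>x + r\<bar> \<partial>lborel)"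
    using inner by (simp add: has_bochner_integral_iff mult.left_commute)
  moreover have J: "(\<integral>x. ?g x t \<partial>lborel) = (1 - cos (t * r) * exp (- (t\<^sup>2 * v / 2))) / t\<^sup>2" for t
  proof -
    have "(\<integral>x. ?g x t \<partial>lborel) = (\<integral>x. (?d x - ?d x * cos (t * (x + r))) / t\<^sup>2 \<partial>lborel)"
      by (intro Bochner_Integration.integral_cong refl) (simp add: field_simps)
    also have "\<dots> = ((\<integral>x. ?d x \<partial>lborel) - (\<integral>x. ?d x * cos (t * (x + r)) \<partial>lborel)) / t\<^sup>2"
      using i0 char_gaussian_cos(2)[OF assms] by simp
    finally show ?thesis using s char_gaussian_cos(1)[OF assms] by simp
  qed
  ultimately have "(\<integral>t. (1 - cos (t * r) * exp (- (t\<^sup>2 * v / 2))) / t\<^sup>2 \<partial>lborel) = pi * (\<integral>x. ?d x * \<bar>x + r\<bar> \<partial>lborel)"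
    by (simp only: J)
  then show "Lam v r = (\<integral>x. ?d x * \<bar>x + r\<bar> \<partial>lborel)"
    by (simp add: Lam_def)
  have "integrable lborel (\<lambda>t. \<integral>x. ?g x t \<partial>lborel)"
    using lborel_pair.integrable_snd[OF P] by simp
  then show "integrable lborel (\<lambda>t. (1 - cos (t * r) * exp (- (t\<^sup>2 * v / 2))) / t\<^sup>2)"
    by (simp only: J)
qed

text \<open>The derivative of \<open>- (v * normal_density 0 (sqrt v) x)\<close> is \<open>x\<close>
  times the density, so the tail integral is a boundary value.\<close>

lemma normal_density_first_moment_tail:
  assumes "v > 0"
  shows "(LBINT x:{r<..}. normal_density 0 (sqrt v) x * x) = v * normal_density 0 (sqrt v) r"
proof -
  let ?d = "normal_density 0 (sqrt v)"
  let ?F = "\<lambda>x. - (v * ?d x)"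
  have s: "sqrt v > 0" using assms by simp
  have m1: "integrable lborel (\<lambda>x. ?d x * x)"
    using integrable_normal_moment[of "sqrt v" 0 1] s by simp
  have c: "isCont ?d x" for x unfolding normal_density_def using s by (intro continuous_intros) auto
  have d: "(?F has_real_derivative ?d x * x) (at x)" for x
    unfolding normal_density_def using assms
    by (auto intro!: derivative_eq_intros simp: field_simps power2_eq_square)
  have l: "(?F \<longlongrightarrow> 0) at_top"
  proof -
    have "((\<lambda>x. - (v * (1 / sqrt (2 * pi * v) * exp (- (x\<^sup>2 / (2 * v)))))) \<longlongrightarrow> 0) at_top"
      using assms by real_asymp
    then show ?thesis using assms by (simp add: normal_density_def)
  qed
  have "(LBINT x=ereal r..\<infinity>. ?d x * x) = 0 - ?F r"
  proof (rule interval_integral_FTC_integrable[where F = ?F])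
    show "set_integrable lborel (einterval (ereal r) \<infinity>) (\<lambda>x. ?d x * x)"
      using m1 unfolding set_integrable_def by (intro integrable_mult_indicator) auto
    show "((?F \<circ> real_of_ereal) \<longlongrightarrow> ?F r) (at_right (ereal r))"
      using DERIV_isCont[OF d] by (simp add: ereal_tendsto_simps isCont_def filterlim_at_split)
  qed (auto intro!: l d[unfolded has_real_derivative_iff_has_vector_derivative] continuous_intros c
       simp: ereal_tendsto_simps)
  moreover have "einterval (ereal r) \<infinity> = {r<..}" by (auto simp: einterval_def)
  ultimately show ?thesis by (simp add: interval_lebesgue_integral_def)
qed

lemma cdf_centered_gaussian:
  assumes "v > 0"
  shows "1 - cdf (centered_gaussian v) r = (LBINT x:{r<..}. normal_density 0 (sqrt v) x)"
proof -
  let ?d = "normal_density 0 (sqrt v)"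
  have s: "sqrt v > 0" using assms by simp
  interpret N: prob_space "density lborel ?d" by (rule prob_space_normal_density[OF s])
  have "1 - cdf (centered_gaussian v) r = measure (density lborel ?d) (space (density lborel ?d) - {..r})"
    using assms by (subst N.prob_compl) (auto simp: centered_gaussian_def cdf_def)
  also have "space (density lborel ?d) - {..r} = {r<..}" by auto
  also have "measure (density lborel ?d) {r<..} = (\<integral>x. indicator {r<..} x \<partial>density lborel ?d)"
    by simp
  also have "\<dots> = (LBINT x:{r<..}. ?d x)"
    unfolding set_lebesgue_integral_def by (subst integral_density) (auto simp: mult.commute)
  finally show ?thesis .
qed

text \<open>For positive \<open>v\<close>, \<open>Psi v r\<close> is the mean of the positive part
  of \<open>x - r\<close> under the centred Gaussian of variance \<open>v\<close>, and |x - r| is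
  twice that positive part minus \<open>x\<close> plus \<open>r\<close>. The symmetry
  \<open>Lam_minus\<close> allows \<open>x - r\<close> in place of \<open>x + r\<close>.\<close>

lemma Lam_eq_Psi:
  assumes "v \<ge> 0"
  shows "Lam v r = 2 * Psi v r + r"
proof (cases "v = 0")
  case True
  have "Lam 0 r = \<bar>r\<bar>"
    using abs_eq_integral_cos[of r] by (simp add: Lam_def has_bochner_integral_iff)
  then show ?thesis using True by (simp add: Psi_def)
next
  case False
  then have v: "v > 0" using assms by simp
  let ?d = "normal_density 0 (sqrt v)"
  have s: "sqrt v > 0" using v by simp
  have m1: "integrable lborel (\<lambda>x. ?d x * x)"
    using integrable_normal_moment[of "sqrt v" 0 1] s by simp
  have m0: "(\<integral>x. ?d x * x \<partial>lborel) = 0"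
    using integral_normal_moment_odd[of "sqrt v" 0 0] s by simp
  have i0: "integrable lborel ?d" using s by simp
  have I: "integrable lborel (\<lambda>x. indicator {r<..} x *\<^sub>R (?d x * x))"
    "integrable lborel (\<lambda>x. indicator {r<..} x *\<^sub>R ?d x)"
    using m1 i0 by (auto intro!: integrable_mult_indicator simp del: real_scaleR_def)
  have "Lam v r = Lam v (- r)" by (simp add: Lam_minus)
  also have "\<dots> = (\<integral>x. ?d x * \<bar>x - r\<bar> \<partial>lborel)" using Lam_normal(1)[OF v, of "-r"] by simp
  also have "\<dots> = (\<integral>x. 2 * (indicator {r<..} x *\<^sub>R (?d x * x)) - 2 * r * (indicator {r<..} x *\<^sub>R ?d x)
       - ?d x * x + r * ?d x \<partial>lborel)"
    by (intro Bochner_Integration.integral_cong refl) (auto simp: indicator_def field_simps abs_if)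
  also have "\<dots> = 2 * (v * ?d r) - 2 * r * (1 - cdf (centered_gaussian v) r) + r"
    using I m1 i0 m0 s normal_density_first_moment_tail[OF v, of r] cdf_centered_gaussian[OF v, of r]
    by (simp add: set_lebesgue_integral_def)
  finally show ?thesis using False by (simp add: Psi_def algebra_simps)
qed

section \<open>The symmetrized walk and its potential kernel\<close>

lemma infsum_finite_support:
  fixes f :: "'b \<Rightarrow> real"
  assumes "finite F" "\<And>x. x \<notin> F \<Longrightarrow> f x = 0"
  shows "(\<Sum>\<^sub>\<infinity>x. f x) = (\<Sum>x\<in>F. f x)"
proof -
  have "(\<Sum>\<^sub>\<infinity>x. f x) = (\<Sum>\<^sub>\<infinity>x\<in>F. f x)"
    by (rule infsum_cong_neutral) (use assms in auto)
  then show ?thesis using assms by simp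
qed

section \<open>The averaged step law and the characteristic function of the difference of two
  steps\<close>

locale step_law =
  fixes p :: "int \<Rightarrow> real" and R :: nat
  assumes p_nonneg: "0 \<le> p j"
    and p_support: "\<bar>j\<bar> > int R \<Longrightarrow> p j = 0"
    and p_sum: "(\<Sum>j=-int R..int R. p j) = 1"
    and p_aperiodic: "\<not> (\<exists>h::int. h > 1 \<and> (\<exists>x. (\<Sum>\<^sub>\<infinity>k. p (x + k * h)) = 1))"
begin

abbreviation "I \<equiv> {-int R..int R}"
abbreviation "I2 \<equiv> {-(2 * int R)..2 * int R}"

definition "mean = (\<Sum>j\<in>I. of_int j * p j)"
definition "var = (\<Sum>j\<in>I. (of_int j - mean)\<^sup>2 * p j)"
text \<open>The law of the difference of two independent steps with law \<open>p\<close>. It is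
  symmetric, so its characteristic function is the real function \<open>chq\<close>.\<close>

definition qb :: "int \<Rightarrow> real" where "qb y = (\<Sum>z\<in>I. p z * p (z + y))"
definition chq :: "real \<Rightarrow> real" where "chq t = (\<Sum>y\<in>I2. qb y * cos (t * y))"

lemma p_out: "j \<notin> I \<Longrightarrow> p j = 0"
  using p_support by auto

lemma qb_sum: "(\<Sum>y\<in>I2. qb y * f y) = (\<Sum>z\<in>I. \<Sum>z'\<in>I. p z * p z' * f (z' - z))"
proof -
  have "(\<Sum>y\<in>I2. qb y * f y) = (\<Sum>z\<in>I. \<Sum>y\<in>I2. p z * p (z + y) * f y)"
    by (subst sum.swap) (simp add: qb_def sum_distrib_right)
  also have "\<dots> = (\<Sum>z\<in>I. \<Sum>z'\<in>I. p z * p z' * f (z' - z))"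
  proof (rule sum.cong[OF refl])
    fix z assume z: "z \<in> I"
    have "(\<Sum>y\<in>I2. p z * p (z + y) * f y) = (\<Sum>z'\<in>(\<lambda>y. z + y) ` I2. p z * p z' * f (z' - z))"
      by (subst sum.reindex) auto
    also have "\<dots> = (\<Sum>z'\<in>I. p z * p z' * f (z' - z))"
    proof (rule sum.mono_neutral_right)
      show "I \<subseteq> (\<lambda>y. z + y) ` I2"
      proof
        fix x assume "x \<in> I"
        then show "x \<in> (\<lambda>y. z + y) ` I2" using z by (intro image_eqI[of _ _ "x - z"]) auto
      qed
    qed (auto simp: p_out)
    finally show "(\<Sum>y\<in>I2. p z * p (z + y) * f y) = (\<Sum>z'\<in>I. p z * p z' * f (z' - z))" .
  qed
  finally show ?thesis .
qed

lemma qb_nonneg: "0 \<le> qb y"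
  unfolding qb_def by (intro sum_nonneg mult_nonneg_nonneg p_nonneg)

lemma qb_out: "y \<notin> I2 \<Longrightarrow> qb y = 0"
  unfolding qb_def by (intro sum.neutral ballI) (auto simp: p_out)

lemma qb_ge: "p z * p (z + y) \<le> qb y"
proof (cases "z \<in> I")
  case True
  then show ?thesis unfolding qb_def
    by (intro member_le_sum) (auto simp: p_nonneg)
next
  case False
  then show ?thesis using qb_nonneg by (simp add: p_out)
qed

lemma qb_sum1: "(\<Sum>y\<in>I2. qb y) = 1"
proof -
  have "(\<Sum>y\<in>I2. qb y) = (\<Sum>z\<in>I. p z) * (\<Sum>z'\<in>I. p z')"
    using qb_sum[of "\<lambda>_. 1"] by (simp add: sum_product)
  then show ?thesis by (simp add: p_sum)
qed

lemma qb_minus: "qb (- y) = qb y"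
proof -
  have s: "(\<Sum>z\<in>I. p z * p (z + y)) = (\<Sum>z\<in>{- int R - \<bar>y\<bar>..int R + \<bar>y\<bar>}. p z * p (z + y))" for y
    by (rule sum.mono_neutral_left) (auto simp: p_out)
  have "(\<Sum>z\<in>{- int R - \<bar>y\<bar>..int R + \<bar>y\<bar>}. p z * p (z - y)) =
        (\<Sum>z\<in>{- int R - \<bar>y\<bar> - y..int R + \<bar>y\<bar> - y}. p z * p (z + y))"
    by (rule sum.reindex_bij_witness[of _ "\<lambda>z. z + y" "\<lambda>z. z - y"]) (auto simp: mult.commute)
  also have "\<dots> = (\<Sum>z\<in>I. p z * p (z + y))"
    by (rule sum.mono_neutral_right) (auto simp: p_out)
  finally show ?thesis using s[of "-y"] by (simp add: qb_def)
qed

text \<open>The characteristic function of a difference of independent copies is the squared modulus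
  of that of one copy. The resulting nonnegativity of \<open>chq\<close> is what later makes its
  powers converge to 0.\<close>

lemma chq_eq: "chq t = (\<Sum>j\<in>I. p j * cos (t * j))\<^sup>2 + (\<Sum>j\<in>I. p j * sin (t * j))\<^sup>2"
proof -
  have "chq t = (\<Sum>z\<in>I. \<Sum>z'\<in>I. p z * p z' * cos (t * of_int (z' - z)))"
    unfolding chq_def by (rule qb_sum)
  also have "\<dots> = (\<Sum>z\<in>I. \<Sum>z'\<in>I. (p z * cos (t * z)) * (p z' * cos (t * z')) + (p z * sin (t * z)) * (p z' * sin (t * z')))"
    by (intro sum.cong refl) (simp add: right_diff_distrib cos_diff algebra_simps)
  finally show ?thesis
    by (simp add: sum.distrib sum_product power2_eq_square)
qed

text \<open>Centre both steps: the two squares contribute \<open>var\<close> each, and the cross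
  term is a product of two centred means, hence zero.\<close>

lemma qb_second_moment: "(\<Sum>y\<in>I2. qb y * (of_int y)\<^sup>2) = 2 * var"
proof -
  have "(\<Sum>y\<in>I2. qb y * (of_int y)\<^sup>2) = (\<Sum>z\<in>I. \<Sum>z'\<in>I. p z * p z' * (of_int (z' - z))\<^sup>2)"
    by (rule qb_sum)
  also have "\<dots> = (\<Sum>z\<in>I. \<Sum>z'\<in>I. p z * (p z' * (of_int z' - mean)\<^sup>2) + (p z * (of_int z - mean)\<^sup>2) * p z'
      - 2 * ((p z * (of_int z - mean)) * (p z' * (of_int z' - mean))))"
    by (intro sum.cong refl) (simp add: power2_eq_square algebra_simps)
  also have "\<dots> = (\<Sum>z\<in>I. p z) * (\<Sum>z'\<in>I. p z' * (of_int z' - mean)\<^sup>2) + (\<Sum>z\<in>I. p z * (of_int z - mean)\<^sup>2) * (\<Sum>z\<in>I. p z)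
      - 2 * ((\<Sum>z\<in>I. p z * (of_int z - mean)) * (\<Sum>z\<in>I. p z * (of_int z - mean)))"
    unfolding sum.distrib sum_subtractf sum_product sum_distrib_left[symmetric] by simp
  also have "(\<Sum>z\<in>I. p z * (of_int z - mean)) = mean - mean"
    unfolding right_diff_distrib sum_subtractf sum_distrib_right[symmetric] p_sum
    by (simp add: mean_def mult.commute)
  finally show ?thesis by (simp add: p_sum var_def mult.commute)
qed

lemma chq_le_1: "chq t \<le> 1" and chq_nonneg: "0 \<le> chq t"
proof -
  have "chq t \<le> (\<Sum>y\<in>I2. qb y * 1)"
    unfolding chq_def by (intro sum_mono mult_left_mono qb_nonneg) auto
  then show "chq t \<le> 1" by (simp add: qb_sum1)
  show "0 \<le> chq t" by (simp add: chq_eq)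
qed

text \<open>If \<open>d\<close> divided \<open>x - x0\<close> for every \<open>x\<close> in the
  support, all mass would lie in a single residue class modulo \<open>d\<close>, which the
  nondegeneracy assumption forbids.\<close>

lemma p_aperiodic': "\<exists>x. p x > 0 \<and> \<not> d dvd (x - x0)" if d: "d > 1" for d x0 :: int
proof (rule ccontr)
  assume "\<not> ?thesis"
  then have *: "d dvd (x - x0)" if "p x > 0" for x using that by auto
  have "(\<Sum>\<^sub>\<infinity>k. p (x0 + k * d)) = infsum p (range (\<lambda>k. x0 + k * d))"
    using d by (subst infsum_reindex) (auto simp: inj_on_def o_def)
  also have "\<dots> = infsum p I"
  proof (rule infsum_cong_neutral)
    fix x assume "x \<in> I - range (\<lambda>k. x0 + k * d)"
    then have "\<not> d dvd (x - x0)"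
      by (metis (no_types, lifting) Diff_iff add.commute diff_add_cancel dvd_def mult.commute rangeI)
    then show "p x = 0" using * p_nonneg[of x] by force
  qed (auto simp: p_out)
  also have "\<dots> = 1" by (simp add: p_sum)
  finally show False using p_aperiodic d by blast
qed

text \<open>If \<open>chq t = 1\<close>, then \<open>t * y\<close> is a multiple of
  \<open>2 * pi\<close> for every \<open>y\<close> charged by \<open>qb\<close>. The integers with
  this property form a subgroup, proper because 0 < |t| \<le> pi keeps 1 out of it. A modulus above
  1 then divides all differences of points of the support, contrary to aperiodicity.\<close>

lemma chq_less_1:
  assumes "t \<noteq> 0" "\<bar>t\<bar> \<le> pi"
  shows "chq t < 1"
proof (rule ccontr)
  assume "\<not> chq t < 1"
  then have c: "chq t = 1" using chq_le_1[of t] by simp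
  have "(\<Sum>y\<in>I2. qb y * (1 - cos (t * y))) = 0"
    using c by (simp add: right_diff_distrib sum_subtractf qb_sum1 chq_def)
  then have z: "qb y * (1 - cos (t * y)) = 0" if "y \<in> I2" for y
    using that by (subst (asm) sum_nonneg_eq_0_iff) (auto intro!: mult_nonneg_nonneg qb_nonneg)
  define H where "H = {h::int. \<exists>k::int. t * of_int h = of_int k * 2 * pi}"
  have H: "y \<in> H" if "qb y > 0" for y
  proof -
    have "y \<in> I2" using that qb_out by force
    with z that have "cos (t * y) = 1" by fastforce
    then show ?thesis unfolding H_def cos_one_2pi_int by (auto simp: mult.assoc)
  qed
  have Hd: "x - y \<in> H" if "x \<in> H" "y \<in> H" for x y
  proof -
    from that obtain k l :: int where "t * x = of_int k * 2 * pi" "t * y = of_int l * 2 * pi"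
      by (auto simp: H_def)
    then have "t * of_int (x - y) = of_int (k - l) * 2 * pi" by (simp add: algebra_simps)
    then show ?thesis unfolding H_def by blast
  qed
  have H0: "0 \<in> H" unfolding H_def by (auto intro!: exI[of _ 0])
  have H1: "1 \<notin> H"
  proof
    assume "1 \<in> H"
    then obtain k :: int where k: "t = of_int k * 2 * pi" by (auto simp: H_def)
    with assms have "k \<noteq> 0" by auto
    then have "\<bar>real_of_int k\<bar> \<ge> 1" by linarith
    then have "1 * (2 * pi) \<le> \<bar>real_of_int k\<bar> * (2 * pi)" by (intro mult_right_mono) auto
    then have "\<bar>t\<bar> \<ge> 2 * pi" unfolding k by (simp add: abs_mult)
    then show False using assms pi_gt_zero by linarith
  qed
  obtain x0 where x0: "p x0 > 0"
    using p_sum p_nonneg by (metis less_eq_real_def sum.neutral zero_neq_one)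
  have "x - x0 \<in> H" if "p x > 0" for x
    using qb_ge[of x0 "x - x0"] mult_pos_pos[OF x0 that] by (intro H) simp
  moreover have "\<exists>d>1. \<forall>h\<in>H. d dvd h"
  proof (cases "\<exists>h\<in>H. h > 0")
    case False
    have "h = 0" if "h \<in> H" for h
      using that False Hd[OF H0 that] by (metis diff_0 linorder_cases neg_0_less_iff_less)
    \<comment> \<open>In the trivial group every modulus divides every element; 2 is the smallest
      that exceeds 1.\<close>
    then show ?thesis by (intro exI[of _ 2]) auto
  next
    case True
    then obtain h0 where h0: "h0 \<in> H" "h0 > 0" by auto
    \<comment> \<open>The least positive element generates the subgroup, by division with remainder;
      it is not 1 because 1 is not in \<open>H\<close>.\<close>
    define d where "d = int (LEAST n. n > 0 \<and> int n \<in> H)"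
    have ex: "nat h0 > 0 \<and> int (nat h0) \<in> H" using h0 by auto
    have d: "d > 0" "d \<in> H" using LeastI[of "\<lambda>n. n > 0 \<and> int n \<in> H", OF ex] by (auto simp: d_def)
    have least: "d \<le> h" if "h > 0" "h \<in> H" for h
      using Least_le[of "\<lambda>n. n > 0 \<and> int n \<in> H" "nat h"] that by (simp add: d_def)
    have mult: "int n * d \<in> H" for n
    proof (induction n)
      case (Suc n)
      have "- d \<in> H" using Hd[OF H0 d(2)] by simp
      then have "int n * d - (- d) \<in> H" using Hd[OF Suc] by blast
      then show ?case by (simp add: algebra_simps)
    qed (simp add: H0)
    have mult': "k * d \<in> H" for k :: int
      using mult[of "nat k"] Hd[OF H0 mult[of "nat (-k)"]] by (cases "k \<ge> 0") auto
    have "d dvd h" if h: "h \<in> H" for h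
    proof -
      have "h - (h div d) * d \<in> H" using Hd[OF h mult'] .
      then have "h mod d \<in> H" by (simp add: minus_div_mult_eq_mod)
      moreover have "0 \<le> h mod d" "h mod d < d" using d by auto
      ultimately have "h mod d = 0" using least[of "h mod d"] by force
      then show ?thesis by auto
    qed
    moreover have "d \<noteq> 1" using d H1 by auto
    ultimately show ?thesis using d by (intro exI[of _ d]) auto
  qed
  ultimately obtain d where "d > 1" "\<And>x. p x > 0 \<Longrightarrow> d dvd (x - x0)" by auto
  then show False using p_aperiodic'[of d x0] by blast
qed

text \<open>Zero variance would concentrate \<open>p\<close> at one point, and then already the
  modulus 2 contradicts aperiodicity.\<close>

lemma var_pos: "var > 0"
proof -
  have "var \<ge> 0" unfolding var_def by (intro sum_nonneg mult_nonneg_nonneg p_nonneg) auto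
  moreover have "var \<noteq> 0"
  proof
    assume "var = 0"
    then have z: "(of_int j - mean)\<^sup>2 * p j = 0" if "j \<in> I" for j
      using that unfolding var_def
      by (subst (asm) sum_nonneg_eq_0_iff) (auto intro!: mult_nonneg_nonneg p_nonneg)
    have m: "of_int j = mean" if "p j > 0" for j
      using z[of j] that p_out[of j] by (cases "j \<in> I") auto
    obtain x0 where x0: "p x0 > 0"
      using p_sum p_nonneg by (metis less_eq_real_def sum.neutral zero_neq_one)
    have "x = x0" if "p x > 0" for x using m[OF that] m[OF x0] by simp
    then show False using p_aperiodic'[of 2 x0] by auto
  qed
  ultimately show ?thesis by simp
qed

definition "m4 = (\<Sum>y\<in>I2. qb y * (of_int y) ^ 4) / 24"

lemma m4_nonneg: "0 \<le> m4"
  unfolding m4_def by (intro divide_nonneg_nonneg sum_nonneg mult_nonneg_nonneg qb_nonneg) auto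

text \<open>The fourth-order expansion of the cosine, averaged over \<open>qb\<close>. The second
  moment \<open>2 * var\<close> of the difference, halved by the expansion, gives the coefficient
  \<open>var\<close>.\<close>

lemma chq_approx: "\<bar>1 - chq t - var * t\<^sup>2\<bar> \<le> m4 * t ^ 4"
proof -
  have "1 - chq t - var * t\<^sup>2 = (\<Sum>y\<in>I2. qb y * 1) - chq t - (\<Sum>y\<in>I2. qb y * (of_int y)\<^sup>2) * t\<^sup>2 / 2"
    by (simp add: qb_sum1 qb_second_moment)
  also have "\<dots> = (\<Sum>y\<in>I2. qb y * (- (cos (t * y) - (1 - (t * y)\<^sup>2 / 2))))"
    unfolding chq_def sum_distrib_right sum_divide_distrib sum_subtractf[symmetric]
    by (intro sum.cong refl) (simp add: algebra_simps power_mult_distrib)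
  finally have "\<bar>1 - chq t - var * t\<^sup>2\<bar> = \<bar>\<Sum>y\<in>I2. qb y * (- (cos (t * y) - (1 - (t * y)\<^sup>2 / 2)))\<bar>" by simp
  also have "\<dots> \<le> (\<Sum>y\<in>I2. \<bar>qb y * (- (cos (t * y) - (1 - (t * y)\<^sup>2 / 2)))\<bar>)"
    by (rule sum_abs)
  also have "\<dots> \<le> (\<Sum>y\<in>I2. qb y * ((t * y) ^ 4 / 24))"
    by (intro sum_mono) (simp only: abs_mult abs_minus_cancel abs_of_nonneg[OF qb_nonneg] mult_left_mono[OF cos_taylor4 qb_nonneg])
  also have "\<dots> = m4 * t ^ 4"
    by (simp add: m4_def sum_divide_distrib sum_distrib_left power_mult_distrib mult_ac)
  finally show ?thesis .
qed

text \<open>Near 0 the quadratic term dominates the quartic error; away from 0 the continuous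
  function \<open>1 - chq\<close> has a positive minimum on a compact set by
  \<open>chq_less_1\<close>.\<close>

lemma chq_lower: "\<exists>c>0. \<forall>t. \<bar>t\<bar> \<le> pi \<longrightarrow> c * t\<^sup>2 \<le> 1 - chq t"
proof -
  \<comment> \<open>Within this radius the quartic error is at most half of the quadratic term;
    \<open>m4 + 1\<close> in place of \<open>m4\<close> keeps the denominator positive.\<close>
  define e where "e = min pi (sqrt (var / (2 * (m4 + 1))))"
  have e: "e > 0" using var_pos m4_nonneg by (simp add: e_def)
  have near: "var / 2 * t\<^sup>2 \<le> 1 - chq t" if "\<bar>t\<bar> \<le> e" for t
  proof -
    have "\<bar>t\<bar> \<le> sqrt (var / (2 * (m4 + 1)))" using that by (simp add: e_def)
    then have "t\<^sup>2 \<le> var / (2 * (m4 + 1))"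
      using real_sqrt_le_iff real_sqrt_abs by metis
    then have "(m4 + 1) * t\<^sup>2 \<le> var / 2" using m4_nonneg by (simp add: field_simps)
    then have "(m4 + 1) * t\<^sup>2 * t\<^sup>2 \<le> var / 2 * t\<^sup>2" by (intro mult_right_mono) auto
    moreover have "m4 * t^4 \<le> (m4 + 1) * t\<^sup>2 * t\<^sup>2"
    proof -
      have "(m4 + 1) * t\<^sup>2 * t\<^sup>2 = m4 * t ^ 4 + t ^ 4"
        by (simp add: algebra_simps power4_eq_xxxx power2_eq_square)
      then show ?thesis by simp
    qed
    ultimately show ?thesis using chq_approx[of t] by linarith
  qed
  have cont: "continuous_on S (\<lambda>t. 1 - chq t)" for S
    unfolding chq_def by (intro continuous_intros)
  let ?K = "{e..pi} \<union> {-pi..-e}"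
  have K: "compact ?K" "?K \<noteq> {}" by (auto simp: e_def intro!: compact_Un)
  obtain t0 where t0: "t0 \<in> ?K" "\<And>t. t \<in> ?K \<Longrightarrow> 1 - chq t0 \<le> 1 - chq t"
    using continuous_attains_inf[OF K cont] by blast
  define m where "m = 1 - chq t0"
  have m: "m > 0" unfolding m_def using t0(1) e chq_less_1[of t0] by auto
  define c where "c = min (var / 2) (m / pi\<^sup>2)"
  have "c * t\<^sup>2 \<le> 1 - chq t" if "\<bar>t\<bar> \<le> pi" for t
  proof (cases "\<bar>t\<bar> \<le> e")
    case True
    have "c * t\<^sup>2 \<le> var / 2 * t\<^sup>2" unfolding c_def by (intro mult_right_mono min.cobounded1) auto
    then show ?thesis using near[OF True] by linarith
  next
    case False
    have "c * t\<^sup>2 \<le> m / pi\<^sup>2 * pi\<^sup>2"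
      using that m by (intro mult_mono) (auto simp: c_def abs_le_square_iff[symmetric])
    also have "\<dots> = m" by simp
    also have "m \<le> 1 - chq t" unfolding m_def using t0(2)[of t] False that by (auto simp: abs_le_iff not_le)
    finally show ?thesis .
  qed
  moreover have "c > 0" using m var_pos by (simp add: c_def)
  ultimately show ?thesis by blast
qed

section \<open>The potential kernel as a Fourier integral\<close>

definition "U = uniform_measure lborel {-pi..pi}"

lemma prob_U: "prob_space U"
  unfolding U_def by (rule prob_space_uniform_measure) auto

lemma sets_U[measurable_cong, simp]: "sets U = sets borel"
  by (simp add: U_def)

lemma space_U[simp]: "space U = UNIV"
  by (simp add: U_def)

lemma AE_U: "AE t in U. t \<noteq> 0 \<and> \<bar>t\<bar> \<le> pi"
  unfolding U_def
proof (subst AE_uniform_measure)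
  show "AE x in lborel. x \<in> {- pi..pi} \<longrightarrow> x \<noteq> 0 \<and> \<bar>x\<bar> \<le> pi"
    using AE_lborel_singleton[of 0] by eventually_elim auto
qed auto

lemma integral_U:
  assumes [measurable]: "f \<in> borel_measurable borel"
  shows "(\<integral>t. f t \<partial>U) = (\<integral>t. indicator {-pi..pi} t * f t \<partial>lborel) / (2 * pi)"
proof -
  have "(\<integral>t. f t \<partial>U) = (\<integral>t. indicator {-pi..pi} t / (2 * pi) * f t \<partial>lborel)"
  proof -
    have "U = density lborel (\<lambda>t. ennreal (indicator {-pi..pi} t / (2 * pi)))"
      unfolding U_def uniform_measure_def
      by (intro density_cong) (auto simp: indicator_def divide_ennreal[symmetric] ennreal_1[symmetric] simp del: ennreal_1)
    then have "(\<integral>t. f t \<partial>U) = (\<integral>t. f t \<partial>density lborel (\<lambda>t. ennreal (indicator {-pi..pi} t / (2 * pi))))"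
      by (simp only:)
    also have "\<dots> = (\<integral>t. indicator {-pi..pi} t / (2 * pi) * f t \<partial>lborel)"
      by (subst integral_density) auto
    finally show ?thesis .
  qed
  also have "\<dots> = (\<integral>t. indicator {-pi..pi} t * f t \<partial>lborel) / (2 * pi)"
    by simp
  finally show ?thesis .
qed

lemma integral_cos_U: "(\<integral>t. cos (t * of_int x) \<partial>U) = (if x = 0 then 1 else 0)" for x :: int
proof (cases "x = 0")
  case True
  interpret U: prob_space U by (rule prob_U)
  show ?thesis using True U.prob_space by simp
next
  case False
  have "(\<integral>t. cos (t * of_int x) * indicator {-pi..pi} t \<partial>lborel)
      = sin (pi * of_int x) / of_int x - sin (- pi * of_int x) / of_int x"
    using False by (intro integral_FTC_Icc_real) (auto intro!: derivative_eq_intros continuous_intros)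
  moreover have "sin (pi * of_int x) = 0" by (metis mult.commute sin_int_2pin sin_npi_int mult_of_int_commute)
  ultimately show ?thesis using False by (subst integral_U) (auto simp: mult.commute)
qed

text \<open>By Fourier inversion on the integers, the k-step return probability differs from the
  probability of going from \<open>x\<close> to 0 by the mean of
  \<open>chq t ^ k * (1 - cos (t * x))\<close> under \<open>U\<close>. Summing the geometric series
  over \<open>k\<close> gives this formula for the potential kernel; \<open>abar_lim\<close> is the
  proof.\<close>

definition abar :: "int \<Rightarrow> real" where
  "abar x = (\<integral>t. (1 - cos (t * of_int x)) / (1 - chq t) \<partial>U)"

lemma chq_measurable[measurable]: "chq \<in> borel_measurable borel"
  unfolding chq_def by measurable

text \<open>The quadratic zero of \<open>1 - cos\<close> at the origin compensates that of
  \<open>1 - chq\<close>, so the integrand is bounded by a constant depending on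
  \<open>x\<close>.\<close>

lemma abar_integrable: "integrable U (\<lambda>t. (1 - cos (t * of_int x)) / (1 - chq t))"
proof -
  interpret U: prob_space U by (rule prob_U)
  obtain c where c: "c > 0" "\<And>t. \<bar>t\<bar> \<le> pi \<Longrightarrow> c * t\<^sup>2 \<le> 1 - chq t" using chq_lower by blast
  show ?thesis
  proof (rule U.integrable_const_bound)
    show "AE t in U. norm ((1 - cos (t * of_int x)) / (1 - chq t)) \<le> (of_int x)\<^sup>2 / (2 * c)"
      using AE_U
    proof eventually_elim
      case (elim t)
      have "norm ((1 - cos (t * of_int x)) / (1 - chq t)) = (1 - cos (t * of_int x)) / (1 - chq t)"
        using chq_le_1[of t] by (simp add: divide_nonneg_nonneg)
      also have "\<dots> \<le> ((t * of_int x)\<^sup>2 / 2) / (c * t\<^sup>2)"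
        using elim c by (intro frac_le one_minus_cos_le) auto
      also have "\<dots> = (of_int x)\<^sup>2 / (2 * c)" using elim c by (simp add: power_mult_distrib)
      finally show ?case .
    qed
  qed measurable
qed

lemma abar_nonneg: "0 \<le> abar x"
  unfolding abar_def by (intro integral_nonneg_AE AE_I2) (auto intro!: divide_nonneg_nonneg simp: chq_le_1)

lemma abar_0[simp]: "abar 0 = 0"
  by (simp add: abar_def)

text \<open>A vanishing integral of a nonnegative function would force
  \<open>cos (t * x) = 1\<close> for almost all \<open>t\<close>, but for
  \<open>x \<noteq> 0\<close> this cosine has mean 0.\<close>

lemma abar_pos:
  assumes "x \<noteq> 0" shows "0 < abar x"
proof (rule ccontr)
  assume "\<not> 0 < abar x"
  then have "abar x = 0" using abar_nonneg[of x] by simp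
  then have "AE t in U. (1 - cos (t * of_int x)) / (1 - chq t) = 0"
    unfolding abar_def
    by (subst (asm) integral_nonneg_eq_0_iff_AE[OF abar_integrable])
       (auto intro!: divide_nonneg_nonneg AE_I2 simp: chq_le_1)
  then have "AE t in U. cos (t * of_int x) = 1"
    using AE_U by eventually_elim (use chq_less_1 in fastforce)
  then have "(\<integral>t. cos (t * of_int x) \<partial>U) = (\<integral>t. 1 \<partial>U)"
    by (intro integral_cong_AE) auto
  then show False using assms integral_cos_U[of x] prob_space.prob_space[OF prob_U] by simp
qed

lemma qb_cos_shift: "(\<Sum>y\<in>I2. qb y * cos (t * of_int (x + y))) = chq t * cos (t * of_int x)"
proof -
  have "(\<Sum>y\<in>I2. qb y * sin (t * y)) = (\<Sum>y\<in>I2. qb (-y) * sin (t * of_int (-y)))"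
    by (rule sum.reindex_bij_witness[of _ uminus uminus]) auto
  then have "(\<Sum>y\<in>I2. qb y * sin (t * y)) = 0"
    by (simp add: qb_minus sum_negf)
  moreover have "(\<Sum>y\<in>I2. qb y * cos (t * of_int (x + y))) =
     cos (t * x) * (\<Sum>y\<in>I2. qb y * cos (t * y)) - sin (t * x) * (\<Sum>y\<in>I2. qb y * sin (t * y))"
    by (simp add: distrib_left cos_add sum_distrib_left sum_subtractf[symmetric] algebra_simps)
  ultimately show ?thesis by (simp add: chq_def mult.commute)
qed

text \<open>Averaging over a step multiplies the cosine by \<open>chq\<close>, and (1 - chq cos) /
  (1 - chq) exceeds (1 - cos) / (1 - chq) by exactly cos, whose mean is the indicator of
  \<open>x = 0\<close>. Harmonicity off the origin is what makes meetings the only source of growth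
  of \<open>abar\<close>.\<close>

lemma abar_harmonic: "(\<Sum>y\<in>I2. qb y * abar (x + y)) = abar x + (if x = 0 then 1 else 0)"
proof -
  interpret U: prob_space U by (rule prob_U)
  have ic: "integrable U (\<lambda>t. cos (t * of_int x))"
    by (rule U.integrable_const_bound[of _ 1]) auto
  have "(\<Sum>y\<in>I2. qb y * abar (x + y)) = (\<integral>t. (\<Sum>y\<in>I2. qb y * ((1 - cos (t * of_int (x + y))) / (1 - chq t))) \<partial>U)"
    unfolding abar_def
    by (subst Bochner_Integration.integral_sum) (auto simp del: times_divide_eq_right of_int_add intro!: integrable_mult_right abar_integrable)
  also have "\<dots> = (\<integral>t. (1 - cos (t * of_int x)) / (1 - chq t) + cos (t * of_int x) \<partial>U)"
  proof (rule integral_cong_AE)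
    show "AE t in U. (\<Sum>y\<in>I2. qb y * ((1 - cos (t * of_int (x + y))) / (1 - chq t))) =
        (1 - cos (t * of_int x)) / (1 - chq t) + cos (t * of_int x)"
      using AE_U
    proof eventually_elim
      case (elim t)
      then have n: "1 - chq t \<noteq> 0" using chq_less_1[of t] by simp
      have "(\<Sum>y\<in>I2. qb y * ((1 - cos (t * of_int (x + y))) / (1 - chq t))) =
         ((\<Sum>y\<in>I2. qb y) - (\<Sum>y\<in>I2. qb y * cos (t * of_int (x + y)))) / (1 - chq t)"
        by (simp add: sum_divide_distrib sum_subtractf[symmetric] algebra_simps diff_divide_distrib)
      also have "\<dots> = (1 - chq t * cos (t * of_int x)) / (1 - chq t)"
        by (simp only: qb_cos_shift qb_sum1)
      also have "\<dots> = (1 - cos (t * of_int x)) / (1 - chq t) + cos (t * of_int x)"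
        using n by (simp add: field_simps)
      finally show ?case .
    qed
  qed measurable
  also have "\<dots> = abar x + (\<integral>t. cos (t * of_int x) \<partial>U)"
    using abar_integrable ic by (simp add: abar_def)
  finally show ?thesis by (simp add: integral_cos_U)
qed

text \<open>Replace \<open>1 - chq t\<close> by \<open>var * t\<^sup>2\<close>: the expansion of
  \<open>chq\<close> and its quadratic lower bound keep the error bounded uniformly in
  \<open>x\<close>. What remains is the cosine integral of |x| cut off at \<open>pi\<close>, and the
  missing tails are bounded too.\<close>

lemma abar_asymp: "\<exists>C. \<forall>x. \<bar>abar x - \<bar>of_int x\<bar> / (2 * var)\<bar> \<le> C"
proof -
  interpret U: prob_space U by (rule prob_U)
  obtain c where c: "c > 0" "\<And>t. \<bar>t\<bar> \<le> pi \<Longrightarrow> c * t\<^sup>2 \<le> 1 - chq t" using chq_lower by blast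
  \<comment> \<open>The difference of the two integrands is at most 2, the bound of
    \<open>1 - cos\<close>, times \<open>m4 * t ^ 4\<close> over
    \<open>(c * t\<^sup>2) * (var * t\<^sup>2)\<close>; the powers of \<open>t\<close>
    cancel.\<close>
  define C where "C = 2 * m4 / (c * var)"
  have "\<bar>abar x - \<bar>of_int x\<bar> / (2 * var)\<bar> \<le> C + 4 / (pi * var * (2 * pi))" for x
  proof -
    let ?g = "\<lambda>t::real. (1 - cos (t * of_int x)) / t\<^sup>2"
    have ig: "integrable lborel ?g" and vg: "(\<integral>t. ?g t \<partial>lborel) = pi * \<bar>of_int x\<bar>"
      using abs_eq_integral_cos[of "of_int x"] by (auto simp: has_bochner_integral_iff)
    have iU: "integrable U (\<lambda>t. ?g t / var)"
    proof (rule U.integrable_const_bound)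
      show "AE t in U. norm (?g t / var) \<le> (of_int x)\<^sup>2 / (2 * var)"
        using AE_U
      proof eventually_elim
        case (elim t)
        have "norm (?g t / var) = ?g t / var"
          using var_pos by simp
        also have "\<dots> \<le> ((t * of_int x)\<^sup>2 / 2) / t\<^sup>2 / var"
          using elim var_pos by (intro divide_right_mono one_minus_cos_le) auto
        also have "\<dots> = (of_int x)\<^sup>2 / (2 * var)" using elim var_pos by (simp add: power_mult_distrib)
        finally show ?case .
      qed
    qed measurable
    have d: "\<bar>(1 - cos (t * of_int x)) / (1 - chq t) - ?g t / var\<bar> \<le> C" if t: "t \<noteq> 0" "\<bar>t\<bar> \<le> pi" for t
    proof -
      have t2: "t\<^sup>2 > 0" using t by simp
      have q: "1 - chq t > 0" using chq_less_1[OF t] by simp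
      have "(1 - cos (t * of_int x)) / (1 - chq t) - ?g t / var =
        (1 - cos (t * of_int x)) * (- ((1 - chq t - var * t\<^sup>2) / ((1 - chq t) * (var * t\<^sup>2))))"
        using q t var_pos by (simp add: field_simps)
      then have "\<bar>(1 - cos (t * of_int x)) / (1 - chq t) - ?g t / var\<bar> =
        \<bar>1 - cos (t * of_int x)\<bar> * (\<bar>1 - chq t - var * t\<^sup>2\<bar> / ((1 - chq t) * (var * t\<^sup>2)))"
        using q t2 var_pos by (simp add: abs_mult)
      also have "\<dots> \<le> 2 * ((m4 * t ^ 4) / ((c * t\<^sup>2) * (var * t\<^sup>2)))"
        using cos_ge_minus_one[of "t * of_int x"] t2 var_pos c t m4_nonneg q
        by (intro mult_mono frac_le chq_approx mult_right_mono) auto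
      also have "\<dots> = C" using t var_pos c
        by (simp add: C_def power4_eq_xxxx power2_eq_square)
      finally show ?thesis .
    qed
    have "\<bar>abar x - (\<integral>t. ?g t / var \<partial>U)\<bar> = \<bar>\<integral>t. (1 - cos (t * of_int x)) / (1 - chq t) - ?g t / var \<partial>U\<bar>"
      unfolding abar_def using abar_integrable iU by simp
    also have "\<dots> \<le> (\<integral>t. \<bar>(1 - cos (t * of_int x)) / (1 - chq t) - ?g t / var\<bar> \<partial>U)"
      by (rule integral_abs_bound)
    also have "\<dots> \<le> (\<integral>t. C \<partial>U)"
    proof (rule integral_mono_AE)
      show "AE t in U. \<bar>(1 - cos (t * of_int x)) / (1 - chq t) - ?g t / var\<bar> \<le> C"
        using AE_U by eventually_elim (intro d; simp)
    qed (intro integrable_abs Bochner_Integration.integrable_diff abar_integrable iU, simp)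
    finally have 1: "\<bar>abar x - (\<integral>t. ?g t / var \<partial>U)\<bar> \<le> C" using U.prob_space by simp
    \<comment> \<open>Majorant for the two tails outside \<open>[-pi, pi]\<close>: there
      \<open>1 - cos\<close> is at most 2 and \<open>1 / t\<^sup>2\<close> has integral
      \<open>1 / pi\<close> on each side, in total at most \<open>4 / pi\<close>.\<close>
    let ?T = "\<lambda>t. indicator {pi<..} t *\<^sub>R (1 / t\<^sup>2) :: real"
    have T: "has_bochner_integral lborel ?T (1 / pi)"
    proof -
      have d: "((\<lambda>t. - 1 / t) has_real_derivative 1 / t\<^sup>2) (at t)" if "ereal pi < ereal t" for t
        using that pi_gt_zero by (auto intro!: derivative_eq_intros simp: power2_eq_square)
      have c: "isCont (\<lambda>t. 1 / t\<^sup>2 :: real) t" if "ereal pi < ereal t" for t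
        using that pi_gt_zero by (intro continuous_intros) auto
      have l1: "(((\<lambda>t. - 1 / t) \<circ> real_of_ereal) \<longlongrightarrow> - 1 / pi) (at_right (ereal pi))"
        unfolding ereal_tendsto_simps by (intro tendsto_intros) auto
      have l2: "(((\<lambda>t::real. - 1 / t) \<circ> real_of_ereal) \<longlongrightarrow> 0) (at_left \<infinity>)"
        unfolding ereal_tendsto_simps by real_asymp
      have "set_integrable lborel (einterval (ereal pi) \<infinity>) (\<lambda>t::real. 1 / t\<^sup>2)"
        "(LBINT t=ereal pi..\<infinity>. 1 / t\<^sup>2) = 0 - (- 1 / pi)"
        by (rule interval_integral_FTC_nonneg[OF _ d c _ l1 l2]; simp)+
      moreover have "einterval (ereal pi) \<infinity> = {pi<..}" by (auto simp: einterval_def)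
      ultimately show ?thesis
        by (simp add: has_bochner_integral_iff set_integrable_def interval_lebesgue_integral_def set_lebesgue_integral_def)
    qed
    have T': "has_bochner_integral lborel (\<lambda>t. ?T (-t)) (1 / pi)"
      using lborel_has_bochner_integral_real_affine_iff[of "-1" ?T "1/pi" 0] T by simp
    have s: "(\<integral>t. ?g t \<partial>lborel) - (\<integral>t. indicator {-pi..pi} t * ?g t \<partial>lborel) =
       (\<integral>t. indicator (- {-pi..pi}) t * ?g t \<partial>lborel)"
    proof -
      have "integrable lborel (\<lambda>t. indicator {-pi..pi} t *\<^sub>R ?g t)"
        using ig by (intro integrable_mult_indicator) auto
      then have "(\<integral>t. ?g t \<partial>lborel) - (\<integral>t. indicator {-pi..pi} t * ?g t \<partial>lborel) =
         (\<integral>t. ?g t - indicator {-pi..pi} t * ?g t \<partial>lborel)" using ig by simp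
      also have "\<dots> = (\<integral>t. indicator (- {-pi..pi}) t * ?g t \<partial>lborel)"
        by (intro Bochner_Integration.integral_cong) (auto simp: indicator_def)
      finally show ?thesis .
    qed
    have le: "(\<integral>t. indicator (- {-pi..pi}) t * ?g t \<partial>lborel) \<le> (\<integral>t. 2 * (?T t + ?T (-t)) \<partial>lborel)"
    proof (rule integral_mono)
      have "integrable lborel (\<lambda>t. indicator (- {-pi..pi}) t *\<^sub>R ?g t)"
        using ig by (intro integrable_mult_indicator) auto
      then show "integrable lborel (\<lambda>t. indicator (- {-pi..pi}) t * ?g t)" by simp
      show "integrable lborel (\<lambda>t. 2 * (?T t + ?T (-t)))"
        using T T' by (intro integrable_mult_right Bochner_Integration.integrable_add) (auto simp: has_bochner_integral_iff)
      show "indicator (- {-pi..pi}) t * ?g t \<le> 2 * (?T t + ?T (-t))" for t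
      proof -
        have "?g t \<le> 2 / t\<^sup>2"
          using cos_ge_minus_one[of "t * of_int x"] by (intro divide_right_mono) auto
        moreover have "\<not> (pi < t \<and> pi < - t)" using pi_gt_zero by linarith
        ultimately show ?thesis by (auto simp: indicator_def)
      qed
    qed
    also have "\<dots> = 2 * (1 / pi + 1 / pi)"
      by (rule has_bochner_integral_integral_eq[OF has_bochner_integral_mult_right[OF has_bochner_integral_add[OF T T']]])
    also have "\<dots> = 4 / pi" by simp
    finally have le: "(\<integral>t. indicator (- {-pi..pi}) t * ?g t \<partial>lborel) \<le> 4 / pi" .
    have ge: "0 \<le> (\<integral>t. indicator (- {-pi..pi}) t * ?g t \<partial>lborel)"
      by (intro integral_nonneg_AE AE_I2) (auto simp: indicator_def)
    have e: "(\<integral>t. ?g t / var \<partial>U) = (pi * \<bar>of_int x\<bar> - (\<integral>t. indicator (- {-pi..pi}) t * ?g t \<partial>lborel)) / var / (2 * pi)"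
    proof -
      have "(\<integral>t. indicator {-pi..pi} t * (?g t / var) \<partial>lborel) = (\<integral>t. indicator {-pi..pi} t * ?g t / var \<partial>lborel)"
        by simp
      also have "\<dots> = (\<integral>t. indicator {-pi..pi} t * ?g t \<partial>lborel) / var"
        by (rule integral_divide_zero)
      also have "(\<integral>t. indicator {-pi..pi} t * ?g t \<partial>lborel) = pi * \<bar>of_int x\<bar> - (\<integral>t. indicator (- {-pi..pi}) t * ?g t \<partial>lborel)"
        using s by (simp only: vg)
      finally show ?thesis by (subst integral_U) auto
    qed
    have "\<bar>(\<integral>t. ?g t / var \<partial>U) - \<bar>of_int x\<bar> / (2 * var)\<bar> =
      (\<integral>t. indicator (- {-pi..pi}) t * ?g t \<partial>lborel) / (var * (2 * pi))"
      unfolding e using ge var_pos pi_gt_zero by (simp add: field_simps abs_mult)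
    also have "\<dots> \<le> (4 / pi) / (var * (2 * pi))"
      using le var_pos by (intro divide_right_mono) auto
    finally have 2: "\<bar>(\<integral>t. ?g t / var \<partial>U) - \<bar>of_int x\<bar> / (2 * var)\<bar> \<le> 4 / (pi * var * (2 * pi))"
      by (simp add: mult.assoc)
    show ?thesis using 1 2 by linarith
  qed
  then show ?thesis by blast
qed

lemma kernel_pow_qb: "kernel_pow (\<lambda>x y. qb (y - x)) k x 0 = (\<integral>t. chq t ^ k * cos (t * of_int x) \<partial>U)"
proof (induction k arbitrary: x)
  case 0
  show ?case by (simp add: integral_cos_U)
next
  case (Suc k)
  interpret U: prob_space U by (rule prob_U)
  have i: "integrable U (\<lambda>t. chq t ^ k * cos (t * of_int z))" for z :: int
    by (rule U.integrable_const_bound[of _ 1])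
       (auto simp: abs_mult chq_nonneg power_le_one chq_le_1 intro!: AE_I2 mult_le_one)
  have "kernel_pow (\<lambda>x y. qb (y - x)) (Suc k) x 0 =
     (\<Sum>\<^sub>\<infinity>z. qb (z - x) * (\<integral>t. chq t ^ k * cos (t * of_int z) \<partial>U))"
    by (simp add: Suc)
  also have "\<dots> = (\<Sum>z\<in>(\<lambda>y. x + y) ` I2. qb (z - x) * (\<integral>t. chq t ^ k * cos (t * of_int z) \<partial>U))"
  proof (rule infsum_finite_support)
    fix z assume "z \<notin> (\<lambda>y. x + y) ` I2"
    then have "z - x \<notin> I2" by (metis add.commute diff_add_cancel image_eqI)
    then show "qb (z - x) * (\<integral>t. chq t ^ k * cos (t * of_int z) \<partial>U) = 0" by (simp add: qb_out)
  qed simp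
  also have "\<dots> = (\<Sum>y\<in>I2. qb y * (\<integral>t. chq t ^ k * cos (t * of_int (x + y)) \<partial>U))"
    by (subst sum.reindex) auto
  also have "\<dots> = (\<integral>t. (\<Sum>y\<in>I2. qb y * (chq t ^ k * cos (t * of_int (x + y)))) \<partial>U)"
    by (subst Bochner_Integration.integral_sum) (auto simp del: of_int_add intro!: integrable_mult_right i)
  also have "\<dots> = (\<integral>t. chq t ^ k * (\<Sum>y\<in>I2. qb y * cos (t * of_int (x + y))) \<partial>U)"
    by (intro Bochner_Integration.integral_cong refl) (simp add: sum_distrib_left mult_ac)
  also have "\<dots> = (\<integral>t. chq t ^ Suc k * cos (t * of_int x) \<partial>U)"
    unfolding qb_cos_shift by (simp add: mult_ac)
  finally show ?case .
qed

text \<open>The partial sums have the integrand of \<open>abar\<close> multiplied by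
  \<open>1 - chq t ^ Suc n\<close>. This factor lies in the unit interval and tends to 1 almost
  everywhere, so dominated convergence applies.\<close>

lemma abar_lim:
  "(\<lambda>n. (\<Sum>k=0..n. kernel_pow (\<lambda>x y. qb (y - x)) k 0 0) - (\<Sum>k=0..n. kernel_pow (\<lambda>x y. qb (y - x)) k x 0))
     \<longlonglongrightarrow> abar x"
proof -
  interpret U: prob_space U by (rule prob_U)
  have i: "integrable U (\<lambda>t. chq t ^ k * cos (t * of_int z))" for k and z :: int
    by (rule U.integrable_const_bound[of _ 1])
       (auto simp: abs_mult chq_nonneg power_le_one chq_le_1 intro!: AE_I2 mult_le_one)
  have e: "(\<Sum>k=0..n. kernel_pow (\<lambda>x y. qb (y - x)) k 0 0) - (\<Sum>k=0..n. kernel_pow (\<lambda>x y. qb (y - x)) k x 0)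
     = (\<integral>t. (1 - cos (t * of_int x)) / (1 - chq t) * (1 - chq t ^ Suc n) \<partial>U)" for n
  proof -
    have "(\<Sum>k=0..n. kernel_pow (\<lambda>x y. qb (y - x)) k 0 0) - (\<Sum>k=0..n. kernel_pow (\<lambda>x y. qb (y - x)) k x 0)
      = (\<integral>t. (\<Sum>k=0..n. chq t ^ k * cos (t * of_int 0) - chq t ^ k * cos (t * of_int x)) \<partial>U)"
      unfolding kernel_pow_qb
      by (subst Bochner_Integration.integral_sum, intro Bochner_Integration.integrable_diff i)
         (simp only: sum_subtractf[symmetric] Bochner_Integration.integral_diff[OF i i])
    also have "\<dots> = (\<integral>t. (1 - cos (t * of_int x)) / (1 - chq t) * (1 - chq t ^ Suc n) \<partial>U)"
    proof (rule integral_cong_AE)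
      show "AE t in U. (\<Sum>k=0..n. chq t ^ k * cos (t * of_int 0) - chq t ^ k * cos (t * of_int x)) =
         (1 - cos (t * of_int x)) / (1 - chq t) * (1 - chq t ^ Suc n)"
        using AE_U
      proof eventually_elim
        case (elim t)
        then have "chq t \<noteq> 1" using chq_less_1[of t] by simp
        then have "(\<Sum>k=0..n. chq t ^ k) = (1 - chq t ^ Suc n) / (1 - chq t)"
          by (simp add: sum_gp0 atMost_atLeast0[symmetric])
        moreover have "(\<Sum>k=0..n. chq t ^ k * cos (t * of_int 0) - chq t ^ k * cos (t * of_int x)) =
          (\<Sum>k=0..n. chq t ^ k) * (1 - cos (t * of_int x))"
          by (simp add: sum_distrib_right right_diff_distrib sum_subtractf)
        ultimately show ?case by simp
      qed
    qed measurable
    finally show ?thesis .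
  qed
  have "(\<lambda>n. \<integral>t. (1 - cos (t * of_int x)) / (1 - chq t) * (1 - chq t ^ Suc n) \<partial>U)
      \<longlonglongrightarrow> (\<integral>t. (1 - cos (t * of_int x)) / (1 - chq t) \<partial>U)"
  proof (rule integral_dominated_convergence)
    show "integrable U (\<lambda>t. (1 - cos (t * of_int x)) / (1 - chq t))" by (rule abar_integrable)
    show "AE t in U. (\<lambda>n. (1 - cos (t * of_int x)) / (1 - chq t) * (1 - chq t ^ Suc n))
         \<longlonglongrightarrow> (1 - cos (t * of_int x)) / (1 - chq t)"
      using AE_U
    proof eventually_elim
      case (elim t)
      then have "(\<lambda>n. chq t ^ Suc n) \<longlonglongrightarrow> 0"
        using chq_less_1[of t] chq_nonneg[of t] by (intro LIMSEQ_Suc LIMSEQ_realpow_zero) auto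
      then have "(\<lambda>n. (1 - cos (t * of_int x)) / (1 - chq t) * (1 - chq t ^ Suc n))
         \<longlonglongrightarrow> (1 - cos (t * of_int x)) / (1 - chq t) * (1 - 0)"
        by (intro tendsto_intros)
      then show ?case by simp
    qed
    show "AE t in U. norm ((1 - cos (t * of_int x)) / (1 - chq t) * (1 - chq t ^ Suc n))
        \<le> (1 - cos (t * of_int x)) / (1 - chq t)" for n
    proof (rule AE_I2)
      fix t
      have "\<bar>1 - chq t ^ Suc n\<bar> \<le> 1"
        using chq_nonneg[of t] chq_le_1[of t] power_le_one[of "chq t" "Suc n"] zero_le_power[of "chq t" "Suc n"] by linarith
      then have "\<bar>(1 - cos (t * of_int x)) / (1 - chq t)\<bar> * \<bar>1 - chq t ^ Suc n\<bar> \<le> \<bar>(1 - cos (t * of_int x)) / (1 - chq t)\<bar> * 1"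
        by (intro mult_left_mono) auto
      then show "norm ((1 - cos (t * of_int x)) / (1 - chq t) * (1 - chq t ^ Suc n))
        \<le> (1 - cos (t * of_int x)) / (1 - chq t)"
        using chq_le_1[of t] by (simp add: abs_mult)
    qed
  qed measurable
  then show ?thesis unfolding e abar_def .
qed

end

section \<open>A central limit theorem with predictable coefficients\<close>

lemma exp_minus_remainder: "\<bar>exp (- u) - (1 - u)\<bar> \<le> u\<^sup>2 / 2" if "0 \<le> u" for u :: real
proof -
  have 1: "1 - u \<le> exp (- u)" using exp_ge_add_one_self[of "- u"] by simp
  have "1 + u + u\<^sup>2 / 2 \<le> exp u" using exp_lower_Taylor_quadratic[OF that] .
  moreover have "exp (- u) \<le> 1 - u + u\<^sup>2 / 2"
  proof -
    have "\<exists>t. \<bar>t\<bar> \<le> \<bar>-u\<bar> \<and> exp (-u) = (\<Sum>m<3. (-u) ^ m / fact m) + exp t / fact 3 * (-u) ^ 3"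
      by (rule Maclaurin_exp_le)
    then obtain t where "exp (-u) = (\<Sum>m<3. (-u) ^ m / fact m) + exp t / fact 3 * (-u) ^ 3" by blast
    moreover have "exp t / fact 3 * (-u) ^ 3 \<le> 0"
      using that by (simp add: mult_nonneg_nonneg)
    moreover have "(\<Sum>m<3. (-u) ^ m / fact m) = 1 - u + u\<^sup>2 / 2"
      by (simp add: numeral_3_eq_3 power2_eq_square)
    ultimately show ?thesis by linarith
  qed
  ultimately show ?thesis using 1 by simp
qed

section \<open>Independence through disjoint index sets, and an orthogonality bound\<close>

locale indep_family = prob_space M for M :: "'a measure" +
  fixes X :: "'i \<Rightarrow> 'a \<Rightarrow> 'b" and S :: "'b measure"
  assumes indep: "indep_vars (\<lambda>_. S) X UNIV"
begin

text \<open>The sigma-algebra generated by the \<open>X i\<close> with \<open>i\<close> in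
  \<open>A\<close>. With it, every later independence claim reduces to the disjointness of two index
  sets (\<open>indep_F\<close>).\<close>

definition "F A = vimage_algebra (space M) (\<lambda>x. \<lambda>i\<in>A. X i x) (PiM A (\<lambda>_. S))"

lemma X_rv[measurable]: "X i \<in> measurable M S"
  using indep by (auto simp: indep_vars_def)

lemma restrict_X_space: "(\<lambda>x. \<lambda>i\<in>A. X i x) \<in> space M \<rightarrow> space (PiM A (\<lambda>_. S))"
  using measurable_space[OF X_rv] by (auto simp: space_PiM PiE_def extensional_def)

lemma space_F[simp]: "space (F A) = space M"
  by (simp add: F_def)

lemma X_F: "i \<in> A \<Longrightarrow> X i \<in> measurable (F A) S"
proof -
  assume i: "i \<in> A"
  have "(\<lambda>x. \<lambda>i\<in>A. X i x) \<in> measurable (F A) (PiM A (\<lambda>_. S))"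
    unfolding F_def by (rule measurable_vimage_algebra1[OF restrict_X_space])
  then have "(\<lambda>x. (\<lambda>i\<in>A. X i x) i) \<in> measurable (F A) S"
    by (rule measurable_compose) (use i in measurable)
  then show ?thesis using i by simp
qed

lemma F_least:
  assumes "space N = space M" "\<And>i. i \<in> A \<Longrightarrow> X i \<in> measurable N S"
  shows "sets (F A) \<subseteq> sets N"
proof -
  have m: "(\<lambda>x. \<lambda>i\<in>A. X i x) \<in> measurable N (PiM A (\<lambda>_. S))"
    by (intro measurable_restrict assms(2))
  show ?thesis
    unfolding F_def sets_vimage_algebra assms(1)[symmetric]
    by (rule sets.sigma_sets_subset) (use measurable_sets[OF m] in auto)
qed

lemma sets_F_le: "sets (F A) \<subseteq> sets M"
  by (rule F_least) auto

lemma F_le: "f \<in> measurable (F A) N \<Longrightarrow> f \<in> measurable M N"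
  using measurable_mono[of N N "F A" M] sets_F_le[of A] by auto

lemma F_mono: "A \<subseteq> B \<Longrightarrow> f \<in> measurable (F A) N \<Longrightarrow> f \<in> measurable (F B) N"
  using measurable_mono[of N N "F A" "F B"] F_least[of "F B" A] X_F[of _ B] by (auto simp: subset_eq)

lemma indep_F:
  assumes "A \<inter> B = {}"
  shows "indep_set (sets (F A)) (sets (F B))"
proof -
  have "indep_var (PiM A (\<lambda>_. S)) (\<lambda>x. \<lambda>i\<in>A. X i x) (PiM B (\<lambda>_. S)) (\<lambda>x. \<lambda>i\<in>B. X i x)"
    using indep assms by (intro indep_var_restrict) auto
  then show ?thesis
    unfolding indep_var_eq F_def by (simp add: sets_vimage_algebra)
qed

lemma indep_var_F:
  assumes "A \<inter> B = {}" "G \<in> measurable (F A) N" "H \<in> measurable (F B) N'"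
  shows "indep_var N G N' H"
  unfolding indep_var_eq
proof (intro conjI)
  show "random_variable N G" "random_variable N' H" using assms F_le by auto
  have 1: "sigma_sets (space M) {G -` C \<inter> space M |C. C \<in> sets N} \<subseteq> sets (F A)"
  proof -
    have "{G -` C \<inter> space M |C. C \<in> sets N} \<subseteq> sets (F A)"
      using measurable_sets[OF assms(2)] by auto
    from sets.sigma_sets_subset[OF this] show ?thesis by simp
  qed
  have 2: "sigma_sets (space M) {H -` C \<inter> space M |C. C \<in> sets N'} \<subseteq> sets (F B)"
  proof -
    have "{H -` C \<inter> space M |C. C \<in> sets N'} \<subseteq> sets (F B)"
      using measurable_sets[OF assms(3)] by auto
    from sets.sigma_sets_subset[OF this] show ?thesis by simp
  qed
  show "indep_set (sigma_sets (space M) {G -` C \<inter> space M |C. C \<in> sets N})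
     (sigma_sets (space M) {H -` C \<inter> space M |C. C \<in> sets N'})"
    using indep_F[OF assms(1)] unfolding indep_set_def
    by (rule indep_sets_mono_sets) (use 1 2 in \<open>auto split: bool.split\<close>)
qed

lemma F_indep_integral:
  fixes G H :: "'a \<Rightarrow> 'c :: {real_normed_field, banach, second_countable_topology}"
  assumes "A \<inter> B = {}" "G \<in> borel_measurable (F A)" "H \<in> borel_measurable (F B)"
    "integrable M G" "integrable M H"
  shows "expectation (\<lambda>x. G x * H x) = expectation G * expectation H"
    "integrable M (\<lambda>x. G x * H x)"
proof -
  have i: "indep_var borel G borel H" by (rule indep_var_F[OF assms(1-3)])
  show "expectation (\<lambda>x. G x * H x) = expectation G * expectation H"
    using indep_var_lebesgue_integral[OF i assms(4,5)] .
  show "integrable M (\<lambda>x. G x * H x)"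
    using indep_var_integrable[OF i assms(4,5)] .
qed

lemma F_bounded_integrable:
  fixes G :: "'a \<Rightarrow> 'c :: {banach, second_countable_topology}"
  assumes "G \<in> borel_measurable (F A)" "\<And>x. x \<in> space M \<Longrightarrow> norm (G x) \<le> B"
  shows "integrable M G"
  by (rule integrable_const_bound[of _ B]) (use assms F_le in auto)

text \<open>Orthogonality in two directions. Terms of different steps are uncorrelated because
  \<open>Z m p\<close> is centred and independent of everything revealed up to \<open>A m\<close>.
  Within one step only pairs whose innovations depend on a common index survive, and these are
  bounded by \<open>C\<^sup>2\<close>. The surviving sum will count coincidences of walks.\<close>

lemma martingale_L2:
  fixes c Z :: "nat \<Rightarrow> 'p \<Rightarrow> 'a \<Rightarrow> real" and A :: "nat \<Rightarrow> 'i set" and T :: "nat \<Rightarrow> 'p \<Rightarrow> 'i set"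
  assumes fin: "\<And>m. finite (P m)"
    and cm: "\<And>m p. m < N \<Longrightarrow> p \<in> P m \<Longrightarrow> c m p \<in> borel_measurable (F (A m))"
    and cb: "\<And>m p x. m < N \<Longrightarrow> p \<in> P m \<Longrightarrow> x \<in> space M \<Longrightarrow> \<bar>c m p x\<bar> \<le> Bc"
    and Zm: "\<And>m p. m < N \<Longrightarrow> p \<in> P m \<Longrightarrow> Z m p \<in> borel_measurable (F (T m p))"
    and Zb: "\<And>m p x. m < N \<Longrightarrow> p \<in> P m \<Longrightarrow> x \<in> space M \<Longrightarrow> \<bar>Z m p x\<bar> \<le> C"
    and Z0: "\<And>m p. m < N \<Longrightarrow> p \<in> P m \<Longrightarrow> expectation (Z m p) = 0"
    and TA: "\<And>m p. m < N \<Longrightarrow> p \<in> P m \<Longrightarrow> T m p \<inter> A m = {}"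
    and TA': "\<And>m p. m < N \<Longrightarrow> p \<in> P m \<Longrightarrow> T m p \<subseteq> A (Suc m)"
    and AA: "\<And>m. m < N \<Longrightarrow> A m \<subseteq> A (Suc m)"
  shows "expectation (\<lambda>x. (\<Sum>m<N. \<Sum>p\<in>P m. c m p x * Z m p x)\<^sup>2) \<le>
    C\<^sup>2 * (\<Sum>m<N. \<Sum>p\<in>P m. \<Sum>p'\<in>P m. if T m p \<inter> T m p' = {} then 0 else expectation (\<lambda>x. \<bar>c m p x\<bar> * \<bar>c m p' x\<bar>))"
proof -
  define D where "D n x = (\<Sum>m<n. \<Sum>p\<in>P m. c m p x * Z m p x)" for n x
  have Dm: "D n \<in> borel_measurable (F (A n))" if "n \<le> N" for n
    using that
  proof (induction n)
    case 0
    then show ?case by (simp add: D_def)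
  next
    case (Suc n)
    then have n: "n < N" by simp
    have "D n \<in> borel_measurable (F (A (Suc n)))"
      using Suc by (intro F_mono[OF AA[OF n]]) auto
    moreover have "c n p \<in> borel_measurable (F (A (Suc n)))" "Z n p \<in> borel_measurable (F (A (Suc n)))"
      if "p \<in> P n" for p
      using F_mono[OF AA[OF n] cm[OF n that]] F_mono[OF TA'[OF n that] Zm[OF n that]] by auto
    ultimately have "(\<lambda>x. D n x + (\<Sum>p\<in>P n. c n p x * Z n p x)) \<in> borel_measurable (F (A (Suc n)))"
      by (intro borel_measurable_add borel_measurable_sum borel_measurable_times) auto
    then show ?case by (simp add: D_def[abs_def])
  qed
  have Db: "\<exists>B. \<forall>x\<in>space M. \<bar>D n x\<bar> \<le> B" if "n \<le> N" for n
  proof -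
    have "\<bar>D n x\<bar> \<le> (\<Sum>m<n. \<Sum>p\<in>P m. Bc * C)" if x: "x \<in> space M" for x
      unfolding D_def
    proof (rule order_trans[OF sum_abs], rule sum_mono, rule order_trans[OF sum_abs], rule sum_mono)
      fix m p assume "m \<in> {..<n}" and p: "p \<in> P m"
      then have m: "m < N" using \<open>n \<le> N\<close> by simp
      have "0 \<le> Bc" using cb[OF m p x] abs_ge_zero order_trans by blast
      then show "\<bar>c m p x * Z m p x\<bar> \<le> Bc * C"
        unfolding abs_mult using cb[OF m p x] Zb[OF m p x] by (intro mult_mono) auto
    qed
    then show ?thesis by blast
  qed
  have "expectation (\<lambda>x. (D n x)\<^sup>2) \<le>
    C\<^sup>2 * (\<Sum>m<n. \<Sum>p\<in>P m. \<Sum>p'\<in>P m. if T m p \<inter> T m p' = {} then 0 else expectation (\<lambda>x. \<bar>c m p x\<bar> * \<bar>c m p' x\<bar>))"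
    if "n \<le> N" for n
    using that
  proof (induction n)
    case 0
    then show ?case by (simp add: D_def)
  next
    case (Suc n)
    then have n: "n < N" by simp
    obtain B where B: "\<And>x. x \<in> space M \<Longrightarrow> \<bar>D n x\<bar> \<le> B" using Db[of n] Suc by auto
    have iD: "integrable M (\<lambda>x. (D n x)\<^sup>2)"
    proof (rule F_bounded_integrable[of _ "A n" "B * B"])
      show "(\<lambda>x. (D n x)\<^sup>2) \<in> borel_measurable (F (A n))" using Dm[of n] Suc by simp
      fix x assume x: "x \<in> space M"
      then show "norm ((D n x)\<^sup>2) \<le> B * B"
        using mult_mono[OF B[OF x] B[OF x]] B[OF x] by (simp add: power2_eq_square abs_mult[symmetric])
    qed
    \<comment> \<open>The past sum and the coefficient live on \<open>A n\<close>, which is disjoint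
      from \<open>T n p\<close>; the mean factorizes and the centred factor kills it.\<close>
    have Dc: "expectation (\<lambda>x. D n x * c n p x * Z n p x) = 0 \<and> integrable M (\<lambda>x. D n x * c n p x * Z n p x)"
      if p: "p \<in> P n" for p
    proof -
      have 1: "integrable M (\<lambda>x. D n x * c n p x)"
      proof (rule F_bounded_integrable[of _ "A n" "B * Bc"])
        show "(\<lambda>x. D n x * c n p x) \<in> borel_measurable (F (A n))" using Dm[of n] Suc cm[OF n p] by simp
        fix x assume x: "x \<in> space M"
        then show "norm (D n x * c n p x) \<le> B * Bc"
          using mult_mono[OF B[OF x] cb[OF n p x]] B[OF x] by (simp add: abs_mult)
      qed
      have 2: "integrable M (Z n p)" using F_bounded_integrable[OF Zm[OF n p], of C] Zb[OF n p] by simp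
      have "A n \<inter> T n p = {}" using TA[OF n p] by auto
      from F_indep_integral[OF this _ Zm[OF n p] 1 2] Dm[of n] Suc cm[OF n p] Z0[OF n p]
      show ?thesis by auto
    qed
    have cc: "expectation (\<lambda>x. c n p x * Z n p x * (c n p' x * Z n p' x)) \<le>
        C\<^sup>2 * (if T n p \<inter> T n p' = {} then 0 else expectation (\<lambda>x. \<bar>c n p x\<bar> * \<bar>c n p' x\<bar>))"
      and ci: "integrable M (\<lambda>x. c n p x * Z n p x * (c n p' x * Z n p' x))"
      if p: "p \<in> P n" and p': "p' \<in> P n" for p p'
    proof -
      have mm: "c n p \<in> borel_measurable M" "c n p' \<in> borel_measurable M" "Z n p \<in> borel_measurable M" "Z n p' \<in> borel_measurable M"
        using cm[OF n] Zm[OF n] p p' F_le by blast+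
      have b: "\<bar>c n p x * Z n p x * (c n p' x * Z n p' x)\<bar> \<le> C\<^sup>2 * (\<bar>c n p x\<bar> * \<bar>c n p' x\<bar>)"
        "C\<^sup>2 * (\<bar>c n p x\<bar> * \<bar>c n p' x\<bar>) \<le> C\<^sup>2 * (Bc * Bc)" "\<bar>c n p x\<bar> * \<bar>c n p' x\<bar> \<le> Bc * Bc" if x: "x \<in> space M" for x
      proof -
        have "\<bar>Z n p x\<bar> * \<bar>Z n p' x\<bar> \<le> C * C"
          using Zb[OF n p x] Zb[OF n p' x] by (intro mult_mono) auto
        then have "(\<bar>c n p x\<bar> * \<bar>c n p' x\<bar>) * (\<bar>Z n p x\<bar> * \<bar>Z n p' x\<bar>) \<le> (\<bar>c n p x\<bar> * \<bar>c n p' x\<bar>) * (C * C)"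
          by (intro mult_left_mono) auto
        then show "\<bar>c n p x * Z n p x * (c n p' x * Z n p' x)\<bar> \<le> C\<^sup>2 * (\<bar>c n p x\<bar> * \<bar>c n p' x\<bar>)"
          by (simp add: abs_mult power2_eq_square mult_ac)
        show 3: "\<bar>c n p x\<bar> * \<bar>c n p' x\<bar> \<le> Bc * Bc"
          using cb[OF n p x] cb[OF n p' x] by (intro mult_mono) auto
        then show "C\<^sup>2 * (\<bar>c n p x\<bar> * \<bar>c n p' x\<bar>) \<le> C\<^sup>2 * (Bc * Bc)"
          by (rule mult_left_mono) auto
      qed
      have ic: "integrable M (\<lambda>x. \<bar>c n p x\<bar> * \<bar>c n p' x\<bar>)"
        by (rule integrable_const_bound[of _ "Bc * Bc"]) (use b(3) mm in \<open>auto simp: abs_mult\<close>)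
      show ci: "integrable M (\<lambda>x. c n p x * Z n p x * (c n p' x * Z n p' x))"
        by (rule integrable_const_bound[of _ "C\<^sup>2 * (Bc * Bc)"]) (use order_trans[OF b(1) b(2)] mm in auto)
      show "expectation (\<lambda>x. c n p x * Z n p x * (c n p' x * Z n p' x)) \<le>
        C\<^sup>2 * (if T n p \<inter> T n p' = {} then 0 else expectation (\<lambda>x. \<bar>c n p x\<bar> * \<bar>c n p' x\<bar>))"
      proof (cases "T n p \<inter> T n p' = {}")
        case False
        have "expectation (\<lambda>x. c n p x * Z n p x * (c n p' x * Z n p' x)) \<le> expectation (\<lambda>x. C\<^sup>2 * (\<bar>c n p x\<bar> * \<bar>c n p' x\<bar>))"
          using ci ic b(1) by (intro integral_mono) (auto intro: order_trans[OF abs_ge_self])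
        then show ?thesis using False by simp
      next
        case True
        \<comment> \<open>With disjoint index sets the two innovations are independent of each other
          and of both coefficients, so the mean of the product is zero.\<close>
        have iZ: "integrable M (Z n p)" "integrable M (Z n p')"
          using F_bounded_integrable[OF Zm[OF n], of _ C] Zb[OF n] p p' by auto
        have ZZ: "expectation (\<lambda>x. Z n p x * Z n p' x) = 0" "integrable M (\<lambda>x. Z n p x * Z n p' x)"
          using F_indep_integral[OF True Zm[OF n p] Zm[OF n p'] iZ] Z0[OF n p] by auto
        have d: "A n \<inter> (T n p \<union> T n p') = {}" using TA[OF n p] TA[OF n p'] by auto
        have icc: "integrable M (\<lambda>x. c n p x * c n p' x)"
          by (rule integrable_const_bound[of _ "Bc * Bc"]) (use b(3) mm in \<open>auto simp: abs_mult\<close>)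
        have "expectation (\<lambda>x. (c n p x * c n p' x) * (Z n p x * Z n p' x)) = expectation (\<lambda>x. c n p x * c n p' x) * expectation (\<lambda>x. Z n p x * Z n p' x)"
          using cm[OF n p] cm[OF n p'] F_mono[OF _ Zm[OF n p], of "T n p \<union> T n p'"] F_mono[OF _ Zm[OF n p'], of "T n p \<union> T n p'"] icc ZZ(2)
          by (intro F_indep_integral(1)[OF d, of "\<lambda>x. c n p x * c n p' x" "\<lambda>x. Z n p x * Z n p' x"]) auto
        then have "expectation (\<lambda>x. c n p x * Z n p x * (c n p' x * Z n p' x)) = 0"
          using ZZ by (simp add: mult_ac)
        then show ?thesis using True by simp
      qed
    qed
    have e: "(D (Suc n) x)\<^sup>2 = (D n x)\<^sup>2 + 2 * (\<Sum>p\<in>P n. D n x * c n p x * Z n p x) +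
        (\<Sum>p\<in>P n. \<Sum>p'\<in>P n. c n p x * Z n p x * (c n p' x * Z n p' x))" for x
    proof -
      have "D (Suc n) x = D n x + (\<Sum>p\<in>P n. c n p x * Z n p x)" by (simp add: D_def)
      then show ?thesis
        by (simp add: power2_sum power2_eq_square[of "sum _ _"] sum_product sum_distrib_left mult_ac)
    qed
    have "expectation (\<lambda>x. (D (Suc n) x)\<^sup>2) = expectation (\<lambda>x. (D n x)\<^sup>2) +
      2 * (\<Sum>p\<in>P n. expectation (\<lambda>x. D n x * c n p x * Z n p x)) +
      (\<Sum>p\<in>P n. \<Sum>p'\<in>P n. expectation (\<lambda>x. c n p x * Z n p x * (c n p' x * Z n p' x)))"
      unfolding e using iD Dc ci by simp
    also have "\<dots> \<le> C\<^sup>2 * (\<Sum>m<n. \<Sum>p\<in>P m. \<Sum>p'\<in>P m. if T m p \<inter> T m p' = {} then 0 else expectation (\<lambda>x. \<bar>c m p x\<bar> * \<bar>c m p' x\<bar>))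
       + 2 * 0 + (\<Sum>p\<in>P n. \<Sum>p'\<in>P n. C\<^sup>2 * (if T n p \<inter> T n p' = {} then 0 else expectation (\<lambda>x. \<bar>c n p x\<bar> * \<bar>c n p' x\<bar>)))"
      using Suc Dc by (intro add_mono sum_mono cc) auto
    finally show ?case by (simp add: sum_distrib_left distrib_left)
  qed
  from this[of N] show ?thesis by (simp add: D_def)
qed

end

section \<open>Gaussian comparison for sums with predictable coefficients\<close>

locale clt_array = indep_family M X S for M :: "'a measure" and X :: "'i \<Rightarrow> 'a \<Rightarrow> 'b" and S +
  fixes N :: nat and A :: "nat \<Rightarrow> 'i set" and J :: "nat \<Rightarrow> 'i" and Z :: "nat \<Rightarrow> 'a \<Rightarrow> real"
    and s :: "nat \<Rightarrow> real" and a K smax \<epsilon> :: real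
  assumes Zm: "k < N \<Longrightarrow> Z k \<in> borel_measurable (F {J k})"
    and JA: "k < N \<Longrightarrow> J k \<notin> A k"
    and AA: "k < N \<Longrightarrow> insert (J k) (A k) \<subseteq> A (Suc k)"
    and a: "0 < a" "a \<le> 1" and K: "0 \<le> K" and eps: "0 \<le> \<epsilon>"
    and Z2: "k < N \<Longrightarrow> integrable M (\<lambda>x. (Z k x)\<^sup>2)" "k < N \<Longrightarrow> expectation (\<lambda>x. (Z k x)\<^sup>2) = s k"
    and Z1: "k < N \<Longrightarrow> expectation (Z k) = 0"
    and Za: "k < N \<Longrightarrow> integrable M (\<lambda>x. \<bar>Z k x\<bar> powr (2 + a))"
      "k < N \<Longrightarrow> expectation (\<lambda>x. \<bar>Z k x\<bar> powr (2 + a)) \<le> K * s k"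
    and smax: "k < N \<Longrightarrow> s k \<le> smax" "0 \<le> smax"
begin

text \<open>The error per unit of conditional variance. Since the moments of order
  \<open>2 + a\<close> are at most \<open>K\<close> times the variance, the error of each step is
  proportional to the variance of that step, and the errors add up to a multiple of the total
  variance.\<close>

definition "\<delta> = K * \<epsilon> powr a + smax * \<epsilon>\<^sup>2"

lemma delta_nonneg: "0 \<le> \<delta>"
  unfolding \<delta>_def using K smax by simp

lemma s_nonneg: "k < N \<Longrightarrow> 0 \<le> s k"
  using Z2(2)[of k] by (metis integral_nonneg_AE AE_I2 zero_le_power2)

lemma Z_integrable: "k < N \<Longrightarrow> integrable M (Z k)"
  using square_integrable_imp_integrable[of "Z k"] Z2 Zm F_le by blast

text \<open>For |y| at most 1 the cubic Taylor bound is used, beyond that the quadratic one; since 0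
  < a \<le> 1, the power \<open>2 + a\<close> dominates both.\<close>

lemma iexp_remainder: "cmod (iexp y - (1 + \<i> * y - y\<^sup>2 / 2)) \<le> \<bar>y\<bar> powr (2 + a)" for y :: real
proof (cases "\<bar>y\<bar> \<le> 1")
  case True
  have "cmod (iexp y - (\<Sum>k\<le>2. (\<i> * y)^k / fact k)) \<le> \<bar>y\<bar>^(Suc 2) / fact (Suc 2)"
    by (rule iexp_approx1)
  also have "\<dots> = \<bar>y\<bar> ^ 3 / 6" by (simp add: fact_numeral numeral_3_eq_3)
  also have "\<dots> \<le> \<bar>y\<bar> ^ 3" using zero_le_power[OF abs_ge_zero, of y 3] by linarith
  also have "\<dots> = \<bar>y\<bar> powr 3 "
    by (cases "y = 0") (auto simp: powr_numeral)
  also have "\<dots> \<le> \<bar>y\<bar> powr (2 + a)" using True a by (intro powr_mono') auto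
  finally show ?thesis by (simp add: numeral_2_eq_2 power2_eq_square field_simps)
next
  case False
  have "cmod (iexp y - (\<Sum>k\<le>2. (\<i> * y)^k / fact k)) \<le> 2 * \<bar>y\<bar>^2 / fact 2"
    by (rule iexp_approx2)
  also have "\<dots> = \<bar>y\<bar> powr 2 "
    using False by (simp add: powr_numeral)
  also have "\<dots> \<le> \<bar>y\<bar> powr (2 + a)" using False a by (intro powr_mono) auto
  finally show ?thesis by (simp add: numeral_2_eq_2 power2_eq_square field_simps)
qed

text \<open>Expand the exponential to second order. The linear part and the centred quadratic part
  have mean zero, because \<open>G\<close> and \<open>c\<close> are measurable with respect to
  \<open>F (A k)\<close> while \<open>Z k\<close> is independent of it. The rest is the Taylor
  remainder of order \<open>2 + a\<close> and that of the Gaussian factor, both small because the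
  coefficient is at most \<open>\<epsilon>\<close>.\<close>

lemma one_step:
  fixes G :: "'a \<Rightarrow> complex" and c :: "'a \<Rightarrow> real"
  assumes k: "k < N" and G: "G \<in> borel_measurable (F (A k))" "\<And>x. x \<in> space M \<Longrightarrow> norm (G x) \<le> B"
    and c: "c \<in> borel_measurable (F (A k))" "\<And>x. x \<in> space M \<Longrightarrow> \<bar>c x\<bar> \<le> \<epsilon>"
  shows "norm (CLINT x|M. G x * (iexp (c x * Z k x) - exp (- (c x)\<^sup>2 * s k / 2)))
    \<le> \<delta> * expectation (\<lambda>x. norm (G x) * ((c x)\<^sup>2 * s k))"
proof -
  have d: "A k \<inter> {J k} = {}" using JA[OF k] by auto
  note [measurable] = F_le[OF G(1)] F_le[OF c(1)] F_le[OF Zm[OF k]]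
  note gm = G(1) c(1)
  have sk: "0 \<le> s k" "s k \<le> smax" using s_nonneg[OF k] smax(1)[OF k] by auto
  have B: "0 \<le> B" if "x \<in> space M" for x using G(2)[OF that] norm_ge_zero order_trans by blast
  have c2: "(c x)\<^sup>2 \<le> \<epsilon>\<^sup>2" if "x \<in> space M" for x
    using c(2)[OF that] eps by (simp add: abs_le_square_iff[symmetric])
  let ?r1 = "\<lambda>x. iexp (c x * Z k x) - (1 + \<i> * (c x * Z k x) - (c x * Z k x)\<^sup>2 / 2)"
  let ?r2 = "\<lambda>x. exp (- ((c x)\<^sup>2 * s k / 2)) - (1 - (c x)\<^sup>2 * s k / 2)"
  let ?a1 = "\<lambda>x. (G x * (\<i> * c x)) * complex_of_real (Z k x)"
  let ?a2 = "\<lambda>x. (G x * (- ((c x)\<^sup>2) / 2)) * complex_of_real ((Z k x)\<^sup>2 - s k)"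
  let ?a3 = "\<lambda>x. G x * (?r1 x - complex_of_real (?r2 x))"
  have split: "G x * (iexp (c x * Z k x) - exp (- (c x)\<^sup>2 * s k / 2)) = ?a1 x + ?a2 x + ?a3 x" for x
    by (simp add: algebra_simps power_mult_distrib exp_of_real[symmetric] diff_divide_distrib)
  have i1: "integrable M (\<lambda>x. G x * (\<i> * c x))"
  proof (rule F_bounded_integrable[of _ "A k" "B * \<epsilon>"])
    fix x assume x: "x \<in> space M"
    show "norm (G x * (\<i> * c x)) \<le> B * \<epsilon>"
      using G(2)[OF x] c(2)[OF x] B[OF x] by (simp add: norm_mult mult_mono)
  qed (use gm in measurable)
  have a1: "(CLINT x|M. ?a1 x) = 0" "integrable M ?a1"
    using F_indep_integral[OF d _ _ i1, of "\<lambda>x. complex_of_real (Z k x)"] gm Zm[OF k] Z_integrable[OF k] Z1[OF k] by simp_all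
  have i2: "integrable M (\<lambda>x. G x * (- ((c x)\<^sup>2) / 2))"
  proof (rule F_bounded_integrable[of _ "A k" "B * \<epsilon>\<^sup>2"])
    fix x assume x: "x \<in> space M"
    have "norm (G x * (- ((c x)\<^sup>2) / 2)) = norm (G x) * ((c x)\<^sup>2 / 2)"
      by (simp add: norm_mult norm_divide norm_power)
    also have "(c x)\<^sup>2 / 2 \<le> \<epsilon>\<^sup>2"
      using c2[OF x] zero_le_power2[of "c x"] by linarith
    then have "norm (G x) * ((c x)\<^sup>2 / 2) \<le> B * \<epsilon>\<^sup>2"
      using G(2)[OF x] B[OF x] by (intro mult_mono) auto
    finally show "norm (G x * (- ((c x)\<^sup>2) / 2)) \<le> B * \<epsilon>\<^sup>2" .
  qed (use gm in measurable)
  have a2: "(CLINT x|M. ?a2 x) = 0" "integrable M ?a2"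
    using F_indep_integral[OF d _ _ i2, of "\<lambda>x. complex_of_real ((Z k x)\<^sup>2 - s k)"] gm Zm[OF k] Z2[OF k] prob_space
    by (simp_all del: of_real_diff of_real_power)
  have b: "norm (?a3 x) \<le> (norm (G x) * ((c x)\<^sup>2 * \<epsilon> powr a)) * \<bar>Z k x\<bar> powr (2 + a)
      + smax * \<epsilon>\<^sup>2 * (norm (G x) * ((c x)\<^sup>2 * s k))" if x: "x \<in> space M" for x
  proof -
    have "norm (?r1 x) \<le> \<bar>c x * Z k x\<bar> powr (2 + a)" using iexp_remainder[of "c x * Z k x"] by simp
    also have "\<dots> = \<bar>c x\<bar> powr (2 + a) * \<bar>Z k x\<bar> powr (2 + a)" by (simp add: abs_mult powr_mult)
    also have "\<bar>c x\<bar> powr (2 + a) = (c x)\<^sup>2 * \<bar>c x\<bar> powr a"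
      by (cases "c x = 0") (simp_all add: powr_add powr_numeral)
    also have "\<dots> * \<bar>Z k x\<bar> powr (2 + a) \<le> ((c x)\<^sup>2 * \<epsilon> powr a) * \<bar>Z k x\<bar> powr (2 + a)"
      using c(2)[OF x] a by (intro mult_right_mono mult_left_mono powr_mono2) auto
    finally have r1: "norm (?r1 x) \<le> ((c x)\<^sup>2 * \<epsilon> powr a) * \<bar>Z k x\<bar> powr (2 + a)" .
    have "\<bar>?r2 x\<bar> \<le> ((c x)\<^sup>2 * s k / 2)\<^sup>2 / 2" using sk by (intro exp_minus_remainder) auto
    also have "\<dots> = (s k * (c x)\<^sup>2 / 8) * ((c x)\<^sup>2 * s k)" by (simp add: power2_eq_square)
    also have "\<dots> \<le> (smax * \<epsilon>\<^sup>2) * ((c x)\<^sup>2 * s k)"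
    proof (rule mult_right_mono)
      have "s k * (c x)\<^sup>2 \<le> smax * \<epsilon>\<^sup>2" using sk c2[OF x] by (intro mult_mono) auto
      moreover have "0 \<le> s k * (c x)\<^sup>2" using sk by simp
      ultimately show "s k * (c x)\<^sup>2 / 8 \<le> smax * \<epsilon>\<^sup>2" by linarith
    qed (use sk in auto)
    finally have r2: "\<bar>?r2 x\<bar> \<le> (smax * \<epsilon>\<^sup>2) * ((c x)\<^sup>2 * s k)" .
    have "norm (?a3 x) \<le> norm (G x) * (norm (?r1 x) + \<bar>?r2 x\<bar>)"
      unfolding norm_mult
      by (rule mult_left_mono[OF order_trans[OF norm_triangle_ineq4]]) (simp_all only: norm_of_real order_refl norm_ge_zero)
    also have "\<dots> \<le> norm (G x) * (((c x)\<^sup>2 * \<epsilon> powr a) * \<bar>Z k x\<bar> powr (2 + a) + (smax * \<epsilon>\<^sup>2) * ((c x)\<^sup>2 * s k))"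
      using r1 r2 by (intro mult_left_mono add_mono) auto
    finally show ?thesis by (simp add: algebra_simps)
  qed
  have i3: "integrable M (\<lambda>x. norm (G x) * ((c x)\<^sup>2 * \<epsilon> powr a))"
  proof (rule F_bounded_integrable[of _ "A k" "B * (\<epsilon>\<^sup>2 * \<epsilon> powr a)"])
    fix x assume x: "x \<in> space M"
    show "norm (norm (G x) * ((c x)\<^sup>2 * \<epsilon> powr a)) \<le> B * (\<epsilon>\<^sup>2 * \<epsilon> powr a)"
      using G(2)[OF x] c2[OF x] B[OF x] by (auto simp: abs_mult intro!: mult_mono)
  qed (use gm in measurable)
  have i4: "integrable M (\<lambda>x. norm (G x) * ((c x)\<^sup>2 * s k))"
  proof (rule F_bounded_integrable[of _ "A k" "B * (\<epsilon>\<^sup>2 * s k)"])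
    fix x assume x: "x \<in> space M"
    show "norm (norm (G x) * ((c x)\<^sup>2 * s k)) \<le> B * (\<epsilon>\<^sup>2 * s k)"
      using G(2)[OF x] c2[OF x] B[OF x] sk by (auto simp: abs_mult intro!: mult_mono)
  qed (use gm in measurable)
  have mZ: "(\<lambda>x. \<bar>Z k x\<bar> powr (2 + a)) \<in> borel_measurable (F {J k})" using Zm[OF k] by measurable
  have a3': "expectation (\<lambda>x. (norm (G x) * ((c x)\<^sup>2 * \<epsilon> powr a)) * \<bar>Z k x\<bar> powr (2 + a)) =
      expectation (\<lambda>x. norm (G x) * ((c x)\<^sup>2 * \<epsilon> powr a)) * expectation (\<lambda>x. \<bar>Z k x\<bar> powr (2 + a))"
    "integrable M (\<lambda>x. (norm (G x) * ((c x)\<^sup>2 * \<epsilon> powr a)) * \<bar>Z k x\<bar> powr (2 + a))"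
    using F_indep_integral[OF d _ mZ i3 Za(1)[OF k]] gm by simp_all
  have i5: "integrable M (\<lambda>x. (norm (G x) * ((c x)\<^sup>2 * \<epsilon> powr a)) * \<bar>Z k x\<bar> powr (2 + a)
      + smax * \<epsilon>\<^sup>2 * (norm (G x) * ((c x)\<^sup>2 * s k)))"
    by (intro Bochner_Integration.integrable_add a3'(2) integrable_mult_right i4)
  have i6: "integrable M ?a3"
  proof (rule Bochner_Integration.integrable_bound[OF i5])
    show "?a3 \<in> borel_measurable M" by measurable
    show "AE x in M. norm (?a3 x) \<le> norm ((norm (G x) * ((c x)\<^sup>2 * \<epsilon> powr a)) * \<bar>Z k x\<bar> powr (2 + a)
      + smax * \<epsilon>\<^sup>2 * (norm (G x) * ((c x)\<^sup>2 * s k)))"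
      by (rule AE_I2, rule order_trans[OF b]) (simp_all only: real_norm_def abs_ge_self)
  qed
  have "norm (CLINT x|M. G x * (iexp (c x * Z k x) - exp (- (c x)\<^sup>2 * s k / 2))) = norm (CLINT x|M. ?a3 x)"
    unfolding split using a1 a2 i6 by simp
  also have "\<dots> \<le> expectation (\<lambda>x. norm (?a3 x))" by (rule integral_norm_bound)
  also have "\<dots> \<le> expectation (\<lambda>x. (norm (G x) * ((c x)\<^sup>2 * \<epsilon> powr a)) * \<bar>Z k x\<bar> powr (2 + a)
      + smax * \<epsilon>\<^sup>2 * (norm (G x) * ((c x)\<^sup>2 * s k)))"
    using b by (intro integral_mono integrable_norm i6 i5)
  also have "\<dots> = expectation (\<lambda>x. norm (G x) * ((c x)\<^sup>2 * \<epsilon> powr a)) * expectation (\<lambda>x. \<bar>Z k x\<bar> powr (2 + a))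
     + smax * \<epsilon>\<^sup>2 * expectation (\<lambda>x. norm (G x) * ((c x)\<^sup>2 * s k))"
    using a3' i4 by simp
  also have "\<dots> \<le> expectation (\<lambda>x. norm (G x) * ((c x)\<^sup>2 * \<epsilon> powr a)) * (K * s k)
     + smax * \<epsilon>\<^sup>2 * expectation (\<lambda>x. norm (G x) * ((c x)\<^sup>2 * s k))"
    by (intro add_right_mono mult_left_mono Za(2)[OF k] integral_nonneg_AE AE_I2) auto
  also have "expectation (\<lambda>x. norm (G x) * ((c x)\<^sup>2 * \<epsilon> powr a)) * (K * s k) =
      K * \<epsilon> powr a * expectation (\<lambda>x. norm (G x) * ((c x)\<^sup>2 * s k))"
    by (simp only: mult.assoc[symmetric] integral_mult_left_zero) (simp only: mult_ac)
  finally show ?thesis by (simp add: \<delta>_def distrib_right)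
qed

text \<open>Multiplying the partial exponentials by exp(V / 2) gives a sequence whose mean is nearly
  constant: each increment is an instance of \<open>one_step\<close>. The bound \<open>L\<close> on
  the variance controls both the weight exp(V / 2) and the sum of the errors.\<close>

lemma bounded_case:
  assumes c: "\<And>k. k < N \<Longrightarrow> c k \<in> borel_measurable (F (A k))" "\<And>k x. k < N \<Longrightarrow> x \<in> space M \<Longrightarrow> \<bar>c k x\<bar> \<le> \<epsilon>"
    and L: "\<And>x. x \<in> space M \<Longrightarrow> (\<Sum>k<N. (c k x)\<^sup>2 * s k) \<le> L" and L0: "0 \<le> L"
  shows "norm ((CLINT x|M. iexp (\<Sum>k<N. c k x * Z k x) * exp ((\<Sum>k<N. (c k x)\<^sup>2 * s k) / 2)) - 1) \<le> \<delta> * exp (L / 2) * L"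
proof -
  let ?S = "\<lambda>n x. \<Sum>k<n. c k x * Z k x"
  let ?V = "\<lambda>n x. \<Sum>k<n. (c k x)\<^sup>2 * s k"
  have V: "0 \<le> ?V n x" "?V n x \<le> L" if "x \<in> space M" "n \<le> N" for x n
  proof -
    show "0 \<le> ?V n x" using s_nonneg that by (intro sum_nonneg) auto
    have "?V n x \<le> ?V N x" using s_nonneg that by (intro sum_mono2) auto
    then show "?V n x \<le> L" using L[OF that(1)] by linarith
  qed
  have m: "?S n \<in> borel_measurable (F (A n)) \<and> ?V n \<in> borel_measurable (F (A n))" if "n \<le> N" for n
    using that
  proof (induction n)
    case (Suc n)
    then have n: "n < N" by simp
    have "c n \<in> borel_measurable (F (A (Suc n)))" "Z n \<in> borel_measurable (F (A (Suc n)))"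
      using F_mono[OF _ c(1)[OF n], of "A (Suc n)"] F_mono[OF _ Zm[OF n], of "A (Suc n)"] AA[OF n] by auto
    moreover have "?S n \<in> borel_measurable (F (A (Suc n)))" "?V n \<in> borel_measurable (F (A (Suc n)))"
      using Suc AA[OF n] F_mono[of "A n" "A (Suc n)" "?S n" borel] F_mono[of "A n" "A (Suc n)" "?V n" borel] by auto
    ultimately show ?case by simp
  qed simp
  have "norm ((CLINT x|M. iexp (?S n x) * exp (?V n x / 2)) - 1) \<le> \<delta> * exp (L / 2) * expectation (?V n)" if "n \<le> N" for n
    using that
  proof (induction n)
    case 0
    then show ?case using prob_space by simp
  next
    case (Suc n)
    then have n: "n < N" "n \<le> N" by auto
    \<comment> \<open>The weight already includes the variance of step \<open>n\<close>. It is still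
      measurable with respect to \<open>F (A n)\<close>, since the coefficient \<open>c n\<close> is
      predictable.\<close>
    define G :: "'a \<Rightarrow> complex" where "G = (\<lambda>x. iexp (?S n x) * exp (?V (Suc n) x / 2))"
    define w where "w = (\<lambda>x. (c n x)\<^sup>2 * s n)"
    define Y :: "nat \<Rightarrow> 'a \<Rightarrow> complex" where "Y = (\<lambda>n x. iexp (?S n x) * exp (?V n x / 2))"
    have Gm: "G \<in> borel_measurable (F (A n))"
    proof -
      note [measurable] = m[OF n(2), THEN conjunct1] m[OF n(2), THEN conjunct2] c(1)[OF n(1)]
      show ?thesis unfolding sum.lessThan_Suc G_def by measurable
    qed
    have Gb: "norm (G x) \<le> exp (L / 2)" if "x \<in> space M" for x
      using V(2)[OF that Suc.prems] unfolding G_def norm_mult by simp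
    have int: "integrable M (Y k)" if "k \<le> N" for k
    proof (rule F_bounded_integrable[of _ "A k" "exp (L / 2)"])
      note [measurable] = m[OF that, THEN conjunct1] m[OF that, THEN conjunct2]
      show "Y k \<in> borel_measurable (F (A k))" unfolding Y_def by measurable
    qed (use V(2)[OF _ that] in \<open>simp add: norm_mult Y_def\<close>)
    have iV: "integrable M (?V k)" if "k \<le> N" for k
      by (rule F_bounded_integrable[of _ "A k" "L"]) (use m[OF that] V[OF _ that] in \<open>auto\<close>)
    have ic: "integrable M w"
      using Bochner_Integration.integrable_diff[OF iV[of "Suc n"] iV[of n]] n unfolding w_def by simp
    have w: "0 \<le> w x" for x using s_nonneg[OF n(1)] unfolding w_def by simp
    have eq: "Y (Suc n) x - Y n x = G x * (iexp (c n x * Z n x) - exp (- (c n x)\<^sup>2 * s n / 2))" for x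
    proof -
      have "complex_of_real (exp (?V (Suc n) x / 2)) * exp (- (c n x)\<^sup>2 * s n / 2) = exp (?V n x / 2)"
        by (simp only: of_real_mult[symmetric] exp_add[symmetric]) (simp add: field_simps)
      moreover have "iexp (?S (Suc n) x) = iexp (?S n x) * iexp (c n x * Z n x)"
        by (simp add: exp_add[symmetric] distrib_left)
      ultimately show ?thesis unfolding Y_def G_def by (simp only: right_diff_distrib mult.assoc) (simp add: mult_ac)
    qed
    have E1: "(CLINT x|M. Y (Suc n) x) - (CLINT x|M. Y n x) =
      (CLINT x|M. G x * (iexp (c n x * Z n x) - exp (- (c n x)\<^sup>2 * s n / 2)))"
      unfolding eq[symmetric] by (rule Bochner_Integration.integral_diff[symmetric]) (use int n in auto)
    have E2: "norm (CLINT x|M. G x * (iexp (c n x * Z n x) - exp (- (c n x)\<^sup>2 * s n / 2)))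
        \<le> \<delta> * expectation (\<lambda>x. norm (G x) * w x)"
      unfolding w_def by (rule one_step[OF n(1) Gm Gb c(1)[OF n(1)] c(2)[OF n(1)]])
    have E3: "expectation (\<lambda>x. norm (G x) * w x) \<le> expectation (\<lambda>x. exp (L / 2) * w x)"
    proof (rule integral_mono)
      show le: "norm (G x) * w x \<le> exp (L / 2) * w x" if "x \<in> space M" for x
        by (rule mult_right_mono[OF Gb[OF that] w])
      show i: "integrable M (\<lambda>x. exp (L / 2) * w x)"
        by (rule integrable_mult_right[OF ic])
      show "integrable M (\<lambda>x. norm (G x) * w x)"
      proof (rule Bochner_Integration.integrable_bound[OF i])
        note [measurable] = F_le[OF Gm]
        have [measurable]: "w \<in> borel_measurable M" using ic by simp
        show "(\<lambda>x. norm (G x) * w x) \<in> borel_measurable M" by measurable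
        show "AE x in M. norm (norm (G x) * w x) \<le> norm (exp (L / 2) * w x)"
          using le w by (intro AE_I2) (simp add: abs_mult)
      qed
    qed
    have E4: "norm ((CLINT x|M. Y (Suc n) x) - (CLINT x|M. Y n x)) \<le> \<delta> * exp (L / 2) * expectation w"
      using E2 mult_left_mono[OF E3 delta_nonneg] unfolding E1 by simp
    have E5: "expectation (?V (Suc n)) = expectation (?V n) + expectation w"
      using iV[OF n(2)] ic unfolding w_def by simp
    have "norm ((CLINT x|M. Y (Suc n) x) - 1) \<le>
       norm ((CLINT x|M. Y (Suc n) x) - (CLINT x|M. Y n x)) + norm ((CLINT x|M. Y n x) - 1)"
      using norm_triangle_ineq[of "(CLINT x|M. Y (Suc n) x) - (CLINT x|M. Y n x)" "(CLINT x|M. Y n x) - 1"] by simp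
    moreover have "norm ((CLINT x|M. Y n x) - 1) \<le> \<delta> * exp (L / 2) * expectation (?V n)"
      using Suc.IH[OF n(2)] unfolding Y_def .
    ultimately have "norm ((CLINT x|M. Y (Suc n) x) - 1) \<le> \<delta> * exp (L / 2) * expectation (?V (Suc n))"
      using E4 unfolding E5 distrib_left by linarith
    then show ?case unfolding Y_def .
  qed
  from this[of N] have "norm ((CLINT x|M. iexp (?S N x) * exp (?V N x / 2)) - 1) \<le> \<delta> * exp (L / 2) * expectation (?V N)" by simp
  also have "\<dots> \<le> \<delta> * exp (L / 2) * L"
  proof (intro mult_left_mono)
    have "integrable M (?V N)"
      by (rule F_bounded_integrable[of _ "A N" "L"]) (use m[of N] V[of _ N] in \<open>auto\<close>)
    then have "expectation (?V N) \<le> expectation (\<lambda>_. L)"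
      using L by (intro integral_mono) auto
    then show "expectation (?V N) \<le> L" using prob_space by simp
  qed (use delta_nonneg in auto)
  finally show ?thesis .
qed

text \<open>Coefficients are switched off once the variance would exceed \<open>L = v + 1\<close>.
  Where this happens the total variance deviates from \<open>v\<close> by more than 1, so every
  discrepancy caused by the truncation is paid for by the mean deviation |V - v|.\<close>

lemma clt_bound:
  assumes c: "\<And>k. k < N \<Longrightarrow> c k \<in> borel_measurable (F (A k))" "\<And>k x. k < N \<Longrightarrow> x \<in> space M \<Longrightarrow> \<bar>c k x\<bar> \<le> \<epsilon>"
    and v: "0 \<le> v"
  shows "norm ((CLINT x|M. iexp (\<Sum>k<N. c k x * Z k x)) - complex_of_real (exp (- v / 2)))
    \<le> (2 + exp ((v + 1) / 2) * (v + 1)) * (\<delta> + expectation (\<lambda>x. \<bar>(\<Sum>k<N. (c k x)\<^sup>2 * s k) - v\<bar>))"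
proof -
  define L where "L = v + 1"
  let ?V = "\<lambda>n x. \<Sum>k<n. (c k x)\<^sup>2 * s k"
  let ?S = "\<lambda>x. \<Sum>k<N. c k x * Z k x"
  \<comment> \<open>The test uses coefficients up to index \<open>k\<close> only, so the truncated
    ones remain predictable; including step \<open>k\<close> in the test keeps the truncated
    variance from ever passing \<open>L\<close>.\<close>
  define c' where "c' k x = (if ?V (Suc k) x \<le> L then c k x else 0)" for k x
  let ?V' = "\<lambda>n x. \<Sum>k<n. (c' k x)\<^sup>2 * s k"
  let ?S' = "\<lambda>x. \<Sum>k<N. c' k x * Z k x"
  have cA: "c j \<in> borel_measurable (F (A k))" if "j \<le> k" "k < N" for j k
  proof -
    have "A j \<subseteq> A k" using that
    proof (induction k)
      case (Suc k)
      then show ?case using AA[of k] by (cases "j = Suc k") auto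
    qed simp
    then show ?thesis using F_mono[OF _ c(1)[of j], of "A k"] that by auto
  qed
  have c'm: "c' k \<in> borel_measurable (F (A k))" if "k < N" for k
  proof -
    have [measurable]: "c j \<in> borel_measurable (F (A k))" if "j \<in> {..<Suc k}" for j
      using cA[of j k] that \<open>k < N\<close> by auto
    have [measurable]: "c k \<in> borel_measurable (F (A k))" using c(1)[OF that] .
    show ?thesis unfolding c'_def[abs_def] by measurable
  qed
  have c'b: "\<bar>c' k x\<bar> \<le> \<epsilon>" if "k < N" "x \<in> space M" for k x
    using c(2)[OF that] eps by (simp add: c'_def)
  have sn: "0 \<le> (c k x)\<^sup>2 * s k" if "k < N" for k x using s_nonneg[OF that] by simp
  have V': "?V' n x \<le> L \<and> ?V' n x \<le> ?V n x \<and> 0 \<le> ?V' n x" if "n \<le> N" for n x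
    using that
  proof (induction n)
    case 0
    then show ?case using v by (simp add: L_def)
  next
    case (Suc n)
    then have "?V' n x \<le> L" "?V' n x \<le> ?V n x" "0 \<le> ?V' n x" by auto
    then show ?case using sn[of n x] Suc.prems s_nonneg[of n] by (auto simp: c'_def)
  qed
  have Veq: "c' k x = c k x" if "?V N x \<le> L" "k < N" for k x
  proof -
    have "?V (Suc k) x \<le> ?V N x" using sn that by (intro sum_mono2) auto
    then show ?thesis using that by (simp add: c'_def)
  qed
  have [measurable]: "c k \<in> borel_measurable M" "c' k \<in> borel_measurable M" "Z k \<in> borel_measurable M" if "k \<in> {..<N}" for k
    using F_le[OF c(1)] F_le[OF c'm] F_le[OF Zm] that by auto
  have iV: "integrable M (?V N)"
  proof (rule integrable_const_bound[of _ "\<Sum>k<N. \<epsilon>\<^sup>2 * s k"])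
    have "?V N x \<le> (\<Sum>k<N. \<epsilon>\<^sup>2 * s k)" if x: "x \<in> space M" for x
      using c(2)[OF _ x] eps s_nonneg by (intro sum_mono mult_right_mono) (auto simp: abs_le_square_iff[symmetric])
    moreover have "0 \<le> ?V N x" for x using sn by (intro sum_nonneg) auto
    ultimately show "AE x in M. norm (?V N x) \<le> (\<Sum>k<N. \<epsilon>\<^sup>2 * s k)" by (intro AE_I2) auto
  qed measurable
  then have id: "integrable M (\<lambda>x. \<bar>?V N x - v\<bar>)" by auto
  have iS: "integrable M (\<lambda>x. iexp (?S x))" "integrable M (\<lambda>x. iexp (?S' x))"
    by (auto intro!: integrable_iexp)
  have iSV: "integrable M (\<lambda>x. iexp (?S' x) * complex_of_real (exp (?V' N x / 2)))"
  proof (rule integrable_const_bound[of _ "exp (L/2)"])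
    show "AE x in M. norm (iexp (?S' x) * complex_of_real (exp (?V' N x / 2))) \<le> exp (L/2)"
      using V'[of N] by (intro AE_I2) (simp add: norm_mult)
  qed measurable
  have p1: "norm (iexp (?S x) - iexp (?S' x)) \<le> 2 * \<bar>?V N x - v\<bar>" for x
  proof (cases "?V N x \<le> L")
    case True
    then have "?S x = ?S' x" using Veq[OF True] by (intro sum.cong) auto
    then show ?thesis by simp
  next
    case False
    then have "\<bar>?V N x - v\<bar> \<ge> 1" by (simp add: L_def)
    have "norm (iexp (?S x) - iexp (?S' x)) \<le> 1 + 1"
      by (intro order_trans[OF norm_triangle_ineq4] add_mono) auto
    also have "\<dots> \<le> 2 * \<bar>?V N x - v\<bar>" using \<open>1 \<le> \<bar>?V N x - v\<bar>\<close> by simp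
    finally show ?thesis .
  qed
  have p2: "\<bar>exp (v / 2) - exp (?V' N x / 2)\<bar> \<le> exp (L / 2) * L * \<bar>?V N x - v\<bar>" for x
  proof -
    have lip: "\<bar>exp (a / 2) - exp (b / 2)\<bar> \<le> exp (L / 2) * \<bar>a - b\<bar>" if "a \<le> L" "b \<le> L" for a b :: real
    proof -
      have *: "exp (b / 2) - exp (a / 2) \<le> exp (L / 2) * (b - a)" if "a \<le> b" "b \<le> L" for a b :: real
      proof -
        have "exp (b / 2) * (1 + (a / 2 - b / 2)) \<le> exp (b / 2) * exp (a / 2 - b / 2)"
          by (intro mult_left_mono exp_ge_add_one_self) auto
        also have "\<dots> = exp (a / 2)" by (simp add: exp_add[symmetric])
        finally have "exp (b / 2) - exp (a / 2) \<le> exp (b / 2) * ((b - a) / 2)" by (simp add: algebra_simps)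
        also have "\<dots> \<le> exp (L / 2) * (b - a)" using that by (intro mult_mono) auto
        finally show ?thesis .
      qed
      show ?thesis
      proof (cases "a \<le> b")
        case True
        then show ?thesis using *[OF True] that by (simp add: abs_if)
      next
        case False
        then show ?thesis using *[of b a] that by (simp add: abs_if)
      qed
    qed
    have "\<bar>exp (v / 2) - exp (?V' N x / 2)\<bar> \<le> exp (L / 2) * \<bar>v - ?V' N x\<bar>"
      using V'[of N x] by (intro lip) (auto simp: L_def)
    \<comment> \<open>Without truncation the two variances agree. With it, both \<open>v\<close> and
      the truncated variance lie between 0 and \<open>L\<close>, while |V - v| is at least
      1.\<close>
    also have "\<bar>v - ?V' N x\<bar> \<le> L * \<bar>?V N x - v\<bar>"
    proof (cases "?V N x \<le> L")
      case True
      have "?V' N x = ?V N x" using Veq[OF True] by (intro sum.cong) auto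
      then show ?thesis using v mult_right_mono[of 1 L "\<bar>?V N x - v\<bar>"] by (simp add: L_def abs_minus_commute)
    next
      case False
      then have "\<bar>?V N x - v\<bar> \<ge> 1" by (simp add: L_def)
      then have "L * 1 \<le> L * \<bar>?V N x - v\<bar>" using v by (intro mult_left_mono) (auto simp: L_def)
      moreover have "\<bar>v - ?V' N x\<bar> \<le> L" using V'[of N x] v by (auto simp: L_def)
      ultimately show ?thesis by linarith
    qed
    finally show ?thesis by (simp add: mult.assoc mult_left_mono)
  qed
  define P :: "'a \<Rightarrow> complex" where "P = (\<lambda>x. iexp (?S x))"
  define Q :: "'a \<Rightarrow> complex" where "Q = (\<lambda>x. iexp (?S' x))"
  define W :: "'a \<Rightarrow> complex" where "W = (\<lambda>x. exp (?V' N x / 2))"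
  define d where "d = (\<lambda>x. \<bar>?V N x - v\<bar>)"
  define e :: complex where "e = exp (v / 2)"
  have iP: "integrable M P" "integrable M Q" "integrable M d" "integrable M (\<lambda>x. Q x * W x)"
    using iS id iSV unfolding P_def Q_def d_def W_def by auto
  have p1': "norm (P x - Q x) \<le> 2 * d x" for x
    using p1[of x] unfolding P_def Q_def d_def .
  have p2': "norm (Q x * e - Q x * W x) \<le> exp (L / 2) * L * d x" for x
  proof -
    have "norm (e - W x) \<le> exp (L / 2) * L * d x"
      using p2[of x] unfolding e_def W_def d_def of_real_diff[symmetric] norm_of_real .
    moreover have "norm (Q x) = 1" unfolding Q_def by simp
    ultimately show ?thesis unfolding right_diff_distrib[symmetric] norm_mult by simp
  qed
  have q1: "norm (integral\<^sup>L M P - integral\<^sup>L M Q) \<le> 2 * expectation d"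
  proof -
    have "norm (integral\<^sup>L M P - integral\<^sup>L M Q) = norm (CLINT x|M. P x - Q x)"
      using iP by simp
    also have "\<dots> \<le> expectation (\<lambda>x. norm (P x - Q x))" by (rule integral_norm_bound)
    also have "\<dots> \<le> expectation (\<lambda>x. 2 * d x)"
      by (rule integral_mono[OF _ _ p1']) (use iP in auto)
    finally show ?thesis by simp
  qed
  have q2: "norm (integral\<^sup>L M Q * e - (CLINT x|M. Q x * W x)) \<le> exp (L / 2) * L * expectation d"
  proof -
    have iQe: "integrable M (\<lambda>x. Q x * e)" using iP by simp
    have "norm (integral\<^sup>L M Q * e - (CLINT x|M. Q x * W x)) = norm (CLINT x|M. Q x * e - Q x * W x)"
      using iP iQe by simp
    also have "\<dots> \<le> expectation (\<lambda>x. norm (Q x * e - Q x * W x))" by (rule integral_norm_bound)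
    also have "\<dots> \<le> expectation (\<lambda>x. exp (L / 2) * L * d x)"
      by (rule integral_mono[OF _ _ p2']) (use iP iQe in auto)
    finally show ?thesis by simp
  qed
  have q3: "norm ((CLINT x|M. Q x * W x) - 1) \<le> \<delta> * exp (L / 2) * L"
    unfolding Q_def W_def
    by (rule bounded_case[OF c'm c'b]) (use V'[of N] v in \<open>auto simp: L_def\<close>)
  define e' :: complex where "e' = complex_of_real (exp (- v / 2))"
  have ee: "e' * e = 1" unfolding e_def e'_def
    by (simp only: of_real_mult[symmetric] exp_add[symmetric]) simp
  have ne: "norm e' \<le> 1" unfolding e'_def using v by simp
  define p q r where "p = integral\<^sup>L M P" and "q = integral\<^sup>L M Q" and "r = (CLINT x|M. Q x * W x)"
  \<comment> \<open>Three errors: truncating the sum, replacing the constant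
    \<open>exp (v / 2)\<close> by the random weight, and the bounded case. Multiplication by
    \<open>e'\<close>, of norm at most 1, undoes the weight.\<close>
  have split: "p - e' = (p - q) + e' * ((q * e - r) + (r - 1))"
  proof -
    have "e' * (q * e) = q" using ee by (metis mult.commute mult.left_commute mult.right_neutral)
    then show ?thesis by (simp add: algebra_simps)
  qed
  have "norm (p - e') \<le> norm (p - q) + norm e' * norm ((q * e - r) + (r - 1))"
    unfolding split norm_mult[symmetric] by (rule norm_triangle_ineq)
  also have "norm e' * norm ((q * e - r) + (r - 1)) \<le> 1 * (norm (q * e - r) + norm (r - 1))"
    using ne by (intro mult_mono norm_triangle_ineq) auto
  finally have "norm (p - e') \<le> norm (p - q) + (norm (q * e - r) + norm (r - 1))" by simp
  also have "\<dots> \<le> 2 * expectation d + (exp (L / 2) * L * expectation d + \<delta> * exp (L / 2) * L)"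
    unfolding p_def q_def r_def by (intro add_mono q1 q2 q3)
  also have "\<dots> \<le> (2 + exp (L / 2) * L) * (\<delta> + expectation d)"
    using delta_nonneg by (simp add: algebra_simps)
  finally show ?thesis unfolding p_def P_def e'_def d_def L_def .
qed

end

section \<open>The backward walk in the random environment\<close>

text \<open>Only the levels from 1 on have to be probability vectors with a common law. Level 0 of
  the family is left free to carry the initial increments later, so that all randomness is a single
  independent family.\<close>

locale walk = indep_family M X vec_space for M :: "'a measure" and X :: "int \<times> nat \<Rightarrow> 'a \<Rightarrow> int \<Rightarrow> real" +
  fixes R :: nat
  assumes pv: "1 \<le> s \<Longrightarrow> x \<in> space M \<Longrightarrow> prob_vector R (X (k, s) x)"
    and idd: "1 \<le> s \<Longrightarrow> distr M vec_space (X (k, s)) = distr M vec_space (X (0, 1))"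
    and aper: "\<not> (\<exists>h::int. h > 1 \<and> (\<exists>x. (\<Sum>\<^sub>\<infinity>k. mean_weight M (X (0, 1)) (x + k * h)) = 1))"
    and nondeg: "measure M {x \<in> space M. Max (X (0, 1) x ` {-int R..int R}) < 1} > 0"
begin

abbreviation "J \<equiv> {-int R..int R}"

definition "p = mean_weight M (X (0, 1))"

lemma X_coord_F: "i \<in> A \<Longrightarrow> (\<lambda>x. X i x j) \<in> borel_measurable (F A)"
  by (rule measurable_compose[OF X_F]) auto

lemma X_coord[measurable]: "(\<lambda>x. X i x j) \<in> borel_measurable M"
  by (rule F_le[OF X_coord_F[of i UNIV]]) simp

lemma X_nonneg: "1 \<le> s \<Longrightarrow> x \<in> space M \<Longrightarrow> 0 \<le> X (k, s) x j"
  using pv[of s x k] by (simp add: prob_vector_def)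

lemma X_sum: "1 \<le> s \<Longrightarrow> x \<in> space M \<Longrightarrow> (\<Sum>j\<in>J. X (k, s) x j) = 1"
  using pv[of s x k] by (simp add: prob_vector_def)

lemma X_out: "1 \<le> s \<Longrightarrow> x \<in> space M \<Longrightarrow> j \<notin> J \<Longrightarrow> X (k, s) x j = 0"
  using pv[of s x k] by (auto simp: prob_vector_def)

lemma X_le_1: "1 \<le> s \<Longrightarrow> x \<in> space M \<Longrightarrow> X (k, s) x j \<le> 1"
proof (cases "j \<in> J")
  case True
  assume s: "1 \<le> s" "x \<in> space M"
  have "X (k, s) x j \<le> (\<Sum>j\<in>J. X (k, s) x j)"
    using True X_nonneg[OF s] by (intro member_le_sum) auto
  then show ?thesis using X_sum[OF s] by simp
qed (simp add: X_out)

lemma X_norm: "1 \<le> s \<Longrightarrow> x \<in> space M \<Longrightarrow> \<bar>X (k, s) x j\<bar> \<le> 1"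
  using X_nonneg[of s x k j] X_le_1[of s x k j] by simp

lemma X_integrable: "1 \<le> s \<Longrightarrow> integrable M (\<lambda>x. X (k, s) x j)"
  by (rule integrable_const_bound[of _ 1]) (auto intro!: AE_I2 X_norm)

lemma XX_integrable: "1 \<le> s \<Longrightarrow> 1 \<le> s' \<Longrightarrow> integrable M (\<lambda>x. X (k, s) x j * X (k', s') x j')"
  by (rule integrable_const_bound[of _ 1]) (auto intro!: AE_I2 mult_le_one X_norm simp: abs_mult)

lemma expectation_X_eq:
  assumes "1 \<le> s" "f \<in> borel_measurable vec_space"
  shows "expectation (\<lambda>x. f (X (k, s) x) :: real) = expectation (\<lambda>x. f (X (0, 1) x))"
proof -
  have "expectation (\<lambda>x. f (X (k, s) x)) = integral\<^sup>L (distr M vec_space (X (k, s))) f"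
    using assms by (subst integral_distr) auto
  also have "\<dots> = expectation (\<lambda>x. f (X (0, 1) x))"
    using assms by (subst idd[OF assms(1)], subst integral_distr) auto
  finally show ?thesis .
qed

lemma expectation_X: "1 \<le> s \<Longrightarrow> expectation (\<lambda>x. X (k, s) x j) = p j"
  unfolding p_def mean_weight_def by (rule expectation_X_eq[of s "\<lambda>v. v j"]) auto

sublocale sl: step_law p R
proof
  show "0 \<le> p j" for j
    unfolding p_def mean_weight_def by (intro integral_nonneg_AE AE_I2 X_nonneg) auto
  show "p j = 0" if "\<bar>j\<bar> > int R" for j
  proof -
    have "p j = expectation (\<lambda>_. 0)"
      unfolding p_def mean_weight_def using that
      by (intro Bochner_Integration.integral_cong refl X_out) auto
    then show ?thesis by simp
  qed
  have "(\<Sum>j\<in>J. p j) = expectation (\<lambda>x. \<Sum>j\<in>J. X (0, 1) x j)"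
    unfolding p_def mean_weight_def by (subst Bochner_Integration.integral_sum) (auto intro!: X_integrable)
  also have "\<dots> = expectation (\<lambda>_. 1)"
    by (intro Bochner_Integration.integral_cong refl X_sum) auto
  finally show "(\<Sum>j=- int R..int R. p j) = 1" using prob_space by simp
  show "\<not> (\<exists>h>1. \<exists>x. (\<Sum>\<^sub>\<infinity>k. p (x + k * h)) = 1)" using aper unfolding p_def by blast
qed

text \<open>The forward equation for the law after \<open>m\<close> backward steps: step number
  \<open>m + 1\<close> uses the weights of level \<open>T - m\<close>. Since \<open>V\<close>
  evaluates it only up to \<open>m = T\<close>, level 0 of \<open>X\<close> never serves as
  weights.\<close>

fun W :: "nat \<Rightarrow> int \<Rightarrow> nat \<Rightarrow> 'a \<Rightarrow> int \<Rightarrow> real" where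
  "W T k 0 x y = (if y = k then 1 else 0)"
| "W T k (Suc m) x y = (\<Sum>j\<in>J. W T k m x (y - j) * X (y - j, T - m) x j)"

text \<open>\<open>V T k l x y\<close> is the quenched probability, in the environment \<open>x\<close>, that the backward walk started
  from \<open>k\<close> at time level \<open>T\<close> sits at \<open>y\<close> when it reaches level \<open>l\<close>; for \<open>l > T\<close> it waits at \<open>k\<close>.\<close>

definition V :: "nat \<Rightarrow> int \<Rightarrow> nat \<Rightarrow> 'a \<Rightarrow> int \<Rightarrow> real" where
  "V T k l = W T k (T - l)"

text \<open>The environment strictly above level \<open>l\<close>. The quenched law at level
  \<open>l\<close> depends on nothing else (\<open>V_F\<close>), hence is independent of the weights
  at level \<open>l\<close>, which the walk uses next.\<close>

definition lev :: "nat \<Rightarrow> (int \<times> nat) set" where "lev l = {(k, s). l < s}"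

lemma V_top: "T \<le> l \<Longrightarrow> V T k l x y = (if y = k then 1 else 0)"
  by (simp add: V_def)

lemma V_step: "1 \<le> l \<Longrightarrow> l \<le> T \<Longrightarrow> V T k (l - 1) x y = (\<Sum>j\<in>J. V T k l x (y - j) * X (y - j, l) x j)"
proof -
  assume l: "1 \<le> l" "l \<le> T"
  have "T - (l - 1) = Suc (T - l)" using l by simp
  moreover have "T - (T - l) = l" using l by simp
  ultimately show ?thesis by (simp add: V_def)
qed

lemma lev_induct[consumes 0, case_names top step]:
  assumes "\<And>l. T \<le> l \<Longrightarrow> P l" "\<And>l. 1 \<le> l \<Longrightarrow> l \<le> T \<Longrightarrow> P l \<Longrightarrow> P (l - 1)"
  shows "P (l::nat)"
proof (induction "T - l" arbitrary: l)
  case 0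
  then show ?case using assms(1) by simp
next
  case (Suc n)
  then have "P (Suc l)" by auto
  then have "P (Suc l - 1)" using Suc by (intro assms(2)) auto
  then show ?case by simp
qed

lemma lev_mono: "l \<le> l' \<Longrightarrow> lev l' \<subseteq> lev l"
  by (auto simp: lev_def)

lemma V_F: "(\<lambda>x. V T k l x y) \<in> borel_measurable (F (lev l))"
proof (induction l arbitrary: y rule: lev_induct[where T = T])
  case (top l)
  then show ?case by (simp add: V_top)
next
  case (step l)
  have "(\<lambda>x. V T k l x (y - j)) \<in> borel_measurable (F (lev (l - 1)))" for j
    by (rule F_mono[OF lev_mono step(3)]) simp
  moreover have "(\<lambda>x. X (y - j, l) x j) \<in> borel_measurable (F (lev (l - 1)))" for j
    using step by (intro X_coord_F) (auto simp: lev_def)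
  ultimately show ?case unfolding V_step[OF step(1,2)] by measurable
qed

lemma V_M[measurable]: "(\<lambda>x. V T k l x y) \<in> borel_measurable M"
  by (rule F_le[OF V_F])

lemma V_nonneg: "x \<in> space M \<Longrightarrow> 0 \<le> V T k l x y"
proof (induction l arbitrary: y rule: lev_induct[where T = T])
  case (top l)
  then show ?case by (simp add: V_top)
next
  case (step l)
  then show ?case unfolding V_step[OF step(1,2)]
    by (intro sum_nonneg mult_nonneg_nonneg X_nonneg) auto
qed

text \<open>A box that contains the walk at all levels at once, so that sums over positions have a
  range independent of the level.\<close>

definition Bx :: "nat \<Rightarrow> int \<Rightarrow> int set" where
  "Bx T k = {k - int R * int T..k + int R * int T}"

lemma finite_Bx[simp]: "finite (Bx T k)" by (simp add: Bx_def)

lemma V_out': "int R * int (T - l) < \<bar>y - k\<bar> \<Longrightarrow> V T k l x y = 0"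
proof (induction l arbitrary: y rule: lev_induct[where T = T])
  case (top l)
  then show ?case by (auto simp: V_top)
next
  case (step l)
  have "int (T - (l - 1)) = int (T - l) + 1" using step by simp
  then have *: "int R * int (T - (l - 1)) = int R * int (T - l) + int R" by (simp add: algebra_simps)
  have "V T k l x (y - j) = 0" if "j \<in> J" for j
    using step(4) that unfolding * by (intro step(3)) auto
  then show ?case unfolding V_step[OF step(1,2)] by simp
qed

lemma V_out: "y \<notin> Bx T k \<Longrightarrow> V T k l x y = 0"
proof (rule V_out')
  assume "y \<notin> Bx T k"
  then have "int R * int T < \<bar>y - k\<bar>" by (auto simp: Bx_def)
  moreover have "int R * int (T - l) \<le> int R * int T" by (intro mult_left_mono) auto
  ultimately show "int R * int (T - l) < \<bar>y - k\<bar>" by linarith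
qed

text \<open>The quenched mean of \<open>f\<close> at level \<open>l\<close>. Values in a real vector
  space are allowed because complex exponentials are averaged as well as real functions.\<close>

definition EV :: "nat \<Rightarrow> int \<Rightarrow> nat \<Rightarrow> 'a \<Rightarrow> (int \<Rightarrow> 'c::real_vector) \<Rightarrow> 'c" where
  "EV T k l x f = (\<Sum>y\<in>Bx T k. V T k l x y *\<^sub>R f y)"

lemma EV_eq: "finite B \<Longrightarrow> Bx T k \<subseteq> B \<Longrightarrow> EV T k l x f = (\<Sum>y\<in>B. V T k l x y *\<^sub>R f y)"
  unfolding EV_def by (rule sum.mono_neutral_left) (auto simp: V_out)

lemma EV_top: "T \<le> l \<Longrightarrow> EV T k l x f = f k"
proof -
  assume l: "T \<le> l"
  have "k \<in> Bx T k" by (simp add: Bx_def)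
  then have "EV T k l x f = (\<Sum>y\<in>{k}. V T k l x y *\<^sub>R f y)"
    unfolding EV_def by (intro sum.mono_neutral_right) (auto simp: V_top l)
  then show ?thesis by (simp add: V_top l)
qed

text \<open>The forward equation transposed: the step is shifted from the law of the walk to the
  test function. Downward inductions on the level all run through this form.\<close>

lemma EV_step:
  assumes "1 \<le> l" "l \<le> T"
  shows "EV T k (l - 1) x f = EV T k l x (\<lambda>y. \<Sum>j\<in>J. X (y, l) x j *\<^sub>R f (y + j))"
proof -
  \<comment> \<open>A shift by one step can leave the box by at most \<open>R\<close>, so both sides
    are compared on a larger one; \<open>V\<close> vanishes on the surplus.\<close>
  let ?B = "{k - int R * int T - int R..k + int R * int T + int R}"
  have B: "finite ?B" "Bx T k \<subseteq> ?B" by (auto simp: Bx_def)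
  have "EV T k (l - 1) x f = (\<Sum>y\<in>?B. \<Sum>j\<in>J. (V T k l x (y - j) * X (y - j, l) x j) *\<^sub>R f y)"
    unfolding EV_eq[OF B] V_step[OF assms] by (simp add: scaleR_sum_left)
  also have "\<dots> = (\<Sum>j\<in>J. \<Sum>y\<in>?B. (V T k l x (y - j) * X (y - j, l) x j) *\<^sub>R f y)"
    by (rule sum.swap)
  also have "\<dots> = (\<Sum>j\<in>J. \<Sum>y\<in>Bx T k. (V T k l x y * X (y, l) x j) *\<^sub>R f (y + j))"
  proof (rule sum.cong[OF refl])
    fix j assume j: "j \<in> J"
    have "(\<Sum>y\<in>Bx T k. (V T k l x y * X (y, l) x j) *\<^sub>R f (y + j)) =
       (\<Sum>y\<in>(\<lambda>y. y + j) ` Bx T k. (V T k l x (y - j) * X (y - j, l) x j) *\<^sub>R f y)"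
      by (subst sum.reindex) auto
    also have "\<dots> = (\<Sum>y\<in>?B. (V T k l x (y - j) * X (y - j, l) x j) *\<^sub>R f y)"
    proof (rule sum.mono_neutral_left)
      show "(\<lambda>y. y + j) ` Bx T k \<subseteq> ?B" using j by (auto simp: Bx_def)
      show "\<forall>y\<in>?B - (\<lambda>y. y + j) ` Bx T k. (V T k l x (y - j) * X (y - j, l) x j) *\<^sub>R f y = 0"
      proof
        fix y assume "y \<in> ?B - (\<lambda>y. y + j) ` Bx T k"
        then have "y - j \<notin> Bx T k" by (metis Diff_iff diff_add_cancel image_eqI)
        then show "(V T k l x (y - j) * X (y - j, l) x j) *\<^sub>R f y = 0" by (simp add: V_out)
      qed
    qed auto
    finally show "(\<Sum>y\<in>?B. (V T k l x (y - j) * X (y - j, l) x j) *\<^sub>R f y) =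
       (\<Sum>y\<in>Bx T k. (V T k l x y * X (y, l) x j) *\<^sub>R f (y + j))" by simp
  qed
  also have "\<dots> = EV T k l x (\<lambda>y. \<Sum>j\<in>J. X (y, l) x j *\<^sub>R f (y + j))"
    unfolding EV_def by (subst sum.swap) (simp add: scaleR_sum_right)
  finally show ?thesis .
qed

lemma EV_const: "x \<in> space M \<Longrightarrow> EV T k l x (\<lambda>_. c) = c"
proof (induction l rule: lev_induct[where T = T])
  case (top l)
  then show ?case by (simp add: EV_top)
next
  case (step l)
  then show ?case
    unfolding EV_step[OF step(1,2)] by (simp add: scaleR_sum_left[symmetric] X_sum)
qed

lemma V_sum: "x \<in> space M \<Longrightarrow> (\<Sum>y\<in>Bx T k. V T k l x y) = 1"
  using EV_const[of x T k l "1::real"] by (simp add: EV_def)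

lemma V_sum': "x \<in> space M \<Longrightarrow> finite B \<Longrightarrow> Bx T k \<subseteq> B \<Longrightarrow> (\<Sum>y\<in>B. V T k l x y) = 1"
  using EV_const[of x T k l "1::real"] EV_eq[of B T k l x "\<lambda>_. 1::real"] by simp

lemma V_le_1: "x \<in> space M \<Longrightarrow> V T k l x y \<le> 1"
proof (cases "y \<in> Bx T k")
  case True
  assume x: "x \<in> space M"
  have "V T k l x y \<le> (\<Sum>y\<in>Bx T k. V T k l x y)"
    using True V_nonneg[OF x] by (intro member_le_sum) auto
  then show ?thesis using V_sum[OF x] by simp
qed (simp add: V_out)

lemma V_norm: "x \<in> space M \<Longrightarrow> \<bar>V T k l x y\<bar> \<le> 1"
  using V_nonneg[of x T k l y] V_le_1[of x T k l y] by simp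

lemma V_integrable: "integrable M (\<lambda>x. V T k l x y)"
  by (rule integrable_const_bound[of _ 1]) (auto intro!: AE_I2 V_norm)

lemma VV_norm: "x \<in> space M \<Longrightarrow> \<bar>V T k l x y * V T' k' l' x y'\<bar> \<le> 1"
  unfolding abs_mult by (intro mult_le_one V_norm) auto

lemma VV_integrable: "integrable M (\<lambda>x. V T k l x y * V T' k' l' x y')"
  by (rule integrable_const_bound[of _ 1]) (auto intro!: AE_I2 VV_norm)

lemma EV_mono: "x \<in> space M \<Longrightarrow> (\<And>y. f y \<le> g y) \<Longrightarrow> EV T k l x f \<le> (EV T k l x g :: real)"
  unfolding EV_def by (intro sum_mono) (auto intro!: mult_left_mono V_nonneg)

lemma EV_norm: "x \<in> space M \<Longrightarrow> (\<And>y. norm (f y) \<le> c) \<Longrightarrow> norm (EV T k l x f :: 'c::real_normed_vector) \<le> c"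
proof -
  assume x: "x \<in> space M" and f: "\<And>y. norm (f y) \<le> c"
  have "norm (EV T k l x f) \<le> (\<Sum>y\<in>Bx T k. V T k l x y * c)"
    unfolding EV_def by (intro order_trans[OF norm_sum] sum_mono) (simp add: V_nonneg[OF x] f mult_left_mono)
  then show ?thesis using V_sum[OF x] by (simp add: sum_distrib_right[symmetric])
qed

lemma EV_M[measurable]: "(\<lambda>x. EV T k l x f :: real) \<in> borel_measurable M"
  unfolding EV_def by measurable

lemma EV_integrable: "integrable M (\<lambda>x. EV T k l x f :: real)"
  unfolding EV_def by (auto intro!: V_integrable)

lemma expectation_V_X:
  assumes "1 \<le> l"
  shows "expectation (\<lambda>x. V T k l x y * X (z, l) x j) = expectation (\<lambda>x. V T k l x y) * p j"
proof -
  have "lev l \<inter> {(z, l)} = {}" by (auto simp: lev_def)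
  from F_indep_integral(1)[OF this V_F X_coord_F[of "(z, l)" "{(z, l)}" j] V_integrable X_integrable[OF assms]]
  show ?thesis using expectation_X[OF assms] by simp
qed

text \<open>The weights used at level \<open>l\<close> are independent of the law accumulated above
  it, so in the mean over the environment they may be replaced by \<open>p\<close>: the annealed
  walk is an ordinary random walk.\<close>

lemma annealed_step:
  fixes f :: "int \<Rightarrow> real"
  assumes "1 \<le> l" "l \<le> T"
  shows "expectation (\<lambda>x. EV T k (l - 1) x f) = expectation (\<lambda>x. EV T k l x (\<lambda>y. \<Sum>j\<in>J. p j * f (y + j)))"
proof -
  have i: "integrable M (\<lambda>x. V T k l x y * X (z, l) x j)" for y z j
    by (rule integrable_const_bound[of _ 1]) (auto intro!: AE_I2 mult_le_one V_norm X_norm[OF assms(1)] simp: abs_mult)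
  have "EV T k (l - 1) x f = (\<Sum>y\<in>Bx T k. \<Sum>j\<in>J. V T k l x y * X (y, l) x j * f (y + j))" for x
    unfolding EV_step[OF assms] by (simp add: EV_def sum_distrib_left mult.assoc)
  then have "expectation (\<lambda>x. EV T k (l - 1) x f) =
      expectation (\<lambda>x. \<Sum>y\<in>Bx T k. \<Sum>j\<in>J. V T k l x y * X (y, l) x j * f (y + j))"
    by (simp only:)
  also have "\<dots> = (\<Sum>y\<in>Bx T k. \<Sum>j\<in>J. expectation (\<lambda>x. V T k l x y) * p j * f (y + j))"
    using i by (simp add: expectation_V_X[OF assms(1)])
  also have "\<dots> = expectation (\<lambda>x. EV T k l x (\<lambda>y. \<Sum>j\<in>J. p j * f (y + j)))"
    unfolding EV_def by (simp add: V_integrable sum_distrib_left mult.assoc)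
  finally show ?thesis .
qed

definition ctr :: "nat \<Rightarrow> int \<Rightarrow> nat \<Rightarrow> real" where
  "ctr T k l = of_int k + sl.mean * real (T - l)"

text \<open>\<open>ctr T k l\<close> is the annealed mean position at level \<open>l\<close>; each
  step adds \<open>sl.var\<close> to the mean square, the cross term being centred.\<close>

lemma second_moment: "expectation (\<lambda>x. EV T k l x (\<lambda>y. (of_int y - ctr T k l)\<^sup>2)) = sl.var * real (T - l)"
proof (induction l rule: lev_induct[where T = T])
  case (top l)
  then show ?case by (simp add: EV_top ctr_def)
next
  case (step l)
  have c: "ctr T k (l - 1) = ctr T k l + sl.mean" and r: "real (T - (l - 1)) = real (T - l) + 1"
    using step by (auto simp: ctr_def of_nat_diff algebra_simps)
  have "(\<Sum>j\<in>J. p j * (of_int (y + j) - ctr T k (l - 1))\<^sup>2) = (of_int y - ctr T k l)\<^sup>2 + sl.var" for y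
  proof -
    have "(\<Sum>j\<in>J. p j * (of_int j - sl.mean)) = 0"
      unfolding right_diff_distrib sum_subtractf sum_distrib_right[symmetric] sl.p_sum
      by (simp add: sl.mean_def mult.commute)
    moreover have "(\<Sum>j\<in>J. p j * (of_int (y + j) - ctr T k (l - 1))\<^sup>2) =
       (\<Sum>j\<in>J. p j) * (of_int y - ctr T k l)\<^sup>2 + 2 * (of_int y - ctr T k l) * (\<Sum>j\<in>J. p j * (of_int j - sl.mean)) + sl.var"
      unfolding sl.var_def c sum_distrib_left sum_distrib_right sum.distrib[symmetric]
      by (intro sum.cong refl) (simp add: power2_eq_square algebra_simps)
    ultimately show ?thesis by (simp add: sl.p_sum)
  qed
  then have "expectation (\<lambda>x. EV T k (l - 1) x (\<lambda>y. (of_int y - ctr T k (l - 1))\<^sup>2)) =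
     expectation (\<lambda>x. EV T k l x (\<lambda>y. (of_int y - ctr T k l)\<^sup>2 + sl.var))"
    unfolding annealed_step[OF step(1,2)] by simp
  also have "\<dots> = expectation (\<lambda>x. EV T k l x (\<lambda>y. (of_int y - ctr T k l)\<^sup>2) + sl.var)"
  proof (rule Bochner_Integration.integral_cong[OF refl])
    fix x assume x: "x \<in> space M"
    show "EV T k l x (\<lambda>y. (of_int y - ctr T k l)\<^sup>2 + sl.var) = EV T k l x (\<lambda>y. (of_int y - ctr T k l)\<^sup>2) + sl.var"
      using EV_const[OF x, of T k l sl.var] by (simp add: EV_def distrib_left sum.distrib)
  qed
  also have "\<dots> = sl.var * real (T - (l - 1))"
    using step(3) EV_integrable prob_space unfolding r by (simp add: distrib_left)
  finally show ?case .
qed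

text \<open>The quenched mean for two walks that are independent given the environment but share it;
  this is why the quenched laws are simply multiplied.\<close>

definition EVV :: "nat \<Rightarrow> int \<Rightarrow> nat \<Rightarrow> int \<Rightarrow> nat \<Rightarrow> 'a \<Rightarrow> (int \<Rightarrow> int \<Rightarrow> real) \<Rightarrow> real" where
  "EVV T k T' k' l x f = (\<Sum>y\<in>Bx T k. \<Sum>z\<in>Bx T' k'. V T k l x y * V T' k' l x z * f y z)"

lemma EVV_EV: "EVV T k T' k' l x f = EV T k l x (\<lambda>y. EV T' k' l x (\<lambda>z. f y z))"
  unfolding EVV_def EV_def by (simp add: sum_distrib_left mult.assoc)

lemma EVV_mono: "x \<in> space M \<Longrightarrow> (\<And>y z. f y z \<le> g y z) \<Longrightarrow> EVV T k T' k' l x f \<le> EVV T k T' k' l x g"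
  unfolding EVV_EV by (intro EV_mono)

lemma EVV_const: "x \<in> space M \<Longrightarrow> EVV T k T' k' l x (\<lambda>_ _. c) = c"
  unfolding EVV_EV by (simp add: EV_const)

lemma EVV_add: "EVV T k T' k' l x (\<lambda>y z. f y z + g y z) = EVV T k T' k' l x f + EVV T k T' k' l x g"
  unfolding EVV_def by (simp add: distrib_left sum.distrib)

lemma EVV_cmult: "EVV T k T' k' l x (\<lambda>y z. c * f y z) = c * EVV T k T' k' l x f"
  unfolding EVV_def by (simp add: sum_distrib_left mult_ac)

lemma EVV_diff: "EVV T k T' k' l x (\<lambda>y z. f y z - g y z) = EVV T k T' k' l x f - EVV T k T' k' l x g"
  unfolding EVV_def by (simp add: right_diff_distrib sum_subtractf)

lemma EVV_integrable: "integrable M (\<lambda>x. EVV T k T' k' l x f)"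
  unfolding EVV_def by (intro Bochner_Integration.integrable_sum integrable_mult_left VV_integrable)

lemma EVV_abs: "x \<in> space M \<Longrightarrow> \<bar>EVV T k T' k' l x f\<bar> \<le> EVV T k T' k' l x (\<lambda>y z. \<bar>f y z\<bar>)"
  using EVV_mono[of x f "\<lambda>y z. \<bar>f y z\<bar>" T k T' k' l] EVV_mono[of x "\<lambda>y z. -1 * f y z" "\<lambda>y z. \<bar>f y z\<bar>" T k T' k' l]
  unfolding EVV_cmult by (simp add: abs_le_iff)

lemma EVV_fst: "x \<in> space M \<Longrightarrow> EVV T k T' k' l x (\<lambda>y z. f y) = EV T k l x f"
  unfolding EVV_EV by (simp add: EV_const)

lemma EVV_snd: "x \<in> space M \<Longrightarrow> EVV T k T' k' l x (\<lambda>y z. f z) = EV T' k' l x f"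
  unfolding EVV_EV by (simp add: EV_const)

lemma EVV_step:
  assumes "1 \<le> l" "l \<le> T" "l \<le> T'"
  shows "EVV T k T' k' (l - 1) x f = EVV T k T' k' l x (\<lambda>y z. \<Sum>a\<in>J. \<Sum>b\<in>J. X (y, l) x a * X (z, l) x b * f (y + a) (z + b))"
proof -
  have "EVV T k T' k' (l - 1) x f = EV T k l x (\<lambda>y. \<Sum>a\<in>J. X (y, l) x a *\<^sub>R EV T' k' l x (\<lambda>z. \<Sum>b\<in>J. X (z, l) x b *\<^sub>R f (y + a) (z + b)))"
    unfolding EVV_EV EV_step[OF assms(1,2)] EV_step[OF assms(1,3)] ..
  also have "\<dots> = EV T k l x (\<lambda>y. EV T' k' l x (\<lambda>z. \<Sum>a\<in>J. \<Sum>b\<in>J. X (y, l) x a * X (z, l) x b * f (y + a) (z + b)))"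
  proof -
    have "(\<Sum>a\<in>J. X (y, l) x a *\<^sub>R EV T' k' l x (\<lambda>z. \<Sum>b\<in>J. X (z, l) x b *\<^sub>R f (y + a) (z + b))) =
      EV T' k' l x (\<lambda>z. \<Sum>a\<in>J. \<Sum>b\<in>J. X (y, l) x a * X (z, l) x b * f (y + a) (z + b))" for y
    proof -
      have "(\<Sum>a\<in>J. X (y, l) x a *\<^sub>R EV T' k' l x (\<lambda>z. \<Sum>b\<in>J. X (z, l) x b *\<^sub>R f (y + a) (z + b))) =
        (\<Sum>a\<in>J. \<Sum>z\<in>Bx T' k'. \<Sum>b\<in>J. V T' k' l x z * (X (y, l) x a * X (z, l) x b * f (y + a) (z + b)))"
        unfolding EV_def by (simp add: sum_distrib_left mult_ac)
      also have "\<dots> = (\<Sum>z\<in>Bx T' k'. \<Sum>a\<in>J. \<Sum>b\<in>J. V T' k' l x z * (X (y, l) x a * X (z, l) x b * f (y + a) (z + b)))"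
        by (rule sum.swap)
      finally show ?thesis unfolding EV_def by (simp add: sum_distrib_left)
    qed
    then show ?thesis by simp
  qed
  finally show ?thesis unfolding EVV_EV .
qed

text \<open>Only the order of magnitude matters later, so the two fluctuations and the distance of
  the centres are separated by the crude inequality with the factor 3.\<close>

lemma EVV_second_moment:
  "expectation (\<lambda>x. EVV T k T' k' l x (\<lambda>y z. (of_int (y - z))\<^sup>2)) \<le>
     3 * (sl.var * real (T - l) + sl.var * real (T' - l) + (ctr T k l - ctr T' k' l)\<^sup>2)"
proof -
  let ?f = "\<lambda>y. (of_int y - ctr T k l)\<^sup>2" and ?g = "\<lambda>z. (of_int z - ctr T' k' l)\<^sup>2" and ?d = "(ctr T k l - ctr T' k' l)\<^sup>2"
  have "expectation (\<lambda>x. EVV T k T' k' l x (\<lambda>y z. (of_int (y - z))\<^sup>2)) \<le>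
     expectation (\<lambda>x. 3 * (EV T k l x ?f + EV T' k' l x ?g + ?d))"
  proof (rule integral_mono)
    show "integrable M (\<lambda>x. 3 * (EV T k l x ?f + EV T' k' l x ?g + ?d))"
      by (intro integrable_mult_right Bochner_Integration.integrable_add EV_integrable integrable_const)
    fix x assume x: "x \<in> space M"
    have three: "(a + b + c)\<^sup>2 \<le> 3 * (a\<^sup>2 + b\<^sup>2 + c\<^sup>2)" for a b c :: real
      using sum_squares_bound[of a b] sum_squares_bound[of b c] sum_squares_bound[of a c]
      by (simp add: power2_eq_square algebra_simps)
    have "EVV T k T' k' l x (\<lambda>y z. (of_int (y - z))\<^sup>2) \<le> EVV T k T' k' l x (\<lambda>y z. 3 * (?f y + ?g z + ?d))"
    proof (rule EVV_mono[OF x])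
      fix y z :: int
      have "(real_of_int (y - z))\<^sup>2 = ((of_int y - ctr T k l) + (ctr T' k' l - of_int z) + (ctr T k l - ctr T' k' l))\<^sup>2"
        by simp
      also have "\<dots> \<le> 3 * ((of_int y - ctr T k l)\<^sup>2 + (ctr T' k' l - of_int z)\<^sup>2 + ?d)" by (rule three)
      finally show "(real_of_int (y - z))\<^sup>2 \<le> 3 * (?f y + ?g z + ?d)" by (simp add: power2_commute)
    qed
    also have "\<dots> = 3 * (EV T k l x ?f + EV T' k' l x ?g + ?d)"
      unfolding EVV_cmult EVV_add EVV_fst[OF x] EVV_snd[OF x] EVV_const[OF x] EV_const[OF x] ..
    finally show "EVV T k T' k' l x (\<lambda>y z. (of_int (y - z))\<^sup>2) \<le> 3 * (EV T k l x ?f + EV T' k' l x ?g + ?d)" .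
  qed (rule EVV_integrable)
  also have "\<dots> = 3 * (sl.var * real (T - l) + sl.var * real (T' - l) + ?d)"
    using EV_integrable prob_space by (simp add: second_moment)
  finally show ?thesis .
qed

text \<open>The mean of \<open>abar\<close> at the difference after one step of two walks that stand
  at the same site and hence use the same weight vector. \<open>rap_beta_eq\<close> identifies it
  with the constant of the statement.\<close>

definition beta :: real where
  "beta = (\<Sum>a\<in>J. \<Sum>b\<in>J. expectation (\<lambda>x. X (0, 1) x a * X (0, 1) x b) * sl.abar (a - b))"

text \<open>Since \<open>abar\<close> is positive off 0, \<open>beta = 0\<close> would make all
  products of different weights vanish almost surely. The weight vector would then be a point mass,
  contrary to the second nondegeneracy assumption.\<close>

lemma beta_pos: "beta > 0"
proof -
  have nn: "0 \<le> expectation (\<lambda>x. X (0, 1) x a * X (0, 1) x b) * sl.abar (a - b)" for a b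
    by (intro mult_nonneg_nonneg sl.abar_nonneg integral_nonneg_AE AE_I2 X_nonneg) auto
  have "beta \<noteq> 0"
  proof
    assume "beta = 0"
    then have z: "expectation (\<lambda>x. X (0, 1) x a * X (0, 1) x b) * sl.abar (a - b) = 0" if "a \<in> J" "b \<in> J" for a b
      using that nn unfolding beta_def by (simp add: sum_nonneg_eq_0_iff sum_nonneg)
    have "AE x in M. X (0, 1) x a * X (0, 1) x b = 0" if "a \<in> J" "b \<in> J" "a \<noteq> b" for a b
    proof -
      have "expectation (\<lambda>x. X (0, 1) x a * X (0, 1) x b) = 0"
        using z[OF that(1,2)] sl.abar_pos[of "a - b"] that by auto
      then show ?thesis
        by (subst (asm) integral_nonneg_eq_0_iff_AE) (auto intro!: XX_integrable AE_I2 mult_nonneg_nonneg X_nonneg)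
    qed
    then have ae: "AE x in M. \<forall>a\<in>J. \<forall>b\<in>J. a \<noteq> b \<longrightarrow> X (0, 1) x a * X (0, 1) x b = 0"
      by (intro AE_ball_countable[THEN iffD2] countable_finite ballI) auto
    have "AE x in M. \<not> Max (X (0, 1) x ` J) < 1"
      using ae AE_space
    proof eventually_elim
      case (elim x)
      have "\<exists>a\<in>J. X (0, 1) x a \<noteq> 0"
        using X_sum[of 1 x 0] elim by (metis (mono_tags, lifting) le_refl sum.neutral zero_neq_one)
      then obtain a where a: "a \<in> J" "X (0, 1) x a \<noteq> 0" by auto
      then have "X (0, 1) x b = 0" if "b \<in> J - {a}" for b
        using bspec[OF bspec[OF elim(1) a(1)], of b] that a by auto
      then have "(\<Sum>b\<in>J - {a}. X (0, 1) x b) = 0" by (intro sum.neutral) auto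
      then have "X (0, 1) x a = 1"
        using X_sum[of 1 x 0] elim a sum.remove[of J a "X (0, 1) x"] by auto
      then have "1 \<le> Max (X (0, 1) x ` J)" using a(1) Max_ge[of "X (0, 1) x ` J" "X (0, 1) x a"] by simp
      then show ?case by (simp only: not_less)
    qed
    moreover have "{x \<in> space M. Max (X (0, 1) x ` J) < 1} = {x \<in> space M. \<forall>a\<in>J. X (0, 1) x a < 1}"
      by auto
    moreover have "{x \<in> space M. \<forall>a\<in>J. X (0, 1) x a < 1} \<in> sets M"
      by (intro sets.sets_Collect_finite_All' finite_atLeastAtMost_int) auto
    ultimately have "measure M {x \<in> space M. Max (X (0, 1) x ` J) < 1} = 0"
      by (subst prob_Collect_eq_0) auto
    then show False using nondeg by simp
  qed
  moreover have "0 \<le> beta" unfolding beta_def by (intro sum_nonneg nn)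
  ultimately show ?thesis by simp
qed

end

lemma sum_sum_product4:
  fixes f g :: "'i \<Rightarrow> 'i \<Rightarrow> real"
  shows "(\<Sum>y\<in>B. \<Sum>z\<in>B. \<Sum>y'\<in>B. \<Sum>z'\<in>B. f y y' * g z z') = (\<Sum>y\<in>B. \<Sum>y'\<in>B. f y y') * (\<Sum>z\<in>B. \<Sum>z'\<in>B. g z z')"
  unfolding sum_product ..

text \<open>Two independent pairs of positions can coincide in four ways. In each case the two
  positions not involved sum out to 1, leaving an inner product of \<open>u\<close> and
  \<open>v\<close>.\<close>

lemma pair_coincidence_sum:
  fixes u v :: "'i \<Rightarrow> real"
  assumes B: "finite B" and u: "sum u B = 1" and v: "sum v B = 1"
  shows "(\<Sum>p\<in>B\<times>B. \<Sum>p'\<in>B\<times>B. (u (fst p) * v (snd p)) * (u (fst p') * v (snd p')) *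
      (of_bool (fst p = fst p') + of_bool (fst p = snd p') + of_bool (snd p = fst p') + of_bool (snd p = snd p')))
    = (\<Sum>y\<in>B. u y * u y) + 2 * (\<Sum>y\<in>B. u y * v y) + (\<Sum>y\<in>B. v y * v y)"
proof -
  have one: "(\<Sum>z\<in>B. \<Sum>z'\<in>B. f z * g z') = sum f B * sum g B" for f g :: "'i \<Rightarrow> real"
    by (simp add: sum_product)
  have diag: "(\<Sum>y\<in>B. \<Sum>y'\<in>B. f y * g y' * of_bool (y = y')) = (\<Sum>y\<in>B. f y * g y)" for f g :: "'i \<Rightarrow> real"
    using B by (intro sum.cong refl) (simp add: of_bool_def if_distrib cong: if_cong)
  have a: "(\<Sum>y\<in>B. \<Sum>z\<in>B. \<Sum>y'\<in>B. \<Sum>z'\<in>B. (u y * u y' * of_bool (y = y')) * (v z * v z')) = (\<Sum>y\<in>B. u y * u y)"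
    unfolding sum_sum_product4 one diag by (simp add: v)
  have b: "(\<Sum>y\<in>B. \<Sum>z\<in>B. \<Sum>y'\<in>B. \<Sum>z'\<in>B. (u y * u y') * (v z * v z' * of_bool (z = z'))) = (\<Sum>y\<in>B. v y * v y)"
    unfolding sum_sum_product4 one diag by (simp add: u)
  have c: "(\<Sum>y\<in>B. \<Sum>z\<in>B. \<Sum>y'\<in>B. \<Sum>z'\<in>B. (u y * v z' * of_bool (y = z')) * (v z * u y')) = (\<Sum>y\<in>B. u y * v y)"
  proof -
    have "(\<Sum>y\<in>B. \<Sum>z\<in>B. \<Sum>y'\<in>B. \<Sum>z'\<in>B. (u y * v z' * of_bool (y = z')) * (v z * u y')) =
      (\<Sum>y\<in>B. \<Sum>z\<in>B. \<Sum>z'\<in>B. \<Sum>y'\<in>B. (u y * v z' * of_bool (y = z')) * (v z * u y'))"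
      by (intro sum.cong refl sum.swap)
    then show ?thesis unfolding sum_sum_product4 one diag by (simp add: u v)
  qed
  have d: "(\<Sum>y\<in>B. \<Sum>z\<in>B. \<Sum>y'\<in>B. \<Sum>z'\<in>B. (u y * v z') * (v z * u y' * of_bool (z = y'))) = (\<Sum>y\<in>B. u y * v y)"
  proof -
    have "(\<Sum>y\<in>B. \<Sum>z\<in>B. \<Sum>y'\<in>B. \<Sum>z'\<in>B. (u y * v z') * (v z * u y' * of_bool (z = y'))) =
      (\<Sum>y\<in>B. \<Sum>z\<in>B. \<Sum>z'\<in>B. \<Sum>y'\<in>B. (u y * v z') * (v z * u y' * of_bool (z = y')))"
      by (intro sum.cong refl sum.swap)
    then show ?thesis unfolding sum_sum_product4 one diag by (simp add: u v mult.commute)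
  qed
  have "(\<Sum>p\<in>B\<times>B. \<Sum>p'\<in>B\<times>B. (u (fst p) * v (snd p)) * (u (fst p') * v (snd p')) *
      (of_bool (fst p = fst p') + of_bool (fst p = snd p') + of_bool (snd p = fst p') + of_bool (snd p = snd p')))
    = (\<Sum>y\<in>B. \<Sum>z\<in>B. \<Sum>y'\<in>B. \<Sum>z'\<in>B. (u y * u y' * of_bool (y = y')) * (v z * v z')
      + (u y * v z' * of_bool (y = z')) * (v z * u y') + (u y * v z') * (v z * u y' * of_bool (z = y')) + (u y * u y') * (v z * v z' * of_bool (z = z')))"
    unfolding sum.cartesian_product' by (intro sum.cong refl) (simp add: distrib_left mult_ac)
  also have "\<dots> = (\<Sum>y\<in>B. u y * u y) + (\<Sum>y\<in>B. u y * v y) + (\<Sum>y\<in>B. u y * v y) + (\<Sum>y\<in>B. v y * v y)"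
    unfolding sum.distrib a b c d ..
  finally show ?thesis by simp
qed

lemma sum_rev_levels: "(\<Sum>m<L. g (L - m)) = (\<Sum>l=1..L. g l)" for g :: "nat \<Rightarrow> 'c::comm_monoid_add"
  by (rule sum.reindex_bij_witness[of _ "\<lambda>l. L - l" "\<lambda>m. L - m"]) auto

section \<open>Meetings of two walks and the discrete Tanaka formula\<close>

context walk begin

definition meet :: "nat \<Rightarrow> int \<Rightarrow> nat \<Rightarrow> int \<Rightarrow> nat \<Rightarrow> 'a \<Rightarrow> real" where
  "meet T k T' k' l x = EVV T k T' k' l x (\<lambda>y z. of_bool (y = z))"

lemma meet_sum:
  assumes "finite B" "Bx T k \<subseteq> B"
  shows "meet T k T' k' l x = (\<Sum>y\<in>B. V T k l x y * V T' k' l x y)"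
proof -
  have "meet T k T' k' l x = (\<Sum>y\<in>Bx T k. \<Sum>z\<in>Bx T' k'. if y = z then V T k l x y * V T' k' l x y else 0)"
    unfolding meet_def EVV_def by (intro sum.cong refl) auto
  also have "\<dots> = (\<Sum>y\<in>Bx T k. V T k l x y * V T' k' l x y)"
    by (intro sum.cong refl) (auto simp: V_out)
  also have "\<dots> = (\<Sum>y\<in>B. V T k l x y * V T' k' l x y)"
    using assms by (intro sum.mono_neutral_left) (auto simp: V_out)
  finally show ?thesis .
qed

lemma meet_nonneg: "x \<in> space M \<Longrightarrow> 0 \<le> meet T k T' k' l x"
  unfolding meet_sum[OF finite_Bx order_refl] by (intro sum_nonneg mult_nonneg_nonneg V_nonneg)

lemma meet_integrable: "integrable M (\<lambda>x. meet T k T' k' l x)"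
  unfolding meet_def by (rule EVV_integrable)

text \<open>Sitewise 2ab \<le> a^2 + b^2. Upper bounds for meetings thus reduce to two walks from
  the same starting point.\<close>

lemma meet_polar: "2 * meet T k T' k' l x \<le> meet T k T k l x + meet T' k' T' k' l x"
proof -
  let ?B = "Bx T k \<union> Bx T' k'"
  have B: "finite ?B" "Bx T k \<subseteq> ?B" "Bx T' k' \<subseteq> ?B" by auto
  show ?thesis unfolding meet_sum[OF B(1,2)] meet_sum[OF B(1,3)] sum_distrib_left sum.distrib[symmetric]
    by (intro sum_mono) (use sum_squares_bound in \<open>simp add: power2_eq_square mult.assoc[symmetric]\<close>)
qed

text \<open>The one-step change of \<open>abar\<close> along the difference of walks at
  \<open>y\<close> and \<open>z\<close>, averaged over the steps and compensated by its mean, which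
  is \<open>beta\<close> at a meeting and 0 otherwise.\<close>

definition H :: "nat \<Rightarrow> int \<Rightarrow> int \<Rightarrow> 'a \<Rightarrow> real" where
  "H l y z x = (\<Sum>a\<in>J. \<Sum>b\<in>J. X (y, l) x a * X (z, l) x b * sl.abar ((y + a) - (z + b)))
     - sl.abar (y - z) - beta * of_bool (y = z)"

lemma H_F: "H l y z \<in> borel_measurable (F {(y, l), (z, l)})"
proof -
  have [measurable]: "(\<lambda>x. X (y, l) x a) \<in> borel_measurable (F {(y, l), (z, l)})"
    "(\<lambda>x. X (z, l) x a) \<in> borel_measurable (F {(y, l), (z, l)})" for a
    by (auto intro!: X_coord_F)
  show ?thesis unfolding H_def[abs_def] by measurable
qed

text \<open>At equal sites the two steps use one weight vector, which is the definition of
  \<open>beta\<close>. At different sites the weights are independent, so the difference moves by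
  \<open>qb\<close>, for which \<open>abar\<close> is harmonic off 0.\<close>

lemma H_expectation:
  assumes "1 \<le> l"
  shows "expectation (H l y z) = 0"
proof -
  have "expectation (\<lambda>x. \<Sum>a\<in>J. \<Sum>b\<in>J. X (y, l) x a * X (z, l) x b * sl.abar ((y + a) - (z + b))) =
     (\<Sum>a\<in>J. \<Sum>b\<in>J. expectation (\<lambda>x. X (y, l) x a * X (z, l) x b) * sl.abar ((y + a) - (z + b)))"
    using XX_integrable[OF assms assms] by simp
  also have "\<dots> = sl.abar (y - z) + beta * of_bool (y = z)"
  proof (cases "y = z")
    case True
    have "expectation (\<lambda>x. X (z, l) x a * X (z, l) x b) = expectation (\<lambda>x. X (0, 1) x a * X (0, 1) x b)" for a b
      by (rule expectation_X_eq[OF assms, of "\<lambda>v. v a * v b"]) auto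
    then show ?thesis using True by (simp add: beta_def)
  next
    case False
    have "expectation (\<lambda>x. X (y, l) x a * X (z, l) x b) = p a * p b" for a b
    proof -
      have "{(y, l)} \<inter> {(z, l)} = {}" using False by auto
      from F_indep_integral(1)[OF this X_coord_F X_coord_F X_integrable[OF assms] X_integrable[OF assms]]
      show ?thesis using expectation_X[OF assms] by simp
    qed
    then have "(\<Sum>a\<in>J. \<Sum>b\<in>J. expectation (\<lambda>x. X (y, l) x a * X (z, l) x b) * sl.abar ((y + a) - (z + b))) =
       (\<Sum>b\<in>J. \<Sum>a\<in>J. p b * p a * sl.abar ((y - z) + (a - b)))"
      by (subst sum.swap) (simp add: algebra_simps)
    also have "\<dots> = (\<Sum>c\<in>sl.I2. sl.qb c * sl.abar ((y - z) + c))"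
      by (rule sl.qb_sum[symmetric])
    also have "\<dots> = sl.abar (y - z)" using False sl.abar_harmonic[of "y - z"] by simp
    finally show ?thesis using False by simp
  qed
  finally have e: "expectation (\<lambda>x. \<Sum>a\<in>J. \<Sum>b\<in>J. X (y, l) x a * X (z, l) x b * sl.abar ((y + a) - (z + b))) =
     sl.abar (y - z) + beta * of_bool (y = z)" .
  have i: "integrable M (\<lambda>x. \<Sum>a\<in>J. \<Sum>b\<in>J. X (y, l) x a * X (z, l) x b * sl.abar ((y + a) - (z + b)))"
    using XX_integrable[OF assms assms] by simp
  have "expectation (H l y z) = expectation (\<lambda>x. (\<Sum>a\<in>J. \<Sum>b\<in>J. X (y, l) x a * X (z, l) x b * sl.abar ((y + a) - (z + b))) - (sl.abar (y - z) + beta * of_bool (y = z)))"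
    unfolding H_def by (simp add: algebra_simps)
  also have "\<dots> = 0"
    by (subst Bochner_Integration.integral_diff[OF i]) (simp_all add: e prob_space del: of_bool_eq_1_iff)
  finally show ?thesis .
qed

text \<open>\<open>abar\<close> is within a bounded distance of a multiple of |x|, which is
  Lipschitz, so its increments over bounded steps are bounded.\<close>

lemma abar_increment: "\<exists>C. \<forall>u v. \<bar>v\<bar> \<le> 2 * int R \<longrightarrow> \<bar>sl.abar (u + v) - sl.abar u\<bar> \<le> C"
proof -
  obtain C where C: "\<And>x. \<bar>sl.abar x - \<bar>of_int x\<bar> / (2 * sl.var)\<bar> \<le> C" using sl.abar_asymp by blast
  have "\<bar>sl.abar (u + v) - sl.abar u\<bar> \<le> 2 * C + 2 * real R / (2 * sl.var)" if "\<bar>v\<bar> \<le> 2 * int R" for u v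
  proof -
    define A B where "A = \<bar>real_of_int (u + v)\<bar>" and "B = \<bar>real_of_int u\<bar>"
    have "\<bar>A - B\<bar> \<le> \<bar>real_of_int v\<bar>" unfolding A_def B_def by simp
    also have "\<dots> \<le> 2 * real R" using that by linarith
    finally have "\<bar>A - B\<bar> / (2 * sl.var) \<le> 2 * real R / (2 * sl.var)"
      using sl.var_pos by (intro divide_right_mono) auto
    moreover have "\<bar>A / (2 * sl.var) - B / (2 * sl.var)\<bar> = \<bar>A - B\<bar> / (2 * sl.var)"
      unfolding diff_divide_distrib[symmetric] abs_divide using sl.var_pos by simp
    moreover have "\<bar>sl.abar (u + v) - A / (2 * sl.var)\<bar> \<le> C" "\<bar>sl.abar u - B / (2 * sl.var)\<bar> \<le> C"
      unfolding A_def B_def by (rule C)+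
    ultimately show ?thesis by linarith
  qed
  then show ?thesis by blast
qed

lemma H_bounded: "\<exists>C. \<forall>l y z. \<forall>x\<in>space M. 1 \<le> l \<longrightarrow> \<bar>H l y z x\<bar> \<le> C"
proof -
  obtain C where C: "\<And>u v. \<bar>v\<bar> \<le> 2 * int R \<Longrightarrow> \<bar>sl.abar (u + v) - sl.abar u\<bar> \<le> C"
    using abar_increment by blast
  have "\<bar>H l y z x\<bar> \<le> C + beta" if x: "x \<in> space M" and l: "1 \<le> l" for l y z x
  proof -
    have one: "(\<Sum>a\<in>J. \<Sum>b\<in>J. X (y, l) x a * X (z, l) x b) = 1"
      using X_sum[OF l x] by (simp add: sum_distrib_left[symmetric])
    have "\<bar>(\<Sum>a\<in>J. \<Sum>b\<in>J. X (y, l) x a * X (z, l) x b * sl.abar ((y + a) - (z + b))) - sl.abar (y - z)\<bar> =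
      \<bar>\<Sum>a\<in>J. \<Sum>b\<in>J. X (y, l) x a * X (z, l) x b * (sl.abar ((y - z) + (a - b)) - sl.abar (y - z))\<bar>"
      unfolding right_diff_distrib sum_subtractf sum_distrib_right[symmetric] one by (simp add: algebra_simps)
    also have "\<dots> \<le> (\<Sum>a\<in>J. \<Sum>b\<in>J. X (y, l) x a * X (z, l) x b * C)"
    proof (rule order_trans[OF sum_abs], rule sum_mono, rule order_trans[OF sum_abs], rule sum_mono)
      fix a b assume ab: "a \<in> J" "b \<in> J"
      have "\<bar>sl.abar ((y - z) + (a - b)) - sl.abar (y - z)\<bar> \<le> C" using ab by (intro C) auto
      then show "\<bar>X (y, l) x a * X (z, l) x b * (sl.abar ((y - z) + (a - b)) - sl.abar (y - z))\<bar> \<le> X (y, l) x a * X (z, l) x b * C"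
        using X_nonneg[OF l x] by (simp add: abs_mult mult_left_mono)
    qed
    also have "\<dots> = C" unfolding sum_distrib_right[symmetric] one by simp
    finally have "\<bar>(\<Sum>a\<in>J. \<Sum>b\<in>J. X (y, l) x a * X (z, l) x b * sl.abar ((y + a) - (z + b))) - sl.abar (y - z)\<bar> \<le> C" .
    moreover have "\<bar>beta * of_bool (y = z)\<bar> \<le> beta" using beta_pos by simp
    ultimately show ?thesis unfolding H_def by linarith
  qed
  then show ?thesis by blast
qed

definition Fa :: "nat \<Rightarrow> int \<Rightarrow> nat \<Rightarrow> int \<Rightarrow> nat \<Rightarrow> 'a \<Rightarrow> real" where
  "Fa T k T' k' l x = EVV T k T' k' l x (\<lambda>y z. sl.abar (y - z))"

lemma tanaka_step:
  assumes "1 \<le> l" "l \<le> T" "l \<le> T'"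
  shows "Fa T k T' k' (l - 1) x - Fa T k T' k' l x = beta * meet T k T' k' l x + EVV T k T' k' l x (\<lambda>y z. H l y z x)"
  unfolding Fa_def EVV_step[OF assms] meet_def EVV_diff[symmetric] EVV_cmult[symmetric] EVV_add[symmetric] H_def
  by (simp add: algebra_simps)

definition mart :: "nat \<Rightarrow> int \<Rightarrow> nat \<Rightarrow> int \<Rightarrow> 'a \<Rightarrow> real" where
  "mart T k T' k' x = (\<Sum>l=1..min T T'. EVV T k T' k' l x (\<lambda>y z. H l y z x))"

text \<open>Telescoping of \<open>tanaka_step\<close> over the levels where both walks move. Above
  level \<open>min T T'\<close> one walk still waits, so the boundary term there is the starting
  configuration.\<close>

lemma tanaka:
  "beta * (\<Sum>l=1..min T T'. meet T k T' k' l x) = Fa T k T' k' 0 x - Fa T k T' k' (min T T') x - mart T k T' k' x"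
proof -
  have "(\<Sum>l=1..L. Fa T k T' k' (l - 1) x - Fa T k T' k' l x) = Fa T k T' k' 0 x - Fa T k T' k' L x" for L
    by (induction L) auto
  moreover have "(\<Sum>l=1..min T T'. Fa T k T' k' (l - 1) x - Fa T k T' k' l x) =
     beta * (\<Sum>l=1..min T T'. meet T k T' k' l x) + mart T k T' k' x"
    unfolding mart_def sum_distrib_left sum.distrib[symmetric] by (intro sum.cong refl tanaka_step) auto
  ultimately show ?thesis by simp
qed

lemma VVH:
  assumes "1 \<le> l"
  shows "integrable M (\<lambda>x. V T k l x y * V T' k' l x z * H l y z x)"
    "expectation (\<lambda>x. V T k l x y * V T' k' l x z * H l y z x) = 0"
proof -
  obtain C where C: "\<And>l y z x. x \<in> space M \<Longrightarrow> 1 \<le> l \<Longrightarrow> \<bar>H l y z x\<bar> \<le> C" using H_bounded by blast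
  have iH: "integrable M (H l y z)" using F_bounded_integrable[OF H_F, of l y z C] C[OF _ assms] by simp
  have d: "lev l \<inter> {(y, l), (z, l)} = {}" by (auto simp: lev_def)
  have m: "(\<lambda>x. V T k l x y * V T' k' l x z) \<in> borel_measurable (F (lev l))"
    using V_F[of T k l y] V_F[of T' k' l z] by simp
  show "integrable M (\<lambda>x. V T k l x y * V T' k' l x z * H l y z x)"
    "expectation (\<lambda>x. V T k l x y * V T' k' l x z * H l y z x) = 0"
    using F_indep_integral[OF d m H_F VV_integrable iH] H_expectation[OF assms] by auto
qed

lemma EVVH_integrable: "1 \<le> l \<Longrightarrow> integrable M (\<lambda>x. EVV T k T' k' l x (\<lambda>y z. H l y z x))"
  unfolding EVV_def by (intro Bochner_Integration.integrable_sum VVH)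

lemma mart_expectation: "expectation (mart T k T' k') = 0"
proof -
  have "expectation (mart T k T' k') = (\<Sum>l=1..min T T'. expectation (\<lambda>x. EVV T k T' k' l x (\<lambda>y z. H l y z x)))"
    unfolding mart_def[abs_def] by (rule Bochner_Integration.integral_sum) (auto intro!: EVVH_integrable)
  also have "\<dots> = 0"
    unfolding EVV_def by (intro sum.neutral ballI) (simp add: VVH)
  finally show ?thesis .
qed

text \<open>Take means in the Tanaka formula for two walks from one point: the martingale vanishes,
  and so does the starting term, as \<open>abar 0 = 0\<close>. The end term grows linearly in the
  distance, whose mean is of order sqrt T by the second moment.\<close>

lemma meet_sum_bound: "\<exists>C\<ge>0. \<forall>T k. expectation (\<lambda>x. \<Sum>l=1..T. meet T k T k l x) \<le> C * sqrt (real T + 1)"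
proof -
  obtain C where C: "\<And>x. \<bar>sl.abar x - \<bar>of_int x\<bar> / (2 * sl.var)\<bar> \<le> C" using sl.abar_asymp by blast
  have C0: "0 \<le> C" using C[of 0] by simp
  define D where "D = ((6 * sl.var + 1) / 2 / (2 * sl.var) + C) / beta"
  have D0: "0 \<le> D" unfolding D_def using C0 sl.var_pos beta_pos by simp
  have "expectation (\<lambda>x. \<Sum>l=1..T. meet T k T k l x) \<le> D * sqrt (real T + 1)" for T k
  proof -
    \<comment> \<open>The scale in |d| \<le> (d^2 / s + s) / 2. With mean square at most
      \<open>6 * sl.var * real T\<close> this yields a bound of order \<open>s\<close>; adding 1 to
      \<open>real T\<close> makes \<open>s\<close> at least 1, so that \<open>C\<close> is absorbed
      in \<open>C * s\<close>.\<close>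
    define s where "s = sqrt (real T + 1)"
    have s: "s \<ge> 1" "s * s = real T + 1" by (auto simp: s_def)
    have im: "integrable M (mart T k T k)" unfolding mart_def[abs_def] by (auto intro!: EVVH_integrable)
    have Fm: "Fa T k T k T x = 0" for x
      unfolding Fa_def EVV_EV by (simp add: EV_top)
    have "beta * expectation (\<lambda>x. \<Sum>l=1..T. meet T k T k l x) = expectation (\<lambda>x. beta * (\<Sum>l=1..min T T. meet T k T k l x))"
      by simp
    also have "\<dots> = expectation (\<lambda>x. Fa T k T k 0 x - mart T k T k x)"
      unfolding tanaka by (simp add: Fm)
    also have "\<dots> = expectation (Fa T k T k 0)"
      using im by (subst Bochner_Integration.integral_diff) (auto simp: mart_expectation Fa_def[abs_def] EVV_integrable)
    also have "\<dots> \<le> expectation (\<lambda>x. (EVV T k T k 0 x (\<lambda>y z. (of_int (y - z))\<^sup>2) / s + s) / 2 / (2 * sl.var) + C)"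
    proof (rule integral_mono)
      show "integrable M (Fa T k T k 0)" unfolding Fa_def[abs_def] by (rule EVV_integrable)
      show "integrable M (\<lambda>x. (EVV T k T k 0 x (\<lambda>y z. (of_int (y - z))\<^sup>2) / s + s) / 2 / (2 * sl.var) + C)"
        by (intro Bochner_Integration.integrable_add integrable_divide EVV_integrable integrable_const)
      fix x assume x: "x \<in> space M"
      have "Fa T k T k 0 x \<le> EVV T k T k 0 x (\<lambda>y z. (1 / (s * 4 * sl.var)) * (of_int (y - z))\<^sup>2 + (s / 2 / (2 * sl.var) + C))"
        unfolding Fa_def
      proof (rule EVV_mono[OF x])
        fix y z :: int
        have "2 * \<bar>real_of_int (y - z)\<bar> * s \<le> \<bar>real_of_int (y - z)\<bar>\<^sup>2 + s\<^sup>2" by (rule sum_squares_bound)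
        then have "\<bar>real_of_int (y - z)\<bar> \<le> ((real_of_int (y - z))\<^sup>2 / s + s) / 2"
          using s by (simp add: field_simps power2_eq_square)
        then have "\<bar>real_of_int (y - z)\<bar> / (2 * sl.var) \<le> ((real_of_int (y - z))\<^sup>2 / s + s) / 2 / (2 * sl.var)"
          using sl.var_pos by (intro divide_right_mono) auto
        moreover have "sl.abar (y - z) \<le> \<bar>real_of_int (y - z)\<bar> / (2 * sl.var) + C" using C[of "y - z"] by linarith
        ultimately have "sl.abar (y - z) \<le> ((real_of_int (y - z))\<^sup>2 / s + s) / 2 / (2 * sl.var) + C" by linarith
        also have "\<dots> = (1 / (s * 4 * sl.var)) * (of_int (y - z))\<^sup>2 + (s / 2 / (2 * sl.var) + C)"
          by (simp add: add_divide_distrib)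
        finally show "sl.abar (y - z) \<le> (1 / (s * 4 * sl.var)) * (of_int (y - z))\<^sup>2 + (s / 2 / (2 * sl.var) + C)" .
      qed
      also have "\<dots> = (EVV T k T k 0 x (\<lambda>y z. (of_int (y - z))\<^sup>2) / s + s) / 2 / (2 * sl.var) + C"
        unfolding EVV_add EVV_cmult EVV_const[OF x] by (simp add: add_divide_distrib)
      finally show "Fa T k T k 0 x \<le> (EVV T k T k 0 x (\<lambda>y z. (of_int (y - z))\<^sup>2) / s + s) / 2 / (2 * sl.var) + C" .
    qed
    also have "\<dots> = (expectation (\<lambda>x. EVV T k T k 0 x (\<lambda>y z. (of_int (y - z))\<^sup>2)) / s + s) / 2 / (2 * sl.var) + C"
      using prob_space by (simp add: EVV_integrable)
    also have "\<dots> \<le> ((6 * sl.var * real T) / s + s) / 2 / (2 * sl.var) + C"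
      using EVV_second_moment[of T k T k 0] s sl.var_pos
      by (intro add_mono divide_right_mono order_refl) (auto simp: mult_ac)
    also have "\<dots> \<le> ((6 * sl.var * s) + s) / 2 / (2 * sl.var) + C * s"
    proof (intro add_mono divide_right_mono order_refl)
      have "real T \<le> s * s" "0 < s" using s by linarith+
      then have "real T / s \<le> s" by (simp add: pos_divide_le_eq)
      from mult_left_mono[OF this, of "6 * sl.var"] show "6 * sl.var * real T / s \<le> 6 * sl.var * s" using sl.var_pos by simp
      show "C \<le> C * s" using s C0 mult_left_mono[of 1 s C] by simp
    qed (use sl.var_pos in auto)
    also have "\<dots> = beta * (D * s)"
    proof -
      have "beta * D = (6 * sl.var + 1) / 2 / (2 * sl.var) + C" using beta_pos by (simp add: D_def)
      moreover have "6 * sl.var * s + s = (6 * sl.var + 1) * s" by (simp add: distrib_right)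
      ultimately show ?thesis unfolding mult.assoc[symmetric] by (simp add: distrib_right)
    qed
    finally show ?thesis using beta_pos by (simp add: s_def)
  qed
  then show ?thesis using D0 by blast
qed

lemma meet_sum_bound': "\<exists>C\<ge>0. \<forall>T k L. L \<le> T \<longrightarrow> (\<Sum>l=1..L. expectation (meet T k T k l)) \<le> C * sqrt (real T + 1)"
proof -
  obtain C where C: "C \<ge> 0" "\<And>T k. expectation (\<lambda>x. \<Sum>l=1..T. meet T k T k l x) \<le> C * sqrt (real T + 1)"
    using meet_sum_bound by blast
  have "(\<Sum>l=1..L. expectation (meet T k T k l)) \<le> C * sqrt (real T + 1)" if "L \<le> T" for T k L
  proof -
    have "(\<Sum>l=1..L. expectation (meet T k T k l)) \<le> (\<Sum>l=1..T. expectation (meet T k T k l))"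
      using that by (intro sum_mono2) (auto intro!: integral_nonneg_AE AE_I2 meet_nonneg)
    also have "\<dots> = expectation (\<lambda>x. \<Sum>l=1..T. meet T k T k l x)"
      using meet_integrable by simp
    finally show ?thesis using C(2)[of T k] by linarith
  qed
  with C(1) show ?thesis by blast
qed

text \<open>The summands \<open>H\<close> at two pairs of sites interact only if the pairs share a
  site, so \<open>martingale_L2\<close> bounds the second moment by meeting counts. These are of
  order sqrt T; hence the martingale is of order T^(1/4), below the order sqrt T of the boundary
  terms.\<close>

lemma mart_L2: "\<exists>C\<ge>0. \<forall>T k T' k'. expectation (\<lambda>x. (mart T k T' k' x)\<^sup>2) \<le> C * (sqrt (real T + 1) + sqrt (real T' + 1))"
proof -
  obtain C where C: "\<And>l y z x. x \<in> space M \<Longrightarrow> 1 \<le> l \<Longrightarrow> \<bar>H l y z x\<bar> \<le> C" using H_bounded by blast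
  obtain D where D: "D \<ge> 0" "\<And>T k L. L \<le> T \<Longrightarrow> (\<Sum>l=1..L. expectation (meet T k T k l)) \<le> D * sqrt (real T + 1)"
    using meet_sum_bound' by blast
  have "expectation (\<lambda>x. (mart T k T' k' x)\<^sup>2) \<le> C\<^sup>2 * 2 * D * (sqrt (real T + 1) + sqrt (real T' + 1))" for T k T' k'
  proof -
    define L where "L = min T T'"
    define B where "B = Bx T k \<union> Bx T' k'"
    have B: "finite B" "Bx T k \<subseteq> B" "Bx T' k' \<subseteq> B" by (auto simp: B_def)
    \<comment> \<open>Step \<open>m\<close> of the martingale is level \<open>L - m\<close>: the
      environment is revealed from late to early.\<close>
    define c where "c m p x = V T k (L - m) x (fst p) * V T' k' (L - m) x (snd p)" for m p x
    define Z where "Z m p x = H (L - m) (fst p) (snd p) x" for m p x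
    define S where "S m p = {(fst p, L - m), (snd p, L - m)}" for m and p :: "int \<times> int"
    have EVVB: "EVV T k T' k' l x f = (\<Sum>p\<in>B\<times>B. V T k l x (fst p) * V T' k' l x (snd p) * f (fst p) (snd p))" for l x f
    proof -
      have "EVV T k T' k' l x f = (\<Sum>p\<in>Bx T k \<times> Bx T' k'. V T k l x (fst p) * V T' k' l x (snd p) * f (fst p) (snd p))"
        unfolding EVV_def by (simp add: sum.cartesian_product split_def)
      also have "\<dots> = (\<Sum>p\<in>B\<times>B. V T k l x (fst p) * V T' k' l x (snd p) * f (fst p) (snd p))"
      proof -
        have "y \<in> Bx T k" if "V T k l x y \<noteq> 0" for y using V_out that by metis
        moreover have "y \<in> Bx T' k'" if "V T' k' l x y \<noteq> 0" for y using V_out that by metis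
        ultimately show ?thesis using B by (intro sum.mono_neutral_left) auto
      qed
      finally show ?thesis .
    qed
    have me: "mart T k T' k' x = (\<Sum>m<L. \<Sum>p\<in>B\<times>B. c m p x * Z m p x)" for x
      unfolding mart_def c_def Z_def EVVB L_def[symmetric] by (rule sum_rev_levels[symmetric])
    have "expectation (\<lambda>x. (\<Sum>m<L. \<Sum>p\<in>B\<times>B. c m p x * Z m p x)\<^sup>2) \<le>
      C\<^sup>2 * (\<Sum>m<L. \<Sum>p\<in>B\<times>B. \<Sum>p'\<in>B\<times>B. if S m p \<inter> S m p' = {} then 0 else expectation (\<lambda>x. \<bar>c m p x\<bar> * \<bar>c m p' x\<bar>))"
    proof (rule martingale_L2[where A = "\<lambda>m. lev (L - m)" and Bc = 1])
      show "c m p \<in> borel_measurable (F (lev (L - m)))" for m p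
        unfolding c_def using V_F[of T k "L - m" "fst p"] V_F[of T' k' "L - m" "snd p"] by simp
      show "Z m p \<in> borel_measurable (F (S m p))" for m p
        unfolding Z_def S_def by (rule H_F)
      show "expectation (Z m p) = 0" if "m < L" for m p
        unfolding Z_def using that by (intro H_expectation) auto
      show "\<bar>Z m p x\<bar> \<le> C" if "m < L" "x \<in> space M" for m p x
        unfolding Z_def using that by (intro C) auto
    qed (use B in \<open>auto simp: c_def S_def lev_def VV_norm\<close>)
    also have "\<dots> \<le> C\<^sup>2 * (\<Sum>m<L. 2 * expectation (meet T k T k (L - m)) + 2 * expectation (meet T' k' T' k' (L - m)))"
    proof (intro mult_left_mono sum_mono)
      fix m
      define u where "u x = V T k (L - m) x" for x
      define v where "v x = V T' k' (L - m) x" for x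
      have ccu: "c m p x = u x (fst p) * v x (snd p)" for p x by (simp add: c_def u_def v_def)
      \<comment> \<open>The number of coincidences between the sites of the two pairs; it is at
        least 1 whenever the innovations involve a common weight vector.\<close>
      let ?w = "\<lambda>p p'. of_bool (fst p = fst p') + of_bool (fst p = snd p') + of_bool (snd p = fst p') + of_bool (snd p = snd p') :: real"
      have ic: "integrable M (\<lambda>x. c m p x * c m p' x)" for p p'
      proof (rule integrable_const_bound[of _ 1])
        show "AE x in M. norm (c m p x * c m p' x) \<le> 1"
          unfolding real_norm_def abs_mult c_def
          by (intro AE_I2 mult_le_one mult_nonneg_nonneg abs_ge_zero V_norm)
        show "(\<lambda>x. c m p x * c m p' x) \<in> borel_measurable M" unfolding c_def by measurable
      qed
      have cn: "0 \<le> c m p x" if "x \<in> space M" for p x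
        unfolding c_def using that by (intro mult_nonneg_nonneg V_nonneg)
      have "(\<Sum>p\<in>B\<times>B. \<Sum>p'\<in>B\<times>B. if S m p \<inter> S m p' = {} then 0 else expectation (\<lambda>x. \<bar>c m p x\<bar> * \<bar>c m p' x\<bar>))
         \<le> (\<Sum>p\<in>B\<times>B. \<Sum>p'\<in>B\<times>B. expectation (\<lambda>x. c m p x * c m p' x * ?w p p'))"
      proof (intro sum_mono)
        fix p p'
        have e: "expectation (\<lambda>x. \<bar>c m p x\<bar> * \<bar>c m p' x\<bar>) = expectation (\<lambda>x. c m p x * c m p' x)"
          using cn by (intro Bochner_Integration.integral_cong) auto
        have nn: "0 \<le> expectation (\<lambda>x. c m p x * c m p' x)"
          using cn by (intro integral_nonneg_AE AE_I2) auto
        show "(if S m p \<inter> S m p' = {} then 0 else expectation (\<lambda>x. \<bar>c m p x\<bar> * \<bar>c m p' x\<bar>))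
           \<le> expectation (\<lambda>x. c m p x * c m p' x * ?w p p')"
        proof (cases "S m p \<inter> S m p' = {}")
          case True
          then show ?thesis using nn by simp
        next
          case False
          then have "?w p p' \<ge> 1" by (auto simp: S_def)
          then have "expectation (\<lambda>x. c m p x * c m p' x) * 1 \<le> expectation (\<lambda>x. c m p x * c m p' x) * ?w p p'"
            using nn by (intro mult_left_mono)
          then show ?thesis using False e by simp
        qed
      qed
      also have "\<dots> = expectation (\<lambda>x. \<Sum>p\<in>B\<times>B. \<Sum>p'\<in>B\<times>B. c m p x * c m p' x * ?w p p')"
      proof -
        have i: "integrable M (\<lambda>x. c m p x * c m p' x * ?w p p')" for p p' by (rule integrable_mult_left) (rule ic)
        show ?thesis by (simp only: Bochner_Integration.integral_sum Bochner_Integration.integrable_sum i)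
      qed
      also have "\<dots> = expectation (\<lambda>x. meet T k T k (L - m) x + 2 * meet T k T' k' (L - m) x + meet T' k' T' k' (L - m) x)"
      proof (rule Bochner_Integration.integral_cong[OF refl])
        fix x assume x: "x \<in> space M"
        show "(\<Sum>p\<in>B\<times>B. \<Sum>p'\<in>B\<times>B. c m p x * c m p' x * ?w p p') =
          meet T k T k (L - m) x + 2 * meet T k T' k' (L - m) x + meet T' k' T' k' (L - m) x"
          unfolding ccu using pair_coincidence_sum[OF B(1), of "u x" "v x"] V_sum'[OF x B(1,2)] V_sum'[OF x B(1,3)]
          unfolding meet_sum[OF B(1,2)] meet_sum[OF B(1,3)] u_def v_def by simp
      qed
      also have "\<dots> \<le> expectation (\<lambda>x. 2 * meet T k T k (L - m) x + 2 * meet T' k' T' k' (L - m) x)"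
      proof (rule integral_mono)
        show "meet T k T k (L - m) x + 2 * meet T k T' k' (L - m) x + meet T' k' T' k' (L - m) x \<le>
          2 * meet T k T k (L - m) x + 2 * meet T' k' T' k' (L - m) x" for x
          using meet_polar[of T k T' k' "L - m" x] by linarith
      qed (intro Bochner_Integration.integrable_add integrable_mult_right meet_integrable)+
      also have "\<dots> = 2 * expectation (meet T k T k (L - m)) + 2 * expectation (meet T' k' T' k' (L - m))"
        using meet_integrable by simp
      finally show "(\<Sum>p\<in>B\<times>B. \<Sum>p'\<in>B\<times>B. if S m p \<inter> S m p' = {} then 0 else expectation (\<lambda>x. \<bar>c m p x\<bar> * \<bar>c m p' x\<bar>))
        \<le> 2 * expectation (meet T k T k (L - m)) + 2 * expectation (meet T' k' T' k' (L - m))" .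
    qed auto
    also have "(\<Sum>m<L. 2 * expectation (meet T k T k (L - m)) + 2 * expectation (meet T' k' T' k' (L - m))) =
      2 * (\<Sum>l=1..L. expectation (meet T k T k l)) + 2 * (\<Sum>l=1..L. expectation (meet T' k' T' k' l))"
      unfolding sum.distrib sum_distrib_left[symmetric] sum_rev_levels[of "\<lambda>l. expectation (meet T k T k l)"]
        sum_rev_levels[of "\<lambda>l. expectation (meet T' k' T' k' l)"] ..
    also have "C\<^sup>2 * \<dots> \<le> C\<^sup>2 * (2 * (D * sqrt (real T + 1)) + 2 * (D * sqrt (real T' + 1)))"
      by (intro mult_left_mono add_mono D) (auto simp: L_def)
    finally show ?thesis unfolding me by (simp add: algebra_simps)
  qed
  then show ?thesis using D(1) by (intro exI[of _ "C\<^sup>2 * 2 * D"]) auto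
qed

end

lemma (in prob_space) expectation_le_sqrt:
  assumes [measurable]: "f \<in> borel_measurable M" and b: "\<And>x. x \<in> space M \<Longrightarrow> \<bar>f x\<bar> \<le> B"
  shows "expectation (\<lambda>x. \<bar>f x\<bar>) \<le> sqrt (expectation (\<lambda>x. (f x)\<^sup>2))"
proof -
  have i1: "integrable M (\<lambda>x. \<bar>f x\<bar>)" by (rule integrable_const_bound[of _ B]) (auto intro!: AE_I2 b)
  have "integrable M (\<lambda>x. \<bar>f x\<bar>\<^sup>2)"
  proof (rule integrable_const_bound[of _ "B * B"])
    show "AE x in M. norm (\<bar>f x\<bar>\<^sup>2) \<le> B * B"
    proof (rule AE_I2)
      fix x assume "x \<in> space M"
      from mult_mono[OF b[OF this] b[OF this]] b[OF this] show "norm (\<bar>f x\<bar>\<^sup>2) \<le> B * B"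
        by (simp add: power2_eq_square abs_mult[symmetric])
    qed
  qed measurable
  from variance_eq[OF i1 this] variance_positive[of "\<lambda>x. \<bar>f x\<bar>"]
  have "(expectation (\<lambda>x. \<bar>f x\<bar>))\<^sup>2 \<le> expectation (\<lambda>x. (f x)\<^sup>2)" by simp
  then show ?thesis by (rule real_le_rsqrt)
qed

section \<open>The quenched characteristic function and its closeness to the annealed one\<close>

context walk begin

text \<open>The characteristic function of the quenched position, centred at the annealed mean
  \<open>ctr\<close>. In the mean over the environment it would be a power of \<open>ph\<close>, the
  characteristic function of one centred annealed step.\<close>

definition Q :: "nat \<Rightarrow> int \<Rightarrow> nat \<Rightarrow> real \<Rightarrow> 'a \<Rightarrow> complex" where
  "Q T k l \<theta> x = EV T k l x (\<lambda>y. iexp (\<theta> * (of_int y - ctr T k l)))"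

definition ph :: "real \<Rightarrow> complex" where
  "ph \<theta> = (\<Sum>j\<in>J. of_real (p j) * iexp (\<theta> * (of_int j - sl.mean)))"

lemma abs_mean_le: "\<bar>sl.mean\<bar> \<le> R"
proof -
  have "\<bar>sl.mean\<bar> \<le> (\<Sum>j\<in>J. real R * p j)"
    unfolding sl.mean_def by (intro order_trans[OF sum_abs] sum_mono) (auto simp: abs_mult sl.p_nonneg intro!: mult_right_mono)
  then show ?thesis by (simp add: sum_distrib_left[symmetric] sl.p_sum)
qed

lemma abs_centred_le: "j \<in> J \<Longrightarrow> \<bar>of_int j - sl.mean\<bar> \<le> 2 * real R"
proof -
  assume "j \<in> J"
  then have "\<bar>real_of_int j\<bar> \<le> real R" by auto
  then show ?thesis using abs_mean_le by linarith
qed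

lemma norm_ph: "norm (ph \<theta>) \<le> 1"
proof -
  have "norm (ph \<theta>) \<le> (\<Sum>j\<in>J. p j)"
    unfolding ph_def by (intro order_trans[OF norm_sum] sum_mono) (simp add: norm_mult sl.p_nonneg)
  then show ?thesis by (simp add: sl.p_sum)
qed

lemma norm_Q: "x \<in> space M \<Longrightarrow> norm (Q T k l \<theta> x) \<le> 1"
  unfolding Q_def by (rule EV_norm) auto

lemma Q_M[measurable]: "Q T k l \<theta> \<in> borel_measurable M"
  unfolding Q_def[abs_def] EV_def by measurable

definition coef :: "nat \<Rightarrow> int \<Rightarrow> real \<Rightarrow> nat \<Rightarrow> int \<Rightarrow> int \<Rightarrow> complex" where
  "coef T k \<theta> l y j = iexp (\<theta> * (of_int y - ctr T k l)) * (iexp (\<theta> * (of_int j - sl.mean)) - 1)"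

lemma Q_step:
  assumes l: "1 \<le> l" "l \<le> T" and x: "x \<in> space M"
  shows "Q T k (l - 1) \<theta> x = ph \<theta> * Q T k l \<theta> x +
    EV T k l x (\<lambda>y. \<Sum>j\<in>J. of_real (X (y, l) x j - p j) * coef T k \<theta> l y j)"
proof -
  have c: "ctr T k (l - 1) = ctr T k l + sl.mean"
    using l by (auto simp: ctr_def of_nat_diff algebra_simps)
  have "(\<Sum>j\<in>J. X (y, l) x j *\<^sub>R iexp (\<theta> * (of_int (y + j) - ctr T k (l - 1)))) =
    ph \<theta> * iexp (\<theta> * (of_int y - ctr T k l)) + (\<Sum>j\<in>J. of_real (X (y, l) x j - p j) * coef T k \<theta> l y j)" for y
  proof -
    let ?u = "iexp (\<theta> * (of_int y - ctr T k l))" and ?e = "\<lambda>j. iexp (\<theta> * (of_int j - sl.mean))"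
    have "(\<Sum>j\<in>J. complex_of_real (X (y, l) x j - p j)) = 0"
      unfolding of_real_sum[symmetric] sum_subtractf using X_sum[OF l(1) x] sl.p_sum by simp
    moreover have "iexp (\<theta> * (of_int (y + j) - ctr T k (l - 1))) = ?u * ?e j" for j
      unfolding c exp_add[symmetric] by (simp add: algebra_simps)
    ultimately have "(\<Sum>j\<in>J. X (y, l) x j *\<^sub>R iexp (\<theta> * (of_int (y + j) - ctr T k (l - 1)))) =
      (\<Sum>j\<in>J. of_real (X (y, l) x j) * (?u * ?e j)) - ?u * (\<Sum>j\<in>J. complex_of_real (X (y, l) x j - p j))"
      by (simp add: scaleR_conv_of_real)
    also have "\<dots> = ph \<theta> * ?u + (\<Sum>j\<in>J. of_real (X (y, l) x j - p j) * coef T k \<theta> l y j)"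
      unfolding ph_def coef_def sum_distrib_left sum_distrib_right sum_subtractf[symmetric] sum.distrib[symmetric]
      by (intro sum.cong refl) (simp add: algebra_simps)
    finally show ?thesis .
  qed
  then have "Q T k (l - 1) \<theta> x = EV T k l x (\<lambda>y. ph \<theta> * iexp (\<theta> * (of_int y - ctr T k l)) + (\<Sum>j\<in>J. of_real (X (y, l) x j - p j) * coef T k \<theta> l y j))"
    unfolding Q_def EV_step[OF l] by simp
  then show ?thesis
    unfolding Q_def EV_def by (simp add: scaleR_add_right sum.distrib sum_distrib_left)
qed

text \<open>Variation of constants for \<open>Q_step\<close>: the fluctuation of the weights at
  level \<open>T - m\<close> is carried on by the remaining \<open>n - 1 - m\<close> steps, each
  contributing a factor \<open>ph \<theta>\<close>.\<close>

lemma Q_expand: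
  assumes "n \<le> T" and x: "x \<in> space M"
  shows "Q T k (T - n) \<theta> x = ph \<theta> ^ n +
    (\<Sum>m<n. \<Sum>y\<in>Bx T k. V T k (T - m) x y *\<^sub>R (\<Sum>j\<in>J. of_real (X (y, T - m) x j - p j) * (ph \<theta> ^ (n - 1 - m) * coef T k \<theta> (T - m) y j)))"
  using assms(1)
proof (induction n)
  case 0
  then show ?case by (simp add: Q_def EV_top ctr_def)
next
  case (Suc n)
  let ?D = "\<lambda>m. EV T k (T - m) x (\<lambda>y. \<Sum>j\<in>J. of_real (X (y, T - m) x j - p j) * coef T k \<theta> (T - m) y j)"
  have D: "(\<Sum>y\<in>Bx T k. V T k (T - m) x y *\<^sub>R (\<Sum>j\<in>J. of_real (X (y, T - m) x j - p j) * (c * coef T k \<theta> (T - m) y j))) = c * ?D m" for m c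
    unfolding EV_def by (simp add: sum_distrib_left scaleR_sum_right mult_ac)
  have e: "T - Suc n = (T - n) - 1" by simp
  have "Q T k (T - Suc n) \<theta> x = ph \<theta> * Q T k (T - n) \<theta> x + ?D n"
    unfolding e by (rule Q_step) (use Suc.prems x in auto)
  also have "Q T k (T - n) \<theta> x = ph \<theta> ^ n + (\<Sum>m<n. ph \<theta> ^ (n - 1 - m) * ?D m)"
    using Suc unfolding D by simp
  also have "ph \<theta> * (ph \<theta> ^ n + (\<Sum>m<n. ph \<theta> ^ (n - 1 - m) * ?D m)) + ?D n =
     ph \<theta> ^ Suc n + ((\<Sum>m<n. ph \<theta> ^ (Suc n - 1 - m) * ?D m) + ph \<theta> ^ (Suc n - 1 - n) * ?D n)"
  proof -
    have "ph \<theta> * (ph \<theta> ^ (n - 1 - m) * ?D m) = ph \<theta> ^ (Suc n - 1 - m) * ?D m" if "m < n" for m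
    proof -
      have "Suc n - 1 - m = Suc (n - 1 - m)" using that by simp
      then show ?thesis by (simp only: power_Suc mult.assoc)
    qed
    then have "(\<Sum>m<n. ph \<theta> * (ph \<theta> ^ (n - 1 - m) * ?D m)) = (\<Sum>m<n. ph \<theta> ^ (Suc n - 1 - m) * ?D m)"
      by (intro sum.cong refl) (simp only: lessThan_iff)
    then show ?thesis unfolding distrib_left sum_distrib_left by simp
  qed
  also have "\<dots> = ph \<theta> ^ Suc n + (\<Sum>m<Suc n. ph \<theta> ^ (Suc n - 1 - m) * ?D m)" by simp
  finally show ?case unfolding D .
qed

lemma norm_coef: "j \<in> J \<Longrightarrow> norm (coef T k \<theta> l y j) \<le> \<bar>\<theta>\<bar> * (2 * real R)"
proof -
  assume j: "j \<in> J"
  have "norm (iexp u - 1) \<le> \<bar>u\<bar>" for u :: real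
    using iexp_approx1[of u 0] by simp
  from this[of "\<theta> * (of_int j - sl.mean)"] have "norm (coef T k \<theta> l y j) \<le> \<bar>\<theta> * (of_int j - sl.mean)\<bar>"
    unfolding coef_def norm_mult by (simp only: norm_exp_i_times mult_1)
  also have "\<dots> \<le> \<bar>\<theta>\<bar> * (2 * real R)"
    unfolding abs_mult by (intro mult_left_mono abs_centred_le j) auto
  finally show ?thesis .
qed

text \<open>The deviation is a martingale with increments of order |\<theta>|, and two of its terms
  interact only at the same site, so its second moment is \<theta>^2 times a count of meetings, of
  order sqrt T. For \<theta> of order 1 / sqrt n and T of order n the bound is n^(-1/4).\<close>

lemma Q_L1: "\<exists>C\<ge>0. \<forall>T k l \<theta>. l \<le> T \<longrightarrow>
  expectation (\<lambda>x. norm (Q T k l \<theta> x - ph \<theta> ^ (T - l))) \<le> C * \<bar>\<theta>\<bar> * sqrt (sqrt (real T + 1))"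
proof -
  obtain D where D: "D \<ge> 0" "\<And>T k L. L \<le> T \<Longrightarrow> (\<Sum>l=1..L. expectation (meet T k T k l)) \<le> D * sqrt (real T + 1)"
    using meet_sum_bound' by blast
  define C where "C = 4 * real R * sqrt D"
  \<comment> \<open>The orthogonality bound is for real sums; it is applied through a real linear
    functional \<open>r\<close>, which is then taken to be the real and the imaginary part.\<close>
  have part: "expectation (\<lambda>x. \<bar>r (Q T k l \<theta> x - ph \<theta> ^ (T - l))\<bar>) \<le> C * \<bar>\<theta>\<bar> * sqrt (sqrt (real T + 1))"
    if r: "bounded_linear r" "\<And>z. \<bar>r z\<bar> \<le> norm z" and l: "l \<le> T" for r :: "complex \<Rightarrow> real" and T k l \<theta>
  proof -
    interpret r: bounded_linear r by (rule r)
    define n where "n = T - l"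
    have n: "n \<le> T" "l = T - n" using l by (auto simp: n_def)
    define cf where "cf m y j = r (ph \<theta> ^ (n - 1 - m) * coef T k \<theta> (T - m) y j)" for m y j
    define Z where "Z m y x = (\<Sum>j\<in>J. (X (y, T - m) x j - p j) * cf m y j)" for m y x
    define c where "c m y x = V T k (T - m) x y" for m y x
    have cf: "\<bar>cf m y j\<bar> \<le> \<bar>\<theta>\<bar> * (2 * real R)" if "j \<in> J" for m y j
    proof -
      have "\<bar>cf m y j\<bar> \<le> norm (ph \<theta>) ^ (n - 1 - m) * norm (coef T k \<theta> (T - m) y j)"
        unfolding cf_def using r(2) by (simp add: norm_mult[symmetric] norm_power[symmetric])
      also have "\<dots> \<le> 1 * (\<bar>\<theta>\<bar> * (2 * real R))"
        using that by (intro mult_mono norm_coef power_le_one norm_ph) auto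
      finally show ?thesis by simp
    qed
    have eq: "r (Q T k l \<theta> x - ph \<theta> ^ n) = (\<Sum>m<n. \<Sum>y\<in>Bx T k. c m y x * Z m y x)" if x: "x \<in> space M" for x
      unfolding n(2) Q_expand[OF n(1) x] c_def Z_def cf_def
      by (simp add: r.sum r.scaleR scaleR_conv_of_real[symmetric] del: of_real_diff)
    have Zb: "\<bar>Z m y x\<bar> \<le> 4 * real R * \<bar>\<theta>\<bar>" if m: "m < n" and x: "x \<in> space M" for m y x
    proof -
      have s: "1 \<le> T - m" using m n by simp
      have "\<bar>Z m y x\<bar> \<le> (\<Sum>j\<in>J. (X (y, T - m) x j + p j) * (\<bar>\<theta>\<bar> * (2 * real R)))"
        unfolding Z_def
      proof (rule order_trans[OF sum_abs], rule sum_mono)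
        fix j assume j: "j \<in> J"
        show "\<bar>(X (y, T - m) x j - p j) * cf m y j\<bar> \<le> (X (y, T - m) x j + p j) * (\<bar>\<theta>\<bar> * (2 * real R))"
          unfolding abs_mult using X_nonneg[OF s x, of y j] sl.p_nonneg[of j]
          by (intro mult_mono cf j) auto
      qed
      also have "\<dots> = 2 * (\<bar>\<theta>\<bar> * (2 * real R))"
        unfolding sum_distrib_right[symmetric] sum.distrib X_sum[OF s x] sl.p_sum by simp
      finally show ?thesis by (simp add: mult_ac)
    qed
    have "expectation (\<lambda>x. (\<Sum>m<n. \<Sum>y\<in>Bx T k. c m y x * Z m y x)\<^sup>2) \<le> (4 * real R * \<bar>\<theta>\<bar>)\<^sup>2 *
      (\<Sum>m<n. \<Sum>y\<in>Bx T k. \<Sum>y'\<in>Bx T k. if {(y, T - m)} \<inter> {(y', T - m)} = {} then 0 else expectation (\<lambda>x. \<bar>c m y x\<bar> * \<bar>c m y' x\<bar>))"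
    proof (rule martingale_L2[where A = "\<lambda>m. lev (T - m)" and Bc = 1])
      show "c m y \<in> borel_measurable (F (lev (T - m)))" for m y
        unfolding c_def by (rule V_F)
      show "Z m y \<in> borel_measurable (F {(y, T - m)})" for m y
      proof -
        have [measurable]: "(\<lambda>x. X (y, T - m) x j) \<in> borel_measurable (F {(y, T - m)})" for j
          by (rule X_coord_F) simp
        show ?thesis unfolding Z_def[abs_def] by measurable
      qed
      show "expectation (Z m y) = 0" if "m < n" for m y
      proof -
        have s: "1 \<le> T - m" using that n by simp
        have "expectation (Z m y) = (\<Sum>j\<in>J. (expectation (\<lambda>x. X (y, T - m) x j) - p j) * cf m y j)"
          unfolding Z_def[abs_def] using X_integrable[OF s] prob_space by simp
        then show ?thesis using expectation_X[OF s] by simp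
      qed
    qed (use n in \<open>auto simp: c_def lev_def V_norm intro: Zb\<close>)
    also have "\<dots> = (4 * real R * \<bar>\<theta>\<bar>)\<^sup>2 * (\<Sum>m<n. expectation (meet T k T k (T - m)))"
    proof -
      have "(\<Sum>y\<in>Bx T k. \<Sum>y'\<in>Bx T k. if {(y, T - m)} \<inter> {(y', T - m)} = {} then 0 else expectation (\<lambda>x. \<bar>c m y x\<bar> * \<bar>c m y' x\<bar>))
        = expectation (meet T k T k (T - m))" for m
      proof -
        have "(\<Sum>y\<in>Bx T k. \<Sum>y'\<in>Bx T k. if {(y, T - m)} \<inter> {(y', T - m)} = {} then 0 else expectation (\<lambda>x. \<bar>c m y x\<bar> * \<bar>c m y' x\<bar>))
          = (\<Sum>y\<in>Bx T k. \<Sum>y'\<in>Bx T k. if y' = y then expectation (\<lambda>x. \<bar>c m y x\<bar> * \<bar>c m y' x\<bar>) else 0)"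
          by (intro sum.cong refl) auto
        also have "\<dots> = (\<Sum>y\<in>Bx T k. expectation (\<lambda>x. \<bar>c m y x\<bar> * \<bar>c m y x\<bar>))" by simp
        also have "\<dots> = expectation (\<lambda>x. \<Sum>y\<in>Bx T k. V T k (T - m) x y * V T k (T - m) x y)"
          unfolding c_def by (simp add: VV_integrable)
        finally show ?thesis unfolding meet_sum[OF finite_Bx order_refl, abs_def] .
      qed
      then show ?thesis by simp
    qed
    also have "\<dots> \<le> (4 * real R * \<bar>\<theta>\<bar>)\<^sup>2 * (D * sqrt (real T + 1))"
    proof (rule mult_left_mono)
      have "(\<Sum>m<n. expectation (meet T k T k (T - m))) \<le> (\<Sum>m<T. expectation (meet T k T k (T - m)))"
        using n by (intro sum_mono2) (auto intro!: integral_nonneg_AE AE_I2 meet_nonneg)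
      also have "\<dots> \<le> D * sqrt (real T + 1)"
        unfolding sum_rev_levels[of "\<lambda>l. expectation (meet T k T k l)"] by (rule D) simp
      finally show "(\<Sum>m<n. expectation (meet T k T k (T - m))) \<le> D * sqrt (real T + 1)" .
    qed auto
    finally have b: "expectation (\<lambda>x. (\<Sum>m<n. \<Sum>y\<in>Bx T k. c m y x * Z m y x)\<^sup>2) \<le> (4 * real R * \<bar>\<theta>\<bar>)\<^sup>2 * (D * sqrt (real T + 1))" .
    have "expectation (\<lambda>x. \<bar>r (Q T k l \<theta> x - ph \<theta> ^ n)\<bar>) \<le> sqrt (expectation (\<lambda>x. (r (Q T k l \<theta> x - ph \<theta> ^ n))\<^sup>2))"
    proof (rule expectation_le_sqrt[of _ "1 + 1"])
      show "(\<lambda>x. r (Q T k l \<theta> x - ph \<theta> ^ n)) \<in> borel_measurable M"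
        using borel_measurable_continuous_onI[OF r.continuous_on[OF continuous_on_id]] by measurable
      show "\<bar>r (Q T k l \<theta> x - ph \<theta> ^ n)\<bar> \<le> 1 + 1" if x: "x \<in> space M" for x
        using r(2)[of "Q T k l \<theta> x - ph \<theta> ^ n"] norm_triangle_ineq4[of "Q T k l \<theta> x" "ph \<theta> ^ n"]
          norm_Q[OF x, of T k l \<theta>] power_le_one[OF norm_ge_zero norm_ph, of \<theta> n] by (simp add: norm_power)
    qed
    also have "\<dots> = sqrt (expectation (\<lambda>x. (\<Sum>m<n. \<Sum>y\<in>Bx T k. c m y x * Z m y x)\<^sup>2))"
      by (intro arg_cong[of _ _ sqrt] Bochner_Integration.integral_cong refl) (simp add: eq)
    also have "\<dots> \<le> sqrt ((4 * real R * \<bar>\<theta>\<bar>)\<^sup>2 * (D * sqrt (real T + 1)))"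
      using b by (rule real_sqrt_le_mono)
    also have "\<dots> = C * \<bar>\<theta>\<bar> * sqrt (sqrt (real T + 1))"
      using D(1) by (simp add: C_def real_sqrt_mult)
    finally show ?thesis unfolding n_def .
  qed
  have C0: "0 \<le> C" unfolding C_def using D(1) by simp
  have "expectation (\<lambda>x. norm (Q T k l \<theta> x - ph \<theta> ^ (T - l))) \<le> 2 * C * \<bar>\<theta>\<bar> * sqrt (sqrt (real T + 1))"
    if l: "l \<le> T" for T k l \<theta>
  proof -
    let ?z = "\<lambda>x. Q T k l \<theta> x - ph \<theta> ^ (T - l)"
    have zb: "norm (?z x) \<le> 2" if x: "x \<in> space M" for x
      using norm_triangle_ineq4[of "Q T k l \<theta> x" "ph \<theta> ^ (T - l)"]
          norm_Q[OF x, of T k l \<theta>] power_le_one[OF norm_ge_zero norm_ph, of \<theta> "T - l"] by (simp add: norm_power)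
    have i: "integrable M ?z"
      by (rule integrable_const_bound[of _ 2]) (auto intro!: AE_I2 zb)
    have iR: "integrable M (\<lambda>x. \<bar>Re (?z x)\<bar>)" "integrable M (\<lambda>x. \<bar>Im (?z x)\<bar>)"
      by (intro integrable_abs integrable_Re integrable_Im i)+
    have "expectation (\<lambda>x. norm (?z x)) \<le> expectation (\<lambda>x. \<bar>Re (?z x)\<bar> + \<bar>Im (?z x)\<bar>)"
      by (intro integral_mono integrable_norm i Bochner_Integration.integrable_add iR cmod_le)
    also have "\<dots> = expectation (\<lambda>x. \<bar>Re (?z x)\<bar>) + expectation (\<lambda>x. \<bar>Im (?z x)\<bar>)"
      by (rule Bochner_Integration.integral_add[OF iR])
    also have "\<dots> \<le> C * \<bar>\<theta>\<bar> * sqrt (sqrt (real T + 1)) + C * \<bar>\<theta>\<bar> * sqrt (sqrt (real T + 1))"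
      by (intro add_mono part l bounded_linear_Re bounded_linear_Im abs_Re_le_cmod abs_Im_le_cmod)
    finally show ?thesis by simp
  qed
  then show ?thesis using C0 by (intro exI[of _ "2 * C"]) auto
qed

text \<open>Both functions equal \<open>1 - sl.var * \<theta>\<^sup>2 / 2\<close> up to higher
  order; the linear term of \<open>ph\<close> vanishes by centring.\<close>

lemma ph_approx: "\<exists>C. \<forall>\<theta>. norm (ph \<theta> - of_real (exp (- (sl.var * \<theta>\<^sup>2 / 2)))) \<le> C * (\<bar>\<theta>\<bar> ^ 3 + \<theta> ^ 4)"
proof -
  define C where "C = (2 * real R) ^ 3 + sl.var\<^sup>2"
  have "norm (ph \<theta> - of_real (exp (- (sl.var * \<theta>\<^sup>2 / 2)))) \<le> C * (\<bar>\<theta>\<bar> ^ 3 + \<theta> ^ 4)" for \<theta>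
  proof -
    let ?u = "\<lambda>j. \<theta> * (of_int j - sl.mean)"
    have m: "(\<Sum>j\<in>J. p j * (of_int j - sl.mean)) = 0"
      unfolding right_diff_distrib sum_subtractf sum_distrib_right[symmetric] sl.p_sum
      by (simp add: sl.mean_def mult.commute)
    have quad: "(\<Sum>j\<in>J. of_real (p j) * (1 + \<i> * ?u j - (?u j)\<^sup>2 / 2)) = complex_of_real (1 - sl.var * \<theta>\<^sup>2 / 2)"
    proof -
      have "(\<Sum>j\<in>J. of_real (p j) * (1 + \<i> * ?u j - (?u j)\<^sup>2 / 2)) =
        of_real (\<Sum>j\<in>J. p j) + \<i> * \<theta> * of_real (\<Sum>j\<in>J. p j * (of_int j - sl.mean)) - of_real (\<theta>\<^sup>2 / 2 * sl.var)"
        unfolding sl.var_def of_real_sum of_real_mult sum_distrib_left sum_subtractf[symmetric] sum.distrib[symmetric]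
        by (intro sum.cong refl) (simp add: algebra_simps power2_eq_square add_divide_distrib diff_divide_distrib)
      then show ?thesis by (simp add: m sl.p_sum mult.commute)
    qed
    have e1: "ph \<theta> - of_real (1 - sl.var * \<theta>\<^sup>2 / 2) = (\<Sum>j\<in>J. of_real (p j) * (iexp (?u j) - (1 + \<i> * ?u j - (?u j)\<^sup>2 / 2)))"
      unfolding quad[symmetric] ph_def sum_subtractf[symmetric] right_diff_distrib ..
    have "norm (ph \<theta> - of_real (1 - sl.var * \<theta>\<^sup>2 / 2)) \<le> (\<Sum>j\<in>J. p j * ((2 * real R) ^ 3 * \<bar>\<theta>\<bar> ^ 3))"
      unfolding e1
    proof (rule order_trans[OF norm_sum], rule sum_mono)
      fix j assume j: "j \<in> J"
      have "norm (iexp (?u j) - (\<Sum>k\<le>2. (\<i> * ?u j)^k / fact k)) \<le> \<bar>?u j\<bar>^(Suc 2) / fact (Suc 2)"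
        by (rule iexp_approx1)
      also have "\<dots> = \<bar>?u j\<bar>^3 / 6" by (simp add: fact_numeral numeral_3_eq_3)
      also have "\<dots> \<le> \<bar>?u j\<bar>^3" by simp
      also have "\<dots> \<le> (\<bar>\<theta>\<bar> * (2 * real R)) ^ 3"
        unfolding abs_mult by (intro power_mono mult_left_mono abs_centred_le j) auto
      also have "(\<Sum>k\<le>2. (\<i> * ?u j)^k / fact k) = 1 + \<i> * ?u j - (?u j)\<^sup>2 / 2"
      proof -
        have "(\<Sum>k\<le>2. f k) = f 0 + f 1 + f 2" for f :: "nat \<Rightarrow> complex"
          by (simp add: numeral_2_eq_2)
        then have "(\<Sum>k\<le>2. (\<i> * complex_of_real u)^k / fact k) = 1 + \<i> * u - u\<^sup>2 / 2" for u :: real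
          by (simp only: power_mult_distrib) simp
        then show ?thesis .
      qed
      finally have "norm (iexp (?u j) - (1 + \<i> * ?u j - (?u j)\<^sup>2 / 2)) \<le> (2 * real R) ^ 3 * \<bar>\<theta>\<bar> ^ 3"
        by (simp add: power_mult_distrib mult_ac)
      then show "norm (of_real (p j) * (iexp (?u j) - (1 + \<i> * ?u j - (?u j)\<^sup>2 / 2))) \<le> p j * ((2 * real R) ^ 3 * \<bar>\<theta>\<bar> ^ 3)"
        unfolding norm_mult norm_of_real abs_of_nonneg[OF sl.p_nonneg] by (intro mult_left_mono sl.p_nonneg)
    qed
    also have "\<dots> = (2 * real R) ^ 3 * \<bar>\<theta>\<bar> ^ 3"
      unfolding sum_distrib_right[symmetric] sl.p_sum by simp
    finally have 1: "norm (ph \<theta> - of_real (1 - sl.var * \<theta>\<^sup>2 / 2)) \<le> (2 * real R) ^ 3 * \<bar>\<theta>\<bar> ^ 3" .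
    have "\<bar>exp (- (sl.var * \<theta>\<^sup>2 / 2)) - (1 - sl.var * \<theta>\<^sup>2 / 2)\<bar> \<le> (sl.var * \<theta>\<^sup>2 / 2)\<^sup>2 / 2"
      using sl.var_pos by (intro exp_minus_remainder) auto
    also have "\<dots> = sl.var\<^sup>2 * \<theta> ^ 4 / 8"
      by (simp add: power4_eq_xxxx power2_eq_square)
    also have "\<dots> \<le> sl.var\<^sup>2 * \<theta> ^ 4" by simp
    finally have 2: "norm (complex_of_real (1 - sl.var * \<theta>\<^sup>2 / 2) - of_real (exp (- (sl.var * \<theta>\<^sup>2 / 2)))) \<le> sl.var\<^sup>2 * \<theta> ^ 4"
      unfolding of_real_diff[symmetric] norm_of_real by (simp only: abs_minus_commute)
    have "norm (ph \<theta> - of_real (exp (- (sl.var * \<theta>\<^sup>2 / 2)))) \<le> (2 * real R) ^ 3 * \<bar>\<theta>\<bar> ^ 3 + sl.var\<^sup>2 * \<theta> ^ 4"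
      using norm_triangle_ineq[of "ph \<theta> - of_real (1 - sl.var * \<theta>\<^sup>2 / 2)" "complex_of_real (1 - sl.var * \<theta>\<^sup>2 / 2) - of_real (exp (- (sl.var * \<theta>\<^sup>2 / 2)))"] 1 2
      by simp
    also have "\<dots> \<le> C * (\<bar>\<theta>\<bar> ^ 3 + \<theta> ^ 4)"
    proof -
      have "0 \<le> (2 * real R) ^ 3 * \<theta> ^ 4 + sl.var\<^sup>2 * \<bar>\<theta>\<bar> ^ 3"
        by (intro add_nonneg_nonneg mult_nonneg_nonneg) auto
      then show ?thesis unfolding C_def by (simp add: algebra_simps)
    qed
    finally show ?thesis .
  qed
  then show ?thesis by blast
qed

text \<open>For numbers in the unit disc, the m-th powers differ by at most m times the difference
  of the numbers. The errors of order n^(-3/2) and n^(-2) therefore survive multiplication by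
  \<open>m n\<close>, which is of order n.\<close>

lemma ph_power_limit:
  assumes "(\<lambda>n. real (m n) / real n) \<longlonglongrightarrow> \<tau>"
  shows "(\<lambda>n. ph (\<theta> / sqrt (real n)) ^ m n) \<longlonglongrightarrow> of_real (exp (- (sl.var * \<tau> * \<theta>\<^sup>2 / 2)))"
proof -
  obtain C where C: "\<And>\<theta>. norm (ph \<theta> - of_real (exp (- (sl.var * \<theta>\<^sup>2 / 2)))) \<le> C * (\<bar>\<theta>\<bar> ^ 3 + \<theta> ^ 4)"
    using ph_approx by blast
  let ?t = "\<lambda>n. \<theta> / sqrt (real n)"
  let ?e = "\<lambda>n. complex_of_real (exp (- (sl.var * (?t n)\<^sup>2 / 2)))"
  have "(\<lambda>n. ph (?t n) ^ m n - ?e n ^ m n) \<longlonglongrightarrow> 0"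
  proof (rule Lim_null_comparison)
    show "eventually (\<lambda>n. norm (ph (?t n) ^ m n - ?e n ^ m n) \<le>
       real (m n) / real n * (C * (\<bar>\<theta>\<bar> ^ 3 / sqrt (real n) + \<theta> ^ 4 / real n))) sequentially"
      using eventually_gt_at_top[of 0]
    proof eventually_elim
      case (elim n)
      have "norm (ph (?t n) ^ m n - ?e n ^ m n) \<le> real (m n) * norm (ph (?t n) - ?e n)"
        using sl.var_pos by (intro norm_power_diff norm_ph) simp
      also have "\<dots> \<le> real (m n) * (C * (\<bar>?t n\<bar> ^ 3 + ?t n ^ 4))"
        by (intro mult_left_mono C) auto
      also have "\<bar>?t n\<bar> ^ 3 = \<bar>\<theta>\<bar> ^ 3 / sqrt (real n) / real n"
        using elim by (simp add: power_divide power3_eq_cube)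
      also have "?t n ^ 4 = \<theta> ^ 4 / real n / real n"
        using elim by (simp add: power_divide power4_eq_xxxx)
      finally show ?case by (simp add: algebra_simps add_divide_distrib)
    qed
    have "(\<lambda>n. \<bar>\<theta>\<bar> ^ 3 / sqrt (real n)) \<longlonglongrightarrow> 0" "(\<lambda>n. \<theta> ^ 4 / real n) \<longlonglongrightarrow> 0" by real_asymp+
    then have "(\<lambda>n. real (m n) / real n * (C * (\<bar>\<theta>\<bar> ^ 3 / sqrt (real n) + \<theta> ^ 4 / real n))) \<longlonglongrightarrow> \<tau> * (C * (0 + 0))"
      by (intro tendsto_mult tendsto_const tendsto_add assms)
    then show "(\<lambda>n. real (m n) / real n * (C * (\<bar>\<theta>\<bar> ^ 3 / sqrt (real n) + \<theta> ^ 4 / real n))) \<longlonglongrightarrow> 0" by simp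
  qed
  moreover have "(\<lambda>n. ?e n ^ m n) \<longlonglongrightarrow> of_real (exp (- (sl.var * \<tau> * \<theta>\<^sup>2 / 2)))"
  proof -
    have "(\<lambda>n. complex_of_real (exp (- (sl.var * (real (m n) / real n) * \<theta>\<^sup>2 / 2)))) \<longlonglongrightarrow> of_real (exp (- (sl.var * \<tau> * \<theta>\<^sup>2 / 2)))"
      by (intro tendsto_intros assms) auto
    moreover have "complex_of_real (exp (- (sl.var * (real (m n) / real n) * \<theta>\<^sup>2 / 2))) = ?e n ^ m n" for n
      unfolding of_real_power[symmetric] exp_of_nat_mult[symmetric] by (simp add: power_divide mult_ac)
    ultimately show ?thesis by simp
  qed
  ultimately show ?thesis using tendsto_add by fastforce
qed

end

section \<open>Mean absolute differences of two walks\<close>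

context walk begin

text \<open>Given the environment the walks are independent, so the characteristic function of their
  difference factorizes; the exponential in front restores the centring removed in
  \<open>Q\<close>.\<close>

lemma EVV_cos: "EVV T k T' k' l x (\<lambda>y z. cos (u * of_int (y - z))) =
    Re (iexp (u * (ctr T k l - ctr T' k' l)) * (Q T k l u x * cnj (Q T' k' l u x)))"
proof -
  let ?e = "iexp (u * (ctr T k l - ctr T' k' l))"
  have "?e * (Q T k l u x * cnj (Q T' k' l u x)) =
     (\<Sum>y\<in>Bx T k. \<Sum>z\<in>Bx T' k'. (V T k l x y * V T' k' l x z) *\<^sub>R iexp (u * of_int (y - z)))"
  proof -
    have "?e * (Q T k l u x * cnj (Q T' k' l u x)) = (\<Sum>y\<in>Bx T k. \<Sum>z\<in>Bx T' k'. ?e *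
       ((V T k l x y *\<^sub>R iexp (u * (of_int y - ctr T k l))) * cnj (V T' k' l x z *\<^sub>R iexp (u * (of_int z - ctr T' k' l)))))"
    proof -
      have "Q T k l u x * cnj (Q T' k' l u x) = (\<Sum>y\<in>Bx T k. \<Sum>z\<in>Bx T' k'.
         (V T k l x y *\<^sub>R iexp (u * (of_int y - ctr T k l))) * cnj (V T' k' l x z *\<^sub>R iexp (u * (of_int z - ctr T' k' l))))"
        unfolding Q_def EV_def cnj_sum sum_product ..
      then show ?thesis by (simp only: sum_distrib_left)
    qed
    also have "\<dots> = (\<Sum>y\<in>Bx T k. \<Sum>z\<in>Bx T' k'. (V T k l x y * V T' k' l x z) *\<^sub>R iexp (u * of_int (y - z)))"
    proof (intro sum.cong refl)
      fix y z
      have "iexp (u * (ctr T k l - ctr T' k' l)) * (iexp (u * (of_int y - ctr T k l)) * cnj (iexp (u * (of_int z - ctr T' k' l)))) =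
        iexp (u * of_int (y - z))"
      proof -
        have c: "cnj (iexp a) = iexp (- a)" for a :: real
          by (simp add: exp_cnj)
        show ?thesis unfolding c exp_add[symmetric] by (simp add: algebra_simps)
      qed
      then show "?e * ((V T k l x y *\<^sub>R iexp (u * (of_int y - ctr T k l))) * cnj (V T' k' l x z *\<^sub>R iexp (u * (of_int z - ctr T' k' l))))
        = (V T k l x y * V T' k' l x z) *\<^sub>R iexp (u * of_int (y - z))"
        by (simp add: scaleR_conv_of_real mult_ac)
    qed
    finally show ?thesis .
  qed
  then show ?thesis unfolding EVV_def by (simp add: Re_exp)
qed

lemma EVV_cos_bounds:
  assumes x: "x \<in> space M"
  shows "\<bar>EVV T k T' k' l x (\<lambda>y z. cos (u * of_int (y - z)))\<bar> \<le> 1"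
    "1 - EVV T k T' k' l x (\<lambda>y z. cos (u * of_int (y - z))) \<le> u\<^sup>2 / 2 * EVV T k T' k' l x (\<lambda>y z. (of_int (y - z))\<^sup>2)"
proof -
  have "EVV T k T' k' l x (\<lambda>y z. \<bar>cos (u * of_int (y - z))\<bar>) \<le> EVV T k T' k' l x (\<lambda>_ _. 1)"
    by (rule EVV_mono[OF x]) auto
  then show "\<bar>EVV T k T' k' l x (\<lambda>y z. cos (u * of_int (y - z)))\<bar> \<le> 1"
    using EVV_abs[OF x, of T k T' k' l "\<lambda>y z. cos (u * of_int (y - z))"] by (simp add: EVV_const[OF x])
  have "EVV T k T' k' l x (\<lambda>y z. 1 - cos (u * of_int (y - z))) \<le> EVV T k T' k' l x (\<lambda>y z. u\<^sup>2 / 2 * (of_int (y - z))\<^sup>2)"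
  proof (rule EVV_mono[OF x])
    show "1 - cos (u * of_int (y - z)) \<le> u\<^sup>2 / 2 * (of_int (y - z))\<^sup>2" for y z
      using one_minus_cos_le[of "u * of_int (y - z)"] by (simp add: power_mult_distrib)
  qed
  then show "1 - EVV T k T' k' l x (\<lambda>y z. cos (u * of_int (y - z))) \<le> u\<^sup>2 / 2 * EVV T k T' k' l x (\<lambda>y z. (of_int (y - z))\<^sup>2)"
    unfolding EVV_diff EVV_cmult EVV_const[OF x] .
qed

text \<open>By the cosine integral, the difference of |z| and its limit is an integral over \<theta>
  of differences of characteristic functions divided by \<theta>^2. For fixed \<theta> these tend to
  0 in mean by \<open>Q_L1\<close> and \<open>ph_power_limit\<close>. The limit may be taken under
  the integral because the mean error is bounded for large \<theta> and at most a multiple of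
  \<theta>^2 for small \<theta>.\<close>

lemma abs_difference_limit:
  fixes T T' l :: "nat \<Rightarrow> nat" and k k' :: "nat \<Rightarrow> int"
  assumes l: "\<And>n. l n \<le> T n" "\<And>n. l n \<le> T' n"
    and t: "(\<lambda>n. real (T n) / real n) \<longlonglongrightarrow> t" "(\<lambda>n. real (T' n) / real n) \<longlonglongrightarrow> t'"
    and tau: "(\<lambda>n. real (T n - l n) / real n) \<longlonglongrightarrow> \<tau>" "(\<lambda>n. real (T' n - l n) / real n) \<longlonglongrightarrow> \<tau>'"
    and rho: "(\<lambda>n. (ctr (T n) (k n) (l n) - ctr (T' n) (k' n) (l n)) / sqrt (real n)) \<longlonglongrightarrow> \<rho>"
  shows "(\<lambda>n. expectation (\<lambda>x. \<bar>EVV (T n) (k n) (T' n) (k' n) (l n) x (\<lambda>y z. \<bar>of_int (y - z)\<bar>) / sqrt (real n)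
      - Lam (sl.var * (\<tau> + \<tau>')) \<rho>\<bar>)) \<longlonglongrightarrow> 0"
proof -
  define v where "v = sl.var * (\<tau> + \<tau>')"
  have tau0: "0 \<le> \<tau>" "0 \<le> \<tau>'"
    using tau by (auto intro!: LIMSEQ_le_const)
  have v0: "0 \<le> v" using tau0 sl.var_pos by (simp add: v_def)
  define G where "G \<theta> = cos (\<theta> * \<rho>) * exp (- (\<theta>\<^sup>2 * v / 2))" for \<theta>
  define E where "E n \<theta> x = EVV (T n) (k n) (T' n) (k' n) (l n) x (\<lambda>y z. cos (\<theta> / sqrt (real n) * of_int (y - z)))" for n \<theta> x
  define e where "e n \<theta> = expectation (\<lambda>x. \<bar>E n \<theta> x - G \<theta>\<bar>)" for n \<theta>
  define \<Delta> where "\<Delta> n = ctr (T n) (k n) (l n) - ctr (T' n) (k' n) (l n)" for n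
  have E1: "\<bar>E n \<theta> x\<bar> \<le> 1" if "x \<in> space M" for n \<theta> x
    unfolding E_def by (rule EVV_cos_bounds(1)[OF that])
  have G1: "\<bar>G \<theta>\<bar> \<le> 1" for \<theta>
    unfolding G_def abs_mult using v0 by (intro mult_le_one) auto
  have EM[measurable]: "(\<lambda>x. E n \<theta> x) \<in> borel_measurable M" for n \<theta>
    unfolding E_def EVV_def by measurable
  have iE: "integrable M (\<lambda>x. E n \<theta> x)" for n \<theta>
    unfolding E_def by (rule EVV_integrable)
  have iEG: "integrable M (\<lambda>x. \<bar>E n \<theta> x - G \<theta>\<bar>)" for n \<theta>
    using iE by auto
  have e0: "0 \<le> e n \<theta>" for n \<theta> unfolding e_def by (intro integral_nonneg_AE AE_I2) auto
  have e2: "e n \<theta> \<le> 2" for n \<theta>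
  proof -
    have "e n \<theta> \<le> expectation (\<lambda>_. 2)"
      unfolding e_def
    proof (rule integral_mono[OF iEG])
      show "\<bar>E n \<theta> x - G \<theta>\<bar> \<le> 2" if "x \<in> space M" for x
        using E1[OF that, of n \<theta>] G1[of \<theta>] by linarith
    qed auto
    then show ?thesis using prob_space by simp
  qed
  define b where "b n = 3 * (sl.var * (real (T n - l n) / real n) + sl.var * (real (T' n - l n) / real n) + (\<Delta> n / sqrt (real n))\<^sup>2)" for n
  have "b \<longlonglongrightarrow> 3 * (sl.var * \<tau> + sl.var * \<tau>' + \<rho>\<^sup>2)"
    unfolding b_def \<Delta>_def by (intro tendsto_intros tau rho)
  then have "convergent b" by (rule convergentI)
  then obtain K where K: "\<And>n. \<bar>b n\<bar> \<le> K"
    using convergent_imp_Bseq[of b] by (auto simp: Bseq_def)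
  \<comment> \<open>Half of the second-moment bound for the rescaled difference, plus half of the
    mean square \<open>\<rho>\<^sup>2 + v\<close> of the limiting Gaussian: both follow from 1 - cos
    u \<le> u^2 / 2 and its analogue for the exponential.\<close>
  define K' where "K' = K / 2 + \<rho>\<^sup>2 / 2 + v / 2"
  have eK: "e n \<theta> \<le> K' * \<theta>\<^sup>2" for n \<theta>
  proof -
    let ?S = "\<lambda>x. EVV (T n) (k n) (T' n) (k' n) (l n) x (\<lambda>y z. (of_int (y - z))\<^sup>2)"
    have G2: "1 - G \<theta> \<le> (\<rho>\<^sup>2 / 2 + v / 2) * \<theta>\<^sup>2"
    proof -
      have a: "1 - cos (\<theta> * \<rho>) \<le> \<theta>\<^sup>2 * \<rho>\<^sup>2 / 2" using one_minus_cos_le[of "\<theta> * \<rho>"] by (simp add: power_mult_distrib)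
      have b: "1 - exp (- (\<theta>\<^sup>2 * v / 2)) \<le> \<theta>\<^sup>2 * v / 2" using exp_ge_add_one_self[of "- (\<theta>\<^sup>2 * v / 2)"] by simp
      have "1 - G \<theta> = (1 - cos (\<theta> * \<rho>)) + cos (\<theta> * \<rho>) * (1 - exp (- (\<theta>\<^sup>2 * v / 2)))"
        by (simp add: G_def algebra_simps)
      also have "\<dots> \<le> (1 - cos (\<theta> * \<rho>)) + 1 * (1 - exp (- (\<theta>\<^sup>2 * v / 2)))"
        using v0 by (intro add_left_mono mult_right_mono) auto
      also have "\<dots> \<le> \<theta>\<^sup>2 * \<rho>\<^sup>2 / 2 + \<theta>\<^sup>2 * v / 2" using a b by simp
      finally show ?thesis by (simp add: algebra_simps)
    qed
    have "e n \<theta> \<le> expectation (\<lambda>x. (\<theta> / sqrt (real n))\<^sup>2 / 2 * ?S x + (\<rho>\<^sup>2 / 2 + v / 2) * \<theta>\<^sup>2)"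
      unfolding e_def
    proof (rule integral_mono[OF iEG])
      show "integrable M (\<lambda>x. (\<theta> / sqrt (real n))\<^sup>2 / 2 * ?S x + (\<rho>\<^sup>2 / 2 + v / 2) * \<theta>\<^sup>2)"
        by (intro Bochner_Integration.integrable_add integrable_mult_right EVV_integrable integrable_const)
      fix x assume x: "x \<in> space M"
      have "1 - E n \<theta> x \<le> (\<theta> / sqrt (real n))\<^sup>2 / 2 * ?S x"
        unfolding E_def by (rule EVV_cos_bounds(2)[OF x])
      then show "\<bar>E n \<theta> x - G \<theta>\<bar> \<le> (\<theta> / sqrt (real n))\<^sup>2 / 2 * ?S x + (\<rho>\<^sup>2 / 2 + v / 2) * \<theta>\<^sup>2"
        using G2 E1[OF x, of n \<theta>] G1[of \<theta>] by linarith
    qed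
    also have "\<dots> = \<theta>\<^sup>2 / real n / 2 * expectation ?S + (\<rho>\<^sup>2 / 2 + v / 2) * \<theta>\<^sup>2"
      using prob_space by (simp add: EVV_integrable power_divide)
    also have "\<theta>\<^sup>2 / real n / 2 * expectation ?S \<le> \<theta>\<^sup>2 / real n / 2 * (3 * (sl.var * real (T n - l n) + sl.var * real (T' n - l n) + (\<Delta> n)\<^sup>2))"
      unfolding \<Delta>_def by (intro mult_left_mono EVV_second_moment) auto
    also have "\<dots> = \<theta>\<^sup>2 / 2 * b n"
      unfolding b_def by (simp add: power_divide add_divide_distrib distrib_left)
    also have "\<dots> \<le> \<theta>\<^sup>2 / 2 * K" using K[of n] by (intro mult_left_mono) auto
    finally show ?thesis by (simp add: K'_def algebra_simps)
  qed
  have K'0: "0 \<le> K'" using order_trans[OF e0 eK[of 0 1]] by simp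
  have etend: "(\<lambda>n. e n \<theta>) \<longlonglongrightarrow> 0" for \<theta>
  proof -
    obtain C where C: "C \<ge> 0" "\<And>T k l \<theta>. l \<le> T \<Longrightarrow>
      expectation (\<lambda>x. norm (Q T k l \<theta> x - ph \<theta> ^ (T - l))) \<le> C * \<bar>\<theta>\<bar> * sqrt (sqrt (real T + 1))"
      using Q_L1 by blast
    let ?u = "\<lambda>n. \<theta> / sqrt (real n)"
    let ?a = "\<lambda>n. ph (?u n) ^ (T n - l n)" and ?b = "\<lambda>n. ph (?u n) ^ (T' n - l n)"
    let ?L = "\<lambda>n. Re (iexp (?u n * \<Delta> n) * (?a n * cnj (?b n)))"
    let ?w = "\<lambda>T n. C * \<bar>?u n\<bar> * sqrt (sqrt (real (T n) + 1))"
    have Llim: "?L \<longlonglongrightarrow> G \<theta>"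
    proof -
      have "(\<lambda>n. iexp (\<theta> * (\<Delta> n / sqrt (real n)))) \<longlonglongrightarrow> iexp (\<theta> * \<rho>)"
        unfolding \<Delta>_def by (intro tendsto_intros rho)
      moreover have "\<theta> * (\<Delta> n / sqrt (real n)) = ?u n * \<Delta> n" for n by simp
      ultimately have l: "(\<lambda>n. iexp (?u n * \<Delta> n)) \<longlonglongrightarrow> iexp (\<theta> * \<rho>)" by (simp only:)
      have "?L \<longlonglongrightarrow> Re (iexp (\<theta> * \<rho>) * (of_real (exp (- (sl.var * \<tau> * \<theta>\<^sup>2 / 2))) * cnj (of_real (exp (- (sl.var * \<tau>' * \<theta>\<^sup>2 / 2))))))"
        by (intro tendsto_Re tendsto_mult tendsto_cnj l ph_power_limit tau)
      moreover have "exp (- (sl.var * \<tau> * \<theta>\<^sup>2 / 2)) * exp (- (sl.var * \<tau>' * \<theta>\<^sup>2 / 2)) = exp (- (\<theta>\<^sup>2 * v / 2))"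
        unfolding exp_add[symmetric] v_def by (simp add: algebra_simps add_divide_distrib)
      ultimately show ?thesis
        unfolding complex_cnj_complex_of_real of_real_mult[symmetric] by (simp add: G_def Re_exp)
    qed
    \<comment> \<open>The scale 1 / sqrt n of the frequency beats the fourth root of
      \<open>T n\<close>, which is of order n.\<close>
    have wlim: "?w T \<longlonglongrightarrow> 0" if "(\<lambda>n. real (T n) / real n) \<longlonglongrightarrow> t" for T t
    proof -
      have i: "(\<lambda>n. 1 / real n) \<longlonglongrightarrow> 0" by real_asymp
      have "(\<lambda>n. C * \<bar>\<theta>\<bar> * sqrt (sqrt ((real (T n) / real n + 1 / real n) * (1 / real n)))) \<longlonglongrightarrow> C * \<bar>\<theta>\<bar> * sqrt (sqrt ((t + 0) * 0))"
        by (intro tendsto_mult tendsto_const tendsto_real_sqrt tendsto_add that i)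
      moreover have "C * \<bar>\<theta>\<bar> * sqrt (sqrt ((real (T n) / real n + 1 / real n) * (1 / real n))) = ?w T n" for n
      proof -
        have "(real (T n) / real n + 1 / real n) * (1 / real n) = (real (T n) + 1) / (real n * real n)"
          by (simp add: add_divide_distrib)
        then have "sqrt (sqrt ((real (T n) / real n + 1 / real n) * (1 / real n))) = sqrt (sqrt (real (T n) + 1)) / sqrt (real n)"
          by (simp add: real_sqrt_divide)
        then show ?thesis by simp
      qed
      ultimately show ?thesis by simp
    qed
    have "e n \<theta> \<le> ?w T n + ?w T' n + \<bar>?L n - G \<theta>\<bar>" for n
    proof -
      let ?q = "\<lambda>x. Q (T n) (k n) (l n) (?u n) x" and ?q' = "\<lambda>x. Q (T' n) (k' n) (l n) (?u n) x"
      have iq: "integrable M (\<lambda>x. norm (?q x - ?a n))" "integrable M (\<lambda>x. norm (?q' x - ?b n))"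
        by (intro integrable_norm Bochner_Integration.integrable_diff integrable_const integrable_const_bound[of _ 1] AE_I2 norm_Q Q_M; assumption?)+
      have "e n \<theta> \<le> expectation (\<lambda>x. norm (?q x - ?a n) + norm (?q' x - ?b n) + \<bar>?L n - G \<theta>\<bar>)"
        unfolding e_def
      proof (rule integral_mono[OF iEG])
        show "integrable M (\<lambda>x. norm (?q x - ?a n) + norm (?q' x - ?b n) + \<bar>?L n - G \<theta>\<bar>)"
          by (intro Bochner_Integration.integrable_add iq integrable_const)
        fix x assume x: "x \<in> space M"
        have "E n \<theta> x = Re (iexp (?u n * \<Delta> n) * (?q x * cnj (?q' x)))"
          unfolding E_def EVV_cos \<Delta>_def ..
        then have "E n \<theta> x - ?L n = Re (iexp (?u n * \<Delta> n) * (?q x * cnj (?q' x) - ?a n * cnj (?b n)))"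
          by (simp only: right_diff_distrib minus_complex.sel)
        then have "\<bar>E n \<theta> x - ?L n\<bar> \<le> norm (iexp (?u n * \<Delta> n) * (?q x * cnj (?q' x) - ?a n * cnj (?b n)))"
          by (simp only: abs_Re_le_cmod)
        also have "\<dots> = norm ((?q x - ?a n) * cnj (?q' x) + ?a n * cnj (?q' x - ?b n))"
          unfolding norm_mult norm_exp_i_times by (simp add: algebra_simps)
        also have "\<dots> \<le> norm (?q x - ?a n) * norm (?q' x) + norm (?a n) * norm (?q' x - ?b n)"
          by (rule order_trans[OF norm_triangle_ineq]) (simp only: norm_mult complex_mod_cnj order_refl)
        also have "\<dots> \<le> norm (?q x - ?a n) * 1 + 1 * norm (?q' x - ?b n)"
          by (intro add_mono mult_mono norm_Q x order_refl) (auto simp: norm_power intro!: power_le_one norm_ph)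
        finally show "\<bar>E n \<theta> x - G \<theta>\<bar> \<le> norm (?q x - ?a n) + norm (?q' x - ?b n) + \<bar>?L n - G \<theta>\<bar>"
          by linarith
      qed
      also have "\<dots> = expectation (\<lambda>x. norm (?q x - ?a n)) + expectation (\<lambda>x. norm (?q' x - ?b n)) + \<bar>?L n - G \<theta>\<bar>"
        using iq prob_space by simp
      also have "\<dots> \<le> ?w T n + ?w T' n + \<bar>?L n - G \<theta>\<bar>"
        by (intro add_mono C(2) l order_refl)
      finally show ?thesis .
    qed
    then have "eventually (\<lambda>n. norm (e n \<theta>) \<le> ?w T n + ?w T' n + \<bar>?L n - G \<theta>\<bar>) sequentially"
      using e0 by (intro always_eventually) auto
    moreover have "(\<lambda>n. ?w T n + ?w T' n + \<bar>?L n - G \<theta>\<bar>) \<longlonglongrightarrow> 0 + 0 + \<bar>G \<theta> - G \<theta>\<bar>"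
      by (intro tendsto_add tendsto_rabs tendsto_diff tendsto_const Llim wlim[OF t(1)] wlim[OF t(2)])
    ultimately show ?thesis by (intro Lim_null_comparison[of "\<lambda>n. e n \<theta>"]) simp_all
  qed
  \<comment> \<open>An integrable majorant of min(2, \<open>K' * \<theta>\<^sup>2\<close>) /
    \<theta>^2 that needs no splitting of the line.\<close>
  define w where "w \<theta> = (2 * K' + 4) * inverse (1 + \<theta>\<^sup>2)" for \<theta> :: real
  have iw: "integrable lborel w"
    using integrable_inverse_1_plus_square unfolding w_def set_integrable_def by (simp add: einterval_def)
  have ew: "e n \<theta> / \<theta>\<^sup>2 \<le> w \<theta>" for n \<theta>
  proof (cases "\<theta> = 0")
    case True
    then show ?thesis using K'0 by (simp add: w_def)
  next
    case False
    then have p: "\<theta>\<^sup>2 > 0" by simp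
    have "e n \<theta> * (1 + \<theta>\<^sup>2) \<le> (2 * K' + 4) * \<theta>\<^sup>2"
    proof -
      have "e n \<theta> * (1 + \<theta>\<^sup>2) = e n \<theta> + e n \<theta> * \<theta>\<^sup>2" by (simp add: algebra_simps)
      also have "\<dots> \<le> K' * \<theta>\<^sup>2 + 2 * \<theta>\<^sup>2" using e2[of n \<theta>] by (intro add_mono eK mult_right_mono) auto
      also have "\<dots> \<le> (2 * K' + 4) * \<theta>\<^sup>2" using K'0 p by (simp add: algebra_simps)
      finally show ?thesis .
    qed
    then show ?thesis using p unfolding w_def
      by (simp add: divide_le_eq field_simps add_pos_pos)
  qed
  have eM[measurable]: "(\<lambda>\<theta>. e n \<theta>) \<in> borel_measurable lborel" for n
    unfolding e_def E_def EVV_def G_def by measurable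
  have ie: "integrable lborel (\<lambda>\<theta>. e n \<theta> / \<theta>\<^sup>2)" for n
  proof (rule Bochner_Integration.integrable_bound[OF iw])
    show "AE \<theta> in lborel. norm (e n \<theta> / \<theta>\<^sup>2) \<le> norm (w \<theta>)"
    proof (rule AE_I2)
      fix \<theta>
      have "0 \<le> e n \<theta> / \<theta>\<^sup>2" using e0 by simp
      with ew[of n \<theta>] show "norm (e n \<theta> / \<theta>\<^sup>2) \<le> norm (w \<theta>)" by simp
    qed
  qed measurable
  have lim0: "(\<lambda>n. \<integral>\<theta>. e n \<theta> / \<theta>\<^sup>2 \<partial>lborel) \<longlonglongrightarrow> integral\<^sup>L lborel (\<lambda>\<theta>::real. 0 :: real)"
  proof (rule integral_dominated_convergence[where w = w])
    show "integrable lborel w" by (rule iw)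
    show "AE \<theta> in lborel. (\<lambda>n. e n \<theta> / \<theta>\<^sup>2) \<longlonglongrightarrow> 0"
      by (intro AE_I2 tendsto_divide_zero etend)
    show "AE \<theta> in lborel. norm (e n \<theta> / \<theta>\<^sup>2) \<le> w \<theta>" for n
      using ew[of n] e0[of n] by (intro AE_I2) (simp add: abs_of_nonneg)
  qed measurable
  have iG: "integrable lborel (\<lambda>\<theta>. (1 - G \<theta>) / \<theta>\<^sup>2)"
  proof (cases "v = 0")
    case True
    then show ?thesis using abs_eq_integral_cos[of \<rho>] by (simp add: G_def has_bochner_integral_iff)
  next
    case False
    then show ?thesis using Lam_normal(2)[of v \<rho>] v0 by (simp add: G_def)
  qed
  have LamG: "(\<integral>\<theta>. (1 - G \<theta>) / \<theta>\<^sup>2 \<partial>lborel) = pi * Lam v \<rho>"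
    by (simp add: Lam_def G_def)
  let ?D = "\<lambda>n x. EVV (T n) (k n) (T' n) (k' n) (l n) x (\<lambda>y z. \<bar>of_int (y - z)\<bar>) / sqrt (real n) - Lam v \<rho>"
  have iD: "integrable M (\<lambda>x. \<bar>?D n x\<bar>)" for n
    by (intro integrable_abs Bochner_Integration.integrable_diff integrable_divide EVV_integrable integrable_const)
  \<comment> \<open>The exchange of the mean and the integral is done for absolute values in the
    extended sense, where Tonelli needs only measurability; \<open>n > 0\<close> makes the rescaling
    by \<open>sqrt (real n)\<close> genuine.\<close>
  have main: "pi * expectation (\<lambda>x. \<bar>?D n x\<bar>) \<le> (\<integral>\<theta>. e n \<theta> / \<theta>\<^sup>2 \<partial>lborel)" if n: "n > 0" for n
  proof -
    interpret P: pair_sigma_finite lborel M ..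
    let ?h = "\<lambda>\<theta> x. (G \<theta> - E n \<theta> x) / \<theta>\<^sup>2"
    have hM: "(\<lambda>(\<theta>, x). ennreal \<bar>?h \<theta> x\<bar>) \<in> borel_measurable (lborel \<Otimes>\<^sub>M M)"
      unfolding E_def EVV_def G_def by measurable
    have rep: "has_bochner_integral lborel (\<lambda>\<theta>. ?h \<theta> x) (pi * ?D n x)" if x: "x \<in> space M" for x
    proof -
      have "has_bochner_integral lborel (\<lambda>\<theta>. EVV (T n) (k n) (T' n) (k' n) (l n) x (\<lambda>y z. (1 - cos (\<theta> * (of_int (y - z) / sqrt (real n)))) / \<theta>\<^sup>2))
         (EVV (T n) (k n) (T' n) (k' n) (l n) x (\<lambda>y z. pi * \<bar>of_int (y - z) / sqrt (real n)\<bar>))"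
        unfolding EVV_def by (intro has_bochner_integral_sum has_bochner_integral_mult_right abs_eq_integral_cos)
      moreover have "EVV (T n) (k n) (T' n) (k' n) (l n) x (\<lambda>y z. (1 - cos (\<theta> * (of_int (y - z) / sqrt (real n)))) / \<theta>\<^sup>2) = (1 - E n \<theta> x) / \<theta>\<^sup>2" for \<theta>
        using EVV_cmult[of "T n" "k n" "T' n" "k' n" "l n" x "1 / \<theta>\<^sup>2" "\<lambda>y z. 1 - cos (\<theta> / sqrt (real n) * of_int (y - z))"]
        unfolding EVV_diff EVV_const[OF x] E_def by simp
      moreover have "EVV (T n) (k n) (T' n) (k' n) (l n) x (\<lambda>y z. pi * \<bar>of_int (y - z) / sqrt (real n)\<bar>) = pi * (EVV (T n) (k n) (T' n) (k' n) (l n) x (\<lambda>y z. \<bar>of_int (y - z)\<bar>) / sqrt (real n))"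
        using EVV_cmult[of "T n" "k n" "T' n" "k' n" "l n" x "pi / sqrt (real n)" "\<lambda>y z. \<bar>of_int (y - z)\<bar>"]
        by (simp add: abs_divide)
      ultimately have 1: "has_bochner_integral lborel (\<lambda>\<theta>. (1 - E n \<theta> x) / \<theta>\<^sup>2) (pi * (EVV (T n) (k n) (T' n) (k' n) (l n) x (\<lambda>y z. \<bar>of_int (y - z)\<bar>) / sqrt (real n)))"
        by simp
      have 2: "has_bochner_integral lborel (\<lambda>\<theta>. (1 - G \<theta>) / \<theta>\<^sup>2) (pi * Lam v \<rho>)"
        using iG LamG by (simp add: has_bochner_integral_iff)
      have "(\<lambda>\<theta>. (1 - E n \<theta> x) / \<theta>\<^sup>2 - (1 - G \<theta>) / \<theta>\<^sup>2) = (\<lambda>\<theta>. ?h \<theta> x)"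
        by (simp add: diff_divide_distrib[symmetric])
      with has_bochner_integral_diff[OF 1 2] show ?thesis by (simp only: right_diff_distrib)
    qed
    have pt: "ennreal (pi * \<bar>?D n x\<bar>) \<le> (\<integral>\<^sup>+\<theta>. ennreal \<bar>?h \<theta> x\<bar> \<partial>lborel)" if x: "x \<in> space M" for x
    proof -
      have i: "integrable lborel (\<lambda>\<theta>. ?h \<theta> x)" and d: "(\<integral>\<theta>. ?h \<theta> x \<partial>lborel) = pi * ?D n x"
        using rep[OF x] by (auto simp: has_bochner_integral_iff)
      show ?thesis using integral_norm_bound_ennreal[OF i] unfolding d by (simp add: abs_mult)
    qed
    have "ennreal (pi * expectation (\<lambda>x. \<bar>?D n x\<bar>)) = (\<integral>\<^sup>+x. ennreal (pi * \<bar>?D n x\<bar>) \<partial>M)"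
      using iD[of n] by (subst nn_integral_eq_integral) auto
    also have "\<dots> \<le> (\<integral>\<^sup>+x. (\<integral>\<^sup>+\<theta>. ennreal \<bar>?h \<theta> x\<bar> \<partial>lborel) \<partial>M)"
      by (intro nn_integral_mono pt)
    also have "\<dots> = (\<integral>\<^sup>+\<theta>. (\<integral>\<^sup>+x. ennreal \<bar>?h \<theta> x\<bar> \<partial>M) \<partial>lborel)"
      using P.Fubini[OF hM] by simp
    also have "\<dots> = (\<integral>\<^sup>+\<theta>. ennreal (e n \<theta> / \<theta>\<^sup>2) \<partial>lborel)"
    proof (rule nn_integral_cong)
      fix \<theta>
      have "(\<integral>\<^sup>+x. ennreal \<bar>?h \<theta> x\<bar> \<partial>M) = (\<integral>\<^sup>+x. ennreal (\<bar>E n \<theta> x - G \<theta>\<bar> / \<theta>\<^sup>2) \<partial>M)"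
        by (simp add: abs_minus_commute)
      also have "\<dots> = ennreal (expectation (\<lambda>x. \<bar>E n \<theta> x - G \<theta>\<bar> / \<theta>\<^sup>2))"
        using iEG[of n \<theta>] by (intro nn_integral_eq_integral) auto
      finally show "(\<integral>\<^sup>+x. ennreal \<bar>?h \<theta> x\<bar> \<partial>M) = ennreal (e n \<theta> / \<theta>\<^sup>2)" by (simp add: e_def)
    qed
    also have "\<dots> = ennreal (\<integral>\<theta>. e n \<theta> / \<theta>\<^sup>2 \<partial>lborel)"
      using e0 by (intro nn_integral_eq_integral ie AE_I2) auto
    finally show ?thesis
      using e0 by (subst (asm) ennreal_le_iff) (auto intro!: integral_nonneg_AE AE_I2)
  qed
  show ?thesis
    unfolding v_def[symmetric]
  proof (rule Lim_null_comparison)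
    show "eventually (\<lambda>n. norm (expectation (\<lambda>x. \<bar>?D n x\<bar>)) \<le> (\<integral>\<theta>. e n \<theta> / \<theta>\<^sup>2 \<partial>lborel) / pi) sequentially"
      using eventually_gt_at_top[of 0]
    proof eventually_elim
      case (elim n)
      have "0 \<le> expectation (\<lambda>x. \<bar>?D n x\<bar>)" by (intro integral_nonneg_AE AE_I2) auto
      then show ?case using main[OF elim] by (simp add: pos_le_divide_eq mult.commute)
    qed
    show "(\<lambda>n. (\<integral>\<theta>. e n \<theta> / \<theta>\<^sup>2 \<partial>lborel) / pi) \<longlonglongrightarrow> 0"
      using tendsto_divide[OF lim0 tendsto_const[of pi]] by simp
  qed
qed

end

section \<open>The Cramer-Wold device and Gaussian processes\<close>

lemma weak_convergence_tightness:
  assumes \<mu>: "\<And>n. real_distribution (\<mu> n)" and \<nu>: "real_distribution \<nu>"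
    and ch: "\<And>t. (\<lambda>n. char (\<mu> n) t) \<longlonglongrightarrow> char \<nu> t" and f: "\<And>x. isCont f x" "\<And>x. \<bar>f x\<bar> \<le> B"
  shows "(\<lambda>n. \<integral>x. f x \<partial>\<mu> n) \<longlonglongrightarrow> (\<integral>x. f x \<partial>\<nu> :: real)"
  by (rule weak_conv_imp_integral_bdd_continuous_conv[OF \<mu> \<nu> levy_continuity[OF \<mu> \<nu> ch]]) (use f in auto)

text \<open>A continuous substitute for the indicator of |u| > K. Its integrals converge along with
  the one-dimensional marginals, which transfers the small tail of the limit to the
  sequence.\<close>

definition ramp :: "real \<Rightarrow> real \<Rightarrow> real" where
  "ramp K u = max 0 (min 1 (\<bar>u\<bar> - K))"

lemma ramp_bounds: "0 \<le> ramp K u" "ramp K u \<le> 1" "K + 1 < \<bar>u\<bar> \<Longrightarrow> ramp K u = 1"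
  by (auto simp: ramp_def)

lemma ramp_measurable[measurable]: "ramp K \<in> borel_measurable borel"
  unfolding ramp_def[abs_def] by measurable

lemma ramp_integral_tendsto_0:
  assumes "prob_space \<nu>" and [measurable]: "f \<in> borel_measurable \<nu>"
  shows "(\<lambda>K. \<integral>x. ramp (real K) (f x) \<partial>\<nu>) \<longlonglongrightarrow> 0"
proof -
  interpret prob_space \<nu> by fact
  have "(\<lambda>K. \<integral>x. ramp (real K) (f x) \<partial>\<nu>) \<longlonglongrightarrow> (\<integral>x. 0 \<partial>\<nu>)"
  proof (rule integral_dominated_convergence[where w = "\<lambda>_. 1"])
    show "AE x in \<nu>. (\<lambda>K. ramp (real K) (f x)) \<longlonglongrightarrow> 0"
    proof (rule AE_I2)
      fix x
      obtain K0 :: nat where "\<bar>f x\<bar> \<le> real K0" using real_arch_simple by blast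
      then have "eventually (\<lambda>K. ramp (real K) (f x) = 0) sequentially"
        by (intro eventually_sequentiallyI[of K0]) (auto simp: ramp_def)
      then show "(\<lambda>K. ramp (real K) (f x)) \<longlonglongrightarrow> 0" by (rule tendsto_eventually)
    qed
  qed (auto simp: ramp_bounds)
  then show ?thesis by simp
qed

text \<open>Polynomials in countably many coordinates, the algebra for Stone-Weierstrass on the
  compact cube. With cosines and sines inserted for the coordinates they become trigonometric
  polynomials. Numbering coordinates by \<open>nat\<close> places the cube in a type with a product
  topology.\<close>

inductive_set coord_alg :: "((nat \<Rightarrow> real) \<Rightarrow> real) set" where
  const: "(\<lambda>_. c) \<in> coord_alg"
| coord: "(\<lambda>z. z i) \<in> coord_alg"
| add: "f \<in> coord_alg \<Longrightarrow> g \<in> coord_alg \<Longrightarrow> (\<lambda>z. f z + g z) \<in> coord_alg"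
| mult: "f \<in> coord_alg \<Longrightarrow> g \<in> coord_alg \<Longrightarrow> (\<lambda>z. f z * g z) \<in> coord_alg"

definition cube :: "(nat \<Rightarrow> real) set" where "cube = {z. \<forall>i. \<bar>z i\<bar> \<le> 1}"

lemma compact_cube: "compact cube"
proof -
  have "cube = PiE UNIV (\<lambda>_. {-1..1})" by (auto simp: cube_def abs_le_iff minus_le_iff)
  moreover have "compactin (product_topology (\<lambda>_::nat. euclidean :: real topology) UNIV) (PiE UNIV (\<lambda>_. {-1..1}))"
    by (subst compactin_PiE) auto
  ultimately show ?thesis by (simp add: euclidean_product_topology)
qed

lemma coord_continuous: "continuous_on S (\<lambda>z::nat \<Rightarrow> real. z i)"
  by (intro continuous_on_product_coordinates[THEN continuous_on_subset]) auto

lemma coord_alg_ring: "function_ring_on coord_alg cube"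
proof
  show "compact cube" by (rule compact_cube)
  show "continuous_on cube f" if "f \<in> coord_alg" for f
    using that by induction (auto intro!: continuous_intros coord_continuous)
  show "\<exists>f\<in>coord_alg. f x \<noteq> f y" if "x \<noteq> y" for x y
    using that coord_alg.coord by (metis ext)
qed (auto intro: coord_alg.intros)

text \<open>Trigonometric polynomials as sums of cosines with phases. The phase covers sines and
  makes the product-to-sum formula the only identity needed for closure under products.\<close>

inductive_set trig :: "'i set \<Rightarrow> (('i \<Rightarrow> real) \<Rightarrow> real) set" for J where
  cosine: "(\<lambda>x. a * cos ((\<Sum>j\<in>J. c j * x j) + d)) \<in> trig J"
| add: "f \<in> trig J \<Longrightarrow> g \<in> trig J \<Longrightarrow> (\<lambda>x. f x + g x) \<in> trig J"

lemma trig_mult_cosine: "g \<in> trig J \<Longrightarrow> (\<lambda>x. (a * cos ((\<Sum>j\<in>J. c j * x j) + d)) * g x) \<in> trig J"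
proof (induction rule: trig.induct)
  case (cosine a' c' d')
  have eq: "(a * cos ((\<Sum>j\<in>J. c j * x j) + d)) * (a' * cos ((\<Sum>j\<in>J. c' j * x j) + d')) =
     (a * a' / 2) * cos ((\<Sum>j\<in>J. (c j - c' j) * x j) + (d - d')) + (a * a' / 2) * cos ((\<Sum>j\<in>J. (c j + c' j) * x j) + (d + d'))" for x
  proof -
    define A B where "A = (\<Sum>j\<in>J. c j * x j) + d" and "B = (\<Sum>j\<in>J. c' j * x j) + d'"
    have "(\<Sum>j\<in>J. (c j - c' j) * x j) + (d - d') = A - B" "(\<Sum>j\<in>J. (c j + c' j) * x j) + (d + d') = A + B"
      by (simp_all add: A_def B_def algebra_simps sum.distrib sum_subtractf)
    moreover have "a * cos A * (a' * cos B) = a * a' / 2 * cos (A - B) + a * a' / 2 * cos (A + B)"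
      by (simp add: cos_add cos_diff algebra_simps)
    ultimately show ?thesis unfolding A_def[symmetric] B_def[symmetric] by simp
  qed
  show ?case unfolding eq by (intro trig.add trig.cosine)
next
  case (add f g)
  then show ?case by (simp add: distrib_left trig.add)
qed

lemma trig_mult: "f \<in> trig J \<Longrightarrow> g \<in> trig J \<Longrightarrow> (\<lambda>x. f x * g x) \<in> trig J"
proof (induction rule: trig.induct)
  case (cosine a c d)
  then show ?case by (rule trig_mult_cosine)
next
  case (add f h)
  then show ?case by (simp add: distrib_right trig.add)
qed

lemma trig_const: "(\<lambda>_. c) \<in> trig J"
  using trig.cosine[of c "\<lambda>_. 0" J 0] by simp

lemma trig_integral_tendsto:
  fixes J :: "'i set" and \<mu> :: "nat \<Rightarrow> ('i \<Rightarrow> real) measure"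
  assumes J: "finite J" and \<mu>: "\<And>n. prob_space (\<mu> n)" "\<And>n. sets (\<mu> n) = sets (PiM J (\<lambda>_. borel))"
    and \<nu>: "prob_space \<nu>" "sets \<nu> = sets (PiM J (\<lambda>_. borel))"
    and ch: "\<And>c. (\<lambda>n. \<integral>x. iexp (\<Sum>j\<in>J. c j * x j) \<partial>\<mu> n) \<longlonglongrightarrow> (\<integral>x. iexp (\<Sum>j\<in>J. c j * x j) \<partial>\<nu>)"
    and f: "f \<in> trig J"
  shows "(\<forall>n. integrable (\<mu> n) f) \<and> integrable \<nu> f \<and> (\<lambda>n. \<integral>x. f x \<partial>\<mu> n) \<longlonglongrightarrow> (\<integral>x. f x \<partial>\<nu>)"
  using f
proof induction
  case (cosine a c d)
  have lin: "(\<lambda>x. \<Sum>j\<in>J. c j * x j) \<in> borel_measurable L" if "sets L = sets (PiM J (\<lambda>_. borel))" for L :: "('i \<Rightarrow> real) measure"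
    unfolding measurable_cong_sets[OF that refl] by measurable
  have i: "integrable L (\<lambda>x. iexp (\<Sum>j\<in>J. c j * x j))" if "prob_space L" "sets L = sets (PiM J (\<lambda>_. borel))" for L :: "('i \<Rightarrow> real) measure"
  proof -
    interpret prob_space L by (rule that)
    have "(\<lambda>x. iexp (\<Sum>j\<in>J. c j * x j)) \<in> borel_measurable L"
      by (rule measurable_compose[OF lin[OF that(2)], of "\<lambda>u. iexp u"]) measurable
    then show ?thesis by (rule integrable_const_bound[of _ 1, rotated]) (simp only: norm_exp_i_times order_refl AE_I2)
  qed
  have e: "a * cos (u + d) = Re (a * iexp d * iexp u)" for u :: real
  proof -
    have "iexp d * iexp u = iexp (u + d)" by (simp add: exp_add[symmetric] algebra_simps)
    then show ?thesis by (simp add: mult.assoc Re_exp)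
  qed
  have int: "integrable L (\<lambda>x. a * cos ((\<Sum>j\<in>J. c j * x j) + d))"
     "(\<integral>x. a * cos ((\<Sum>j\<in>J. c j * x j) + d) \<partial>L) = Re (a * iexp d * (\<integral>x. iexp (\<Sum>j\<in>J. c j * x j) \<partial>L))"
    if "prob_space L" "sets L = sets (PiM J (\<lambda>_. borel))" for L :: "('i \<Rightarrow> real) measure"
  proof -
    have i': "integrable L (\<lambda>x. a * iexp d * iexp (\<Sum>j\<in>J. c j * x j))"
      by (rule integrable_mult_right) (rule i[OF that])
    show "integrable L (\<lambda>x. a * cos ((\<Sum>j\<in>J. c j * x j) + d))"
      unfolding e by (rule integrable_Re[OF i'])
    have "(\<integral>x. a * cos ((\<Sum>j\<in>J. c j * x j) + d) \<partial>L) = Re (\<integral>x. a * iexp d * iexp (\<Sum>j\<in>J. c j * x j) \<partial>L)"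
      unfolding e by (rule integral_Re[OF i'])
    also have "(\<integral>x. a * iexp d * iexp (\<Sum>j\<in>J. c j * x j) \<partial>L) = a * iexp d * (\<integral>x. iexp (\<Sum>j\<in>J. c j * x j) \<partial>L)"
      by (rule integral_mult_right_zero)
    finally show "(\<integral>x. a * cos ((\<Sum>j\<in>J. c j * x j) + d) \<partial>L) = Re (a * iexp d * (\<integral>x. iexp (\<Sum>j\<in>J. c j * x j) \<partial>L))" .
  qed
  show ?case
    unfolding int(2)[OF \<mu>] int(2)[OF \<nu>]
    by (intro conjI allI int(1) \<mu> \<nu> tendsto_Re tendsto_mult tendsto_const ch)
next
  case (add f g)
  then show ?case by (auto intro!: tendsto_add)
qed

text \<open>On a large box \<open>f\<close> agrees with a bounded periodic function, which
  Stone-Weierstrass approximates uniformly by a trigonometric polynomial; the integrals of the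
  latter converge by hypothesis. Outside the box everything is bounded by multiples of
  \<open>ramp\<close> integrals, which become small with the size of the box.\<close>

theorem cramer_wold:
  fixes J :: "'i set" and \<mu> :: "nat \<Rightarrow> ('i \<Rightarrow> real) measure"
  assumes J: "finite J" and \<mu>: "\<And>n. prob_space (\<mu> n)" "\<And>n. sets (\<mu> n) = sets (PiM J (\<lambda>_. borel))"
    and \<nu>: "prob_space \<nu>" "sets \<nu> = sets (PiM J (\<lambda>_. borel))"
    and ch: "\<And>c. (\<lambda>n. \<integral>x. iexp (\<Sum>j\<in>J. c j * x j) \<partial>\<mu> n) \<longlonglongrightarrow> (\<integral>x. iexp (\<Sum>j\<in>J. c j * x j) \<partial>\<nu>)"
    and f: "continuous_map (product_topology (\<lambda>_. euclideanreal) J) euclideanreal f"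
    and fm: "f \<in> borel_measurable (PiM J (\<lambda>_. borel))"
    and B: "\<And>x. x \<in> PiE J (\<lambda>_. UNIV) \<Longrightarrow> \<bar>f x\<bar> \<le> B"
  shows "(\<lambda>n. \<integral>x. f x \<partial>\<mu> n) \<longlonglongrightarrow> (\<integral>x. f x \<partial>\<nu>)"
proof -
  have B0: "0 \<le> B" using B[of "\<lambda>j\<in>J. 0"] abs_ge_zero order_trans by fastforce
  have sp: "space (\<mu> n) = PiE J (\<lambda>_. UNIV)" "space \<nu> = PiE J (\<lambda>_. UNIV)" for n
    using sets_eq_imp_space_eq[OF \<mu>(2)] sets_eq_imp_space_eq[OF \<nu>(2)] by (auto simp: space_PiM)
  have meas: "g \<in> borel_measurable (PiM J (\<lambda>_. borel)) \<Longrightarrow> g \<in> borel_measurable (\<mu> n)"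
     "g \<in> borel_measurable (PiM J (\<lambda>_. borel)) \<Longrightarrow> g \<in> borel_measurable \<nu>" for g :: "('i \<Rightarrow> real) \<Rightarrow> real" and n
    unfolding measurable_cong_sets[OF \<mu>(2) refl] measurable_cong_sets[OF \<nu>(2) refl] by assumption+
  define r where "r K x = (\<Sum>j\<in>J. ramp K (x j))" for K and x :: "'i \<Rightarrow> real"
  have rm: "r K \<in> borel_measurable (PiM J (\<lambda>_. borel))" for K unfolding r_def[abs_def] by measurable
  have r0: "0 \<le> r K x" "r K x \<le> real (card J)" for K x
    unfolding r_def using sum_mono[of J "\<lambda>j. ramp K (x j)" "\<lambda>_. 1"] by (auto intro!: sum_nonneg simp: ramp_bounds)
  have rint: "integrable L (r K)" if "prob_space L" "r K \<in> borel_measurable L" for L K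
  proof -
    interpret prob_space L by (rule that)
    show ?thesis
    proof (rule integrable_const_bound[OF _ that(2)])
      show "AE x in L. norm (r K x) \<le> real (card J)" using r0 by (intro AE_I2) simp
    qed
  qed
  have rconv: "(\<lambda>n. \<integral>x. r K x \<partial>\<mu> n) \<longlonglongrightarrow> (\<integral>x. r K x \<partial>\<nu>)" for K
  proof -
    have one: "(\<lambda>n. \<integral>x. ramp K (x j) \<partial>\<mu> n) \<longlonglongrightarrow> (\<integral>x. ramp K (x j) \<partial>\<nu>)" if j: "j \<in> J" for j
    proof -
      have cm: "(\<lambda>x. x j) \<in> measurable (\<mu> n) borel" "(\<lambda>x. x j) \<in> measurable \<nu> borel" for n
        by (rule meas(1)[OF measurable_component_singleton[OF j]], rule meas(2)[OF measurable_component_singleton[OF j]])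
      have ct: "(\<lambda>n. char (distr (\<mu> n) borel (\<lambda>x. x j)) t) \<longlonglongrightarrow> char (distr \<nu> borel (\<lambda>x. x j)) t" for t
      proof -
        have s: "(\<Sum>i\<in>J. (if i = j then t else 0) * x i) = t * x j" for x :: "'i \<Rightarrow> real"
          using J j by (simp add: if_distrib[of "\<lambda>u. u * _"] cong: if_cong)
        show ?thesis
          using ch[of "\<lambda>i. if i = j then t else 0"] cm unfolding s char_def by (simp add: integral_distr)
      qed
      have "(\<lambda>n. \<integral>u. ramp K u \<partial>distr (\<mu> n) borel (\<lambda>x. x j)) \<longlonglongrightarrow> (\<integral>u. ramp K u \<partial>distr \<nu> borel (\<lambda>x. x j))"
      proof (rule weak_convergence_tightness[OF _ _ ct])
        show "real_distribution (distr (\<mu> n) borel (\<lambda>x. x j))" for n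
          by (intro prob_space.real_distribution_distr \<mu> cm)
        show "real_distribution (distr \<nu> borel (\<lambda>x. x j))"
          by (intro prob_space.real_distribution_distr \<nu> cm)
        show "isCont (ramp K) x" for x unfolding ramp_def[abs_def] by (intro continuous_intros)
        show "\<bar>ramp K x\<bar> \<le> 1" for x using ramp_bounds[of K x] by simp
      qed
      then show ?thesis using cm by (simp add: integral_distr)
    qed
    have ri: "integrable L (\<lambda>x. ramp K (x j))" if "prob_space L" "sets L = sets (PiM J (\<lambda>_. borel))" "j \<in> J" for L :: "('i \<Rightarrow> real) measure" and j
    proof -
      interpret prob_space L by (rule that)
      have "(\<lambda>x. ramp K (x j)) \<in> borel_measurable L"
        unfolding measurable_cong_sets[OF that(2) refl] using that(3) by measurable
      then show ?thesis by (rule integrable_const_bound[of _ 1, rotated]) (use ramp_bounds in \<open>auto intro!: AE_I2\<close>)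
    qed
    have "(\<lambda>n. \<Sum>j\<in>J. \<integral>x. ramp K (x j) \<partial>\<mu> n) \<longlonglongrightarrow> (\<Sum>j\<in>J. \<integral>x. ramp K (x j) \<partial>\<nu>)"
      by (intro tendsto_sum one)
    then show ?thesis unfolding r_def using ri[OF \<mu>] ri[OF \<nu>] by (simp add: Bochner_Integration.integral_sum)
  qed
  have rtail: "(\<lambda>K. \<integral>x. r (real K) x \<partial>\<nu>) \<longlonglongrightarrow> 0"
  proof -
    have "(\<lambda>K. \<Sum>j\<in>J. \<integral>x. ramp (real K) (x j) \<partial>\<nu>) \<longlonglongrightarrow> (\<Sum>j\<in>J. 0)"
      by (intro tendsto_sum ramp_integral_tendsto_0 \<nu> meas(2) measurable_component_singleton)
    moreover have "integrable \<nu> (\<lambda>x. ramp (real K) (x j))" if "j \<in> J" for K j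
    proof -
      interpret prob_space \<nu> by (rule \<nu>)
      have "(\<lambda>x. ramp (real K) (x j)) \<in> borel_measurable \<nu>"
        unfolding measurable_cong_sets[OF \<nu>(2) refl] using that by measurable
      then show ?thesis by (rule integrable_const_bound[of _ 1, rotated]) (use ramp_bounds in \<open>auto intro!: AE_I2\<close>)
    qed
    ultimately show ?thesis unfolding r_def by (simp add: Bochner_Integration.integral_sum)
  qed
  obtain e :: "'i \<Rightarrow> nat" where e: "inj_on e J" using J finite_imp_inj_to_nat_seg by blast
  define g where "g = inv_into J e"
  have ge: "g (e j) = j" if "j \<in> J" for j using e that by (simp add: g_def)
  have gJ: "g i \<in> J" if "i \<in> e ` J" for i using that by (simp add: g_def inv_into_into)
  have key: "eventually (\<lambda>n. \<bar>(\<integral>x. f x \<partial>\<mu> n) - (\<integral>x. f x \<partial>\<nu>)\<bar> < (6 * B + 3) * \<epsilon>) sequentially"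
    if \<epsilon>: "\<epsilon> > 0" for \<epsilon>
  proof -
    obtain K :: nat where K: "(\<integral>x. r (real K) x \<partial>\<nu>) < \<epsilon>"
      using order_tendstoD(2)[OF rtail \<epsilon>] by (auto simp: eventually_sequentially)
    \<comment> \<open>Half the period. On the box |x j| \<le> K + 1 the angle
      \<open>pi / L * x j\<close> is at most \<open>pi / 3\<close>, where its cosine is at least 1/2
      and the arcsine of its sine recovers it.\<close>
    define L where "L = 3 * (real K + 1)"
    have L0: "L > 0" by (simp add: L_def)
    \<comment> \<open>Equal to 1 from cosine 1/2 on and to 0 for negative cosine, where the arcsine
      of the sine returns a different angle.\<close>
    define cut where "cut u = max 0 (min 1 (2 * u))" for u :: real
    have cut: "0 \<le> cut u" "cut u \<le> 1" for u by (auto simp: cut_def)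
    define \<Phi> where "\<Phi> z = (\<lambda>j\<in>J. L / pi * arcsin (z (2 * e j + 1)))" for z :: "nat \<Rightarrow> real"
    define G where "G z = f (\<Phi> z) * (\<Prod>j\<in>J. cut (z (2 * e j)))" for z :: "nat \<Rightarrow> real"
    have Gc: "continuous_on cube G"
    proof -
      have "continuous_map (top_of_set cube) (product_topology (\<lambda>_. euclideanreal) J) \<Phi>"
        unfolding continuous_map_componentwise
      proof (intro conjI ballI)
        show "\<Phi> ` topspace (top_of_set cube) \<subseteq> extensional J" by (auto simp: \<Phi>_def)
        fix j assume "j \<in> J"
        have "continuous_on cube (\<lambda>z. L / pi * arcsin (z (2 * e j + 1)))"
          by (intro continuous_intros coord_continuous) (auto simp: cube_def abs_le_iff intro: minus_le_iff[THEN iffD1])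
        then show "continuous_map (top_of_set cube) euclideanreal (\<lambda>z. \<Phi> z j)"
          using \<open>j \<in> J\<close> by (simp add: \<Phi>_def)
      qed
      from continuous_map_compose[OF this f] have "continuous_on cube (\<lambda>z. f (\<Phi> z))" by (simp add: o_def)
      then show ?thesis unfolding G_def cut_def by (intro continuous_intros coord_continuous)
    qed
    obtain P where P: "P \<in> coord_alg" "\<And>z. z \<in> cube \<Longrightarrow> \<bar>G z - P z\<bar> < \<epsilon>"
      using function_ring_on.Stone_Weierstrass_basic[OF coord_alg_ring Gc \<epsilon>] by blast
    define tr where "tr x i = (if i div 2 \<in> e ` J then (if even i then cos (pi / L * x (g (i div 2))) else sin (pi / L * x (g (i div 2)))) else 0)"
      for x :: "'i \<Rightarrow> real" and i
    have tr_cube: "tr x \<in> cube" for x by (auto simp: cube_def tr_def)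
    have tr_e: "tr x (2 * e j) = cos (pi / L * x j)" "tr x (2 * e j + 1) = sin (pi / L * x j)" if "j \<in> J" for x j
      using that ge by (auto simp: tr_def)
    have Ptrig: "(\<lambda>x. P (tr x)) \<in> trig J"
      using P(1)
    proof induction
      case (coord i)
      show ?case
      proof (cases "i div 2 \<in> e ` J")
        case True
        define j where "j = g (i div 2)"
        have j: "j \<in> J" using gJ True by (simp add: j_def)
        have s: "(\<Sum>k\<in>J. (if k = j then pi / L else 0) * x k) = pi / L * x j" for x :: "'i \<Rightarrow> real"
          using J j by (simp add: if_distrib[of "\<lambda>u. u * _"] cong: if_cong)
        \<comment> \<open>A coordinate is a cosine of a linear form concentrated on
          \<open>j\<close>; the phase \<open>- (pi / 2)\<close> turns the cosine into a
          sine.\<close>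
        have "(\<lambda>x. tr x i) = (\<lambda>x. 1 * cos ((\<Sum>k\<in>J. (if k = j then pi / L else 0) * x k) + (if even i then 0 else - (pi / 2))))"
          unfolding s using True by (auto simp: tr_def j_def cos_diff)
        then show ?thesis by (simp only: trig.cosine)
      next
        case False
        then show ?thesis by (simp add: tr_def trig_const)
      qed
    qed (auto intro: trig_const trig_mult trig.add)
    define h where "h x = G (tr x)" for x
    have hB: "\<bar>h x\<bar> \<le> B" for x
    proof -
      have "(\<Prod>j\<in>J. cut (tr x (2 * e j))) \<le> 1" "0 \<le> (\<Prod>j\<in>J. cut (tr x (2 * e j)))"
        using cut by (auto intro!: prod_le_1 prod_nonneg)
      moreover have "\<bar>f (\<Phi> (tr x))\<bar> \<le> B" by (intro B) (auto simp: \<Phi>_def)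
      ultimately have "\<bar>f (\<Phi> (tr x))\<bar> * \<bar>\<Prod>j\<in>J. cut (tr x (2 * e j))\<bar> \<le> B * 1"
        using B0 by (intro mult_mono) auto
      then show ?thesis by (simp add: h_def G_def abs_mult)
    qed
    have hf: "h x = f x" if x: "x \<in> PiE J (\<lambda>_. UNIV)" "\<forall>j\<in>J. \<bar>x j\<bar> \<le> real K + 1" for x
    proof -
      have a: "\<bar>pi / L * x j\<bar> \<le> pi / 3" if "j \<in> J" for j
      proof -
        have "\<bar>pi / L * x j\<bar> = pi / L * \<bar>x j\<bar>" using L0 by (simp add: abs_mult)
        also have "\<dots> \<le> pi / L * (real K + 1)" using x that L0 by (intro mult_left_mono) auto
        also have "\<dots> = pi / 3" by (simp add: L_def field_simps)
        finally show ?thesis .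
      qed
      have "cut (tr x (2 * e j)) = 1" if j: "j \<in> J" for j
      proof -
        have "cos (pi / 3) \<le> cos \<bar>pi / L * x j\<bar>" using a[OF j] by (intro cos_monotone_0_pi_le) auto
        then have "1 / 2 \<le> cos (pi / L * x j)" by (simp only: cos_abs_real cos_60)
        moreover have "cut c = 1" if "1 / 2 \<le> c" for c using that by (auto simp: cut_def)
        ultimately show ?thesis unfolding tr_e(1)[OF j] by blast
      qed
      moreover have "\<Phi> (tr x) = x"
      proof
        fix j
        show "\<Phi> (tr x) j = x j"
        proof (cases "j \<in> J")
          case True
          have "- (pi / 2) \<le> pi / L * x j" "pi / L * x j \<le> pi / 2" using a[OF True] pi_gt_zero by linarith+
          then have "arcsin (sin (pi / L * x j)) = pi / L * x j" by (rule arcsin_sin)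
          then show ?thesis using True tr_e(2)[OF True, of x] L0 by (simp add: \<Phi>_def)
        next
          case False
          then show ?thesis using x by (auto simp: \<Phi>_def PiE_def extensional_def)
        qed
      qed
      ultimately show ?thesis by (simp add: h_def G_def)
    qed
    have fh: "\<bar>f x - P (tr x)\<bar> \<le> 2 * B * r (real K) x + \<epsilon>" if x: "x \<in> PiE J (\<lambda>_. UNIV)" for x
    proof -
      have hP: "\<bar>h x - P (tr x)\<bar> < \<epsilon>" unfolding h_def by (rule P(2)[OF tr_cube])
      show ?thesis
      proof (cases "\<forall>j\<in>J. \<bar>x j\<bar> \<le> real K + 1")
        case True
        have "0 \<le> 2 * B * r (real K) x" using B0 r0 by simp
        then show ?thesis using hf[OF x True] hP by linarith
      next
        case False
        then obtain j where j: "j \<in> J" "real K + 1 < \<bar>x j\<bar>" by auto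
        have "ramp (real K) (x j) \<le> r (real K) x"
          unfolding r_def using J j by (intro member_le_sum) (auto simp: ramp_bounds)
        then have "1 \<le> r (real K) x" using ramp_bounds(3)[OF j(2)] by simp
        then have "2 * B * 1 \<le> 2 * B * r (real K) x" using B0 by (intro mult_left_mono) auto
        then show ?thesis using hP hB[of x] B[OF x] by linarith
      qed
    qed
    have Pt: "(\<forall>n. integrable (\<mu> n) (\<lambda>x. P (tr x))) \<and> integrable \<nu> (\<lambda>x. P (tr x)) \<and> (\<lambda>n. \<integral>x. P (tr x) \<partial>\<mu> n) \<longlonglongrightarrow> (\<integral>x. P (tr x) \<partial>\<nu>)"
      by (rule trig_integral_tendsto[OF J \<mu> \<nu> ch Ptrig])
    have bound: "\<bar>(\<integral>x. f x \<partial>N) - (\<integral>x. P (tr x) \<partial>N)\<bar> \<le> 2 * B * (\<integral>x. r (real K) x \<partial>N) + \<epsilon>"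
      if N: "prob_space N" "sets N = sets (PiM J (\<lambda>_. borel))" and iP: "integrable N (\<lambda>x. P (tr x))" for N
    proof -
      interpret N: prob_space N by (rule N)
      have spN: "space N = PiE J (\<lambda>_. UNIV)" using sets_eq_imp_space_eq[OF N(2)] by (auto simp: space_PiM)
      have mN: "f \<in> borel_measurable N" "r (real K) \<in> borel_measurable N"
        unfolding measurable_cong_sets[OF N(2) refl] by (rule fm rm)+
      have if': "integrable N f" by (rule N.integrable_const_bound[of _ B]) (use B mN spN in auto)
      have ir: "integrable N (r (real K))" by (rule rint[OF N(1) mN(2)])
      have "\<bar>(\<integral>x. f x \<partial>N) - (\<integral>x. P (tr x) \<partial>N)\<bar> = \<bar>\<integral>x. f x - P (tr x) \<partial>N\<bar>" using if' iP by simp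
      also have "\<dots> \<le> (\<integral>x. \<bar>f x - P (tr x)\<bar> \<partial>N)" by (rule integral_abs_bound)
      also have "\<dots> \<le> (\<integral>x. 2 * B * r (real K) x + \<epsilon> \<partial>N)"
        using if' iP ir fh spN by (intro integral_mono) auto
      also have "\<dots> = 2 * B * (\<integral>x. r (real K) x \<partial>N) + \<epsilon>" using ir N.prob_space by simp
      finally show ?thesis .
    qed
    have ev1: "eventually (\<lambda>n. (\<integral>x. r (real K) x \<partial>\<mu> n) < \<epsilon>) sequentially"
      using order_tendstoD(2)[OF rconv K] .
    have ev2: "eventually (\<lambda>n. \<bar>(\<integral>x. P (tr x) \<partial>\<mu> n) - (\<integral>x. P (tr x) \<partial>\<nu>)\<bar> < \<epsilon>) sequentially"
      using Pt \<epsilon> by (auto simp: tendsto_iff dist_real_def)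
    show ?thesis
      using ev1 ev2
    proof eventually_elim
      case (elim n)
      have b1: "2 * B * (\<integral>x. r (real K) x \<partial>\<mu> n) \<le> 2 * B * \<epsilon>" "2 * B * (\<integral>x. r (real K) x \<partial>\<nu>) \<le> 2 * B * \<epsilon>"
        using elim(1) K B0 by (auto intro!: mult_left_mono)
      have "\<bar>(\<integral>x. f x \<partial>\<mu> n) - (\<integral>x. f x \<partial>\<nu>)\<bar> < 2 * B * \<epsilon> + \<epsilon> + (2 * B * \<epsilon> + \<epsilon>) + \<epsilon>"
        using bound[OF \<mu>, of n] bound[OF \<nu>] Pt b1 elim(2) by fastforce
      also have "\<dots> \<le> (6 * B + 3) * \<epsilon>" using B0 \<epsilon> by (simp add: algebra_simps)
      finally show ?case .
    qed
  qed
  show ?thesis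
  proof (rule tendstoI)
    fix \<epsilon> :: real assume \<epsilon>: "0 < \<epsilon>"
    have "eventually (\<lambda>n. \<bar>(\<integral>x. f x \<partial>\<mu> n) - (\<integral>x. f x \<partial>\<nu>)\<bar> < (6 * B + 3) * (\<epsilon> / (6 * B + 3))) sequentially"
      using \<epsilon> B0 by (intro key) auto
    then show "eventually (\<lambda>n. dist (\<integral>x. f x \<partial>\<mu> n) (\<integral>x. f x \<partial>\<nu>) < \<epsilon>) sequentially"
      using B0 by (simp add: dist_real_def)
  qed
qed

lemma weakly_converges_cramer_wold:
  fixes J :: "'i set" and \<mu> :: "nat \<Rightarrow> ('i \<Rightarrow> real) measure"
  assumes J: "finite J" and \<mu>: "\<And>n. prob_space (\<mu> n)" "\<And>n. sets (\<mu> n) = sets (PiM J (\<lambda>_. borel))"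
    and \<nu>: "prob_space \<nu>" "sets \<nu> = sets (PiM J (\<lambda>_. borel))"
    and ch: "\<And>c. (\<lambda>n. \<integral>x. iexp (\<Sum>j\<in>J. c j * x j) \<partial>\<mu> n) \<longlonglongrightarrow> (\<integral>x. iexp (\<Sum>j\<in>J. c j * x j) \<partial>\<nu>)"
    and meas: "\<And>f. continuous_map (product_topology (\<lambda>_. euclideanreal) J) euclideanreal f \<Longrightarrow> f \<in> borel_measurable (PiM J (\<lambda>_. borel))"
  shows "weakly_converges (product_topology (\<lambda>_. euclideanreal) J) \<mu> \<nu>"
  unfolding weakly_converges_def
proof (intro allI impI)
  fix f assume f: "continuous_map (product_topology (\<lambda>_. euclideanreal) J) euclideanreal f \<and>
    bounded (f ` topspace (product_topology (\<lambda>_. euclideanreal) J))"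
  then obtain B where "\<And>x. x \<in> PiE J (\<lambda>_. UNIV) \<Longrightarrow> \<bar>f x\<bar> \<le> B"
    unfolding bounded_iff by auto
  then show "(\<lambda>n. integral\<^sup>L (\<mu> n) f) \<longlonglongrightarrow> integral\<^sup>L \<nu> f"
    using f by (intro cramer_wold[OF J \<mu> \<nu> ch] meas) auto
qed

lemma orthant_indicator_limit:
  "(\<lambda>m. max 0 (1 - real m * max 0 (u - a))) \<longlonglongrightarrow> (if u \<le> a then 1 else 0)" for u a :: real
proof (cases "u \<le> a")
  case False
  then obtain m0 :: nat where "1 / (u - a) < real m0" using reals_Archimedean2 by blast
  moreover have pos: "0 < u - a" using False by simp
  ultimately have m0: "1 < real m0 * (u - a)" by (simp only: pos_divide_less_eq)
  have "1 \<le> real m * (u - a)" if "m \<ge> m0" for m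
  proof -
    have "real m0 * (u - a) \<le> real m * (u - a)" using that pos by (intro mult_right_mono) auto
    then show ?thesis using m0 by linarith
  qed
  moreover have "max 0 (1 - t) = 0" if "1 \<le> t" for t :: real using that by (auto simp: max_def)
  moreover have "max 0 (u - a) = u - a" using pos by simp
  ultimately have "eventually (\<lambda>m. max 0 (1 - real m * max 0 (u - a)) = 0) sequentially"
    by (intro eventually_sequentiallyI[of m0]) (simp only:)
  then show ?thesis using False by (simp add: tendsto_eventually)
qed simp

text \<open>Uniqueness as a special case of convergence: \<open>cramer_wold\<close> for a constant
  sequence shows that both measures integrate bounded continuous functions equally. Piecewise linear
  products approximate indicators of orthants, and the orthants are an intersection-stable
  generator.\<close>

lemma PiM_borel_eqI:
  fixes J :: "'i set"
  assumes J: "finite J" and P: "prob_space P" "sets P = sets (PiM J (\<lambda>_. borel :: real measure))"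
    and Q: "prob_space Q" "sets Q = sets (PiM J (\<lambda>_. borel))"
    and eq: "\<And>c. (\<integral>x. iexp (\<Sum>j\<in>J. c j * x j) \<partial>P) = (\<integral>x. iexp (\<Sum>j\<in>J. c j * x j) \<partial>Q)"
  shows "P = Q"
proof -
  interpret P: prob_space P by (rule P)
  interpret Q: prob_space Q by (rule Q)
  let ?E = "{PiE J F |F. \<forall>j\<in>J. F j \<in> range (\<lambda>a::real. {..a})}"
  have gen: "sets (PiM J (\<lambda>_. borel :: real measure)) = sigma_sets (PiE J (\<lambda>_. UNIV)) ?E"
  proof -
    have "sets (PiM J (\<lambda>_. borel :: real measure)) = sets (PiM J (\<lambda>_. sigma UNIV (range (\<lambda>a::real. {..a}))))"
      by (simp only: borel_eq_atMost)
    also have "\<dots> = sets (sigma (PiE J (\<lambda>_. UNIV))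
        {{f \<in> PiE J (\<lambda>_. UNIV). \<forall>i\<in>j. f i \<in> A i} | A j. j \<in> {J} \<and> A \<in> Pi j (\<lambda>_. range (\<lambda>a::real. {..a}))})"
    proof (rule sets_PiM_sigma)
      have "UNIV = \<Union> (range (\<lambda>n::nat. {..real n}))" using real_arch_simple by auto
      then show "\<exists>S\<subseteq>range (\<lambda>a::real. {..a}). countable S \<and> UNIV = \<Union> S"
        by (intro exI[of _ "range (\<lambda>n::nat. {..real n})"]) auto
    qed (use J in auto)
    also have "{{f \<in> PiE J (\<lambda>_. UNIV). \<forall>i\<in>j. f i \<in> A i} | A j. j \<in> {J} \<and> A \<in> Pi j (\<lambda>_. range (\<lambda>a::real. {..a}))} = ?E"
    proof -
      have "{f \<in> PiE J (\<lambda>_. UNIV). \<forall>i\<in>J. f i \<in> A i} = PiE J A" for A :: "'i \<Rightarrow> real set"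
        by (auto simp: PiE_iff extensional_def)
      then show ?thesis by (auto simp: Pi_iff)
    qed
    also have "sets (sigma (PiE J (\<lambda>_. UNIV)) ?E) = sigma_sets (PiE J (\<lambda>_. UNIV)) ?E"
      by (rule sets_measure_of) (auto simp: PiE_iff)
    finally show ?thesis .
  qed
  have spP: "space P = PiE J (\<lambda>_. UNIV)" and spQ: "space Q = PiE J (\<lambda>_. UNIV)"
    using sets_eq_imp_space_eq[OF P(2)] sets_eq_imp_space_eq[OF Q(2)] by (auto simp: space_PiM)
  have orth: "measure P (PiE J (\<lambda>j. {..a j})) = measure Q (PiE J (\<lambda>j. {..a j}))" for a :: "'i \<Rightarrow> real"
  proof -
    define f where "f m x = (\<Prod>j\<in>J. max 0 (1 - real m * max 0 (x j - a j)))" for m :: nat and x :: "'i \<Rightarrow> real"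
    have fm: "f m \<in> borel_measurable (PiM J (\<lambda>_. borel))" for m unfolding f_def[abs_def] by measurable
    have fb: "\<bar>f m x\<bar> \<le> 1" for m x
      unfolding f_def abs_prod by (intro prod_le_1) auto
    have fc: "continuous_map (product_topology (\<lambda>_. euclideanreal) J) euclideanreal (f m)" for m
      unfolding f_def[abs_def]
      by (intro continuous_map_prod J continuous_map_real_max continuous_map_diff continuous_map_real_mult
           continuous_map_const[THEN iffD2] continuous_map_product_projection disjI2) auto
    have "(\<lambda>n. \<integral>x. f m x \<partial>P) \<longlonglongrightarrow> (\<integral>x. f m x \<partial>Q)" for m
      by (rule cramer_wold[OF J P Q _ fc fm fb]) (simp only: eq tendsto_const)
    then have e: "(\<integral>x. f m x \<partial>P) = (\<integral>x. f m x \<partial>Q)" for m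
      by (simp only: LIMSEQ_const_iff)
    have lim: "(\<lambda>m. \<integral>x. f m x \<partial>N) \<longlonglongrightarrow> measure N (PiE J (\<lambda>j. {..a j}))"
      if N: "prob_space N" "sets N = sets (PiM J (\<lambda>_. borel))" for N
    proof -
      interpret N: prob_space N by (rule N)
      have spN: "space N = PiE J (\<lambda>_. UNIV)" using sets_eq_imp_space_eq[OF N(2)] by (auto simp: space_PiM)
      have S: "PiE J (\<lambda>j. {..a j}) \<in> sets N" unfolding N(2) using J by (intro sets_PiM_I_finite) auto
      have "(\<lambda>m. \<integral>x. f m x \<partial>N) \<longlonglongrightarrow> (\<integral>x. indicator (PiE J (\<lambda>j. {..a j})) x \<partial>N)"
      proof (rule integral_dominated_convergence[where w = "\<lambda>_. 1"])
        show "AE x in N. (\<lambda>m. f m x) \<longlonglongrightarrow> indicator (PiE J (\<lambda>j. {..a j})) x"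
        proof (rule AE_I2)
          fix x assume x: "x \<in> space N"
          have "(\<lambda>m. f m x) \<longlonglongrightarrow> (\<Prod>j\<in>J. if x j \<le> a j then 1 else 0)"
            unfolding f_def by (intro tendsto_prod orthant_indicator_limit)
          also have "(\<Prod>j\<in>J. if x j \<le> a j then 1 else 0 :: real) = indicator (PiE J (\<lambda>j. {..a j})) x"
            using x J unfolding spN by (auto simp: indicator_def PiE_iff)
          finally show "(\<lambda>m. f m x) \<longlonglongrightarrow> indicator (PiE J (\<lambda>j. {..a j})) x" .
        qed
        show "f m \<in> borel_measurable N" for m unfolding measurable_cong_sets[OF N(2) refl] by (rule fm)
      qed (use S fb in auto)
      then show ?thesis using S by simp
    qed
    show ?thesis using LIMSEQ_unique[OF lim[OF P, unfolded e] lim[OF Q]] .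
  qed
  show ?thesis
  proof (rule measure_eqI_generator_eq[where E = ?E and \<Omega> = "PiE J (\<lambda>_. UNIV)" and A = "\<lambda>n. PiE J (\<lambda>_. {..real n})"])
    show "Int_stable ?E"
    proof (rule Int_stableI)
      fix A B assume "A \<in> ?E" "B \<in> ?E"
      then obtain F G where AB: "A = PiE J F" "B = PiE J G" and
        FG: "\<forall>j\<in>J. F j \<in> range (\<lambda>a::real. {..a})" "\<forall>j\<in>J. G j \<in> range (\<lambda>a::real. {..a})"
        by blast
      have "F j \<inter> G j \<in> range (\<lambda>a::real. {..a})" if j: "j \<in> J" for j
      proof -
        obtain a b where "F j = {..a}" "G j = {..b}" using FG j by blast
        then have "F j \<inter> G j = {..min a b}" by auto
        then show ?thesis by blast
      qed
      moreover have "A \<inter> B = PiE J (\<lambda>j. F j \<inter> G j)" unfolding AB by (rule PiE_Int)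
      ultimately show "A \<inter> B \<in> ?E" by blast
    qed
    show "emeasure P X = emeasure Q X" if X: "X \<in> ?E" for X
    proof -
      obtain F where F: "X = PiE J F" "\<forall>j\<in>J. F j \<in> range (\<lambda>a::real. {..a})" using X by blast
      then obtain a where a: "\<forall>j\<in>J. F j = {..a j}" unfolding image_iff by metis
      have "X = PiE J (\<lambda>j. {..a j})" unfolding F(1) using a by (intro PiE_cong) auto
      then show ?thesis using orth[of a] by (simp add: P.emeasure_eq_measure Q.emeasure_eq_measure)
    qed
    show "sets P = sigma_sets (PiE J (\<lambda>_. UNIV)) ?E" "sets Q = sigma_sets (PiE J (\<lambda>_. UNIV)) ?E"
      using P(2) Q(2) gen by auto
    show "?E \<subseteq> Pow (PiE J (\<lambda>_. UNIV))" by (auto simp: PiE_iff)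
    show "range (\<lambda>n. PiE J (\<lambda>_. {..real n})) \<subseteq> ?E" by auto
    show "(\<Union>n. PiE J (\<lambda>_. {..real n})) = PiE J (\<lambda>_. UNIV)"
    proof
      show "PiE J (\<lambda>_. UNIV) \<subseteq> (\<Union>n. PiE J (\<lambda>_. {..real n}))"
      proof
        fix x :: "'i \<Rightarrow> real" assume x: "x \<in> PiE J (\<lambda>_. UNIV)"
        obtain n :: nat where n: "(\<Sum>j\<in>J. \<bar>x j\<bar>) \<le> real n" using real_arch_simple by blast
        have "x j \<le> real n" if "j \<in> J" for j
          using n member_le_sum[of j J "\<lambda>j. \<bar>x j\<bar>"] that J by auto
        then show "x \<in> (\<Union>n. PiE J (\<lambda>_. {..real n}))" using x by (auto simp: PiE_iff)
      qed
    qed auto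
    show "emeasure P (PiE J (\<lambda>_. {..real n})) \<noteq> \<infinity>" for n by simp
  qed
qed

section \<open>Positive semidefinite kernels and the construction of Gaussian processes\<close>

lemma psd_diag_zero:
  fixes K :: "'i \<Rightarrow> 'i \<Rightarrow> real"
  assumes "finite J" "u \<in> J" "j \<in> J"
    and sym: "\<And>i j. i \<in> J \<Longrightarrow> j \<in> J \<Longrightarrow> K i j = K j i"
    and psd: "\<And>c. 0 \<le> (\<Sum>i\<in>J. \<Sum>j\<in>J. c i * c j * K i j)" and z: "K u u = 0"
  shows "K u j = 0"
proof (cases "j = u")
  case False
  have q: "0 \<le> 2 * t * K u j + K j j" for t
  proof -
    let ?c = "\<lambda>i. if i = u then t else if i = j then 1 else 0"
    have "(\<Sum>i\<in>J. \<Sum>k\<in>J. ?c i * ?c k * K i k) = (\<Sum>i\<in>{u, j}. \<Sum>k\<in>{u, j}. ?c i * ?c k * K i k)"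
      using assms by (intro sum.mono_neutral_cong_right ballI sum.neutral sum.mono_neutral_right) auto
    also have "\<dots> = 2 * t * K u j + K j j"
      using False z sym[OF assms(2,3)] by simp
    finally show ?thesis using psd[of ?c] by simp
  qed
  show ?thesis
  proof (rule ccontr)
    assume n: "K u j \<noteq> 0"
    \<comment> \<open>The quadratic form restricted to \<open>u\<close> and \<open>j\<close> is
      affine in \<open>t\<close> when \<open>K u u = 0\<close>; with nonzero slope this choice of
      \<open>t\<close> makes it negative.\<close>
    have "2 * (- (K j j + 1) / (2 * K u j)) * K u j + K j j = - 1" using n by (simp add: field_simps)
    then show False using q[of "- (K j j + 1) / (2 * K u j)"] by linarith
  qed
qed (simp add: z)

text \<open>Induction by one step of the Cholesky factorization: split off the column of
  \<open>u\<close> and apply the hypothesis to the Schur complement \<open>K'\<close>.\<close>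

lemma psd_gram:
  fixes K :: "'i \<Rightarrow> 'i \<Rightarrow> real"
  assumes "finite J" "\<And>i j. i \<in> J \<Longrightarrow> j \<in> J \<Longrightarrow> K i j = K j i"
    "\<And>c. 0 \<le> (\<Sum>i\<in>J. \<Sum>j\<in>J. c i * c j * K i j)"
  shows "\<exists>a. \<forall>i\<in>J. \<forall>j\<in>J. K i j = (\<Sum>k\<in>J. a i k * a j k)"
  using assms
proof (induction J arbitrary: K rule: finite_induct)
  case (insert u J)
  note sym = insert.prems(1) and psd = insert.prems(2)
  \<comment> \<open>If \<open>K u u = 0\<close>, division by zero gives the zero column, which is
    right because \<open>psd_diag_zero\<close> makes the whole row vanish.\<close>
  define r where "r i = K i u / sqrt (K u u)" for i
  define K' where "K' i j = K i j - r i * r j" for i j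
  have exp: "(\<Sum>i\<in>insert u J. \<Sum>j\<in>insert u J. c i * c j * K i j) =
      c u * c u * K u u + 2 * c u * (\<Sum>j\<in>J. c j * K j u) + (\<Sum>i\<in>J. \<Sum>j\<in>J. c i * c j * K i j)" for c
  proof -
    have "(\<Sum>j\<in>J. c u * c j * K u j) = c u * (\<Sum>j\<in>J. c j * K j u)" "(\<Sum>i\<in>J. c i * c u * K i u) = c u * (\<Sum>j\<in>J. c j * K j u)"
      using sym by (auto simp: sum_distrib_left mult_ac intro!: sum.cong)
    then show ?thesis using insert.hyps by (simp add: sum.distrib)
  qed
  have Kuu: "0 \<le> K u u"
  proof -
    let ?c = "\<lambda>i. if i = u then 1 else 0 :: real"
    have "(\<Sum>j\<in>J. ?c j * K j u) = 0" "(\<Sum>i\<in>J. \<Sum>j\<in>J. ?c i * ?c j * K i j) = 0"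
      using insert.hyps by (auto intro!: sum.neutral)
    then show ?thesis using psd[of ?c] unfolding exp by simp
  qed
  have zero: "K j u = 0" if "K u u = 0" "j \<in> insert u J" for j
    using psd_diag_zero[of "insert u J" u j K] insert.hyps sym psd that by auto
  have ru: "r i * r u = K i u" if "i \<in> insert u J" for i
    using zero[OF _ that] Kuu by (cases "K u u = 0") (auto simp: r_def)
  have "\<exists>a. \<forall>i\<in>J. \<forall>j\<in>J. K' i j = (\<Sum>k\<in>J. a i k * a j k)"
  proof (rule insert.IH)
    show "K' i j = K' j i" if "i \<in> J" "j \<in> J" for i j using sym that by (simp add: K'_def mult.commute)
    fix c :: "'i \<Rightarrow> real"
    define s where "s = (\<Sum>j\<in>J. c j * K j u)"
    \<comment> \<open>The value at \<open>u\<close> minimizes the quadratic form when the other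
      entries are fixed; the minimum is the form of the Schur complement.\<close>
    define c' where "c' i = (if i = u then - (s / K u u) else c i)" for i
    have cc: "c' i = c i" if "i \<in> J" for i using that insert.hyps by (auto simp: c'_def)
    have s': "(\<Sum>j\<in>J. c' j * K j u) = s" unfolding s_def using cc by (intro sum.cong) auto
    have "0 \<le> c' u * c' u * K u u + 2 * c' u * s + (\<Sum>i\<in>J. \<Sum>j\<in>J. c i * c j * K i j)"
      using psd[of c'] unfolding exp s' using cc by (simp cong: sum.cong)
    moreover have "c' u * c' u * K u u + 2 * c' u * s = - ((s / sqrt (K u u)) * (s / sqrt (K u u)))"
      using Kuu by (cases "K u u = 0") (auto simp: c'_def field_simps power2_eq_square)
    moreover have "(s / sqrt (K u u)) * (s / sqrt (K u u)) = (\<Sum>i\<in>J. \<Sum>j\<in>J. c i * c j * (r i * r j))"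
      unfolding s_def r_def sum_divide_distrib sum_product by (intro sum.cong refl) simp
    ultimately show "0 \<le> (\<Sum>i\<in>J. \<Sum>j\<in>J. c i * c j * K' i j)"
      unfolding K'_def right_diff_distrib sum_subtractf by linarith
  qed
  then obtain a where a: "\<And>i j. i \<in> J \<Longrightarrow> j \<in> J \<Longrightarrow> K' i j = (\<Sum>k\<in>J. a i k * a j k)" by blast
  define a' where "a' i k = (if k = u then r i else if i = u then 0 else a i k)" for i k
  have "K i j = (\<Sum>k\<in>insert u J. a' i k * a' j k)" if ij: "i \<in> insert u J" "j \<in> insert u J" for i j
  proof -
    have e: "(\<Sum>k\<in>insert u J. a' i k * a' j k) = r i * r j + (\<Sum>k\<in>J. if i = u \<or> j = u then 0 else a i k * a j k)"
      using insert.hyps by (auto simp: a'_def intro!: sum.cong)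
    show ?thesis
    proof (cases "i = u \<or> j = u")
      case True
      then show ?thesis using e ru[OF ij(1)] ru[OF ij(2)] sym[OF ij] by (auto simp: mult.commute)
    next
      case False
      then show ?thesis using e a[of i j] ij by (auto simp: K'_def)
    qed
  qed
  then show ?case by blast
qed simp

definition gaussian_char :: "('i \<Rightarrow> 'i \<Rightarrow> real) \<Rightarrow> 'i set \<Rightarrow> ('i \<Rightarrow> real) measure \<Rightarrow> bool" where
  "gaussian_char K J P \<longleftrightarrow> prob_space P \<and> sets P = sets (PiM J (\<lambda>_. borel)) \<and>
     (\<forall>c. (\<integral>x. iexp (\<Sum>j\<in>J. c j * x j) \<partial>P) = complex_of_real (exp (- (\<Sum>i\<in>J. \<Sum>j\<in>J. c i * c j * K i j) / 2)))"

text \<open>The image of independent standard normal variables under the Gram factor of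
  \<open>K\<close>; the characteristic function of a linear combination is then a product of
  one-dimensional ones.\<close>

lemma finite_gaussian_exists:
  fixes K :: "'i \<Rightarrow> 'i \<Rightarrow> real"
  assumes J: "finite J" and sym: "\<And>i j. i \<in> J \<Longrightarrow> j \<in> J \<Longrightarrow> K i j = K j i"
    and psd: "\<And>c. 0 \<le> (\<Sum>i\<in>J. \<Sum>j\<in>J. c i * c j * K i j)"
  shows "\<exists>P. gaussian_char K J P"
proof -
  obtain a where a: "\<And>i j. i \<in> J \<Longrightarrow> j \<in> J \<Longrightarrow> K i j = (\<Sum>k\<in>J. a i k * a j k)"
    using psd_gram[OF J sym psd] by blast
  interpret S: real_distribution std_normal_distribution by (rule real_dist_normal_dist)
  interpret G: product_prob_space "\<lambda>_. std_normal_distribution" J ..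
  define G where "G = PiM J (\<lambda>_. std_normal_distribution)"
  have Gp: "prob_space G" unfolding G_def by (rule prob_space_PiM) unfold_locales
  have Gs: "sets G = sets (PiM J (\<lambda>_. borel))" unfolding G_def by (intro sets_PiM_cong) auto
  let ?T = "\<lambda>x. \<lambda>i\<in>J. \<Sum>k\<in>J. a i k * x k"
  have T: "?T \<in> measurable G (PiM J (\<lambda>_. borel))"
    unfolding measurable_cong_sets[OF Gs refl] by measurable
  have "(\<integral>x. iexp (\<Sum>j\<in>J. c j * x j) \<partial>distr G (PiM J (\<lambda>_. borel)) ?T) =
     complex_of_real (exp (- (\<Sum>i\<in>J. \<Sum>j\<in>J. c i * c j * K i j) / 2))" for c
  proof -
    define b where "b k = (\<Sum>i\<in>J. c i * a i k)" for k
    have m: "(\<lambda>x. iexp (\<Sum>j\<in>J. c j * x j)) \<in> borel_measurable (PiM J (\<lambda>_. borel :: real measure))"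
      by (rule measurable_compose[of "\<lambda>x. \<Sum>j\<in>J. c j * x j" _ borel "\<lambda>u. iexp u"]) measurable
    have lin: "(\<Sum>j\<in>J. c j * ?T x j) = (\<Sum>k\<in>J. b k * x k)" for x
      unfolding b_def sum_distrib_right
      by (subst sum.swap) (simp add: sum_distrib_left mult.assoc)
    have "(\<integral>x. iexp (\<Sum>j\<in>J. c j * x j) \<partial>distr G (PiM J (\<lambda>_. borel)) ?T) = (\<integral>x. iexp (\<Sum>j\<in>J. c j * ?T x j) \<partial>G)"
      by (rule integral_distr[OF T m])
    also have "\<dots> = (\<integral>x. (\<Prod>k\<in>J. iexp (b k * x k)) \<partial>G)"
      unfolding lin using J by (simp add: sum_distrib_left exp_sum)
    also have "\<dots> = (\<Prod>k\<in>J. \<integral>u. iexp (b k * u) \<partial>std_normal_distribution)"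
      unfolding G_def by (rule G.product_integral_prod[OF J]) (auto intro!: S.integrable_iexp)
    also have "\<dots> = (\<Prod>k\<in>J. complex_of_real (exp (- ((b k)\<^sup>2) / 2)))"
    proof (rule prod.cong[OF refl])
      fix k
      show "(\<integral>u. iexp (b k * u) \<partial>std_normal_distribution) = complex_of_real (exp (- ((b k)\<^sup>2) / 2))"
        using char_std_normal_distribution by (simp add: char_def fun_eq_iff exp_of_real[symmetric])
    qed
    also have "\<dots> = complex_of_real (exp (\<Sum>k\<in>J. - ((b k)\<^sup>2) / 2))"
      using J by (simp add: exp_sum)
    also have "(\<Sum>k\<in>J. - ((b k)\<^sup>2) / 2) = - (\<Sum>k\<in>J. (b k)\<^sup>2) / 2"
      by (simp add: sum_divide_distrib sum_negf)
    also have "(\<Sum>k\<in>J. (b k)\<^sup>2) = (\<Sum>i\<in>J. \<Sum>j\<in>J. c i * c j * K i j)"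
    proof -
      have "(\<Sum>k\<in>J. (b k)\<^sup>2) = (\<Sum>k\<in>J. \<Sum>i\<in>J. \<Sum>j\<in>J. c i * c j * (a i k * a j k))"
        unfolding b_def power2_eq_square sum_product by (intro sum.cong refl) (simp add: mult_ac)
      also have "\<dots> = (\<Sum>i\<in>J. \<Sum>k\<in>J. \<Sum>j\<in>J. c i * c j * (a i k * a j k))" by (rule sum.swap)
      also have "\<dots> = (\<Sum>i\<in>J. \<Sum>j\<in>J. \<Sum>k\<in>J. c i * c j * (a i k * a j k))"
        by (intro sum.cong refl sum.swap)
      also have "\<dots> = (\<Sum>i\<in>J. \<Sum>j\<in>J. c i * c j * K i j)"
        by (intro sum.cong refl) (simp add: a sum_distrib_left)
      finally show ?thesis .
    qed
    finally show ?thesis .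
  qed
  then show ?thesis
    unfolding gaussian_char_def
    by (intro exI[of _ "distr G (PiM J (\<lambda>_. borel)) ?T"] conjI allI prob_space.prob_space_distr[OF Gp T]) auto
qed

text \<open>Kolmogorov extension. The finite-dimensional laws are chosen independently of each
  other, so their consistency is proved by uniqueness of characteristic functions.\<close>

theorem gaussian_process_exists:
  fixes K :: "'i \<Rightarrow> 'i \<Rightarrow> real"
  assumes sym: "\<And>i j. i \<in> I \<Longrightarrow> j \<in> I \<Longrightarrow> K i j = K j i"
    and psd: "\<And>J c. finite J \<Longrightarrow> J \<subseteq> I \<Longrightarrow> 0 \<le> (\<Sum>i\<in>J. \<Sum>j\<in>J. c i * c j * K i j)"
  shows "\<exists>N. prob_space N \<and> sets N = sets (PiM I (\<lambda>_. borel)) \<and>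
     (\<forall>J c. finite J \<and> J \<subseteq> I \<longrightarrow> (\<integral>x. iexp (\<Sum>j\<in>J. c j * x j) \<partial>N) =
        complex_of_real (exp (- (\<Sum>i\<in>J. \<Sum>j\<in>J. c i * c j * K i j) / 2)))"
proof -
  define P where "P J = (SOME P. gaussian_char K J P)" for J
  have P: "gaussian_char K J (P J)" if "finite J" "J \<subseteq> I" for J
    unfolding P_def
  proof (rule someI_ex, rule finite_gaussian_exists)
    show "K i j = K j i" if "i \<in> J" "j \<in> J" for i j by (rule sym) (use that \<open>J \<subseteq> I\<close> in auto)
  qed (use that psd in auto)
  have m: "(\<lambda>x. iexp (\<Sum>j\<in>J. c j * x j)) \<in> borel_measurable (PiM J (\<lambda>_. borel :: real measure))" for c and J :: "'i set"
    by (rule measurable_compose[of "\<lambda>x. \<Sum>j\<in>J. c j * x j" _ borel "\<lambda>u. iexp u"]) measurable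
  interpret PP: polish_projective I P
  proof (intro polish_projective.intro projective_family.intro)
    show "prob_space (P J)" if "finite J" "J \<subseteq> I" for J using P[OF that] by (simp add: gaussian_char_def)
    fix J H assume JH: "J \<subseteq> H" "finite H" "H \<subseteq> I"
    then have fJ: "finite J" "J \<subseteq> I" using finite_subset by auto
    have PJ: "gaussian_char K J (P J)" and PH: "gaussian_char K H (P H)" using P fJ JH by auto
    have sH: "sets (P H) = sets (PiM H (\<lambda>_. borel))" using PH by (simp add: gaussian_char_def)
    have R: "(\<lambda>f. restrict f J) \<in> measurable (P H) (PiM J (\<lambda>_. borel))"
      unfolding measurable_cong_sets[OF sH refl] by (rule measurable_restrict_subset[OF JH(1)])
    show "P J = distr (P H) (PiM J (\<lambda>_. borel)) (\<lambda>f. restrict f J)"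
    proof (rule PiM_borel_eqI[OF fJ(1)])
      show "prob_space (P J)" "sets (P J) = sets (PiM J (\<lambda>_. borel))" using PJ by (auto simp: gaussian_char_def)
      show "prob_space (distr (P H) (PiM J (\<lambda>_. borel)) (\<lambda>f. restrict f J))"
        using PH by (intro prob_space.prob_space_distr R) (simp add: gaussian_char_def)
      fix c :: "'i \<Rightarrow> real"
      \<comment> \<open>A linear form on the smaller index set is extended by zero, which leaves the
        variance unchanged.\<close>
      define c' where "c' j = (if j \<in> J then c j else 0)" for j
      have "(\<integral>x. iexp (\<Sum>j\<in>J. c j * x j) \<partial>distr (P H) (PiM J (\<lambda>_. borel)) (\<lambda>f. restrict f J)) =
        (\<integral>x. iexp (\<Sum>j\<in>J. c j * restrict x J j) \<partial>P H)"
        by (rule integral_distr[OF R m])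
      also have "\<dots> = (\<integral>x. iexp (\<Sum>j\<in>H. c' j * x j) \<partial>P H)"
      proof -
        have "(\<Sum>j\<in>J. c j * restrict x J j) = (\<Sum>j\<in>H. c' j * x j)" for x
          using JH by (intro sum.mono_neutral_cong_left) (auto simp: c'_def)
        then show ?thesis by simp
      qed
      also have "\<dots> = complex_of_real (exp (- (\<Sum>i\<in>H. \<Sum>j\<in>H. c' i * c' j * K i j) / 2))"
        using PH by (simp add: gaussian_char_def)
      also have "(\<Sum>i\<in>H. \<Sum>j\<in>H. c' i * c' j * K i j) = (\<Sum>i\<in>J. \<Sum>j\<in>J. c i * c j * K i j)"
        using JH by (intro sum.mono_neutral_cong_right) (auto simp: c'_def intro!: sum.mono_neutral_cong_right)
      also have "complex_of_real (exp (- (\<Sum>i\<in>J. \<Sum>j\<in>J. c i * c j * K i j) / 2)) = (\<integral>x. iexp (\<Sum>j\<in>J. c j * x j) \<partial>P J)"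
        using PJ by (simp add: gaussian_char_def)
      finally show "(\<integral>x. iexp (\<Sum>j\<in>J. c j * x j) \<partial>P J) = (\<integral>x. iexp (\<Sum>j\<in>J. c j * x j) \<partial>distr (P H) (PiM J (\<lambda>_. borel)) (\<lambda>f. restrict f J))" ..
    qed simp
  qed
  have "(\<integral>x. iexp (\<Sum>j\<in>J. c j * x j) \<partial>PP.lim) = complex_of_real (exp (- (\<Sum>i\<in>J. \<Sum>j\<in>J. c i * c j * K i j) / 2))"
    if J: "finite J" "J \<subseteq> I" for J and c :: "'i \<Rightarrow> real"
  proof -
    have sJ: "sets (P J) = sets (PiM J (\<lambda>_. borel))" using P[OF J] by (simp add: gaussian_char_def)
    have R: "(\<lambda>f. restrict f J) \<in> measurable PP.lim (PiM J (\<lambda>_. borel))"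
      unfolding measurable_cong_sets[OF PP.sets_lim refl] by (rule measurable_restrict_subset[OF J(2)])
    have "distr PP.lim (PiM J (\<lambda>_. borel)) (\<lambda>f. restrict f J) = P J"
    proof (rule measure_eqI)
      fix A assume "A \<in> sets (distr PP.lim (PiM J (\<lambda>_. borel)) (\<lambda>f. restrict f J))"
      then have A: "A \<in> sets (PiM J (\<lambda>_. borel :: real measure))" by simp
      have "emeasure (distr PP.lim (PiM J (\<lambda>_. borel)) (\<lambda>f. restrict f J)) A = emeasure PP.lim (prod_emb I (\<lambda>_. borel) J A)"
        using A R by (simp add: emeasure_distr prod_emb_def space_PiM)
      also have "\<dots> = P J A" by (rule PP.emeasure_lim_emb[OF J(2,1) A])
      finally show "emeasure (distr PP.lim (PiM J (\<lambda>_. borel)) (\<lambda>f. restrict f J)) A = emeasure (P J) A" .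
    qed (simp add: sJ)
    then have "(\<integral>x. iexp (\<Sum>j\<in>J. c j * x j) \<partial>P J) = (\<integral>x. iexp (\<Sum>j\<in>J. c j * restrict x J j) \<partial>PP.lim)"
      using integral_distr[OF R m, of c] by simp
    then show ?thesis using P[OF J] by (simp add: gaussian_char_def)
  qed
  then show ?thesis
    by (intro exI[of _ PP.lim] conjI allI impI PP.P.prob_space_axioms) auto
qed

lemma char_centered_gaussian:
  assumes "0 \<le> v"
  shows "char (centered_gaussian v) t = complex_of_real (exp (- (t\<^sup>2 * v / 2)))"
proof (cases "v = 0")
  case True
  then show ?thesis by (simp add: centered_gaussian_def char_def integral_return)
next
  case False
  then have v: "v > 0" using assms by simp
  interpret S: real_distribution std_normal_distribution by (rule real_dist_normal_dist)
  have "distributed std_normal_distribution lborel (\<lambda>x. x) std_normal_density"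
    by (auto simp: distributed_def measure_density_const distr_id2 intro: distr_id2)
  then have "distr std_normal_distribution lborel (\<lambda>x. sqrt v * x) = density lborel (normal_density 0 (sqrt v))"
    using v S.normal_density_affine[of "\<lambda>x. x" 0 1 "sqrt v" 0] by (simp add: distributed_def)
  moreover have "distr std_normal_distribution lborel (\<lambda>x. sqrt v * x) = distr std_normal_distribution borel (\<lambda>x. sqrt v * x)"
    by (rule distr_cong) auto
  ultimately have D: "centered_gaussian v = distr std_normal_distribution borel (\<lambda>x. sqrt v * x)"
    using False by (simp add: centered_gaussian_def)
  have "char (centered_gaussian v) t = char std_normal_distribution (t * sqrt v)"
    unfolding D char_def by (subst integral_distr) (auto simp: mult_ac)
  then show ?thesis using v by (simp add: char_std_normal_distribution power_mult_distrib exp_of_real[symmetric] flip: of_real_power)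
qed

lemma centered_gaussian_distribution:
  assumes "0 \<le> v" shows "real_distribution (centered_gaussian v)"
proof (cases "v = 0")
  case True
  then show ?thesis
    by (simp add: centered_gaussian_def real_distribution_def real_distribution_axioms_def prob_space_return)
next
  case False
  then show ?thesis using assms prob_space_normal_density[of "sqrt v" 0]
    by (simp add: centered_gaussian_def real_distribution_def real_distribution_axioms_def)
qed

lemma centered_gaussian_second_moment:
  assumes "0 \<le> v"
  shows "integrable (centered_gaussian v) (\<lambda>x. x\<^sup>2)" "(\<integral>x. x\<^sup>2 \<partial>centered_gaussian v) = v"
proof -
  show "integrable (centered_gaussian v) (\<lambda>x. x\<^sup>2)"
  proof (cases "v = 0")
    case True
    interpret prob_space "return borel 0 :: real measure" by (rule prob_space_return) simp
    have "AE x in return borel 0. norm ((x::real)\<^sup>2) \<le> 1" by (subst AE_return) auto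
    then have "integrable (return borel 0) (\<lambda>x. x\<^sup>2 :: real)" by (rule integrable_const_bound) simp
    then show ?thesis using True by (simp add: centered_gaussian_def)
  next
    case False
    then have "integrable lborel (\<lambda>x. normal_density 0 (sqrt v) x * (x - 0) ^ 2)"
      using assms by (intro integrable_normal_moment) auto
    then show ?thesis using False by (simp add: centered_gaussian_def integrable_density)
  qed
  show "(\<integral>x. x\<^sup>2 \<partial>centered_gaussian v) = v"
  proof (cases "v = 0")
    case True
    then show ?thesis by (simp add: centered_gaussian_def integral_return)
  next
    case False
    then show ?thesis using assms integral_normal_moment_even[of "sqrt v" 0 1]
      by (simp add: centered_gaussian_def integral_density fact_numeral)
  qed
qed

section \<open>The innovations of the height process\<close>

lemma (in prob_space) indep_vars_prob_ball:
  assumes X: "indep_vars N X I" and J: "finite J" "J \<subseteq> I" and B: "\<And>j. j \<in> J \<Longrightarrow> B j \<in> sets (N j)"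
  shows "prob {x \<in> space M. \<forall>j\<in>J. X j x \<in> B j} = (\<Prod>j\<in>J. prob (X j -` B j \<inter> space M))"
proof (cases "J = {}")
  case True
  then show ?thesis by (simp add: prob_space)
next
  case False
  have "{x \<in> space M. \<forall>j\<in>J. X j x \<in> B j} = (\<Inter>j\<in>J. X j -` B j \<inter> space M)"
    using False by auto
  then show ?thesis using indep_varsD[OF X False J(1,2)] B by simp
qed

lemma const_fun_measurable: "(\<lambda>u::real. (\<lambda>_::int. u)) \<in> measurable borel vec_space"
  by (rule measurable_PiM_single') auto

lemma all_level_split:
  "(\<forall>k s. q k s \<longrightarrow> r k s) \<longleftrightarrow> (\<forall>k. q k 0 \<longrightarrow> r k 0) \<and> (\<forall>k s. q k s \<longrightarrow> s \<noteq> (0::nat) \<longrightarrow> r k s)"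
  by metis

text \<open>Merges initial increments and weights into one family over space-time. An increment is
  stored at level 0 as a constant vector so that all members have the same value space. A finite
  intersection of events splits into its level-0 part and the rest; independence of the two groups
  combines with independence within each.\<close>

lemma (in prob_space) joint_indep_vars:
  fixes \<eta> :: "int \<Rightarrow> 'a \<Rightarrow> real" and \<omega> :: "int \<Rightarrow> nat \<Rightarrow> 'a \<Rightarrow> int \<Rightarrow> real"
  assumes w: "indep_vars (\<lambda>_. vec_space) (\<lambda>(k, s). \<omega> k s) (UNIV \<times> {1..})"
    and e: "indep_vars (\<lambda>_. borel) \<eta> UNIV"
    and ind: "independent_elements M (PiM UNIV (\<lambda>_::int. borel)) (\<lambda>x i. \<eta> i x)
          (PiM (UNIV \<times> {1..}) (\<lambda>_. vec_space)) (\<lambda>x. \<lambda>(k, s)\<in>UNIV \<times> {1..}. \<omega> k s x)"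
  shows "indep_vars (\<lambda>_. vec_space) (\<lambda>(k, s). if s = 0 then (\<lambda>x _. \<eta> k x) else \<omega> k s) UNIV"
proof -
  define X where "X = (\<lambda>(k, s). if s = 0 then (\<lambda>x _. \<eta> k x) else \<omega> k s)"
  have eM[measurable]: "\<eta> k \<in> borel_measurable M" for k
    using e unfolding indep_vars_def by blast
  have wM: "\<omega> k s \<in> measurable M vec_space" if "s \<ge> 1" for k s
  proof -
    have "\<forall>i\<in>UNIV \<times> {1..}. (case i of (k, s) \<Rightarrow> \<omega> k s) \<in> measurable M vec_space"
      using w unfolding indep_vars_def by blast
    from bspec[OF this, of "(k, s)"] that show ?thesis by simp
  qed
  have X0: "X (k, 0) = (\<lambda>x. (\<lambda>_. \<eta> k x))" and X1: "s \<ge> 1 \<Longrightarrow> X (k, s) = \<omega> k s" for k s by (auto simp: X_def)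
  have XM: "X i \<in> measurable M vec_space" for i
  proof (cases i)
    case (Pair k s)
    show ?thesis
    proof (cases "s = 0")
      case True
      show ?thesis unfolding Pair True X0 by (rule measurable_compose[OF eM const_fun_measurable])
    next
      case False
      then have s: "1 \<le> s" by simp
      show ?thesis unfolding Pair X1[OF s] by (rule wM[OF s])
    qed
  qed
  have "indep_vars (\<lambda>_. vec_space) X UNIV"
    unfolding indep_vars_def2
  proof (intro conjI ballI XM indep_setsI)
    show "{X i -` A \<inter> space M |A. A \<in> sets vec_space} \<subseteq> events" for i
      by (auto intro: measurable_sets[OF XM])
    fix A and J :: "(int \<times> nat) set" assume J: "J \<noteq> {}" "J \<subseteq> UNIV" "finite J"
      and A: "\<forall>j\<in>J. A j \<in> {X j -` A \<inter> space M |A. A \<in> sets vec_space}"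
    obtain B where B: "\<And>j. j \<in> J \<Longrightarrow> B j \<in> sets vec_space" "\<And>j. j \<in> J \<Longrightarrow> A j = X j -` B j \<inter> space M"
    proof -
      have "\<forall>j\<in>J. \<exists>B. B \<in> sets vec_space \<and> A j = X j -` B \<inter> space M" using A by blast
      from bchoice[OF this] that show ?thesis by blast
    qed
    define J0 where "J0 = {k. (k, 0) \<in> J}"
    define J1 where "J1 = {j \<in> J. snd j \<noteq> 0}"
    have fin: "finite J0" "finite J1"
    proof -
      have "J0 \<subseteq> fst ` J" by (force simp: J0_def)
      then show "finite J0" using finite_imageI[OF J(3), of fst] by (rule finite_subset)
      show "finite J1" unfolding J1_def using J(3) by simp
    qed
    \<comment> \<open>Pulls the event for the constant vector back to an event for the real
      increment.\<close>
    define D where "D k = (\<lambda>u::real. (\<lambda>_::int. u)) -` B (k, 0)" for k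
    have D: "D k \<in> sets borel" if "k \<in> J0" for k
      using measurable_sets[OF const_fun_measurable B(1)[of "(k, 0)"]] that by (simp add: D_def J0_def)
    define E0 where "E0 = {x \<in> space M. \<forall>k\<in>J0. \<eta> k x \<in> D k}"
    define E1 where "E1 = {x \<in> space M. \<forall>j\<in>J1. (case j of (k, s) \<Rightarrow> \<omega> k s) x \<in> B j}"
    have split: "(\<Inter>j\<in>J. A j) = E0 \<inter> E1"
    proof -
      have "x \<in> (\<Inter>j\<in>J. A j) \<longleftrightarrow> x \<in> space M \<and> (\<forall>j\<in>J. X j x \<in> B j)" for x
        using J(1) B(2) by auto
      moreover have "(\<forall>j\<in>J. X j x \<in> B j) \<longleftrightarrow> (\<forall>k\<in>J0. \<eta> k x \<in> D k) \<and> (\<forall>j\<in>J1. (case j of (k, s) \<Rightarrow> \<omega> k s) x \<in> B j)" for x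
      proof -
        have "(\<forall>j\<in>J. X j x \<in> B j) \<longleftrightarrow> (\<forall>k s. (k, s) \<in> J \<longrightarrow> X (k, s) x \<in> B (k, s))" by auto
        also have "\<dots> \<longleftrightarrow> (\<forall>k. (k, 0) \<in> J \<longrightarrow> X (k, 0) x \<in> B (k, 0)) \<and> (\<forall>k s. (k, s) \<in> J \<longrightarrow> s \<noteq> 0 \<longrightarrow> X (k, s) x \<in> B (k, s))"
          by (rule all_level_split)
        also have "\<dots> \<longleftrightarrow> (\<forall>k\<in>J0. \<eta> k x \<in> D k) \<and> (\<forall>j\<in>J1. (case j of (k, s) \<Rightarrow> \<omega> k s) x \<in> B j)"
          by (auto simp: J0_def J1_def D_def X_def)
        finally show ?thesis .
      qed
      ultimately show ?thesis by (auto simp: E0_def E1_def)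
    qed
    have p0: "prob E0 = (\<Prod>k\<in>J0. prob (A (k, 0)))"
    proof -
      have "prob E0 = (\<Prod>k\<in>J0. prob (\<eta> k -` D k \<inter> space M))"
        unfolding E0_def by (rule indep_vars_prob_ball[OF e fin(1)]) (use D in auto)
      also have "\<dots> = (\<Prod>k\<in>J0. prob (A (k, 0)))"
        using B(2) by (intro prod.cong refl arg_cong[of _ _ prob]) (auto simp: J0_def D_def X0)
      finally show ?thesis .
    qed
    have p1: "prob E1 = (\<Prod>j\<in>J1. prob (A j))"
    proof -
      have "prob E1 = (\<Prod>j\<in>J1. prob ((case j of (k, s) \<Rightarrow> \<omega> k s) -` B j \<inter> space M))"
        unfolding E1_def by (rule indep_vars_prob_ball[OF w fin(2)]) (use B(1) in \<open>auto simp: J1_def\<close>)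
      also have "\<dots> = (\<Prod>j\<in>J1. prob (A j))"
        using B(2) by (intro prod.cong refl arg_cong[of _ _ prob]) (auto simp: J1_def X_def split: prod.splits)
      finally show ?thesis .
    qed
    have "prob (E0 \<inter> E1) = prob E0 * prob E1"
    proof (rule indep_setD[OF ind[unfolded independent_elements_def, THEN conjunct2, THEN conjunct2]])
      let ?C0 = "{f \<in> space (PiM UNIV (\<lambda>_::int. borel :: real measure)). \<forall>k\<in>J0. f k \<in> D k}"
      have "?C0 \<in> sets (PiM UNIV (\<lambda>_::int. borel :: real measure))"
      proof (rule sets.sets_Collect_finite_All[OF _ fin(1)])
        show "{f \<in> space (PiM UNIV (\<lambda>_::int. borel :: real measure)). f k \<in> D k} \<in> sets (PiM UNIV (\<lambda>_. borel))" if "k \<in> J0" for k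
          using D[OF that] by measurable
      qed
      moreover have "E0 = (\<lambda>x i. \<eta> i x) -` ?C0 \<inter> space M" by (auto simp: E0_def space_PiM)
      ultimately show "E0 \<in> {(\<lambda>x i. \<eta> i x) -` A \<inter> space M |A. A \<in> sets (PiM UNIV (\<lambda>_::int. borel))}" by blast
      let ?I = "UNIV \<times> {1..} :: (int \<times> nat) set"
      let ?C1 = "{g \<in> space (PiM ?I (\<lambda>_. vec_space)). \<forall>j\<in>J1. g j \<in> B j}"
      have J1I: "J1 \<subseteq> ?I" by (auto simp: J1_def)
      have "?C1 \<in> sets (PiM ?I (\<lambda>_. vec_space))"
      proof (rule sets.sets_Collect_finite_All[OF _ fin(2)])
        fix j assume j: "j \<in> J1"
        have [measurable]: "B j \<in> sets vec_space" using j B(1) by (simp add: J1_def)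
        have [measurable]: "(\<lambda>g. g j) \<in> measurable (PiM ?I (\<lambda>_. vec_space)) vec_space"
          by (rule measurable_component_singleton) (use j J1I in auto)
        show "{g \<in> space (PiM ?I (\<lambda>_. vec_space)). g j \<in> B j} \<in> sets (PiM ?I (\<lambda>_. vec_space))" by measurable
      qed
      moreover have "E1 = (\<lambda>x. \<lambda>(k, s)\<in>?I. \<omega> k s x) -` ?C1 \<inter> space M"
      proof -
        have "(\<lambda>x. \<lambda>(k, s)\<in>?I. \<omega> k s x) \<in> measurable M (PiM ?I (\<lambda>_. vec_space))"
          using ind by (simp add: independent_elements_def)
        from measurable_space[OF this] show ?thesis using J1I by (fastforce simp: E1_def)
      qed
      ultimately show "E1 \<in> {(\<lambda>x. \<lambda>(k, s)\<in>?I. \<omega> k s x) -` A \<inter> space M |A. A \<in> sets (PiM ?I (\<lambda>_. vec_space))}" by blast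
    qed
    then have "prob (\<Inter>j\<in>J. A j) = (\<Prod>k\<in>J0. prob (A (k, 0))) * (\<Prod>j\<in>J1. prob (A j))"
      unfolding split p0 p1 .
    also have "(\<Prod>k\<in>J0. prob (A (k, 0))) = (\<Prod>j\<in>J - J1. prob (A j))"
      by (rule prod.reindex_bij_witness[of _ fst "\<lambda>k. (k, 0)"]) (auto simp: J0_def J1_def)
    also have "(\<Prod>j\<in>J - J1. prob (A j)) * (\<Prod>j\<in>J1. prob (A j)) = (\<Prod>j\<in>J. prob (A j))"
      using J(3) by (intro prod.subset_diff[symmetric]) (auto simp: J1_def)
    finally show "prob (\<Inter>j\<in>J. A j) = (\<Prod>j\<in>J. prob (A j))" .
  qed
  then show ?thesis unfolding X_def .
qed

section \<open>Convergence in mean to a constant\<close>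

definition (in prob_space) L1 :: "(nat \<Rightarrow> 'a \<Rightarrow> real) \<Rightarrow> real \<Rightarrow> bool" where
  "L1 f c \<longleftrightarrow> (\<forall>n. integrable M (f n)) \<and> (\<lambda>n. expectation (\<lambda>x. \<bar>f n x - c\<bar>)) \<longlonglongrightarrow> 0"

context prob_space begin

lemma L1_bound:
  assumes "\<And>n. integrable M (f n)" "\<And>n. integrable M (g n)" "(\<lambda>n. expectation (g n)) \<longlonglongrightarrow> 0"
    "\<And>n x. x \<in> space M \<Longrightarrow> \<bar>f n x - c\<bar> \<le> g n x"
  shows "L1 f c"
  unfolding L1_def
proof (intro conjI allI assms(1))
  show "(\<lambda>n. expectation (\<lambda>x. \<bar>f n x - c\<bar>)) \<longlonglongrightarrow> 0"
  proof (rule Lim_null_comparison[OF always_eventually assms(3)], rule allI)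
    fix n
    have "expectation (\<lambda>x. \<bar>f n x - c\<bar>) \<le> expectation (g n)"
      by (rule integral_mono) (use assms in auto)
    then show "norm (expectation (\<lambda>x. \<bar>f n x - c\<bar>)) \<le> expectation (g n)"
      by (simp add: integral_nonneg_AE)
  qed
qed

lemma L1_add: "L1 f c \<Longrightarrow> L1 g d \<Longrightarrow> L1 (\<lambda>n x. f n x + g n x) (c + d)"
proof -
  assume f: "L1 f c" and g: "L1 g d"
  then have i: "integrable M (f n)" "integrable M (g n)" for n by (auto simp: L1_def)
  have j: "integrable M (\<lambda>x. \<bar>f n x - c\<bar>)" "integrable M (\<lambda>x. \<bar>g n x - d\<bar>)" for n using i by auto
  show ?thesis
  proof (rule L1_bound[where g = "\<lambda>n x. \<bar>f n x - c\<bar> + \<bar>g n x - d\<bar>"])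
    have "(\<lambda>n. expectation (\<lambda>x. \<bar>f n x - c\<bar>) + expectation (\<lambda>x. \<bar>g n x - d\<bar>)) \<longlonglongrightarrow> 0 + 0"
      using f g by (intro tendsto_add) (auto simp: L1_def)
    then show "(\<lambda>n. expectation (\<lambda>x. \<bar>f n x - c\<bar> + \<bar>g n x - d\<bar>)) \<longlonglongrightarrow> 0"
      using j by simp
  qed (use i j in auto)
qed

lemma L1_cmult: "L1 f c \<Longrightarrow> L1 (\<lambda>n x. a * f n x) (a * c)"
proof -
  assume f: "L1 f c"
  then have i: "integrable M (f n)" for n by (auto simp: L1_def)
  have j: "integrable M (\<lambda>x. \<bar>f n x - c\<bar>)" for n using i by auto
  show ?thesis
  proof (rule L1_bound[where g = "\<lambda>n x. \<bar>a\<bar> * \<bar>f n x - c\<bar>"])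
    have "(\<lambda>n. \<bar>a\<bar> * expectation (\<lambda>x. \<bar>f n x - c\<bar>)) \<longlonglongrightarrow> \<bar>a\<bar> * 0"
      using f by (intro tendsto_mult_left) (auto simp: L1_def)
    then show "(\<lambda>n. expectation (\<lambda>x. \<bar>a\<bar> * \<bar>f n x - c\<bar>)) \<longlonglongrightarrow> 0" by simp
  qed (use i j in \<open>auto simp: abs_mult[symmetric] right_diff_distrib\<close>)
qed

lemma L1_diff: "L1 f c \<Longrightarrow> L1 g d \<Longrightarrow> L1 (\<lambda>n x. f n x - g n x) (c - d)"
  using L1_add[of f c "\<lambda>n x. (-1) * g n x" "(-1) * d"] L1_cmult[of g d "-1"] by simp

lemma L1_sum: "finite J \<Longrightarrow> (\<And>j. j \<in> J \<Longrightarrow> L1 (f j) (c j)) \<Longrightarrow> L1 (\<lambda>n x. \<Sum>j\<in>J. f j n x) (\<Sum>j\<in>J. c j)"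
proof (induction J rule: finite_induct)
  case empty
  then show ?case by (simp add: L1_def)
next
  case (insert j J)
  then show ?case using L1_add[of "f j" "c j" "\<lambda>n x. \<Sum>j\<in>J. f j n x"] by simp
qed

text \<open>Serves to obtain the positive semidefiniteness of the limiting covariance from the
  nonnegativity of the conditional variances.\<close>

lemma L1_nonneg:
  assumes "L1 f c" "\<And>n x. x \<in> space M \<Longrightarrow> 0 \<le> f n x"
  shows "0 \<le> c"
proof -
  have "- c \<le> expectation (\<lambda>x. \<bar>f n x - c\<bar>)" for n
  proof -
    have "expectation (\<lambda>_. - c) \<le> expectation (\<lambda>x. \<bar>f n x - c\<bar>)"
    proof (rule integral_mono)
      have "integrable M (f n)" using assms(1) by (simp add: L1_def)
      then show "integrable M (\<lambda>x. \<bar>f n x - c\<bar>)" by auto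
      show "- c \<le> \<bar>f n x - c\<bar>" if "x \<in> space M" for x
        using assms(2)[OF that, of n] by linarith
    qed auto
    then show ?thesis using prob_space by simp
  qed
  then have "- c \<le> 0"
    using assms(1) by (intro LIMSEQ_le_const[of "\<lambda>n. expectation (\<lambda>x. \<bar>f n x - c\<bar>)" 0]) (auto simp: L1_def)
  then show ?thesis by simp
qed

end

lemma abs_add_powr_le:
  fixes u v p :: real
  assumes "0 \<le> p"
  shows "\<bar>u + v\<bar> powr p \<le> 2 powr p * (\<bar>u\<bar> powr p + \<bar>v\<bar> powr p)"
proof -
  have "\<bar>u + v\<bar> powr p \<le> (2 * max \<bar>u\<bar> \<bar>v\<bar>) powr p"
    using assms by (intro powr_mono2) auto
  also have "\<dots> = 2 powr p * (max \<bar>u\<bar> \<bar>v\<bar>) powr p" by (simp add: powr_mult)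
  also have "(max \<bar>u\<bar> \<bar>v\<bar>) powr p \<le> \<bar>u\<bar> powr p + \<bar>v\<bar> powr p" by (auto simp: max_def)
  finally show ?thesis by simp
qed

section \<open>The constants of the statement in terms of the walk, and the quenched drift\<close>

context walk begin

lemma drift_eq: "drift M (X (0, 1)) = sl.mean"
  unfolding drift_def p_def[symmetric] sl.mean_def
  by (rule infsum_finite_support) (auto simp: sl.p_out)

lemma sigma1_sq_eq: "sigma1_sq M (X (0, 1)) = sl.var"
  unfolding sigma1_sq_def drift_eq p_def[symmetric] sl.var_def
  by (rule infsum_finite_support) (auto simp: sl.p_out)

definition D :: "int \<Rightarrow> nat \<Rightarrow> 'a \<Rightarrow> real" where
  "D y l x = (\<Sum>j\<in>J. of_int j * X (y, l) x j) - sl.mean"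

definition sD :: real where "sD = expectation (\<lambda>x. (D 0 1 x)\<^sup>2)"

lemma sigmaD_sq_eq: "sigmaD_sq M (X (0, 1)) = sD"
  unfolding sigmaD_sq_def drift_eq sD_def
proof (rule Bochner_Integration.integral_cong[OF refl])
  fix x assume x: "x \<in> space M"
  have "(\<Sum>\<^sub>\<infinity>j. real_of_int j * X (0, 1) x j) = (\<Sum>j\<in>J. of_int j * X (0, 1) x j)"
    by (rule infsum_finite_support) (use X_out[OF order_refl x] in auto)
  then show "((\<Sum>\<^sub>\<infinity>j. real_of_int j * X (0, 1) x j) - sl.mean)\<^sup>2 = (D 0 1 x)\<^sup>2" by (simp add: D_def)
qed

lemma qbar_eq: "qbar M (X (0, 1)) = (\<lambda>x y. sl.qb (y - x))"
proof (intro ext)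
  fix x y
  have "(\<Sum>\<^sub>\<infinity>z. p z * p (z + y - x)) = (\<Sum>z\<in>J. p z * p (z + y - x))"
    by (rule infsum_finite_support) (auto simp: sl.p_out)
  then show "qbar M (X (0, 1)) x y = sl.qb (y - x)"
    unfolding qbar_def p_def[symmetric] sl.qb_def by (simp add: add_diff_eq)
qed

lemma potential_kernel_eq: "potential_kernel M (X (0, 1)) x = sl.abar x"
  unfolding potential_kernel_def qbar_eq by (rule limI) (rule sl.abar_lim)

text \<open>The kernel \<open>qker\<close> at 0 is the law of the difference of two steps drawn from
  one weight vector. Summing over the difference or over both steps is a reindexing, and the joint
  mean \<open>h\<close> is symmetric.\<close>

lemma rap_beta_eq: "rap_beta M (X (0, 1)) = beta"
proof -
  define h where "h a b = expectation (\<lambda>x. X (0, 1) x a * X (0, 1) x b)" for a b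
  have h0: "h a b = 0" if "a \<notin> J \<or> b \<notin> J" for a b
  proof -
    have "h a b = expectation (\<lambda>_. 0)"
      unfolding h_def using that X_out[OF order_refl]
      by (intro Bochner_Integration.integral_cong refl) auto
    then show ?thesis by simp
  qed
  have q: "qker M (X (0, 1)) 0 x = (\<Sum>z\<in>J. h z (z + x))" for x
    unfolding qker_def h_def[symmetric] by simp (rule infsum_finite_support, use h0 in auto)
  have "rap_beta M (X (0, 1)) = (\<Sum>x\<in>sl.I2. (\<Sum>z\<in>J. h z (z + x)) * sl.abar x)"
    unfolding rap_beta_def q potential_kernel_eq
  proof (rule infsum_finite_support)
    fix x assume "x \<notin> sl.I2"
    then have "h z (z + x) = 0" if "z \<in> J" for z using that by (intro h0) auto
    then show "(\<Sum>z\<in>J. h z (z + x)) * sl.abar x = 0" by simp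
  qed simp
  also have "\<dots> = (\<Sum>z\<in>J. \<Sum>x\<in>sl.I2. h z (z + x) * sl.abar x)"
    unfolding sum_distrib_right by (rule sum.swap)
  also have "\<dots> = (\<Sum>z\<in>J. \<Sum>a\<in>J. h z a * sl.abar (a - z))"
  proof (rule sum.cong[OF refl])
    fix z assume z: "z \<in> J"
    have "(\<Sum>x\<in>sl.I2. h z (z + x) * sl.abar x) = (\<Sum>a\<in>(\<lambda>x. z + x) ` sl.I2. h z a * sl.abar (a - z))"
      by (subst sum.reindex) auto
    also have "\<dots> = (\<Sum>a\<in>J. h z a * sl.abar (a - z))"
    proof (rule sum.mono_neutral_right)
      show "J \<subseteq> (\<lambda>x. z + x) ` sl.I2"
      proof
        fix a assume "a \<in> J"
        then show "a \<in> (\<lambda>x. z + x) ` sl.I2" using z by (intro image_eqI[of _ _ "a - z"]) auto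
      qed
    qed (auto simp: h0)
    finally show "(\<Sum>x\<in>sl.I2. h z (z + x) * sl.abar x) = (\<Sum>a\<in>J. h z a * sl.abar (a - z))" .
  qed
  also have "\<dots> = beta"
    unfolding beta_def h_def[symmetric]
    by (subst sum.swap) (simp add: h_def mult.commute)
  finally show ?thesis .
qed

lemma D_F: "D y l \<in> borel_measurable (F {(y, l)})"
proof -
  have [measurable]: "(\<lambda>x. X (y, l) x j) \<in> borel_measurable (F {(y, l)})" for j
    by (rule X_coord_F) simp
  show ?thesis unfolding D_def[abs_def] by measurable
qed

lemma D_bound: "1 \<le> l \<Longrightarrow> x \<in> space M \<Longrightarrow> \<bar>D y l x\<bar> \<le> 2 * real R"
proof -
  assume l: "1 \<le> l" and x: "x \<in> space M"
  have "\<bar>\<Sum>j\<in>J. of_int j * X (y, l) x j\<bar> \<le> (\<Sum>j\<in>J. real R * X (y, l) x j)"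
    by (intro order_trans[OF sum_abs] sum_mono) (auto simp: abs_mult X_nonneg[OF l x] intro!: mult_right_mono)
  also have "\<dots> = real R" by (simp add: sum_distrib_left[symmetric] X_sum[OF l x])
  finally show ?thesis unfolding D_def using abs_mean_le by linarith
qed

lemma D_expectation: "1 \<le> l \<Longrightarrow> expectation (D y l) = 0"
  unfolding D_def[abs_def] using X_integrable[of l y] prob_space
  by (simp add: expectation_X sl.mean_def)

lemma D_second: "1 \<le> l \<Longrightarrow> expectation (\<lambda>x. (D y l x)\<^sup>2) = sD"
  unfolding sD_def D_def
  by (rule expectation_X_eq[of l "\<lambda>v. ((\<Sum>j\<in>J. of_int j * v j) - sl.mean)\<^sup>2"]) auto

lemma sD_nonneg: "0 \<le> sD" unfolding sD_def by (intro integral_nonneg_AE AE_I2) auto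

lemma EV_cong: "(\<And>y. y \<in> Bx T k \<Longrightarrow> f y = g y) \<Longrightarrow> EV T k l x f = EV T k l x g"
  unfolding EV_def by (intro sum.cong) auto

text \<open>The Doob decomposition of the quenched mean endpoint: each level adds the annealed mean
  step and the average, over the quenched law, of the centred quenched drift
  \<open>D\<close>.\<close>

lemma EV_identity:
  assumes x: "x \<in> space M"
  shows "EV T k 0 x of_int = of_int k + sl.mean * real T + (\<Sum>l=1..T. EV T k l x (\<lambda>y. D y l x))"
proof -
  have "EV T k l x of_int = of_int k + sl.mean * real (T - l) + (\<Sum>l'=Suc l..T. EV T k l' x (\<lambda>y. D y l' x))" for l
  proof (induction l rule: lev_induct[where T = T])
    case (top l)
    then show ?case by (simp add: EV_top)
  next
    case (step l)
    have r: "real (T - (l - 1)) = real (T - l) + 1" using step by auto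
    have set: "{Suc (l - 1)..T} = insert l {Suc l..T}" using step by auto
    have "(\<Sum>j\<in>J. X (y, l) x j *\<^sub>R real_of_int (y + j)) = of_int y + sl.mean + D y l x" for y
    proof -
      have "(\<Sum>j\<in>J. X (y, l) x j *\<^sub>R real_of_int (y + j)) = of_int y * (\<Sum>j\<in>J. X (y, l) x j) + (\<Sum>j\<in>J. of_int j * X (y, l) x j)"
        unfolding sum_distrib_left sum.distrib[symmetric] by (intro sum.cong refl) (simp add: algebra_simps)
      then show ?thesis by (simp add: X_sum[OF step(1) x] D_def)
    qed
    then have "EV T k (l - 1) x of_int = EV T k l x (\<lambda>y. of_int y + sl.mean + D y l x)"
      unfolding EV_step[OF step(1,2)] by simp
    also have "\<dots> = EV T k l x of_int + sl.mean + EV T k l x (\<lambda>y. D y l x)"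
      using EV_const[OF x, of T k l sl.mean] unfolding EV_def by (simp add: distrib_left sum.distrib)
    finally show ?case unfolding step(3) r set by (simp add: algebra_simps)
  qed
  from this[of 0] show ?thesis by simp
qed

end

text \<open>\<open>gg z y\<close> is the coefficient of the increment \<open>f z - f (z - 1)\<close> in \<open>f y - f 0\<close>.\<close>

definition gg :: "int \<Rightarrow> int \<Rightarrow> real" where
  "gg z y = of_bool (0 < z \<and> z \<le> y) - of_bool (y < z \<and> z \<le> 0)"

lemma gg_zero[simp]: "gg z 0 = 0"
  by (auto simp: gg_def)

lemma gg_step: "gg z y - gg z (y - 1) = of_bool (z = y)"
  by (auto simp: gg_def)

lemma gg_bound: "\<bar>gg z y\<bar> \<le> 1"
  by (auto simp: gg_def)

text \<open>The two coefficient functions differ, by 1 in absolute value, exactly at the sites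
  between \<open>y\<close> and \<open>y'\<close>.\<close>

lemma gg_diff_square_sum:
  assumes "\<bar>y\<bar> \<le> B" "\<bar>y'\<bar> \<le> B"
  shows "(\<Sum>z\<in>{-B..B}. (gg z y - gg z y')\<^sup>2) = \<bar>of_int (y - y')\<bar>"
proof -
  have "(gg z y - gg z y')\<^sup>2 = of_bool (z \<in> {min y y' + 1..max y y'})" for z
    by (auto simp: gg_def)
  then have "(\<Sum>z\<in>{-B..B}. (gg z y - gg z y')\<^sup>2) = (\<Sum>z\<in>{-B..B}. of_bool (z \<in> {min y y' + 1..max y y'}))"
    by simp
  also have "\<dots> = (\<Sum>z\<in>{min y y' + 1..max y y'}. 1)"
    using assms by (intro sum.mono_neutral_cong_right) auto
  also have "\<dots> = \<bar>of_int (y - y')\<bar>" by (simp add: min_def max_def)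
  finally show ?thesis .
qed

text \<open>Polarization of the previous identity. This is the covariance of a two-sided simple
  random path, the discrete source of the level-0 part of the limit.\<close>

lemma gg_inner:
  assumes "\<bar>y\<bar> \<le> B" "\<bar>y'\<bar> \<le> B"
  shows "(\<Sum>z\<in>{-B..B}. gg z y * gg z y') = (\<bar>of_int y\<bar> + \<bar>of_int y'\<bar> - \<bar>of_int (y - y')\<bar>) / 2"
proof -
  have B: "\<bar>0::int\<bar> \<le> B" using assms by simp
  have "(\<Sum>z\<in>{-B..B}. (gg z y - gg z y')\<^sup>2) = (\<Sum>z\<in>{-B..B}. (gg z y - gg z 0)\<^sup>2 + (gg z y' - gg z 0)\<^sup>2 - 2 * (gg z y * gg z y'))"
    by (intro sum.cong refl) (simp add: power2_eq_square algebra_simps)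
  also have "\<dots> = (\<Sum>z\<in>{-B..B}. (gg z y - gg z 0)\<^sup>2) + (\<Sum>z\<in>{-B..B}. (gg z y' - gg z 0)\<^sup>2) - 2 * (\<Sum>z\<in>{-B..B}. gg z y * gg z y')"
    by (simp only: sum.distrib sum_subtractf sum_distrib_left)
  finally show ?thesis
    unfolding gg_diff_square_sum[OF assms] gg_diff_square_sum[OF assms(1) B] gg_diff_square_sum[OF assms(2) B] by simp
qed

text \<open>Both sides vanish at 0 and have the same increments, by \<open>gg_step\<close>;
  induction runs upward and downward from 0.\<close>

lemma increments_rep:
  fixes f :: "int \<Rightarrow> real"
  assumes f0: "f 0 = 0" and y: "\<bar>y\<bar> \<le> B"
  shows "f y = (\<Sum>z\<in>{-B..B}. gg z y * (f z - f (z - 1)))"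
proof -
  define g where "g y = (\<Sum>z\<in>{-B..B}. gg z y * (f z - f (z - 1)))" for y
  have g: "g y - g (y - 1) = f y - f (y - 1)" if "\<bar>y\<bar> \<le> B" for y
  proof -
    have "g y - g (y - 1) = (\<Sum>z\<in>{-B..B}. if z = y then f z - f (z - 1) else 0)"
      unfolding g_def sum_subtractf[symmetric] left_diff_distrib[symmetric] gg_step by (intro sum.cong refl) auto
    also have "\<dots> = f y - f (y - 1)"
    proof -
      have "y \<in> {-B..B}" using that by auto
      then show ?thesis by (subst sum.delta) auto
    qed
    finally show ?thesis .
  qed
  have g0: "g 0 = 0" by (simp add: g_def)
  have up: "int n \<le> B \<Longrightarrow> f (int n) = g (int n)" for n
  proof (induction n)
    case (Suc n)
    then show ?case using g[of "int (Suc n)"] by simp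
  qed (simp add: f0 g0)
  have down: "int n \<le> B \<Longrightarrow> f (- int n) = g (- int n)" for n
  proof (induction n)
    case (Suc n)
    then have "g (- int n) - g (- int n - 1) = f (- int n) - f (- int n - 1)" by (intro g) auto
    then have *: "f (- int n - 1) = g (- int n - 1)" using Suc by simp
    have "- int (Suc n) = - int n - 1" by simp
    then show ?case using * by (simp only:)
  qed (simp add: f0 g0)
  have "f y = g y"
    using up[of "nat y"] down[of "nat (- y)"] y by (cases "y \<ge> 0") auto
  then show ?thesis by (simp add: g_def)
qed

text \<open>Valid also for \<open>n = 0\<close>, where both sides are 0 by the conventions for
  \<open>powr\<close> and division.\<close>

lemma powr_quarter_square: "(real n powr (-1/4))\<^sup>2 = 1 / sqrt (real n)"
proof (cases "n = 0")
  case False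
  then have "(real n powr (-1/4))\<^sup>2 = real n powr (- (1/2))"
    by (simp add: power2_eq_square powr_add[symmetric])
  also have "\<dots> = 1 / sqrt (real n)" using False by (simp add: powr_minus_divide powr_half_sqrt)
  finally show ?thesis .
qed simp

section \<open>The random average process and its innovations on space-time\<close>

locale rap = walk M X R for M :: "'a measure" and X :: "int \<times> nat \<Rightarrow> 'a \<Rightarrow> int \<Rightarrow> real" and R :: nat +
  fixes \<eta> :: "int \<Rightarrow> 'a \<Rightarrow> real" and \<sigma> :: "nat \<Rightarrow> int \<Rightarrow> 'a \<Rightarrow> real" and \<alpha> \<mu>\<^sub>0 s0 :: real
  assumes X0: "X (k, 0) = (\<lambda>x _. \<eta> k x)"
    and evo: "1 \<le> s \<Longrightarrow> x \<in> space M \<Longrightarrow> \<sigma> s k x = (\<Sum>j\<in>{-int R..int R}. X (k, s) x j * \<sigma> (s - 1) (k + j) x)"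
    and init: "x \<in> space M \<Longrightarrow> \<sigma> 0 0 x = 0"
    and inc: "x \<in> space M \<Longrightarrow> \<eta> k x = \<sigma> 0 k x - \<sigma> 0 (k - 1) x"
    and eid: "distr M borel (\<eta> k) = distr M borel (\<eta> 0)"
    and alpha: "0 < \<alpha>"
    and mom: "integrable M (\<lambda>x. \<bar>\<eta> 0 x\<bar> powr (2 + \<alpha>))"
    and mu: "\<mu>\<^sub>0 = expectation (\<eta> 0)"
    and s0: "s0 = variance (\<eta> 0)"
begin

lemma quenched_rep:
  assumes x: "x \<in> space M"
  shows "\<sigma> T k x = EV T k 0 x (\<lambda>y. \<sigma> 0 y x)"
proof -
  have "l \<le> T \<longrightarrow> \<sigma> T k x = EV T k l x (\<lambda>y. \<sigma> l y x)" for l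
  proof (induction l rule: lev_induct[where T = T])
    case (top l)
    then show ?case by (auto simp: EV_top)
  next
    case (step l)
    show ?case
      unfolding EV_step[OF step(1,2)] using step evo[OF step(1) x] by simp
  qed
  then show ?thesis by blast
qed

lemma eta_F: "\<eta> k \<in> borel_measurable (F {(k, 0)})"
  using X_coord_F[of "(k, 0)" "{(k, 0)}" 0] by (simp add: X0)

lemma eta_M[measurable]: "\<eta> k \<in> borel_measurable M"
  by (rule F_le[OF eta_F])

lemma eta_transfer:
  assumes [measurable]: "f \<in> borel_measurable borel"
  shows "expectation (\<lambda>x. f (\<eta> k x) :: real) = expectation (\<lambda>x. f (\<eta> 0 x))"
    "integrable M (\<lambda>x. f (\<eta> 0 x)) \<Longrightarrow> integrable M (\<lambda>x. f (\<eta> k x) :: real)"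
proof -
  show "expectation (\<lambda>x. f (\<eta> k x)) = expectation (\<lambda>x. f (\<eta> 0 x))"
    using integral_distr[of "\<eta> k" M borel f] integral_distr[of "\<eta> 0" M borel f] by (simp add: eid[of k])
  show "integrable M (\<lambda>x. f (\<eta> 0 x)) \<Longrightarrow> integrable M (\<lambda>x. f (\<eta> k x))"
    using integrable_distr_eq[of "\<eta> k" M borel f] integrable_distr_eq[of "\<eta> 0" M borel f] by (simp add: eid[of k])
qed

text \<open>The Taylor estimate \<open>iexp_remainder\<close> works for exponents at most 1, so a
  larger moment exponent is lowered.\<close>

definition "a = min \<alpha> 1"

lemma a: "0 < a" "a \<le> 1" "a \<le> \<alpha>"
  using alpha by (auto simp: a_def)

definition d :: "int \<Rightarrow> 'a \<Rightarrow> real" where "d k x = \<eta> k x - \<mu>\<^sub>0"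

lemma d_moment: "integrable M (\<lambda>x. \<bar>d k x\<bar> powr (2 + a))"
proof -
  have "integrable M (\<lambda>x. \<bar>d 0 x\<bar> powr (2 + a))"
  proof (rule Bochner_Integration.integrable_bound)
    show "integrable M (\<lambda>x. 2 powr (2 + a) * (1 + \<bar>\<eta> 0 x\<bar> powr (2 + \<alpha>) + \<bar>\<mu>\<^sub>0\<bar> powr (2 + a)))"
      by (intro integrable_mult_right Bochner_Integration.integrable_add mom integrable_const)
    show "AE x in M. norm (\<bar>d 0 x\<bar> powr (2 + a)) \<le> norm (2 powr (2 + a) * (1 + \<bar>\<eta> 0 x\<bar> powr (2 + \<alpha>) + \<bar>\<mu>\<^sub>0\<bar> powr (2 + a)))"
    proof (rule AE_I2)
      fix x
      have "\<bar>d 0 x\<bar> powr (2 + a) \<le> 2 powr (2 + a) * (\<bar>\<eta> 0 x\<bar> powr (2 + a) + \<bar>\<mu>\<^sub>0\<bar> powr (2 + a))"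
        using abs_add_powr_le[of "2 + a" "\<eta> 0 x" "- \<mu>\<^sub>0"] a by (simp add: d_def)
      also have "\<bar>\<eta> 0 x\<bar> powr (2 + a) \<le> 1 + \<bar>\<eta> 0 x\<bar> powr (2 + \<alpha>)"
      proof (cases "\<bar>\<eta> 0 x\<bar> \<le> 1")
        case True
        then have "\<bar>\<eta> 0 x\<bar> powr (2 + a) \<le> 1 powr (2 + a)" using a by (intro powr_mono2) auto
        then show ?thesis using powr_ge_zero[of "\<bar>\<eta> 0 x\<bar>" "2 + \<alpha>"] unfolding powr_one_eq_one by linarith
      next
        case False
        then have "\<bar>\<eta> 0 x\<bar> powr (2 + a) \<le> \<bar>\<eta> 0 x\<bar> powr (2 + \<alpha>)" using a by (intro powr_mono) auto
        then show ?thesis by simp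
      qed
      finally show "norm (\<bar>d 0 x\<bar> powr (2 + a)) \<le> norm (2 powr (2 + a) * (1 + \<bar>\<eta> 0 x\<bar> powr (2 + \<alpha>) + \<bar>\<mu>\<^sub>0\<bar> powr (2 + a)))"
        by simp
    qed
  qed (simp add: d_def)
  then show ?thesis
    unfolding d_def by (rule eta_transfer(2)[of "\<lambda>u. \<bar>u - \<mu>\<^sub>0\<bar> powr (2 + a)", rotated]) measurable
qed

lemma d_square: "integrable M (\<lambda>x. (d k x)\<^sup>2)"
proof (rule Bochner_Integration.integrable_bound)
  show "integrable M (\<lambda>x. 1 + \<bar>d k x\<bar> powr (2 + a))"
    by (intro Bochner_Integration.integrable_add d_moment integrable_const)
  show "AE x in M. norm ((d k x)\<^sup>2) \<le> norm (1 + \<bar>d k x\<bar> powr (2 + a))"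
  proof (rule AE_I2)
    fix x
    have "(d k x)\<^sup>2 \<le> 1 + \<bar>d k x\<bar> powr (2 + a)"
    proof (cases "\<bar>d k x\<bar> \<le> 1")
      case True
      then have "(d k x)\<^sup>2 \<le> 1" by (simp add: abs_square_le_1)
      then show ?thesis using powr_ge_zero[of "\<bar>d k x\<bar>" "2 + a"] by linarith
    next
      case False
      then have "\<bar>d k x\<bar> powr 2 \<le> \<bar>d k x\<bar> powr (2 + a)" using a by (intro powr_mono) auto
      moreover have "\<bar>d k x\<bar> powr 2 = (d k x)\<^sup>2" using False by (simp add: powr_numeral)
      ultimately show ?thesis by simp
    qed
    then show "norm ((d k x)\<^sup>2) \<le> norm (1 + \<bar>d k x\<bar> powr (2 + a))" by simp
  qed
qed (simp add: d_def)

lemma d_integrable: "integrable M (d k)"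
  by (rule square_integrable_imp_integrable[OF _ d_square]) (simp add: d_def[abs_def])

lemma d_expectation: "expectation (d k) = 0"
proof -
  have i: "integrable M (\<eta> 0)"
    using Bochner_Integration.integrable_add[OF d_integrable[of 0] integrable_const[of \<mu>\<^sub>0]] by (simp add: d_def)
  have "expectation (d k) = expectation (\<lambda>x. \<eta> 0 x - \<mu>\<^sub>0)"
    unfolding d_def[abs_def] by (rule eta_transfer(1)[of "\<lambda>u. u - \<mu>\<^sub>0"]) auto
  then show ?thesis using i prob_space mu by simp
qed

lemma d_second: "expectation (\<lambda>x. (d k x)\<^sup>2) = s0"
  unfolding d_def s0 mu[symmetric] by (rule eta_transfer(1)[of "\<lambda>u. (u - \<mu>\<^sub>0)\<^sup>2"]) auto

lemma s0_nonneg: "0 \<le> s0" unfolding s0 by (rule variance_positive)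

definition ZZ :: "nat \<Rightarrow> int \<Rightarrow> 'a \<Rightarrow> real" where "ZZ l y = (if l = 0 then d y else D y l)"
definition ss :: "nat \<Rightarrow> real" where "ss l = (if l = 0 then s0 else sD)"
definition "md = expectation (\<lambda>x. \<bar>d 0 x\<bar> powr (2 + a))"
text \<open>A common bound for the ratio of the moment of order \<open>2 + a\<close> to the
  variance. At level 0 it is \<open>md / s0\<close>, or 0 for degenerate increments, whose moment
  vanishes as well. At later levels |D| is at most \<open>2 * real R\<close>, so a factor |D|^a
  splits off.\<close>

definition "KK = (if s0 = 0 then 0 else md / s0) + (2 * real R) powr a"

lemma md_nonneg: "0 \<le> md" unfolding md_def by (intro integral_nonneg_AE AE_I2) auto

lemma KK_nonneg: "0 \<le> KK" unfolding KK_def using md_nonneg s0_nonneg by simp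

lemma ZZ_F: "ZZ l y \<in> borel_measurable (F {(y, l)})"
  using D_F[of y l] eta_F[of y] by (cases "l = 0") (auto simp: ZZ_def d_def[abs_def])

lemma ZZ_mean: "expectation (ZZ l y) = 0"
  using d_expectation[of y] D_expectation[of l y] by (cases "l = 0") (auto simp: ZZ_def)

lemma ZZ_second: "expectation (\<lambda>x. (ZZ l y x)\<^sup>2) = ss l"
  using d_second[of y] D_second[of l y] by (cases "l = 0") (auto simp: ZZ_def ss_def)

lemma ZZ_square_integrable: "integrable M (\<lambda>x. (ZZ l y x)\<^sup>2)"
proof (cases "l = 0")
  case True
  then show ?thesis using d_square by (simp add: ZZ_def)
next
  case False
  have "integrable M (\<lambda>x. (D y l x)\<^sup>2)"
  proof (rule integrable_const_bound[of _ "(2 * real R)\<^sup>2"])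
    show "AE x in M. norm ((D y l x)\<^sup>2) \<le> (2 * real R)\<^sup>2"
    proof (rule AE_I2)
      fix x assume "x \<in> space M"
      then have "\<bar>D y l x\<bar> \<le> 2 * real R" using D_bound[of l x y] False by simp
      from power_mono[OF this, of 2] show "norm ((D y l x)\<^sup>2) \<le> (2 * real R)\<^sup>2" by simp
    qed
    show "(\<lambda>x. (D y l x)\<^sup>2) \<in> borel_measurable M" using F_le[OF D_F] by measurable
  qed
  then show ?thesis using False by (simp add: ZZ_def)
qed

lemma ZZ_moment:
  "integrable M (\<lambda>x. \<bar>ZZ l y x\<bar> powr (2 + a))" "expectation (\<lambda>x. \<bar>ZZ l y x\<bar> powr (2 + a)) \<le> KK * ss l"
proof -
  have "integrable M (\<lambda>x. \<bar>ZZ l y x\<bar> powr (2 + a)) \<and> expectation (\<lambda>x. \<bar>ZZ l y x\<bar> powr (2 + a)) \<le> KK * ss l"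
  proof (cases "l = 0")
    case True
    have m: "expectation (\<lambda>x. \<bar>d y x\<bar> powr (2 + a)) = md"
      unfolding md_def d_def by (rule eta_transfer(1)[of "\<lambda>u. \<bar>u - \<mu>\<^sub>0\<bar> powr (2 + a)"]) measurable
    have "md \<le> KK * s0"
    proof (cases "s0 = 0")
      case True
      have "AE x in M. (d 0 x)\<^sup>2 = 0"
        using d_second[of 0] True integral_nonneg_eq_0_iff_AE[OF d_square[of 0]] by simp
      then have "AE x in M. \<bar>d 0 x\<bar> powr (2 + a) = 0" by eventually_elim simp
      then have "md = 0" unfolding md_def by (simp add: integral_eq_zero_AE)
      then show ?thesis using True by simp
    next
      case False
      then have "md = md / s0 * s0" by simp
      also have "\<dots> \<le> KK * s0" unfolding KK_def using False s0_nonneg by (intro mult_right_mono) auto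
      finally show ?thesis .
    qed
    then show ?thesis using True d_moment[of y] m by (simp add: ZZ_def ss_def)
  next
    case False
    then have l: "1 \<le> l" by simp
    have b: "\<bar>D y l x\<bar> powr (2 + a) \<le> (D y l x)\<^sup>2 * (2 * real R) powr a" if "x \<in> space M" for x
    proof -
      have "\<bar>D y l x\<bar> powr (2 + a) = (D y l x)\<^sup>2 * \<bar>D y l x\<bar> powr a"
        by (cases "D y l x = 0") (simp_all add: powr_add powr_numeral)
      also have "\<dots> \<le> (D y l x)\<^sup>2 * (2 * real R) powr a"
        using D_bound[OF l that, of y] a by (intro mult_left_mono powr_mono2) auto
      finally show ?thesis .
    qed
    have i2: "integrable M (\<lambda>x. (D y l x)\<^sup>2)" using ZZ_square_integrable[of l y] False by (simp add: ZZ_def)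
    have [measurable]: "D y l \<in> borel_measurable M" by (rule F_le[OF D_F])
    have i: "integrable M (\<lambda>x. \<bar>D y l x\<bar> powr (2 + a))"
      by (rule Bochner_Integration.integrable_bound[OF integrable_mult_left[OF i2, of "(2 * real R) powr a"]])
         (use b in auto)
    have "expectation (\<lambda>x. \<bar>D y l x\<bar> powr (2 + a)) \<le> expectation (\<lambda>x. (D y l x)\<^sup>2 * (2 * real R) powr a)"
      using i i2 b by (intro integral_mono) auto
    also have "\<dots> = sD * (2 * real R) powr a" using D_second[OF l] by simp
    also have "\<dots> \<le> sD * KK"
      unfolding KK_def using sD_nonneg md_nonneg s0_nonneg by (intro mult_left_mono) auto
    finally show ?thesis using i False by (simp add: ZZ_def ss_def mult.commute)
  qed
  then show "integrable M (\<lambda>x. \<bar>ZZ l y x\<bar> powr (2 + a))" "expectation (\<lambda>x. \<bar>ZZ l y x\<bar> powr (2 + a)) \<le> KK * ss l" by auto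
qed

text \<open>Specializes \<open>clt_bound\<close> to innovations on a box of space-time points,
  listed level by level from the latest level down to 0. Coefficients at level \<open>l\<close>
  depend on strictly later levels only, so they are predictable in this order.\<close>

lemma clt_levels:
  fixes L :: nat and B :: int and cc :: "nat \<Rightarrow> int \<Rightarrow> 'a \<Rightarrow> real"
  assumes B: "0 \<le> B" and eps: "0 \<le> \<epsilon>" and v: "0 \<le> v"
    and cF: "\<And>l y. cc l y \<in> borel_measurable (F (lev l))"
    and cb: "\<And>l y x. x \<in> space M \<Longrightarrow> \<bar>cc l y x\<bar> \<le> \<epsilon>"
  shows "norm ((CLINT x|M. iexp (\<Sum>l\<le>L. \<Sum>y\<in>{-B..B}. cc l y x * ZZ l y x)) - complex_of_real (exp (- v / 2)))
    \<le> (2 + exp ((v + 1) / 2) * (v + 1)) * (KK * \<epsilon> powr a + (s0 + sD) * \<epsilon>\<^sup>2 +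
        expectation (\<lambda>x. \<bar>(\<Sum>l\<le>L. \<Sum>y\<in>{-B..B}. (cc l y x)\<^sup>2 * ss l) - v\<bar>))"
proof -
  define m where "m = nat (2 * B + 1)"
  have m: "m > 0" "int m = 2 * B + 1" using B by (auto simp: m_def)
  \<comment> \<open>Each level occupies a block of \<open>m\<close> consecutive indices; the
    quotient counts levels downward from \<open>L\<close>, the remainder runs through the
    sites.\<close>
  define pos where "pos q = (int (q mod m) - B, L - q div m)" for q
  define N where "N = (L + 1) * m"
  have dv: "q div m \<le> L" if "q < N" for q
    using that m unfolding N_def by (metis Suc_eq_plus1 less_Suc_eq_le less_mult_imp_div_less)
  have bij: "bij_betw pos {..<N} ({-B..B} \<times> {..L})"
  proof (rule bij_betw_byWitness[where f' = "\<lambda>(y, s). (L - s) * m + nat (y + B)"])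
    show "\<forall>q\<in>{..<N}. (case pos q of (y, s) \<Rightarrow> (L - s) * m + nat (y + B)) = q"
    proof
      fix q assume "q \<in> {..<N}"
      then have "L - (L - q div m) = q div m" using dv[of q] by simp
      then show "(case pos q of (y, s) \<Rightarrow> (L - s) * m + nat (y + B)) = q"
        by (simp add: pos_def)
    qed
    have md: "nat (y + B) < m" if "y \<in> {-B..B}" for y using that m by auto
    show "\<forall>p\<in>{-B..B} \<times> {..L}. pos (case p of (y, s) \<Rightarrow> (L - s) * m + nat (y + B)) = p"
    proof
      fix p assume p: "p \<in> {-B..B} \<times> {..L}"
      obtain y s where ys: "p = (y, s)" by (cases p)
      have "((L - s) * m + nat (y + B)) mod m = nat (y + B)" "((L - s) * m + nat (y + B)) div m = L - s"
        using md[of y] p ys m(1) by auto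
      then show "pos (case p of (y, s) \<Rightarrow> (L - s) * m + nat (y + B)) = p"
        using p ys by (simp add: pos_def)
    qed
    have "pos q \<in> {-B..B} \<times> {..L}" for q
    proof -
      have "int (q mod m) < int m" using m(1) by simp
      then show ?thesis using m(2) by (auto simp: pos_def)
    qed
    then show "pos ` {..<N} \<subseteq> {-B..B} \<times> {..L}" by blast
    have "(L - s) * m + nat (y + B) < N" if "y \<in> {-B..B}" for y s
    proof -
      have "(L - s) * m + nat (y + B) < (L - s) * m + m" using md[OF that] by simp
      also have "\<dots> = (L - s + 1) * m" by simp
      also have "\<dots> \<le> N" unfolding N_def by (intro mult_right_mono) auto
      finally show ?thesis .
    qed
    then show "(\<lambda>(y, s). (L - s) * m + nat (y + B)) ` ({-B..B} \<times> {..L}) \<subseteq> {..<N}" by auto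
  qed
  have reidx: "(\<Sum>q<N. g (snd (pos q)) (fst (pos q))) = (\<Sum>l\<le>L. \<Sum>y\<in>{-B..B}. g l y)" for g :: "nat \<Rightarrow> int \<Rightarrow> real"
  proof -
    have "(\<Sum>q<N. g (snd (pos q)) (fst (pos q))) = (\<Sum>p\<in>{-B..B} \<times> {..L}. g (snd p) (fst p))"
      by (rule sum.reindex_bij_betw[OF bij])
    also have "\<dots> = (\<Sum>y\<in>{-B..B}. \<Sum>l\<le>L. g l y)" by (simp add: sum.cartesian_product split_def)
    also have "\<dots> = (\<Sum>l\<le>L. \<Sum>y\<in>{-B..B}. g l y)" by (rule sum.swap)
    finally show ?thesis .
  qed
  \<comment> \<open>Besides the points already listed, all later levels are included in full: the
    coefficients may depend on sites outside the box.\<close>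
  define A where "A q = pos ` {..<q} \<union> lev (snd (pos q))" for q
  have inj: "inj_on pos {..<N}" using bij by (rule bij_betw_imp_inj_on)
  interpret C: clt_array M X vec_space N A pos "\<lambda>q. ZZ (snd (pos q)) (fst (pos q))" "\<lambda>q. ss (snd (pos q))" a KK "s0 + sD" \<epsilon>
  proof (intro clt_array.intro clt_array_axioms.intro indep_family_axioms)
    show "ZZ (snd (pos k)) (fst (pos k)) \<in> borel_measurable (F {pos k})" for k
      using ZZ_F[of "snd (pos k)" "fst (pos k)"] by simp
    show "pos k \<notin> A k" if k: "k < N" for k
    proof -
      have "pos k \<notin> pos ` {..<k}"
      proof
        assume "pos k \<in> pos ` {..<k}"
        then obtain q where "q < k" "pos k = pos q" by auto
        then show False using inj_onD[OF inj, of k q] k by auto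
      qed
      then show ?thesis by (auto simp: A_def lev_def)
    qed
    show "insert (pos k) (A k) \<subseteq> A (Suc k)" if k: "k < N" for k
    proof -
      have "snd (pos (Suc k)) \<le> snd (pos k)"
        by (simp add: pos_def diff_le_mono2 div_le_mono)
      then show ?thesis
        using lev_mono[of "snd (pos (Suc k))" "snd (pos k)"] unfolding A_def by (auto simp: lessThan_Suc)
    qed
    show "ss (snd (pos k)) \<le> s0 + sD" for k using s0_nonneg sD_nonneg by (simp add: ss_def)
    show "0 \<le> s0 + sD" using s0_nonneg sD_nonneg by simp
  qed (rule a KK_nonneg eps ZZ_square_integrable ZZ_second ZZ_mean ZZ_moment)+
  have "norm ((CLINT x|M. iexp (\<Sum>q<N. cc (snd (pos q)) (fst (pos q)) x * ZZ (snd (pos q)) (fst (pos q)) x)) - complex_of_real (exp (- v / 2)))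
    \<le> (2 + exp ((v + 1) / 2) * (v + 1)) * (C.\<delta> + expectation (\<lambda>x. \<bar>(\<Sum>q<N. (cc (snd (pos q)) (fst (pos q)) x)\<^sup>2 * ss (snd (pos q))) - v\<bar>))"
  proof (rule C.clt_bound)
    show "cc (snd (pos k)) (fst (pos k)) \<in> borel_measurable (F (A k))" for k
      by (rule F_mono[OF _ cF]) (auto simp: A_def)
  qed (use cb v in auto)
  then show ?thesis
    unfolding reidx[of "\<lambda>l y. cc l y _ * ZZ l y _"] reidx[of "\<lambda>l y. (cc l y _)\<^sup>2 * ss l"] C.\<delta>_def .
qed

end

section \<open>Convergence of the quenched covariance\<close>

lemma tendsto_div_bounded:
  fixes f g :: "nat \<Rightarrow> real"
  assumes b: "\<And>n. \<bar>f n - g n * r\<bar> \<le> C" and g: "filterlim g at_top sequentially"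
  shows "(\<lambda>n. f n / g n) \<longlonglongrightarrow> r"
proof -
  have "(\<lambda>n. C / g n) \<longlonglongrightarrow> 0"
    using g by (intro tendsto_divide_0[OF tendsto_const] filterlim_at_top_imp_at_infinity)
  then have "(\<lambda>n. f n / g n - r) \<longlonglongrightarrow> 0"
  proof (rule Lim_null_comparison[rotated])
    have "eventually (\<lambda>n. g n > 0) sequentially" using g by (auto simp: filterlim_at_top_dense)
    then show "\<forall>\<^sub>F n in sequentially. norm (f n / g n - r) \<le> C / g n"
    proof eventually_elim
      case (elim n)
      then have "f n / g n - r = (f n - g n * r) / g n" by (simp add: field_simps)
      then show ?case using b[of n] elim by (simp add: abs_divide divide_right_mono)
    qed
  qed
  then show ?thesis by (rule LIM_zero_cancel)
qed

lemma sqrt_nat_at_top: "filterlim (\<lambda>n. sqrt (real n)) at_top sequentially"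
  by real_asymp

context rap begin

definition TT :: "nat \<Rightarrow> real \<times> real \<Rightarrow> nat" where
  "TT n u = nat \<lfloor>real n * fst u\<rfloor>"

definition kk :: "nat \<Rightarrow> real \<times> real \<Rightarrow> int" where
  "kk n u = \<lfloor>snd u * sqrt (real n)\<rfloor> + \<lfloor>real n * fst u * (- sl.mean)\<rfloor>"

lemma TT_bound:
  assumes "0 \<le> fst u"
  shows "\<bar>real (TT n u) - real n * fst u\<bar> \<le> 1"
proof -
  have "real (TT n u) = of_int \<lfloor>real n * fst u\<rfloor>" using assms by (simp add: TT_def)
  then show ?thesis by linarith
qed

lemma TT_lim: "0 \<le> fst u \<Longrightarrow> (\<lambda>n. real (TT n u) / real n) \<longlonglongrightarrow> fst u"
  by (rule tendsto_div_bounded[where C = 1, OF _ filterlim_real_sequentially]) (rule TT_bound)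

text \<open>The drift of the walk over the time \<open>TT n u\<close> cancels the shift of the
  observation point by \<open>- sl.mean\<close> per unit time, so the annealed mean endpoint is
  \<open>sqrt (real n) * snd u\<close> up to three rounding errors.\<close>

lemma kk_bound:
  assumes u: "0 \<le> fst u"
  shows "\<bar>of_int (kk n u) + sl.mean * real (TT n u) - sqrt (real n) * snd u\<bar> \<le> 2 + \<bar>sl.mean\<bar>"
proof -
  have a: "\<bar>sl.mean * (real (TT n u) - real n * fst u)\<bar> \<le> \<bar>sl.mean\<bar>"
    unfolding abs_mult using mult_left_mono[OF TT_bound[OF u, of n], of "\<bar>sl.mean\<bar>"] by simp
  have b: "\<bar>of_int \<lfloor>snd u * sqrt (real n)\<rfloor> - snd u * sqrt (real n)\<bar> \<le> 1"
    "\<bar>of_int \<lfloor>real n * fst u * (- sl.mean)\<rfloor> - real n * fst u * (- sl.mean)\<bar> \<le> 1" by linarith+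
  have "of_int (kk n u) + sl.mean * real (TT n u) - sqrt (real n) * snd u =
    (of_int \<lfloor>snd u * sqrt (real n)\<rfloor> - snd u * sqrt (real n)) +
    (of_int \<lfloor>real n * fst u * (- sl.mean)\<rfloor> - real n * fst u * (- sl.mean)) +
    sl.mean * (real (TT n u) - real n * fst u)"
    by (simp add: kk_def algebra_simps)
  then show ?thesis using a b by linarith
qed

lemma ctr_diff_limit:
  assumes u: "0 \<le> fst u" "0 \<le> fst u'" and l: "\<And>n. l n \<le> TT n u" "\<And>n. l n \<le> TT n u'"
  shows "(\<lambda>n. (ctr (TT n u) (kk n u) (l n) - ctr (TT n u') (kk n u') (l n)) / sqrt (real n)) \<longlonglongrightarrow> snd u - snd u'"
proof (rule tendsto_div_bounded[OF _ sqrt_nat_at_top])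
  fix n
  have *: "ctr (TT n u) (kk n u) (l n) - ctr (TT n u') (kk n u') (l n) - sqrt (real n) * (snd u - snd u') =
    (of_int (kk n u) + sl.mean * real (TT n u) - sqrt (real n) * snd u) -
    (of_int (kk n u') + sl.mean * real (TT n u') - sqrt (real n) * snd u')"
    unfolding ctr_def of_nat_diff[OF l(1)] of_nat_diff[OF l(2)] by (simp add: algebra_simps)
  show "\<bar>ctr (TT n u) (kk n u) (l n) - ctr (TT n u') (kk n u') (l n) - sqrt (real n) * (snd u - snd u')\<bar>
      \<le> 2 * (2 + \<bar>sl.mean\<bar>)"
    unfolding * using order_trans[OF abs_triangle_ineq4 add_mono[OF kk_bound[OF u(1)] kk_bound[OF u(2)]]] by simp
qed

text \<open>Down to level \<open>l n\<close> the walks run for rescaled times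
  \<open>fst u - \<tau>\<close> and \<open>fst u' - \<tau>\<close>; their variances add, while the
  common drift cancels in the difference.\<close>

lemma pair_limit:
  assumes u: "0 \<le> fst u" "0 \<le> fst u'" and l: "\<And>n. l n \<le> TT n u" "\<And>n. l n \<le> TT n u'"
    and lam: "(\<lambda>n. real (l n) / real n) \<longlonglongrightarrow> \<tau>"
  shows "L1 (\<lambda>n x. EVV (TT n u) (kk n u) (TT n u') (kk n u') (l n) x (\<lambda>y z. \<bar>of_int (y - z)\<bar>) / sqrt (real n))
    (Lam (sl.var * ((fst u - \<tau>) + (fst u' - \<tau>))) (snd u - snd u'))"
  unfolding L1_def
proof (intro conjI allI)
  show "integrable M (\<lambda>x. EVV (TT n u) (kk n u) (TT n u') (kk n u') (l n) x (\<lambda>y z. \<bar>of_int (y - z)\<bar>) / sqrt (real n))" for n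
    by (simp only: divide_inverse) (intro integrable_mult_left EVV_integrable)
  have "(\<lambda>n. real (TT n u - l n) / real n) \<longlonglongrightarrow> fst u - \<tau>"
    unfolding of_nat_diff[OF l(1)] diff_divide_distrib by (intro tendsto_diff TT_lim u lam)
  moreover have "(\<lambda>n. real (TT n u' - l n) / real n) \<longlonglongrightarrow> fst u' - \<tau>"
    unfolding of_nat_diff[OF l(2)] diff_divide_distrib by (intro tendsto_diff TT_lim u lam)
  ultimately show "(\<lambda>n. expectation (\<lambda>x. \<bar>EVV (TT n u) (kk n u) (TT n u') (kk n u') (l n) x (\<lambda>y z. \<bar>of_int (y - z)\<bar>) / sqrt (real n)
      - Lam (sl.var * ((fst u - \<tau>) + (fst u' - \<tau>))) (snd u - snd u')\<bar>)) \<longlonglongrightarrow> 0"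
    by (intro abs_difference_limit[OF l TT_lim[OF u(1)] TT_lim[OF u(2)] _ _ ctr_diff_limit[OF u l]])
qed

lemma end_limit:
  assumes "0 \<le> fst u" "0 \<le> fst u'"
  shows "L1 (\<lambda>n x. EVV (TT n u) (kk n u) (TT n u') (kk n u') 0 x (\<lambda>y z. \<bar>of_int (y - z)\<bar>) / sqrt (real n))
    (Lam (sl.var * (fst u + fst u')) (snd u - snd u'))"
  using pair_limit[OF assms, of "\<lambda>_. 0" 0] by simp

text \<open>At the level \<open>min (TT n u) (TT n u')\<close> the walk of shorter duration is still
  at its start and the other one has run for the difference of the times. This is the origin of the
  second term of \<open>Gamma1\<close>.\<close>

lemma start_limit:
  assumes u: "0 \<le> fst u" "0 \<le> fst u'"
  shows "L1 (\<lambda>n x. EVV (TT n u) (kk n u) (TT n u') (kk n u') (min (TT n u) (TT n u')) x (\<lambda>y z. \<bar>of_int (y - z)\<bar>) / sqrt (real n))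
    (Lam (sl.var * \<bar>fst u - fst u'\<bar>) (snd u - snd u'))"
proof -
  have "(\<lambda>n. min (real (TT n u) / real n) (real (TT n u') / real n)) \<longlonglongrightarrow> min (fst u) (fst u')"
    by (intro tendsto_min TT_lim u)
  moreover have "min (real (TT n u) / real n) (real (TT n u') / real n) = real (min (TT n u) (TT n u')) / real n" for n
    by (simp add: min_def divide_le_cancel)
  moreover have "(fst u - min (fst u) (fst u')) + (fst u' - min (fst u) (fst u')) = \<bar>fst u - fst u'\<bar>"
    by (simp add: min_def)
  ultimately show ?thesis
    using pair_limit[OF u, of "\<lambda>n. min (TT n u) (TT n u')" "min (fst u) (fst u')"] by simp
qed

lemma abs_limit:
  assumes "0 \<le> fst u"
  shows "L1 (\<lambda>n x. EV (TT n u) (kk n u) 0 x (\<lambda>y. \<bar>of_int y\<bar>) / sqrt (real n)) (Lam (sl.var * fst u) (snd u))"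
proof -
  \<comment> \<open>A walk started at the origin at time 0 stands still, so |y| is the distance to
    it and the two-walk limit applies.\<close>
  have "TT n (0, 0) = 0" "kk n (0, 0) = 0" for n by (simp_all add: TT_def kk_def)
  then show ?thesis
    using end_limit[OF assms, of "(0, 0)"] by (simp add: EVV_EV EV_top)
qed

text \<open>By \<open>abar_asymp\<close>, \<open>abar\<close> may be replaced by |x| / (2 var) at a
  bounded cost, which disappears on division by sqrt n.\<close>

lemma Fa_limit:
  assumes f: "L1 (\<lambda>n x. EVV (T n) (k n) (T' n) (k' n) (l n) x (\<lambda>y z. \<bar>of_int (y - z)\<bar>) / sqrt (real n)) c"
  shows "L1 (\<lambda>n x. Fa (T n) (k n) (T' n) (k' n) (l n) x / sqrt (real n)) (c / (2 * sl.var))"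
proof -
  obtain C where C: "\<And>y. \<bar>sl.abar y - \<bar>of_int y\<bar> / (2 * sl.var)\<bar> \<le> C" using sl.abar_asymp by blast
  let ?f = "\<lambda>n x. EVV (T n) (k n) (T' n) (k' n) (l n) x (\<lambda>y z. \<bar>of_int (y - z)\<bar>)"
  have Fi: "integrable M (\<lambda>x. Fa (T n) (k n) (T' n) (k' n) (l n) x / sqrt (real n))" for n
    unfolding Fa_def by (simp only: divide_inverse) (intro integrable_mult_left EVV_integrable)
  have fi: "integrable M (\<lambda>x. ?f n x / sqrt (real n))" for n using f by (simp add: L1_def)
  have gi: "integrable M (\<lambda>x. \<bar>?f n x / sqrt (real n) - c\<bar>)" for n
    by (intro integrable_abs Bochner_Integration.integrable_diff fi integrable_const)
  show ?thesis
  proof (rule L1_bound[where g = "\<lambda>n x. \<bar>?f n x / sqrt (real n) - c\<bar> * (1 / (2 * sl.var)) + C / sqrt (real n)"])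
    show "integrable M (\<lambda>x. \<bar>?f n x / sqrt (real n) - c\<bar> * (1 / (2 * sl.var)) + C / sqrt (real n))" for n
      by (intro Bochner_Integration.integrable_add integrable_mult_left gi integrable_const)
    have "expectation (\<lambda>x. \<bar>?f n x / sqrt (real n) - c\<bar> * (1 / (2 * sl.var)) + C / sqrt (real n)) =
      expectation (\<lambda>x. \<bar>?f n x / sqrt (real n) - c\<bar>) * (1 / (2 * sl.var)) + C / sqrt (real n)" for n
    proof -
      have "expectation (\<lambda>x. \<bar>?f n x / sqrt (real n) - c\<bar> * (1 / (2 * sl.var)) + C / sqrt (real n)) =
        expectation (\<lambda>x. \<bar>?f n x / sqrt (real n) - c\<bar> * (1 / (2 * sl.var))) + expectation (\<lambda>x. C / sqrt (real n))"
        by (intro Bochner_Integration.integral_add integrable_mult_left gi integrable_const)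
      then show ?thesis using prob_space by simp
    qed
    moreover have "(\<lambda>n. expectation (\<lambda>x. \<bar>?f n x / sqrt (real n) - c\<bar>) * (1 / (2 * sl.var)) + C / sqrt (real n)) \<longlonglongrightarrow> 0 * (1 / (2 * sl.var)) + 0"
    proof (intro tendsto_add tendsto_mult tendsto_const)
      show "(\<lambda>n. expectation (\<lambda>x. \<bar>?f n x / sqrt (real n) - c\<bar>)) \<longlonglongrightarrow> 0" using f by (simp add: L1_def)
      show "(\<lambda>n. C / sqrt (real n)) \<longlonglongrightarrow> 0"
        by (intro tendsto_divide_0[OF tendsto_const] filterlim_at_top_imp_at_infinity sqrt_nat_at_top)
    qed
    ultimately show "(\<lambda>n. expectation (\<lambda>x. \<bar>?f n x / sqrt (real n) - c\<bar> * (1 / (2 * sl.var)) + C / sqrt (real n))) \<longlonglongrightarrow> 0"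
      by simp
    fix n x assume x: "x \<in> space M"
    have "\<bar>EVV (T n) (k n) (T' n) (k' n) (l n) x (\<lambda>y z. sl.abar (y - z) - 1 / (2 * sl.var) * \<bar>of_int (y - z)\<bar>)\<bar>
      \<le> EVV (T n) (k n) (T' n) (k' n) (l n) x (\<lambda>y z. \<bar>sl.abar (y - z) - 1 / (2 * sl.var) * \<bar>of_int (y - z)\<bar>\<bar>)"
      by (rule EVV_abs[OF x])
    also have "\<dots> \<le> EVV (T n) (k n) (T' n) (k' n) (l n) x (\<lambda>y z. C)"
    proof (rule EVV_mono[OF x])
      show "\<bar>sl.abar (y - z) - 1 / (2 * sl.var) * \<bar>of_int (y - z)\<bar>\<bar> \<le> C" for y z
        using C[of "y - z"] by simp
    qed
    finally have e: "\<bar>Fa (T n) (k n) (T' n) (k' n) (l n) x - 1 / (2 * sl.var) * ?f n x\<bar> \<le> C"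
      unfolding EVV_const[OF x] EVV_diff EVV_cmult Fa_def .
    have "Fa (T n) (k n) (T' n) (k' n) (l n) x / sqrt (real n) - c / (2 * sl.var) =
      (?f n x / sqrt (real n) - c) * (1 / (2 * sl.var)) +
      (Fa (T n) (k n) (T' n) (k' n) (l n) x - 1 / (2 * sl.var) * ?f n x) / sqrt (real n)"
      by (simp add: diff_divide_distrib left_diff_distrib)
    moreover have "\<bar>(?f n x / sqrt (real n) - c) * (1 / (2 * sl.var))\<bar> = \<bar>?f n x / sqrt (real n) - c\<bar> * (1 / (2 * sl.var))"
      using sl.var_pos by (simp add: abs_mult)
    moreover have "\<bar>(Fa (T n) (k n) (T' n) (k' n) (l n) x - 1 / (2 * sl.var) * ?f n x) / sqrt (real n)\<bar> \<le> C / sqrt (real n)"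
      using divide_right_mono[OF e, of "sqrt (real n)"] by (simp add: abs_divide)
    ultimately show "\<bar>Fa (T n) (k n) (T' n) (k' n) (l n) x / sqrt (real n) - c / (2 * sl.var)\<bar>
      \<le> \<bar>?f n x / sqrt (real n) - c\<bar> * (1 / (2 * sl.var)) + C / sqrt (real n)"
      using abs_triangle_ineq[of "(?f n x / sqrt (real n) - c) * (1 / (2 * sl.var))"
        "(Fa (T n) (k n) (T' n) (k' n) (l n) x - 1 / (2 * sl.var) * ?f n x) / sqrt (real n)"] by linarith
  qed (rule Fi)
qed

lemma mart_integrable: "integrable M (mart T k T' k')"
  unfolding mart_def[abs_def] by (intro Bochner_Integration.integrable_sum EVVH_integrable) auto

lemma mart_bounded: "\<exists>B. \<forall>x\<in>space M. \<bar>mart T k T' k' x\<bar> \<le> B"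
proof -
  obtain C where C: "\<And>l y z x. x \<in> space M \<Longrightarrow> 1 \<le> l \<Longrightarrow> \<bar>H l y z x\<bar> \<le> C" using H_bounded by blast
  have "\<bar>mart T k T' k' x\<bar> \<le> (\<Sum>l=1..min T T'. C)" if x: "x \<in> space M" for x
    unfolding mart_def
  proof (intro order_trans[OF sum_abs] sum_mono)
    fix l assume "l \<in> {1..min T T'}"
    then have l: "1 \<le> l" by simp
    have "EVV T k T' k' l x (\<lambda>y z. \<bar>H l y z x\<bar>) \<le> EVV T k T' k' l x (\<lambda>y z. C)"
      by (rule EVV_mono[OF x]) (rule C[OF x l])
    then show "\<bar>EVV T k T' k' l x (\<lambda>y z. H l y z x)\<bar> \<le> C"
      unfolding EVV_const[OF x] by (rule order_trans[OF EVV_abs[OF x]])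
  qed
  then show ?thesis by blast
qed

lemma sqrt_TT_limit:
  assumes "0 \<le> fst u"
  shows "(\<lambda>n. sqrt (real (TT n u) + 1) / real n) \<longlonglongrightarrow> 0"
proof -
  have "(\<lambda>n. sqrt ((real (TT n u) / real n + 1 / real n) * (1 / real n))) \<longlonglongrightarrow> sqrt ((fst u + 0) * 0)"
    by (intro tendsto_real_sqrt tendsto_mult tendsto_add TT_lim assms lim_1_over_n)
  moreover have "sqrt ((real (TT n u) / real n + 1 / real n) * (1 / real n)) = sqrt (real (TT n u) + 1) / real n" for n
    unfolding add_divide_distrib[symmetric] times_divide_times_eq by (simp add: real_sqrt_divide)
  ultimately show ?thesis by simp
qed

text \<open>The mean square is of order sqrt n, hence the mean absolute value of order n^(1/4),
  which is negligible against sqrt n.\<close>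

lemma mart_limit:
  assumes u: "0 \<le> fst u" "0 \<le> fst u'"
  shows "L1 (\<lambda>n x. mart (TT n u) (kk n u) (TT n u') (kk n u') x / sqrt (real n)) 0"
proof -
  obtain C where C: "C \<ge> 0" "\<And>T k T' k'. expectation (\<lambda>x. (mart T k T' k' x)\<^sup>2) \<le> C * (sqrt (real T + 1) + sqrt (real T' + 1))"
    using mart_L2 by blast
  have b: "expectation (\<lambda>x. \<bar>mart T k T' k' x\<bar>) \<le> sqrt (C * (sqrt (real T + 1) + sqrt (real T' + 1)))" for T k T' k'
  proof -
    obtain B where B: "\<And>x. x \<in> space M \<Longrightarrow> \<bar>mart T k T' k' x\<bar> \<le> B" using mart_bounded by blast
    have "expectation (\<lambda>x. \<bar>mart T k T' k' x\<bar>) \<le> sqrt (expectation (\<lambda>x. (mart T k T' k' x)\<^sup>2))"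
      by (rule expectation_le_sqrt[OF borel_measurable_integrable[OF mart_integrable] B])
    then show ?thesis using real_sqrt_le_mono[OF C(2)] by (rule order_trans)
  qed
  have i: "integrable M (\<lambda>x. mart (TT n u) (kk n u) (TT n u') (kk n u') x / sqrt (real n))" for n
    by (simp only: divide_inverse) (intro integrable_mult_left mart_integrable)
  show ?thesis
    unfolding L1_def
  proof (intro conjI allI i)
    have "(\<lambda>n. sqrt (C * (sqrt (real (TT n u) + 1) / real n + sqrt (real (TT n u') + 1) / real n))) \<longlonglongrightarrow> sqrt (C * (0 + 0))"
      by (intro tendsto_real_sqrt tendsto_mult tendsto_const tendsto_add sqrt_TT_limit u)
    then have "(\<lambda>n. sqrt (C * (sqrt (real (TT n u) + 1) / real n + sqrt (real (TT n u') + 1) / real n))) \<longlonglongrightarrow> 0" by simp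
    then show "(\<lambda>n. expectation (\<lambda>x. \<bar>mart (TT n u) (kk n u) (TT n u') (kk n u') x / sqrt (real n) - 0\<bar>)) \<longlonglongrightarrow> 0"
    proof (rule Lim_null_comparison[rotated, OF _ always_eventually], intro allI)
      fix n
      have "expectation (\<lambda>x. \<bar>mart (TT n u) (kk n u) (TT n u') (kk n u') x / sqrt (real n) - 0\<bar>) =
        expectation (\<lambda>x. \<bar>mart (TT n u) (kk n u) (TT n u') (kk n u') x\<bar>) / sqrt (real n)"
        by (simp add: abs_divide)
      moreover have "expectation (\<lambda>x. \<bar>mart (TT n u) (kk n u) (TT n u') (kk n u') x\<bar>) / sqrt (real n)
        \<le> sqrt (C * (sqrt (real (TT n u) + 1) + sqrt (real (TT n u') + 1))) / sqrt (real n)"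
        by (intro divide_right_mono b) simp
      moreover have "sqrt (C * (sqrt (real (TT n u) + 1) + sqrt (real (TT n u') + 1))) / sqrt (real n) =
        sqrt (C * (sqrt (real (TT n u) + 1) / real n + sqrt (real (TT n u') + 1) / real n))"
        unfolding real_sqrt_divide[symmetric] by (simp add: add_divide_distrib distrib_left)
      moreover have "0 \<le> expectation (\<lambda>x. \<bar>mart (TT n u) (kk n u) (TT n u') (kk n u') x / sqrt (real n) - 0\<bar>)"
        by (intro integral_nonneg_AE AE_I2) simp
      ultimately show "norm (expectation (\<lambda>x. \<bar>mart (TT n u) (kk n u) (TT n u') (kk n u') x / sqrt (real n) - 0\<bar>))
        \<le> sqrt (C * (sqrt (real (TT n u) + 1) / real n + sqrt (real (TT n u') + 1) / real n))"
        by simp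
    qed
  qed
qed

text \<open>Solve the Tanaka formula for the number of meetings: the end and start terms converge by
  \<open>Fa_limit\<close>, and the martingale drops out.\<close>

lemma meet_limit:
  assumes u: "0 \<le> fst u" "0 \<le> fst u'"
  shows "L1 (\<lambda>n x. (\<Sum>l=1..min (TT n u) (TT n u'). meet (TT n u) (kk n u) (TT n u') (kk n u') l x) / sqrt (real n))
    ((Lam (sl.var * (fst u + fst u')) (snd u - snd u') - Lam (sl.var * \<bar>fst u - fst u'\<bar>) (snd u - snd u')) / (2 * sl.var * beta))"
proof -
  have "(\<Sum>l=1..min T T'. meet T k T' k' l x) = (Fa T k T' k' 0 x - Fa T k T' k' (min T T') x - mart T k T' k' x) / beta" for T k T' k' x
    using tanaka[where T = T and T' = T' and k = k and k' = k' and x = x] beta_pos by (simp add: field_simps)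
  then have eq: "(\<Sum>l=1..min T T'. meet T k T' k' l x) / s =
      1 / beta * (Fa T k T' k' 0 x / s - Fa T k T' k' (min T T') x / s - mart T k T' k' x / s)" for T k T' k' x s
    by (simp add: diff_divide_distrib mult.commute)
  have "L1 (\<lambda>n x. (\<Sum>l=1..min (TT n u) (TT n u'). meet (TT n u) (kk n u) (TT n u') (kk n u') l x) / sqrt (real n))
    (1 / beta * (Lam (sl.var * (fst u + fst u')) (snd u - snd u') / (2 * sl.var)
      - Lam (sl.var * \<bar>fst u - fst u'\<bar>) (snd u - snd u') / (2 * sl.var) - 0))"
    unfolding eq by (intro L1_cmult L1_diff Fa_limit end_limit start_limit mart_limit u)
  moreover have "1 / beta * (p / (2 * sl.var) - q / (2 * sl.var) - 0) = (p - q) / (2 * sl.var * beta)" for p q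
    by (simp add: diff_divide_distrib)
  ultimately show ?thesis by simp
qed

end

lemma quadratic_sum:
  fixes f :: "'u \<Rightarrow> 'i \<Rightarrow> real"
  shows "(\<Sum>i\<in>I. (q * (\<Sum>u\<in>U. \<theta> u * f u i))\<^sup>2) = q\<^sup>2 * (\<Sum>u\<in>U. \<Sum>u'\<in>U. \<theta> u * \<theta> u' * (\<Sum>i\<in>I. f u i * f u' i))"
proof -
  have "(q * (\<Sum>u\<in>U. \<theta> u * f u i))\<^sup>2 = q\<^sup>2 * (\<Sum>u\<in>U. \<Sum>u'\<in>U. \<theta> u * \<theta> u' * (f u i * f u' i))" for i
    unfolding power_mult_distrib power2_eq_square[of "sum _ _"] sum_product by (simp add: mult_ac)
  then have "(\<Sum>i\<in>I. (q * (\<Sum>u\<in>U. \<theta> u * f u i))\<^sup>2) = q\<^sup>2 * (\<Sum>i\<in>I. \<Sum>u\<in>U. \<Sum>u'\<in>U. \<theta> u * \<theta> u' * (f u i * f u' i))"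
    by (simp add: sum_distrib_left)
  moreover have "(\<Sum>i\<in>I. \<Sum>u\<in>U. \<Sum>u'\<in>U. \<theta> u * \<theta> u' * (f u i * f u' i)) = (\<Sum>u\<in>U. \<Sum>u'\<in>U. \<theta> u * \<theta> u' * (\<Sum>i\<in>I. f u i * f u' i))"
    unfolding sum_distrib_left by (subst sum.swap, rule sum.cong[OF refl], rule sum.swap)
  ultimately show ?thesis by simp
qed

lemma (in prob_space) L1_cong:
  assumes "\<And>n x. x \<in> space M \<Longrightarrow> f n x = g n x" "L1 g c"
  shows "L1 f c"
proof -
  have "integrable M (f n) = integrable M (g n)" for n
    by (rule Bochner_Integration.integrable_cong) (simp_all add: assms(1))
  moreover have "expectation (\<lambda>x. \<bar>f n x - c\<bar>) = expectation (\<lambda>x. \<bar>g n x - c\<bar>)" for n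
    by (rule Bochner_Integration.integral_cong) (simp_all add: assms(1))
  ultimately show ?thesis using assms(2) by (simp add: L1_def)
qed

section \<open>Expansion of the heights, conditional variances and their limits\<close>

context rap begin

text \<open>The quenched average of \<open>gg_inner\<close> over two independent walks; the mixed
  term becomes the mean distance of the two walks.\<close>

lemma EV_gg_inner:
  assumes x: "x \<in> space M" and B: "Bx T k \<subseteq> {-B..B}" "Bx T' k' \<subseteq> {-B..B}"
  shows "(\<Sum>y\<in>{-B..B}. EV T k l x (gg y) * EV T' k' l x (gg y)) =
    1 / 2 * (EV T k l x (\<lambda>y. \<bar>of_int y\<bar>) + EV T' k' l x (\<lambda>y. \<bar>of_int y\<bar>) - EVV T k T' k' l x (\<lambda>y z. \<bar>of_int (y - z)\<bar>))"
proof -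
  have "(\<Sum>y\<in>{-B..B}. EV T k l x (gg y) * EV T' k' l x (gg y)) =
    (\<Sum>y\<in>{-B..B}. \<Sum>p\<in>Bx T k. \<Sum>q\<in>Bx T' k'. V T k l x p * V T' k' l x q * (gg y p * gg y q))"
    unfolding EV_def real_scaleR_def sum_product by (simp add: mult_ac)
  moreover have "\<dots> = (\<Sum>p\<in>Bx T k. \<Sum>q\<in>Bx T' k'. V T k l x p * V T' k' l x q * (\<Sum>y\<in>{-B..B}. gg y p * gg y q))"
    unfolding sum_distrib_left by (subst sum.swap, rule sum.cong[OF refl], rule sum.swap)
  moreover have "\<dots> = EVV T k T' k' l x (\<lambda>y z. 1 / 2 * (\<bar>of_int y\<bar> + \<bar>of_int z\<bar> - \<bar>of_int (y - z)\<bar>))"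
    unfolding EVV_def
  proof (intro sum.cong refl arg_cong2[of _ _ _ _ "(*)"])
    fix p q assume "p \<in> Bx T k" "q \<in> Bx T' k'"
    then have "\<bar>p\<bar> \<le> B" "\<bar>q\<bar> \<le> B" using B by fastforce+
    from gg_inner[OF this] show "(\<Sum>y\<in>{-B..B}. gg y p * gg y q) = 1 / 2 * (\<bar>of_int p\<bar> + \<bar>of_int q\<bar> - \<bar>of_int (p - q)\<bar>)"
      by simp
  qed
  ultimately show ?thesis
    by (simp only: EVV_cmult EVV_diff EVV_add EVV_fst[OF x] EVV_snd[OF x])
qed

text \<open>The initial profile is its mean slope plus centred increments. The slope part is
  \<open>\<mu>\<^sub>0\<close> times the quenched mean endpoint, expanded by
  \<open>EV_identity\<close>; the increments are collected site by site through
  \<open>gg\<close>.\<close>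

lemma height_expansion:
  assumes x: "x \<in> space M" and B: "Bx T k \<subseteq> {-B..B}" and L: "T \<le> L"
  shows "\<sigma> T k x = \<mu>\<^sub>0 * (of_int k + sl.mean * real T) + (\<Sum>z\<in>{-B..B}. EV T k 0 x (gg z) * d z x)
    + (\<Sum>l=1..L. \<Sum>y\<in>{-B..B}. \<mu>\<^sub>0 * (of_bool (l \<le> T) * V T k l x y) * D y l x)"
proof -
  have f: "\<sigma> 0 y x = \<mu>\<^sub>0 * of_int y + (\<Sum>z\<in>{-B..B}. gg z y * d z x)" if "y \<in> Bx T k" for y
  proof -
    have y: "\<bar>y\<bar> \<le> B" using that B by fastforce
    have 1: "\<sigma> 0 y x = (\<Sum>z\<in>{-B..B}. gg z y * \<eta> z x)"
      using increments_rep[of "\<lambda>y. \<sigma> 0 y x" y B] init[OF x] y inc[OF x] by simp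
    \<comment> \<open>The increment representation applied to the identity, whose increments are 1;
      it expresses the mean slope in the same coefficients.\<close>
    have 2: "real_of_int y = (\<Sum>z\<in>{-B..B}. gg z y)"
      using increments_rep[of real_of_int y B] y by simp
    show ?thesis
      unfolding 1 2 sum_distrib_left sum.distrib[symmetric] by (intro sum.cong refl) (simp add: d_def algebra_simps)
  qed
  have lin: "EV T k 0 x (\<lambda>y. \<mu>\<^sub>0 * of_int y + g y) = \<mu>\<^sub>0 * EV T k 0 x of_int + EV T k 0 x g" for g
    by (simp add: EV_def sum.distrib sum_distrib_left algebra_simps)
  have g: "EV T k 0 x (\<lambda>y. \<Sum>z\<in>{-B..B}. gg z y * d z x) = (\<Sum>z\<in>{-B..B}. EV T k 0 x (gg z) * d z x)"
    unfolding EV_def real_scaleR_def sum_distrib_left sum_distrib_right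
    by (subst sum.swap) (simp add: mult.assoc)
  have s: "\<sigma> T k x = \<mu>\<^sub>0 * EV T k 0 x of_int + (\<Sum>z\<in>{-B..B}. EV T k 0 x (gg z) * d z x)"
  proof -
    have "\<sigma> T k x = EV T k 0 x (\<lambda>y. \<mu>\<^sub>0 * of_int y + (\<Sum>z\<in>{-B..B}. gg z y * d z x))"
      by (rule trans[OF quenched_rep[OF x] EV_cong]) (rule f)
    then show ?thesis unfolding lin g .
  qed
  have "EV T k l x (\<lambda>y. D y l x) = (\<Sum>y\<in>{-B..B}. V T k l x y * D y l x)" for l
    using EV_eq[OF _ B, of l x "\<lambda>y. D y l x"] by simp
  then have "\<mu>\<^sub>0 * (\<Sum>l=1..T. EV T k l x (\<lambda>y. D y l x)) = (\<Sum>l=1..T. \<Sum>y\<in>{-B..B}. \<mu>\<^sub>0 * (of_bool (l \<le> T) * V T k l x y) * D y l x)"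
    by (simp add: sum_distrib_left mult.assoc)
  \<comment> \<open>All heights of a combination are expanded up to a common level. Above its own
    level \<open>T\<close> the law \<open>V\<close> is a unit mass at \<open>k\<close>, so the
    factor \<open>of_bool (l \<le> T)\<close> is essential there.\<close>
  moreover have "\<dots> = (\<Sum>l=1..L. \<Sum>y\<in>{-B..B}. \<mu>\<^sub>0 * (of_bool (l \<le> T) * V T k l x y) * D y l x)"
    using L by (intro sum.mono_neutral_left) auto
  ultimately show ?thesis unfolding s EV_identity[OF x] by (simp add: distrib_left)
qed

text \<open>\<open>cc U \<theta> n l y\<close> is the coefficient of the innovation at the space-time point \<open>(y, l)\<close>.\<close>

definition cc :: "(real \<times> real) set \<Rightarrow> (real \<times> real \<Rightarrow> real) \<Rightarrow> nat \<Rightarrow> nat \<Rightarrow> int \<Rightarrow> 'a \<Rightarrow> real" where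
  "cc U \<theta> n l y x = real n powr (-1/4) *
     (if l = 0 then \<Sum>u\<in>U. \<theta> u * EV (TT n u) (kk n u) 0 x (gg y)
      else \<mu>\<^sub>0 * (\<Sum>u\<in>U. \<theta> u * (of_bool (l \<le> TT n u) * V (TT n u) (kk n u) l x y)))"

text \<open>Sums rather than maxima: any common upper bound for the levels will do, and likewise for
  the sites in \<open>BB\<close>.\<close>

definition LL :: "(real \<times> real) set \<Rightarrow> nat \<Rightarrow> nat" where
  "LL U n = (\<Sum>u\<in>U. TT n u)"

definition BB :: "(real \<times> real) set \<Rightarrow> nat \<Rightarrow> int" where
  "BB U n = (\<Sum>u\<in>U. \<bar>kk n u\<bar> + int R * int (TT n u))"

definition dd :: "(real \<times> real) set \<Rightarrow> (real \<times> real \<Rightarrow> real) \<Rightarrow> nat \<Rightarrow> real" where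
  "dd U \<theta> n = real n powr (-1/4) * (\<Sum>u\<in>U. \<theta> u * (\<mu>\<^sub>0 * (of_int (kk n u) + sl.mean * real (TT n u) - sqrt (real n) * snd u)))"

text \<open>The limit as it arises, in terms of mean absolute values \<open>Lam\<close>;
  \<open>cov_eq\<close> translates it into \<open>Gamma1\<close> and \<open>Gamma2\<close>.\<close>

definition cov :: "real \<times> real \<Rightarrow> real \<times> real \<Rightarrow> real" where
  "cov u u' = \<mu>\<^sub>0\<^sup>2 * sD * ((Lam (sl.var * (fst u + fst u')) (snd u - snd u') - Lam (sl.var * \<bar>fst u - fst u'\<bar>) (snd u - snd u')) / (2 * sl.var * beta))
    + s0 * (1 / 2 * (Lam (sl.var * fst u) (snd u) + Lam (sl.var * fst u') (snd u') - Lam (sl.var * (fst u + fst u')) (snd u - snd u')))"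

lemma LL_ge: "finite U \<Longrightarrow> u \<in> U \<Longrightarrow> TT n u \<le> LL U n"
  unfolding LL_def by (rule member_le_sum) auto

lemma BB_ge: "finite U \<Longrightarrow> u \<in> U \<Longrightarrow> Bx (TT n u) (kk n u) \<subseteq> {-BB U n..BB U n}"
proof -
  assume "finite U" "u \<in> U"
  then have "\<bar>kk n u\<bar> + int R * int (TT n u) \<le> BB U n"
    unfolding BB_def by (intro member_le_sum[where f = "\<lambda>u. \<bar>kk n u\<bar> + int R * int (TT n u)"]) auto
  then show ?thesis by (auto simp: Bx_def)
qed

lemma BB_nonneg: "0 \<le> BB U n"
  unfolding BB_def by (intro sum_nonneg) auto

lemma height_combination:
  assumes x: "x \<in> space M" and U: "finite U"
  shows "(\<Sum>u\<in>U. \<theta> u * Ybar \<sigma> \<mu>\<^sub>0 (- sl.mean) n u x) =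
    dd U \<theta> n + (\<Sum>l\<le>LL U n. \<Sum>y\<in>{-BB U n..BB U n}. cc U \<theta> n l y x * ZZ l y x)"
proof -
  let ?q = "real n powr (-1/4)" and ?I = "{-BB U n..BB U n}"
  let ?a = "\<lambda>u. of_int (kk n u) + sl.mean * real (TT n u)"
  let ?b = "\<lambda>u. \<Sum>z\<in>?I. EV (TT n u) (kk n u) 0 x (gg z) * d z x"
  let ?c = "\<lambda>u. \<Sum>l=1..LL U n. \<Sum>y\<in>?I. \<mu>\<^sub>0 * (of_bool (l \<le> TT n u) * V (TT n u) (kk n u) l x y) * D y l x"
  have yb: "Ybar \<sigma> \<mu>\<^sub>0 (- sl.mean) n u x = ?q * (\<mu>\<^sub>0 * (?a u - sqrt (real n) * snd u) + ?b u + ?c u)" if "u \<in> U" for u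
  proof -
    have "Ybar \<sigma> \<mu>\<^sub>0 (- sl.mean) n u x = ?q * (\<sigma> (TT n u) (kk n u) x - \<mu>\<^sub>0 * snd u * sqrt (real n))"
      by (simp add: Ybar_def TT_def kk_def split_def)
    then show ?thesis
      unfolding height_expansion[OF x BB_ge[OF U that] LL_ge[OF U that]] by (simp add: algebra_simps)
  qed
  have "(\<Sum>u\<in>U. \<theta> u * Ybar \<sigma> \<mu>\<^sub>0 (- sl.mean) n u x) =
    (\<Sum>u\<in>U. ?q * (\<theta> u * (\<mu>\<^sub>0 * (?a u - sqrt (real n) * snd u))) + ?q * (\<theta> u * ?b u) + ?q * (\<theta> u * ?c u))"
  proof (intro sum.cong refl)
    fix u assume "u \<in> U"
    have d: "t * (q * (p + b + c)) = q * (t * p) + q * (t * b) + q * (t * c)" for t q p b c :: real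
      by (simp add: algebra_simps)
    show "\<theta> u * Ybar \<sigma> \<mu>\<^sub>0 (- sl.mean) n u x =
      ?q * (\<theta> u * (\<mu>\<^sub>0 * (?a u - sqrt (real n) * snd u))) + ?q * (\<theta> u * ?b u) + ?q * (\<theta> u * ?c u)"
      unfolding yb[OF \<open>u \<in> U\<close>] by (rule d)
  qed
  then have 1: "(\<Sum>u\<in>U. \<theta> u * Ybar \<sigma> \<mu>\<^sub>0 (- sl.mean) n u x) = dd U \<theta> n + (\<Sum>u\<in>U. ?q * (\<theta> u * ?b u)) + (\<Sum>u\<in>U. ?q * (\<theta> u * ?c u))"
    by (simp only: sum.distrib dd_def sum_distrib_left)
  have 2: "(\<Sum>u\<in>U. ?q * (\<theta> u * ?b u)) = (\<Sum>y\<in>?I. cc U \<theta> n 0 y x * ZZ 0 y x)"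
  proof -
    have "(\<Sum>u\<in>U. ?q * (\<theta> u * ?b u)) = (\<Sum>u\<in>U. \<Sum>z\<in>?I. ?q * (\<theta> u * (EV (TT n u) (kk n u) 0 x (gg z) * d z x)))"
      by (simp only: sum_distrib_left)
    moreover have "\<dots> = (\<Sum>z\<in>?I. \<Sum>u\<in>U. ?q * (\<theta> u * (EV (TT n u) (kk n u) 0 x (gg z) * d z x)))"
      by (rule sum.swap)
    moreover have "\<dots> = (\<Sum>y\<in>?I. cc U \<theta> n 0 y x * ZZ 0 y x)"
      by (simp add: cc_def ZZ_def sum_distrib_left sum_distrib_right mult.assoc)
    ultimately show ?thesis by simp
  qed
  have 3: "(\<Sum>u\<in>U. ?q * (\<theta> u * ?c u)) = (\<Sum>l=1..LL U n. \<Sum>y\<in>?I. cc U \<theta> n l y x * ZZ l y x)"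
  proof -
    let ?g = "\<lambda>u l y. ?q * (\<theta> u * (\<mu>\<^sub>0 * (of_bool (l \<le> TT n u) * V (TT n u) (kk n u) l x y) * D y l x))"
    have "(\<Sum>u\<in>U. ?q * (\<theta> u * ?c u)) = (\<Sum>u\<in>U. \<Sum>l=1..LL U n. \<Sum>y\<in>?I. ?g u l y)"
      by (simp only: sum_distrib_left)
    moreover have "\<dots> = (\<Sum>l=1..LL U n. \<Sum>y\<in>?I. \<Sum>u\<in>U. ?g u l y)"
      by (subst sum.swap, rule sum.cong[OF refl], rule sum.swap)
    moreover have "\<dots> = (\<Sum>l=1..LL U n. \<Sum>y\<in>?I. cc U \<theta> n l y x * ZZ l y x)"
    proof (intro sum.cong refl)
      fix l y assume "l \<in> {1..LL U n}"
      then have l: "l \<noteq> 0" by simp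
      have "cc U \<theta> n l y x * ZZ l y x = ?q * (\<mu>\<^sub>0 * (\<Sum>u\<in>U. \<theta> u * (of_bool (l \<le> TT n u) * V (TT n u) (kk n u) l x y))) * D y l x"
        using l by (simp add: cc_def ZZ_def)
      then show "(\<Sum>u\<in>U. ?g u l y) = cc U \<theta> n l y x * ZZ l y x"
        unfolding sum_distrib_left sum_distrib_right by (simp add: mult_ac)
    qed
    ultimately show ?thesis by simp
  qed
  have "(\<Sum>l\<le>LL U n. \<Sum>y\<in>?I. cc U \<theta> n l y x * ZZ l y x) =
    (\<Sum>y\<in>?I. cc U \<theta> n 0 y x * ZZ 0 y x) + (\<Sum>l=1..LL U n. \<Sum>y\<in>?I. cc U \<theta> n l y x * ZZ l y x)"
    unfolding atMost_atLeast0 by (subst sum.atLeast_Suc_atMost) simp_all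
  then show ?thesis using 1 2 3 by simp
qed

text \<open>The deterministic part consists of the rounding errors of \<open>kk_bound\<close>, which
  are bounded, times \<open>real n powr (-1/4)\<close>.\<close>

lemma dd_limit:
  assumes U: "U \<subseteq> {0..} \<times> UNIV"
  shows "dd U \<theta> \<longlonglongrightarrow> 0"
proof -
  have "(\<lambda>n. real n powr (-1/4) * (\<Sum>u\<in>U. \<bar>\<theta> u\<bar> * (\<bar>\<mu>\<^sub>0\<bar> * (2 + \<bar>sl.mean\<bar>)))) \<longlonglongrightarrow> 0 * (\<Sum>u\<in>U. \<bar>\<theta> u\<bar> * (\<bar>\<mu>\<^sub>0\<bar> * (2 + \<bar>sl.mean\<bar>)))"
    by (intro tendsto_mult tendsto_const) real_asymp
  then have "(\<lambda>n. real n powr (-1/4) * (\<Sum>u\<in>U. \<bar>\<theta> u\<bar> * (\<bar>\<mu>\<^sub>0\<bar> * (2 + \<bar>sl.mean\<bar>)))) \<longlonglongrightarrow> 0" by simp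
  then show ?thesis
  proof (rule Lim_null_comparison[rotated, OF _ always_eventually], intro allI)
    fix n
    have "\<bar>\<Sum>u\<in>U. \<theta> u * (\<mu>\<^sub>0 * (of_int (kk n u) + sl.mean * real (TT n u) - sqrt (real n) * snd u))\<bar>
      \<le> (\<Sum>u\<in>U. \<bar>\<theta> u\<bar> * (\<bar>\<mu>\<^sub>0\<bar> * (2 + \<bar>sl.mean\<bar>)))"
    proof (intro order_trans[OF sum_abs] sum_mono)
      fix u assume "u \<in> U"
      then have "0 \<le> fst u" using U by auto
      then show "\<bar>\<theta> u * (\<mu>\<^sub>0 * (of_int (kk n u) + sl.mean * real (TT n u) - sqrt (real n) * snd u))\<bar>
        \<le> \<bar>\<theta> u\<bar> * (\<bar>\<mu>\<^sub>0\<bar> * (2 + \<bar>sl.mean\<bar>))"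
        unfolding abs_mult by (intro mult_left_mono kk_bound) auto
    qed
    then show "norm (dd U \<theta> n) \<le> real n powr (-1/4) * (\<Sum>u\<in>U. \<bar>\<theta> u\<bar> * (\<bar>\<mu>\<^sub>0\<bar> * (2 + \<bar>sl.mean\<bar>)))"
      unfolding dd_def real_norm_def abs_mult by (intro mult_mono) auto
  qed
qed

lemma cc_measurable: "cc U \<theta> n l y \<in> borel_measurable (F (lev l))"
proof -
  have e: "(\<lambda>x. EV T k l x (gg y)) \<in> borel_measurable (F (lev l))" for T k
    unfolding EV_def real_scaleR_def
    by (intro borel_measurable_sum borel_measurable_times borel_measurable_const V_F)
  show ?thesis
  proof (cases "l = 0")
    case True
    have "cc U \<theta> n l y = (\<lambda>x. real n powr (-1/4) * (\<Sum>u\<in>U. \<theta> u * EV (TT n u) (kk n u) l x (gg y)))"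
      unfolding True by (simp add: cc_def fun_eq_iff)
    then show ?thesis
      by (simp only:) (intro borel_measurable_sum borel_measurable_times borel_measurable_const e)
  next
    case False
    then have "cc U \<theta> n l y = (\<lambda>x. real n powr (-1/4) * (\<mu>\<^sub>0 * (\<Sum>u\<in>U. \<theta> u * (of_bool (l \<le> TT n u) * V (TT n u) (kk n u) l x y))))"
      by (simp add: cc_def fun_eq_iff)
    then show ?thesis
      by (simp only:) (intro borel_measurable_sum borel_measurable_times borel_measurable_const V_F)
  qed
qed

text \<open>Quenched averages of \<open>gg\<close> and quenched probabilities are at most 1 in
  absolute value, so the scaling alone makes all coefficients uniformly small.\<close>

lemma cc_bound:
  assumes x: "x \<in> space M"
  shows "\<bar>cc U \<theta> n l y x\<bar> \<le> real n powr (-1/4) * ((\<bar>\<mu>\<^sub>0\<bar> + 1) * (\<Sum>u\<in>U. \<bar>\<theta> u\<bar>))"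
proof -
  have s: "\<bar>\<Sum>u\<in>U. \<theta> u * f u\<bar> \<le> (\<Sum>u\<in>U. \<bar>\<theta> u\<bar>)" if "\<And>u. \<bar>f u\<bar> \<le> 1" for f
    using that by (intro order_trans[OF sum_abs] sum_mono) (simp add: abs_mult mult_left_le)
  have 0: "\<bar>\<Sum>u\<in>U. \<theta> u * EV (TT n u) (kk n u) 0 x (gg y)\<bar> \<le> 1 * (\<Sum>u\<in>U. \<bar>\<theta> u\<bar>)"
    using s[of "\<lambda>u. EV (TT n u) (kk n u) 0 x (gg y)"] EV_norm[OF x, of "gg y" 1] by (simp add: gg_bound)
  have 1: "\<bar>\<Sum>u\<in>U. \<theta> u * (of_bool (l \<le> TT n u) * V (TT n u) (kk n u) l x y)\<bar> \<le> (\<Sum>u\<in>U. \<bar>\<theta> u\<bar>)"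
    by (rule s) (simp add: V_norm[OF x])
  have n: "0 \<le> (\<Sum>u\<in>U. \<bar>\<theta> u\<bar>)" by (intro sum_nonneg) simp
  show ?thesis
  proof (cases "l = 0")
    case True
    have "1 * (\<Sum>u\<in>U. \<bar>\<theta> u\<bar>) \<le> (\<bar>\<mu>\<^sub>0\<bar> + 1) * (\<Sum>u\<in>U. \<bar>\<theta> u\<bar>)" using n by (intro mult_right_mono) auto
    then show ?thesis using order_trans[OF 0] True by (simp add: cc_def abs_mult mult_left_mono)
  next
    case False
    have "\<bar>\<mu>\<^sub>0\<bar> * \<bar>\<Sum>u\<in>U. \<theta> u * (of_bool (l \<le> TT n u) * V (TT n u) (kk n u) l x y)\<bar> \<le> (\<bar>\<mu>\<^sub>0\<bar> + 1) * (\<Sum>u\<in>U. \<bar>\<theta> u\<bar>)"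
      using 1 by (intro mult_mono) auto
    then show ?thesis using False by (simp add: cc_def abs_mult mult_left_mono)
  qed
qed

definition VV :: "(real \<times> real) set \<Rightarrow> (real \<times> real \<Rightarrow> real) \<Rightarrow> nat \<Rightarrow> 'a \<Rightarrow> real" where
  "VV U \<theta> n x = (\<Sum>l\<le>LL U n. \<Sum>y\<in>{-BB U n..BB U n}. (cc U \<theta> n l y x)\<^sup>2 * ss l)"

text \<open>Expand the squares over pairs of observation points. Level 0 yields the inner products
  of \<open>EV_gg_inner\<close>, and the later levels yield sums over sites of products of quenched
  probabilities, that is, meetings. The square of the scaling is 1 / sqrt n.\<close>

lemma VV_eq:
  assumes x: "x \<in> space M" and U: "finite U"
  shows "VV U \<theta> n x = (\<Sum>u\<in>U. \<Sum>u'\<in>U. \<theta> u * \<theta> u' * (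
    \<mu>\<^sub>0\<^sup>2 * sD * ((\<Sum>l=1..min (TT n u) (TT n u'). meet (TT n u) (kk n u) (TT n u') (kk n u') l x) / sqrt (real n)) +
    s0 * (1 / 2 * (EV (TT n u) (kk n u) 0 x (\<lambda>y. \<bar>of_int y\<bar>) / sqrt (real n) + EV (TT n u') (kk n u') 0 x (\<lambda>y. \<bar>of_int y\<bar>) / sqrt (real n)
      - EVV (TT n u) (kk n u) (TT n u') (kk n u') 0 x (\<lambda>y z. \<bar>of_int (y - z)\<bar>) / sqrt (real n)))))"
proof -
  let ?I = "{-BB U n..BB U n}" and ?L = "{1..LL U n}" and ?q = "real n powr (-1/4)"
  let ?v = "\<lambda>u l y. of_bool (l \<le> TT n u) * V (TT n u) (kk n u) l x y"
  let ?m = "\<lambda>u u'. \<Sum>l=1..min (TT n u) (TT n u'). meet (TT n u) (kk n u) (TT n u') (kk n u') l x"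
  let ?e = "\<lambda>u u'. 1 / 2 * (EV (TT n u) (kk n u) 0 x (\<lambda>y. \<bar>of_int y\<bar>) + EV (TT n u') (kk n u') 0 x (\<lambda>y. \<bar>of_int y\<bar>)
      - EVV (TT n u) (kk n u) (TT n u') (kk n u') 0 x (\<lambda>y z. \<bar>of_int (y - z)\<bar>))"
  have 1: "VV U \<theta> n x = (\<Sum>y\<in>?I. (cc U \<theta> n 0 y x)\<^sup>2) * s0 + (\<Sum>l\<in>?L. \<Sum>y\<in>?I. (cc U \<theta> n l y x)\<^sup>2) * sD"
  proof -
    have "VV U \<theta> n x = (\<Sum>y\<in>?I. (cc U \<theta> n 0 y x)\<^sup>2 * ss 0) + (\<Sum>l\<in>?L. \<Sum>y\<in>?I. (cc U \<theta> n l y x)\<^sup>2 * ss l)"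
      unfolding VV_def atMost_atLeast0 by (subst sum.atLeast_Suc_atMost) simp_all
    moreover have "(\<Sum>l\<in>?L. \<Sum>y\<in>?I. (cc U \<theta> n l y x)\<^sup>2 * ss l) = (\<Sum>l\<in>?L. \<Sum>y\<in>?I. (cc U \<theta> n l y x)\<^sup>2 * sD)"
      by (intro sum.cong refl) (simp add: ss_def)
    ultimately show ?thesis by (simp add: ss_def sum_distrib_right)
  qed
  have 2: "(\<Sum>y\<in>?I. (cc U \<theta> n 0 y x)\<^sup>2) = 1 / sqrt (real n) * (\<Sum>u\<in>U. \<Sum>u'\<in>U. \<theta> u * \<theta> u' * ?e u u')"
  proof -
    have "(\<Sum>y\<in>?I. (cc U \<theta> n 0 y x)\<^sup>2) = (\<Sum>y\<in>?I. (?q * (\<Sum>u\<in>U. \<theta> u * EV (TT n u) (kk n u) 0 x (gg y)))\<^sup>2)"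
      by (simp add: cc_def)
    then show ?thesis
      unfolding quadratic_sum powr_quarter_square by (simp add: EV_gg_inner[OF x BB_ge[OF U] BB_ge[OF U]])
  qed
  have 3: "(\<Sum>l\<in>?L. \<Sum>y\<in>?I. (cc U \<theta> n l y x)\<^sup>2) = 1 / sqrt (real n) * \<mu>\<^sub>0\<^sup>2 * (\<Sum>u\<in>U. \<Sum>u'\<in>U. \<theta> u * \<theta> u' * ?m u u')"
  proof -
    have "(\<Sum>l\<in>?L. \<Sum>y\<in>?I. (cc U \<theta> n l y x)\<^sup>2) = (\<Sum>l\<in>?L. \<Sum>y\<in>?I. (?q * \<mu>\<^sub>0 * (\<Sum>u\<in>U. \<theta> u * ?v u l y))\<^sup>2)"
      by (intro sum.cong refl) (simp add: cc_def mult.assoc)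
    moreover have "\<dots> = (\<Sum>p\<in>?L \<times> ?I. (?q * \<mu>\<^sub>0 * (\<Sum>u\<in>U. \<theta> u * ?v u (fst p) (snd p)))\<^sup>2)"
      by (simp add: sum.cartesian_product split_def)
    moreover have "\<dots> = (?q * \<mu>\<^sub>0)\<^sup>2 * (\<Sum>u\<in>U. \<Sum>u'\<in>U. \<theta> u * \<theta> u' * (\<Sum>p\<in>?L \<times> ?I. ?v u (fst p) (snd p) * ?v u' (fst p) (snd p)))"
      by (rule quadratic_sum)
    moreover have "(\<Sum>p\<in>?L \<times> ?I. ?v u (fst p) (snd p) * ?v u' (fst p) (snd p)) = ?m u u'" if u: "u \<in> U" "u' \<in> U" for u u'
    proof -
      have "(\<Sum>p\<in>?L \<times> ?I. ?v u (fst p) (snd p) * ?v u' (fst p) (snd p)) = (\<Sum>l\<in>?L. \<Sum>y\<in>?I. ?v u l y * ?v u' l y)"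
        by (simp add: sum.cartesian_product split_def)
      moreover have "\<dots> = (\<Sum>l\<in>?L. of_bool (l \<le> min (TT n u) (TT n u')) * meet (TT n u) (kk n u) (TT n u') (kk n u') l x)"
        using BB_ge[OF U u(1), of n]
        by (intro sum.cong refl) (simp add: meet_sum[of ?I] sum_distrib_left)
      moreover have "\<dots> = (\<Sum>l=1..min (TT n u) (TT n u'). of_bool (l \<le> min (TT n u) (TT n u')) * meet (TT n u) (kk n u) (TT n u') (kk n u') l x)"
        using LL_ge[OF U u(1), of n] by (intro sum.mono_neutral_right) auto
      ultimately show ?thesis by simp
    qed
    ultimately show ?thesis unfolding power_mult_distrib powr_quarter_square by simp
  qed
  have 4: "t * (K * (m / s) + z * (1 / 2 * (p / s + q / s - r / s))) = t * m * (K / s) + t * (1 / 2 * (p + q - r)) * (z / s)"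
    for t K m s z p q r :: real
    by (simp add: add_divide_distrib diff_divide_distrib algebra_simps)
  show ?thesis
    unfolding 4 sum.distrib sum_distrib_right[symmetric] 1 2 3 by (simp add: mult_ac)
qed

lemma VV_limit:
  assumes U: "finite U" "U \<subseteq> {0..} \<times> UNIV"
  shows "L1 (VV U \<theta>) (\<Sum>u\<in>U. \<Sum>u'\<in>U. \<theta> u * \<theta> u' * cov u u')"
proof -
  have nn: "0 \<le> fst u" if "u \<in> U" for u using that U by auto
  show ?thesis
    unfolding cov_def
    by (rule L1_cong[OF VV_eq[OF _ U(1)]], assumption)
       (intro L1_sum U L1_cmult L1_add L1_diff meet_limit abs_limit end_limit nn; assumption)
qed

text \<open>The quadratic form is the limit in mean of conditional variances, which are
  nonnegative.\<close>

lemma cov_psd: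
  assumes "finite U" "U \<subseteq> {0..} \<times> UNIV"
  shows "0 \<le> (\<Sum>u\<in>U. \<Sum>u'\<in>U. \<theta> u * \<theta> u' * cov u u')"
  using VV_limit[OF assms] by (rule L1_nonneg) (auto simp: VV_def ss_def s0_nonneg sD_nonneg intro!: sum_nonneg)

text \<open>The three errors of \<open>clt_levels\<close> vanish: two because the coefficients are
  of order n^(-1/4) and \<open>a > 0\<close>, the third by \<open>VV_limit\<close>. The
  deterministic part only contributes a phase tending to 1.\<close>

lemma char_limit:
  assumes U: "finite U" "U \<subseteq> {0..} \<times> UNIV"
  shows "(\<lambda>n. CLINT x|M. iexp (\<Sum>u\<in>U. \<theta> u * Ybar \<sigma> \<mu>\<^sub>0 (- sl.mean) n u x))
    \<longlonglongrightarrow> complex_of_real (exp (- (\<Sum>u\<in>U. \<Sum>u'\<in>U. \<theta> u * \<theta> u' * cov u u') / 2))"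
proof -
  define v where "v = (\<Sum>u\<in>U. \<Sum>u'\<in>U. \<theta> u * \<theta> u' * cov u u')"
  define \<epsilon> where "\<epsilon> n = real n powr (-1/4) * ((\<bar>\<mu>\<^sub>0\<bar> + 1) * (\<Sum>u\<in>U. \<bar>\<theta> u\<bar>))" for n
  define S where "S n x = (\<Sum>l\<le>LL U n. \<Sum>y\<in>{-BB U n..BB U n}. cc U \<theta> n l y x * ZZ l y x)" for n x
  have v: "0 \<le> v" unfolding v_def by (rule cov_psd[OF U])
  have eps: "0 \<le> \<epsilon> n" for n unfolding \<epsilon>_def by (intro mult_nonneg_nonneg sum_nonneg) auto
  have eps0: "\<epsilon> \<longlonglongrightarrow> 0"
  proof -
    have "\<epsilon> \<longlonglongrightarrow> 0 * ((\<bar>\<mu>\<^sub>0\<bar> + 1) * (\<Sum>u\<in>U. \<bar>\<theta> u\<bar>))"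
      unfolding \<epsilon>_def[abs_def] by (intro tendsto_mult tendsto_const) real_asymp
    then show ?thesis by simp
  qed
  have "(\<lambda>n. (2 + exp ((v + 1) / 2) * (v + 1)) * (KK * \<epsilon> n powr a + (s0 + sD) * (\<epsilon> n)\<^sup>2 + expectation (\<lambda>x. \<bar>VV U \<theta> n x - v\<bar>)))
    \<longlonglongrightarrow> (2 + exp ((v + 1) / 2) * (v + 1)) * (KK * (0 powr a) + (s0 + sD) * 0\<^sup>2 + 0)"
  proof (intro tendsto_mult tendsto_add tendsto_const tendsto_power eps0)
    show "(\<lambda>n. expectation (\<lambda>x. \<bar>VV U \<theta> n x - v\<bar>)) \<longlonglongrightarrow> 0"
      using VV_limit[OF U, of \<theta>] by (simp add: L1_def v_def)
    show "(\<lambda>n. \<epsilon> n powr a) \<longlonglongrightarrow> 0 powr a"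
      using a eps by (intro tendsto_powr2 eps0 tendsto_const always_eventually) auto
  qed
  then have b: "(\<lambda>n. (2 + exp ((v + 1) / 2) * (v + 1)) * (KK * \<epsilon> n powr a + (s0 + sD) * (\<epsilon> n)\<^sup>2 + expectation (\<lambda>x. \<bar>VV U \<theta> n x - v\<bar>))) \<longlonglongrightarrow> 0"
    by simp
  have "(\<lambda>n. (CLINT x|M. iexp (S n x)) - complex_of_real (exp (- v / 2))) \<longlonglongrightarrow> 0"
  proof (rule Lim_null_comparison[OF always_eventually b], intro allI)
    show "norm ((CLINT x|M. iexp (S n x)) - complex_of_real (exp (- v / 2))) \<le>
      (2 + exp ((v + 1) / 2) * (v + 1)) * (KK * \<epsilon> n powr a + (s0 + sD) * (\<epsilon> n)\<^sup>2 + expectation (\<lambda>x. \<bar>VV U \<theta> n x - v\<bar>))" for n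
      unfolding S_def VV_def
      by (rule clt_levels[OF BB_nonneg eps v cc_measurable]) (unfold \<epsilon>_def, rule cc_bound)
  qed
  then have S: "(\<lambda>n. CLINT x|M. iexp (S n x)) \<longlonglongrightarrow> complex_of_real (exp (- v / 2))" by (rule LIM_zero_cancel)
  have d: "(\<lambda>n. iexp (dd U \<theta> n)) \<longlonglongrightarrow> iexp 0"
    by (intro tendsto_exp tendsto_mult tendsto_const tendsto_of_real dd_limit U(2))
  have "(CLINT x|M. iexp (\<Sum>u\<in>U. \<theta> u * Ybar \<sigma> \<mu>\<^sub>0 (- sl.mean) n u x)) = iexp (dd U \<theta> n) * (CLINT x|M. iexp (S n x))" for n
  proof -
    have "(CLINT x|M. iexp (\<Sum>u\<in>U. \<theta> u * Ybar \<sigma> \<mu>\<^sub>0 (- sl.mean) n u x)) = (CLINT x|M. iexp (dd U \<theta> n) * iexp (S n x))"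
    proof (rule Bochner_Integration.integral_cong[OF refl])
      fix x assume x: "x \<in> space M"
      show "iexp (\<Sum>u\<in>U. \<theta> u * Ybar \<sigma> \<mu>\<^sub>0 (- sl.mean) n u x) = iexp (dd U \<theta> n) * iexp (S n x)"
        unfolding height_combination[OF x U(1)] S_def[symmetric] by (simp add: exp_add[symmetric] distrib_left)
    qed
    then show ?thesis by simp
  qed
  then show ?thesis using tendsto_mult[OF d S] unfolding v_def by simp
qed

text \<open>Each use of \<open>Lam_eq_Psi\<close> leaves a linear term. These cancel in both
  combinations, and the factors 2 are absorbed by the denominators; evenness of \<open>Lam\<close>
  adjusts the signs of the sites.\<close>

lemma cov_eq:
  assumes "0 \<le> fst u" "0 \<le> fst u'"
  shows "cov u u' = \<mu>\<^sub>0\<^sup>2 * rap_kappa M (X (0, 1)) * Gamma1 (sigma1_sq M (X (0, 1))) u u' + s0 * Gamma2 (sigma1_sq M (X (0, 1))) u u'"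
proof -
  obtain s q t r where [simp]: "u = (s, q)" "u' = (t, r)" by (cases u, cases u')
  have nn: "0 \<le> s" "0 \<le> t" using assms by auto
  have v: "0 < sl.var" by (rule sl.var_pos)
  have e1: "Lam (sl.var * (s + t)) (q - r) = 2 * Psi (sl.var * (t + s)) (r - q) + (r - q)"
    using Lam_eq_Psi[of "sl.var * (t + s)" "r - q"] Lam_minus[of "sl.var * (s + t)" "r - q"] nn v by (simp add: add.commute)
  have e2: "Lam (sl.var * \<bar>s - t\<bar>) (q - r) = 2 * Psi (sl.var * \<bar>t - s\<bar>) (r - q) + (r - q)"
    using Lam_eq_Psi[of "sl.var * \<bar>t - s\<bar>" "r - q"] Lam_minus[of "sl.var * \<bar>s - t\<bar>" "r - q"] v by (simp add: abs_minus_commute)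
  have e3: "Lam (sl.var * s) q = 2 * Psi (sl.var * s) (- q) - q"
    using Lam_eq_Psi[of "sl.var * s" "- q"] Lam_minus[of "sl.var * s" q] nn v by simp
  have e4: "Lam (sl.var * t) r = 2 * Psi (sl.var * t) r + r"
    using Lam_eq_Psi[of "sl.var * t" r] nn v by simp
  have k: "rap_kappa M (X (0, 1)) = sD / (beta * sl.var)"
    unfolding rap_kappa_def sigmaD_sq_eq rap_beta_eq sigma1_sq_eq ..
  have "(2 * p + z - (2 * p' + z)) / (2 * sl.var * beta) = (p - p') / (beta * sl.var)" for p p' z
    using v beta_pos by (simp add: field_simps)
  then have "cov u u' = \<mu>\<^sub>0\<^sup>2 * sD * ((Psi (sl.var * (t + s)) (r - q) - Psi (sl.var * \<bar>t - s\<bar>) (r - q)) / (beta * sl.var)) +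
      s0 * (Psi (sl.var * s) (- q) + Psi (sl.var * t) r - Psi (sl.var * (t + s)) (r - q))"
    unfolding cov_def by (simp add: e1 e2 e3 e4)
  then show ?thesis unfolding k sigma1_sq_eq by (simp add: Gamma1_def Gamma2_def)
qed

lemma cov_sym: "cov u u' = cov u' u"
  using Lam_minus[of _ "snd u - snd u'"] by (simp add: cov_def add.commute abs_minus_commute)

end

section \<open>Convergence of the finite-dimensional distributions\<close>

text \<open>Numbering the coordinates transports \<open>f\<close> to functions on
  \<open>nat\<close>, where the product sigma-algebra is the Borel algebra of the product topology;
  coordinates beyond the finite set are filled with 0.\<close>

lemma continuous_map_PiM_measurable:
  fixes f :: "('i \<Rightarrow> real) \<Rightarrow> real"
  assumes J: "finite J" and f: "continuous_map (product_topology (\<lambda>_. euclideanreal) J) euclideanreal f"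
  shows "f \<in> borel_measurable (PiM J (\<lambda>_. borel))"
proof -
  obtain e where e: "bij_betw e J {0..<card J}" using ex_bij_betw_finite_nat[OF J] by blast
  define h where "h z = (\<lambda>j\<in>J. z (e j))" for z :: "nat \<Rightarrow> real"
  define g where "g x = (\<lambda>i. if i < card J then x (inv_into J e i) else 0)" for x :: "'i \<Rightarrow> real"
  have "continuous_map euclidean (product_topology (\<lambda>_. euclideanreal) J) h"
    unfolding continuous_map_componentwise h_def
    by (auto simp: continuous_on_product_coordinates)
  then have "continuous_map euclidean euclideanreal (f \<circ> h)" using f by (rule continuous_map_compose)
  then have fh: "f \<circ> h \<in> borel_measurable (PiM UNIV (\<lambda>_::nat. borel))"
    by (simp add: borel_measurable_continuous_onI measurable_cong_sets[OF sets_PiM_equal_borel refl])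
  have "g \<in> measurable (PiM J (\<lambda>_. borel)) (PiM UNIV (\<lambda>_::nat. borel))"
    unfolding g_def[abs_def]
  proof (rule measurable_PiM_single')
    fix i :: nat
    show "(\<lambda>x. if i < card J then x (inv_into J e i) else (0::real)) \<in> borel_measurable (PiM J (\<lambda>_. borel))"
    proof (cases "i < card J")
      case True
      then have "inv_into J e i \<in> J" using e by (intro inv_into_into) (auto simp: bij_betw_def)
      then show ?thesis using True measurable_component_singleton[of "inv_into J e i" J "\<lambda>_. borel"] by simp
    qed simp
  qed auto
  from measurable_compose[OF this fh] have m: "(\<lambda>x. (f \<circ> h) (g x)) \<in> borel_measurable (PiM J (\<lambda>_. borel))" .
  have "h (g x) = x" if "x \<in> space (PiM J (\<lambda>_. borel :: real measure))" for x
  proof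
    fix j
    show "h (g x) j = x j"
    proof (cases "j \<in> J")
      case True
      then have "e j < card J" "inv_into J e (e j) = j" using e by (auto simp: bij_betw_def)
      then show ?thesis using True by (simp add: h_def g_def)
    next
      case False
      then show ?thesis using that by (auto simp: h_def space_PiM PiE_def extensional_def)
    qed
  qed
  then show ?thesis using m by (subst measurable_cong[where g = "\<lambda>x. (f \<circ> h) (g x)"]) auto
qed

lemma linear_char_measurable:
  "(\<lambda>x. iexp (\<Sum>j\<in>J. c j * x j)) \<in> borel_measurable (PiM J (\<lambda>_. borel :: real measure))"
  by (rule measurable_compose[of "\<lambda>x. \<Sum>j\<in>J. c j * x j" _ borel "\<lambda>u. iexp u"]) measurable

lemma fd_law_char:
  assumes X: "\<And>j. j \<in> J \<Longrightarrow> X j \<in> borel_measurable M"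
  shows "(\<integral>x. iexp (\<Sum>j\<in>J. c j * x j) \<partial>fd_law M J X) = (\<integral>x. iexp (\<Sum>j\<in>J. c j * X j x) \<partial>M)"
  unfolding fd_law_def
  by (subst integral_distr[OF measurable_restrict[OF X] linear_char_measurable]) (auto intro!: Bochner_Integration.integral_cong)

lemma fdd_convergeI:
  assumes M: "prob_space M" and N: "prob_space N"
    and X: "\<And>n j. j \<in> I \<Longrightarrow> X n j \<in> borel_measurable M" and Z: "\<And>j. j \<in> I \<Longrightarrow> Z j \<in> borel_measurable N"
    and ch: "\<And>J c. finite J \<Longrightarrow> J \<subseteq> I \<Longrightarrow>
      (\<lambda>n. CLINT x|M. iexp (\<Sum>j\<in>J. c j * X n j x)) \<longlonglongrightarrow> (CLINT x|N. iexp (\<Sum>j\<in>J. c j * Z j x))"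
  shows "fdd_converge I M X N Z"
  unfolding fdd_converge_def
proof (intro allI impI)
  fix J assume J: "finite J \<and> J \<subseteq> I"
  then have Xm: "\<And>n j. j \<in> J \<Longrightarrow> X n j \<in> borel_measurable M" and Zm: "\<And>j. j \<in> J \<Longrightarrow> Z j \<in> borel_measurable N"
    using X Z by auto
  show "weakly_converges (product_topology (\<lambda>_. euclideanreal) J) (\<lambda>n. fd_law M J (X n)) (fd_law N J Z)"
  proof (rule weakly_converges_cramer_wold)
    show "prob_space (fd_law M J (X n))" for n
      unfolding fd_law_def by (rule prob_space.prob_space_distr[OF M measurable_restrict[OF Xm]])
    show "prob_space (fd_law N J Z)"
      unfolding fd_law_def by (rule prob_space.prob_space_distr[OF N measurable_restrict[OF Zm]])
    show "(\<lambda>n. \<integral>x. iexp (\<Sum>j\<in>J. c j * x j) \<partial>fd_law M J (X n)) \<longlonglongrightarrow> (\<integral>x. iexp (\<Sum>j\<in>J. c j * x j) \<partial>fd_law N J Z)" for c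
    proof -
      have "(\<integral>x. iexp (\<Sum>j\<in>J. c j * x j) \<partial>fd_law M J (X n)) = (CLINT x|M. iexp (\<Sum>j\<in>J. c j * X n j x))" for n
        by (rule fd_law_char) (rule Xm)
      moreover have "(\<integral>x. iexp (\<Sum>j\<in>J. c j * x j) \<partial>fd_law N J Z) = (CLINT x|N. iexp (\<Sum>j\<in>J. c j * Z j x))"
        by (rule fd_law_char) (rule Zm)
      ultimately show ?thesis using ch[of J c] J by simp
    qed
    show "f \<in> borel_measurable (PiM J (\<lambda>_. borel))"
      if "continuous_map (product_topology (\<lambda>_. euclideanreal) J) euclideanreal f" for f
      using J that by (intro continuous_map_PiM_measurable) auto
  qed (use J in \<open>auto simp: fd_law_def\<close>)
qed

section \<open>The coordinate process of the constructed Gaussian measure\<close>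

locale gaussian_family = prob_space N for N :: "('i \<Rightarrow> real) measure" +
  fixes I :: "'i set" and K :: "'i \<Rightarrow> 'i \<Rightarrow> real"
  assumes setsN: "sets N = sets (PiM I (\<lambda>_. borel))"
    and psd: "finite J \<Longrightarrow> J \<subseteq> I \<Longrightarrow> 0 \<le> (\<Sum>i\<in>J. \<Sum>j\<in>J. c i * c j * K i j)"
    and char_N: "finite J \<Longrightarrow> J \<subseteq> I \<Longrightarrow> (CLINT x|N. iexp (\<Sum>j\<in>J. c j * x j)) =
        complex_of_real (exp (- (\<Sum>i\<in>J. \<Sum>j\<in>J. c i * c j * K i j) / 2))"
begin

lemma coordinate_measurable: "i \<in> I \<Longrightarrow> (\<lambda>x. x i) \<in> borel_measurable N"
  unfolding measurable_cong_sets[OF setsN refl] by (rule measurable_component_singleton)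

lemma linear_measurable: "J \<subseteq> I \<Longrightarrow> (\<lambda>x. \<Sum>j\<in>J. c j * x j) \<in> borel_measurable N"
  by (intro borel_measurable_sum borel_measurable_times borel_measurable_const coordinate_measurable) auto

text \<open>Scaling the coefficients by \<open>t\<close> in the joint characteristic function gives
  that of the linear combination; one-dimensional uniqueness concludes.\<close>

lemma linear_distr:
  assumes J: "finite J" "J \<subseteq> I"
  shows "distr N borel (\<lambda>x. \<Sum>j\<in>J. c j * x j) = centered_gaussian (\<Sum>i\<in>J. \<Sum>j\<in>J. c i * c j * K i j)"
proof (rule Levy_uniqueness)
  let ?v = "\<Sum>i\<in>J. \<Sum>j\<in>J. c i * c j * K i j"
  note m = linear_measurable[OF J(2), of c]
  show "real_distribution (distr N borel (\<lambda>x. \<Sum>j\<in>J. c j * x j))"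
    by (rule real_distribution_distr[OF m])
  show "real_distribution (centered_gaussian ?v)"
    by (rule centered_gaussian_distribution[OF psd[OF J]])
  show "char (distr N borel (\<lambda>x. \<Sum>j\<in>J. c j * x j)) = char (centered_gaussian ?v)"
  proof
    fix t
    have "char (distr N borel (\<lambda>x. \<Sum>j\<in>J. c j * x j)) t = (CLINT x|N. iexp (\<Sum>j\<in>J. (t * c j) * x j))"
      unfolding char_def by (subst integral_distr[OF m]) (auto simp: sum_distrib_left mult.assoc)
    moreover have "(\<Sum>i\<in>J. \<Sum>j\<in>J. (t * c i) * (t * c j) * K i j) = t\<^sup>2 * ?v"
      by (simp add: sum_distrib_left power2_eq_square mult_ac)
    ultimately show "char (distr N borel (\<lambda>x. \<Sum>j\<in>J. c j * x j)) t = char (centered_gaussian ?v) t"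
      unfolding char_N[OF J] char_centered_gaussian[OF psd[OF J]] by simp
  qed
qed

lemma is_centered_gaussian_process: "centered_gaussian_process N I (\<lambda>i x. x i)"
  unfolding centered_gaussian_process_def
  using prob_space_axioms coordinate_measurable linear_distr psd by blast

lemma linear_second_moment:
  assumes J: "finite J" "J \<subseteq> I"
  shows "integrable N (\<lambda>x. (\<Sum>j\<in>J. c j * x j)\<^sup>2)"
    "expectation (\<lambda>x. (\<Sum>j\<in>J. c j * x j)\<^sup>2) = (\<Sum>i\<in>J. \<Sum>j\<in>J. c i * c j * K i j)"
proof -
  note m = linear_measurable[OF J(2), of c] and g = centered_gaussian_second_moment[OF psd[OF J, of c]]
  show "integrable N (\<lambda>x. (\<Sum>j\<in>J. c j * x j)\<^sup>2)"
    using g(1) integrable_distr_eq[OF m, of "\<lambda>x. x\<^sup>2"] unfolding linear_distr[OF J] by simp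
  show "expectation (\<lambda>x. (\<Sum>j\<in>J. c j * x j)\<^sup>2) = (\<Sum>i\<in>J. \<Sum>j\<in>J. c i * c j * K i j)"
    using g(2) integral_distr[OF m, of "\<lambda>x. x\<^sup>2"] unfolding linear_distr[OF J] by simp
qed

text \<open>Polarization: variances of single coordinates and of a sum of two are already
  known.\<close>

lemma covariance:
  assumes u: "u \<in> I" "v \<in> I" and sym: "K u v = K v u"
  shows "expectation (\<lambda>x. x u * x v) = K u v"
proof -
  have 1: "integrable N (\<lambda>x. (x i)\<^sup>2)" "expectation (\<lambda>x. (x i)\<^sup>2) = K i i" if "i \<in> I" for i
    using linear_second_moment[of "{i}" "\<lambda>_. 1"] that by simp_all
  show ?thesis
  proof (cases "u = v")
    case True
    then show ?thesis using 1(2)[OF u(1)] by (simp add: power2_eq_square)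
  next
    case False
    then have 2: "integrable N (\<lambda>x. (x u + x v)\<^sup>2)" "expectation (\<lambda>x. (x u + x v)\<^sup>2) = K u u + K v v + 2 * K u v"
      using linear_second_moment[of "{u, v}" "\<lambda>_. 1"] u sym by simp_all
    have "x u * x v = 1 / 2 * ((x u + x v)\<^sup>2 - (x u)\<^sup>2 - (x v)\<^sup>2)" for x :: "'i \<Rightarrow> real"
      by (simp add: power2_eq_square algebra_simps)
    then have "expectation (\<lambda>x. x u * x v) = expectation (\<lambda>x. 1 / 2 * ((x u + x v)\<^sup>2 - (x u)\<^sup>2 - (x v)\<^sup>2))"
      by (simp only:)
    then show ?thesis using 1[OF u(1)] 1[OF u(2)] 2 by simp
  qed
qed

end

text \<open>Measurability of the heights is not assumed; it follows because they are polynomials in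
  the weights and initial increments, through the quenched representation.\<close>

lemma (in rap) height_measurable: "\<sigma> T k \<in> borel_measurable M"
proof -
  have "\<sigma> T k x = (\<Sum>y\<in>Bx T k. V T k 0 x y * (\<Sum>z\<in>{-\<bar>y\<bar>..\<bar>y\<bar>}. gg z y * \<eta> z x))" if x: "x \<in> space M" for x
  proof -
    have "\<sigma> 0 y x = (\<Sum>z\<in>{-\<bar>y\<bar>..\<bar>y\<bar>}. gg z y * \<eta> z x)" for y
      using increments_rep[of "\<lambda>y. \<sigma> 0 y x" y "\<bar>y\<bar>"] init[OF x] inc[OF x] by simp
    then show ?thesis using quenched_rep[OF x, of T k] by (simp add: EV_def)
  qed
  moreover have "(\<lambda>x. \<Sum>y\<in>Bx T k. V T k 0 x y * (\<Sum>z\<in>{-\<bar>y\<bar>..\<bar>y\<bar>}. gg z y * \<eta> z x)) \<in> borel_measurable M"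
    by (intro borel_measurable_sum borel_measurable_times borel_measurable_const V_M eta_M)
  ultimately show ?thesis by (subst measurable_cong) assumption+
qed

lemma (in rap) Ybar_measurable: "Ybar \<sigma> m b n u \<in> borel_measurable M"
proof -
  have "Ybar \<sigma> m b n u = (\<lambda>x. real n powr (-1/4) *
      (\<sigma> (nat \<lfloor>real n * fst u\<rfloor>) (\<lfloor>snd u * sqrt (real n)\<rfloor> + \<lfloor>real n * fst u * b\<rfloor>) x - m * snd u * sqrt (real n)))"
    by (simp add: Ybar_def split_def fun_eq_iff)
  then show ?thesis
    by (simp only:) (intro borel_measurable_times borel_measurable_diff borel_measurable_const height_measurable)
qed

theorem (in rap) finite_dimensional_limit:
  "\<exists>(N :: (real \<times> real \<Rightarrow> real) measure) Z.
     centered_gaussian_process N ({0..} \<times> UNIV) Z \<and>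
     (\<forall>u \<in> {0..} \<times> UNIV. \<forall>v \<in> {0..} \<times> UNIV.
        prob_space.expectation N (\<lambda>x. Z u x * Z v x) =
          \<mu>\<^sub>0\<^sup>2 * rap_kappa M (X (0, 1)) * Gamma1 (sigma1_sq M (X (0, 1))) u v
          + s0 * Gamma2 (sigma1_sq M (X (0, 1))) u v) \<and>
     fdd_converge ({0..} \<times> UNIV) M (Ybar \<sigma> \<mu>\<^sub>0 (- drift M (X (0, 1)))) N Z"
proof -
  let ?I = "{0..} \<times> UNIV :: (real \<times> real) set"
  have "\<exists>N. prob_space N \<and> sets N = sets (PiM ?I (\<lambda>_. borel)) \<and>
     (\<forall>J c. finite J \<and> J \<subseteq> ?I \<longrightarrow> (\<integral>x. iexp (\<Sum>j\<in>J. c j * x j) \<partial>N) =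
        complex_of_real (exp (- (\<Sum>i\<in>J. \<Sum>j\<in>J. c i * c j * cov i j) / 2)))"
    by (rule gaussian_process_exists[OF cov_sym cov_psd])
  then obtain N where N': "prob_space N \<and> sets N = sets (PiM ?I (\<lambda>_. borel)) \<and>
     (\<forall>J c. finite J \<and> J \<subseteq> ?I \<longrightarrow> (\<integral>x. iexp (\<Sum>j\<in>J. c j * x j) \<partial>N) =
        complex_of_real (exp (- (\<Sum>i\<in>J. \<Sum>j\<in>J. c i * c j * cov i j) / 2)))" ..
  have N: "prob_space N" "sets N = sets (PiM ?I (\<lambda>_. borel))"
    using N' by (simp_all only: simp_thms)
  have N3: "(\<integral>x. iexp (\<Sum>j\<in>J. c j * x j) \<partial>N) =
        complex_of_real (exp (- (\<Sum>i\<in>J. \<Sum>j\<in>J. c i * c j * cov i j) / 2))" if "finite J" "J \<subseteq> ?I" for J c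
    using N'[THEN conjunct2, THEN conjunct2, rule_format, of J c] that by (simp only: simp_thms)
  interpret G: gaussian_family N ?I cov
    by (intro gaussian_family.intro gaussian_family_axioms.intro N N3 cov_psd)
  show ?thesis
  proof (intro exI[of _ N] exI[of _ "\<lambda>u x. x u"] conjI ballI)
    show "centered_gaussian_process N ?I (\<lambda>u x. x u)" by (rule G.is_centered_gaussian_process)
    fix u v assume uv: "u \<in> ?I" "v \<in> ?I"
    then have "0 \<le> fst u" "0 \<le> fst v" by auto
    then show "G.expectation (\<lambda>x. x u * x v) =
      \<mu>\<^sub>0\<^sup>2 * rap_kappa M (X (0, 1)) * Gamma1 (sigma1_sq M (X (0, 1))) u v + s0 * Gamma2 (sigma1_sq M (X (0, 1))) u v"
      unfolding G.covariance[OF uv cov_sym] by (rule cov_eq)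
  next
    show "fdd_converge ?I M (Ybar \<sigma> \<mu>\<^sub>0 (- drift M (X (0, 1)))) N (\<lambda>u x. x u)"
    proof (rule fdd_convergeI[OF prob_space_axioms N(1) Ybar_measurable G.coordinate_measurable])
      fix J :: "(real \<times> real) set" and c assume J: "finite J" "J \<subseteq> ?I"
      show "(\<lambda>n. CLINT x|M. iexp (\<Sum>j\<in>J. c j * Ybar \<sigma> \<mu>\<^sub>0 (- drift M (X (0, 1))) n j x)) \<longlonglongrightarrow> (CLINT x|N. iexp (\<Sum>j\<in>J. c j * x j))"
        unfolding N3[OF J] drift_eq by (rule char_limit[OF J])
    qed
  qed
qed

theorem theorem4p1:
  fixes M :: "'a measure" and R :: nat
    and \<omega> :: "int \<Rightarrow> nat \<Rightarrow> 'a \<Rightarrow> int \<Rightarrow> real"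
    and \<sigma> :: "nat \<Rightarrow> int \<Rightarrow> 'a \<Rightarrow> real"
    and \<eta> :: "int \<Rightarrow> 'a \<Rightarrow> real"
    and w :: "'a \<Rightarrow> int \<Rightarrow> real"
    and \<alpha> \<mu>\<^sub>0 \<sigma>\<^sub>0_sq b :: real
  assumes "prob_space M"
    and weights_prob: "\<And>k s x. s \<ge> 1 \<Longrightarrow> x \<in> space M \<Longrightarrow> prob_vector R (\<omega> k s x)"
    and weights_iid: "iid M vec_space (\<lambda>(k, s). \<omega> k s) (UNIV \<times> {1..})"
    and generic: "w = \<omega> 0 1"
    and evolution: "\<And>s k x. s \<ge> 1 \<Longrightarrow> x \<in> space M \<Longrightarrow>
          \<sigma> s k x = (\<Sum>j=-int R..int R. \<omega> k s x j * \<sigma> (s - 1) (k + j) x)"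
    and nondeg_i: "\<not> (\<exists>h::int. h > 1 \<and> (\<exists>x. (\<Sum>\<^sub>\<infinity>k. mean_weight M w (x + k * h)) = 1))"
    and nondeg_ii: "measure M {x \<in> space M. Max (w x ` {-int R..int R}) < 1} > 0"
    and init_zero: "\<And>x. x \<in> space M \<Longrightarrow> \<sigma> 0 0 x = 0"
    and increments: "\<And>i x. x \<in> space M \<Longrightarrow> \<eta> i x = \<sigma> 0 i x - \<sigma> 0 (i - 1) x"
    and increments_iid: "iid M borel \<eta> UNIV"
    and init_indep: "independent_elements M
          (PiM UNIV (\<lambda>_::int. borel)) (\<lambda>x i. \<eta> i x)
          (PiM (UNIV \<times> {1..}) (\<lambda>_. vec_space)) (\<lambda>x. \<lambda>(k, s)\<in>UNIV \<times> {1..}. \<omega> k s x)"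
    and "\<alpha> > 0"
    and moment: "integrable M (\<lambda>x. \<bar>\<eta> 0 x\<bar> powr (2 + \<alpha>))"
    and "\<mu>\<^sub>0 = prob_space.expectation M (\<eta> 0)"
    and "\<sigma>\<^sub>0_sq = prob_space.variance M (\<eta> 0)"
    and "b = - drift M w"
  shows "\<exists>(N :: (real \<times> real \<Rightarrow> real) measure) Z.
     centered_gaussian_process N ({0..} \<times> UNIV) Z \<and>
     (\<forall>u \<in> {0..} \<times> UNIV. \<forall>v \<in> {0..} \<times> UNIV.
        prob_space.expectation N (\<lambda>x. Z u x * Z v x) =
          \<mu>\<^sub>0\<^sup>2 * rap_kappa M w * Gamma1 (sigma1_sq M w) u v
          + \<sigma>\<^sub>0_sq * Gamma2 (sigma1_sq M w) u v) \<and>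
     fdd_converge ({0..} \<times> UNIV) M (Ybar \<sigma> \<mu>\<^sub>0 b) N Z"
proof -
  interpret prob_space M by fact
  \<comment> \<open>The evolution uses weights from level 1 on, so the slot at level 0 is free for
    the initial increments.\<close>
  define X where "X = (\<lambda>(k, s). if s = 0 then (\<lambda>x _. \<eta> k x) else \<omega> k s)"
  have X0: "X (k, 0) = (\<lambda>x _. \<eta> k x)" and X1: "1 \<le> s \<Longrightarrow> X (k, s) = \<omega> k s" for k s
    by (auto simp: X_def)
  have w: "w = X (0, 1)" by (simp add: generic X1)
  have "rap M X R \<eta> \<sigma> \<alpha> \<mu>\<^sub>0 \<sigma>\<^sub>0_sq"
  proof (intro rap.intro walk.intro indep_family.intro indep_family_axioms.intro walk_axioms.intro rap_axioms.intro prob_space_axioms)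
    show "indep_vars (\<lambda>_. vec_space) X UNIV"
      unfolding X_def using weights_iid increments_iid init_indep
      by (intro joint_indep_vars) (simp_all add: iid_def)
    show "distr M vec_space (X (k, s)) = distr M vec_space (X (0, 1))" if "1 \<le> s" for k s
    proof -
      have "distr M vec_space (case (k, s) of (k, s) \<Rightarrow> \<omega> k s) = distr M vec_space (case (0, 1) of (k, s) \<Rightarrow> \<omega> k s)"
        using weights_iid that unfolding iid_def by (elim conjE, elim ballE[of _ _ "(k, s)"] ballE[of _ _ "(0, 1)"]) auto
      then show ?thesis using that by (simp add: X1)
    qed
    show "distr M borel (\<eta> k) = distr M borel (\<eta> 0)" for k using increments_iid by (simp add: iid_def)
    show "prob_vector R (X (k, s) x)" if "1 \<le> s" "x \<in> space M" for k s x
      unfolding X1[OF that(1)] by (rule weights_prob[OF that])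
    show "\<sigma> s k x = (\<Sum>j\<in>{-int R..int R}. X (k, s) x j * \<sigma> (s - 1) (k + j) x)" if "1 \<le> s" "x \<in> space M" for k s x
      unfolding X1[OF that(1)] by (rule evolution[OF that])
    show "\<not> (\<exists>h::int. h > 1 \<and> (\<exists>x. (\<Sum>\<^sub>\<infinity>k. mean_weight M (X (0, 1)) (x + k * h)) = 1))"
      using nondeg_i unfolding w .
    show "measure M {x \<in> space M. Max (X (0, 1) x ` {-int R..int R}) < 1} > 0"
      using nondeg_ii unfolding w .
    show "\<sigma> 0 0 x = 0" if "x \<in> space M" for x by (rule init_zero[OF that])
    show "\<eta> k x = \<sigma> 0 k x - \<sigma> 0 (k - 1) x" if "x \<in> space M" for k x by (rule increments[OF that])
  qed (fact X0 \<open>\<alpha> > 0\<close> moment \<open>\<mu>\<^sub>0 = expectation (\<eta> 0)\<close> \<open>\<sigma>\<^sub>0_sq = variance (\<eta> 0)\<close>)+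
  from rap.finite_dimensional_limit[OF this] show ?thesis unfolding \<open>b = - drift M w\<close> w .
qed

end
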